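(* Let $A\in\mathbb{R}^{m\times n}$. For each of the following choices of $\mu(A)$: (i) $\mu(A)=\sqrt{s_{2p}(A)\,s_{2(1-p)}(A^T)}$, for any $p\in[0,1]$; (ii) $\mu(A)=\|A\|_F$; there is an efficient QRAM data structure for storing $A$ such that a quantum algorithm with access to this data structure can perform singular value estimation (SVE) for $A$ with error $\delta$ in time $\widetilde{O}(\mu(A)/\delta)$, for every $\delta>0$.
   Context: Notation: $[n]=\{1,\dots,n\}$; $a_i$ is the $i$-th row of $A$. For $q\ge 0$, $s_q(A)=\max_{i\in[m]}\|a_i\|_q^q=\max_{i\in[m]}\sum_{j}|a_{ij}|^q$ (with $0^0=0$, so $s_0(A)$ is the maximum number of nonzero entries in a row); $s_q(A^T)$ is the analogous maximum over columns of $A$. $\|A\|_F$ is the Frobenius norm. $\widetilde{O}(\cdot)$ suppresses factors polylogarithmic in $m,n$. QRAM: a quantum random access memory stores data $(i,x_i)$, $i\in[N]$, and allows queries $|i,0\rangle\to|i,x_i\rangle$ in superposition in time $O(\mathrm{polylog}(N))$. A QRAM data structure storing $N$ entries is efficient if its memory requirement is $\widetilde{O}(N)$ and the cost of updating, inserting or deleting a single entry is $O(\mathrm{polylog}(N))$. Here the entries are the matrix entries $(i,j,a_{ij})$. SVE problem with error $\delta>0$: let $A=\sum_{i\in[k]}\sigma_i u_iv_i^T$ be the singular value decomposition, $k=\min(m,n)$ (some $\sigma_i$ may be $0$). Given $|b\rangle=\sum_{i\in[k]}\beta_i|v_i\rangle$, perform the mapping $\sum_{i\in[k]}\beta_i|v_i\rangle|0\rangle\to\sum_{i\in[k]}\beta_i|v_i\rangle|\overline{\sigma}_i\rangle$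 such that $|\overline{\sigma}_i-\sigma_i|\le\delta$ for all $i\in[k]$, with probability $1-1/\mathrm{poly}(n)$. Here $|v\rangle=\frac{1}{\|v\|}\sum_i v_i|i\rangle$. *)

theory Defs
  imports Complex_Main "Jordan_Normal_Form.Matrix"
begin

section \<open>Matrix quantities\<close>

text \<open>Rows, columns and singular triples are numbered from 0. The convention $0^0 = 0$ is that
  of \<^const>\<open>powr\<close>.\<close>

definition s_norm :: "real \<Rightarrow> real mat \<Rightarrow> real" where
  "s_norm q A = Max ((\<lambda>i. \<Sum>j<dim_col A. \<bar>A $$ (i, j)\<bar> powr q) ` {..<dim_row A})"

definition mu_p :: "real \<Rightarrow> real mat \<Rightarrow> real" where
  "mu_p p A = sqrt (s_norm (2 * p) A * s_norm (2 * (1 - p)) (transpose_mat A))"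

definition frobenius :: "real mat \<Rightarrow> real" where
  "frobenius A = sqrt (\<Sum>i<dim_row A. \<Sum>j<dim_col A. (A $$ (i, j))\<^sup>2)"

definition set_entry :: "real mat \<Rightarrow> nat \<Rightarrow> nat \<Rightarrow> real \<Rightarrow> real mat" where
  "set_entry A i j x =
     mat (dim_row A) (dim_col A) (\<lambda>(i', j'). if (i', j') = (i, j) then x else A $$ (i', j'))"

definition num_entries :: "real mat \<Rightarrow> nat" where
  "num_entries A = card {(i, j). i < dim_row A \<and> j < dim_col A \<and> A $$ (i, j) \<noteq> 0}"

definition is_svd ::
  "real mat \<Rightarrow> (nat \<Rightarrow> real) \<Rightarrow> (nat \<Rightarrow> real vec) \<Rightarrow> (nat \<Rightarrow> real vec) \<Rightarrow> bool" where
  "is_svd A \<sigma> u v \<longleftrightarrow>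
     (let m = dim_row A; n = dim_col A; k = min m n in
       (\<forall>i<k. 0 \<le> \<sigma> i \<and> u i \<in> carrier_vec m \<and> v i \<in> carrier_vec n) \<and>
       (\<forall>i<k. \<forall>j<k. u i \<bullet> u j = (if i = j then 1 else 0) \<and>
                    v i \<bullet> v j = (if i = j then 1 else 0)) \<and>
       (\<forall>r<m. \<forall>c<n. A $$ (r, c) = (\<Sum>i<k. \<sigma> i * (u i $ r) * (v i $ c))))"

section \<open>A real RAM that controls quantum registers and has a QRAM\<close>

text \<open>Entries of \<open>A\<close> are exact real numbers, so every word of the machine (classical register,
  memory cell, quantum cell) holds a real number and arithmetic on words has unit cost.
  The machine has classical registers, a QRAM memory, and quantum cells. A basis state assigns a
  real number to every quantum cell; a quantum state gives an amplitude to each basis state.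

  Angles are limited to $[-2\pi, 2\pi]$: with unbounded arguments the trigonometric
  primitives would provide a unit-cost floor function on arbitrarily large numbers, which the
  real RAM must not have.\<close>

type_synonym regs = "nat \<Rightarrow> real"
type_synonym memory = "nat \<Rightarrow> real"
type_synonym config = "nat \<Rightarrow> real"
type_synonym qstate = "config \<Rightarrow> complex"

definition addr :: "real \<Rightarrow> nat" where
  "addr x = nat \<lfloor>x\<rfloor>"

definition angle :: "real \<Rightarrow> real" where
  "angle x = (if \<bar>x\<bar> \<le> 2 * pi then x else 0)"

datatype arith = Const real | Add | Sub | Mul | Div | Pow | Cos | Sin | Arccos | Leq

fun arith_val :: "arith \<Rightarrow> real \<Rightarrow> real \<Rightarrow> real" where
  "arith_val (Const a) x y = a"
| "arith_val Add x y = x + y"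
| "arith_val Sub x y = x - y"
| "arith_val Mul x y = x * y"
| "arith_val Div x y = x / y"
| "arith_val Pow x y = (if 0 < x then x powr y else 0)"
| "arith_val Cos x y = cos (angle x)"
| "arith_val Sin x y = sin (angle x)"
| "arith_val Arccos x y = (if \<bar>x\<bar> \<le> 1 then arccos x else 0)"
| "arith_val Leq x y = (if x \<le> y then 1 else 0)"

text \<open>Operands of gates are classical registers; the contents of these registers select the
  quantum cells. \<open>QAdd f k i j\<close> is $|x_i, x_j, x_k\rangle \to |x_i, x_j, x_k + f(x_i, x_j)\rangle$,
  and \<open>Query k i\<close> is the QRAM query $|x_i, x_k\rangle \to |x_i, x_k + M(x_i)\rangle$; \<open>QSub\<close> and
  \<open>Query_inv\<close> are their inverses. \<open>QShift k r\<close> adds the classical value in register \<open>r\<close>.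
  \<open>Rot k i\<close> rotates the qubit spanned by the values 0 and 1 of cell \<open>k\<close> by the angle in cell
  \<open>i\<close>, and \<open>Phase i\<close> multiplies by $e^{\mathrm{i} x_i}$. A gate whose target cell is also one
  of its other operands acts as the identity, so that all gates are unitary.\<close>

datatype gate =
    QShift nat nat
  | QAdd arith nat nat nat
  | QSub arith nat nat nat
  | Query nat nat
  | Query_inv nat nat
  | Rot nat nat
  | Phase nat

definition translate :: "nat \<Rightarrow> (config \<Rightarrow> real) \<Rightarrow> qstate \<Rightarrow> qstate" where
  "translate k f \<psi> = (\<lambda>c. \<psi> (c(k := c k - f c)))"

definition rotate_cell :: "nat \<Rightarrow> nat \<Rightarrow> qstate \<Rightarrow> qstate" where
  "rotate_cell k i \<psi> = (\<lambda>c.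
     let co = complex_of_real (cos (angle (c i)));
         si = complex_of_real (sin (angle (c i)));
         a0 = \<psi> (c(k := 0)); a1 = \<psi> (c(k := 1)) in
     if c k = 0 then co * a0 - si * a1
     else if c k = 1 then si * a0 + co * a1
     else \<psi> c)"

fun apply_gate :: "gate \<Rightarrow> regs \<Rightarrow> memory \<Rightarrow> qstate \<Rightarrow> qstate" where
  "apply_gate (QShift k r) R M \<psi> = translate (addr (R k)) (\<lambda>_. R r) \<psi>"
| "apply_gate (QAdd f k i j) R M \<psi> =
     (let k' = addr (R k); i' = addr (R i); j' = addr (R j) in
      if k' \<in> {i', j'} then \<psi> else translate k' (\<lambda>c. arith_val f (c i') (c j')) \<psi>)"
| "apply_gate (QSub f k i j) R M \<psi> =
     (let k' = addr (R k); i' = addr (R i); j' = addr (R j) in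
      if k' \<in> {i', j'} then \<psi> else translate k' (\<lambda>c. - arith_val f (c i') (c j')) \<psi>)"
| "apply_gate (Query k i) R M \<psi> =
     (let k' = addr (R k); i' = addr (R i) in
      if k' = i' then \<psi> else translate k' (\<lambda>c. M (addr (c i'))) \<psi>)"
| "apply_gate (Query_inv k i) R M \<psi> =
     (let k' = addr (R k); i' = addr (R i) in
      if k' = i' then \<psi> else translate k' (\<lambda>c. - M (addr (c i'))) \<psi>)"
| "apply_gate (Rot k i) R M \<psi> =
     (let k' = addr (R k); i' = addr (R i) in
      if k' = i' then \<psi> else rotate_cell k' i' \<psi>)"
| "apply_gate (Phase i) R M \<psi> = (\<lambda>c. cis (angle (c (addr (R i)))) * \<psi> c)"

datatype com =
    Skip
  | Arith arith nat nat nat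
  | Load nat nat
  | Store nat nat
  | Gate gate
  | Seq com com
  | If_nz nat com com
  | While_nz nat com

text \<open>\<open>exec P (R, M, \<psi>) t (R', M', \<psi>')\<close>: the program \<open>P\<close> terminates after \<open>t\<close> elementary steps
  (classical instructions, tests, gates and QRAM queries alike). There is no measurement, so
  the classical part of the run, in particular the memory, does not depend on \<open>\<psi>\<close>.\<close>

inductive exec ::
  "com \<Rightarrow> regs \<times> memory \<times> qstate \<Rightarrow> nat \<Rightarrow> regs \<times> memory \<times> qstate \<Rightarrow> bool" where
  skip: "exec Skip s 0 s"
| arith: "exec (Arith f r a b) (R, M, \<psi>) 1 (R(r := arith_val f (R a) (R b)), M, \<psi>)"
| load: "exec (Load r a) (R, M, \<psi>) 1 (R(r := M (addr (R a))), M, \<psi>)"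
| store: "exec (Store a r) (R, M, \<psi>) 1 (R, M(addr (R a) := R r), \<psi>)"
| gate: "exec (Gate g) (R, M, \<psi>) 1 (R, M, apply_gate g R M \<psi>)"
| seq: "exec P s t s' \<Longrightarrow> exec Q s' t' s'' \<Longrightarrow> exec (Seq P Q) s (t + t') s''"
| if_true: "R r \<noteq> 0 \<Longrightarrow> exec P (R, M, \<psi>) t s' \<Longrightarrow> exec (If_nz r P Q) (R, M, \<psi>) (t + 1) s'"
| if_false: "R r = 0 \<Longrightarrow> exec Q (R, M, \<psi>) t s' \<Longrightarrow> exec (If_nz r P Q) (R, M, \<psi>) (t + 1) s'"
| while_false: "R r = 0 \<Longrightarrow> exec (While_nz r P) (R, M, \<psi>) 1 (R, M, \<psi>)"
| while_true: "R r \<noteq> 0 \<Longrightarrow> exec P (R, M, \<psi>) t s' \<Longrightarrow> exec (While_nz r P) s' t' s'' \<Longrightarrow>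
    exec (While_nz r P) (R, M, \<psi>) (t + t' + 1) s''"

definition init_regs :: "real list \<Rightarrow> regs" where
  "init_regs xs = (\<lambda>r. if r < length xs then xs ! r else 0)"

definition zero_state :: qstate where
  "zero_state = (\<lambda>c. if c = (\<lambda>_. 0) then 1 else 0)"

section \<open>QRAM data structures\<close>

text \<open>A data structure is given by its update program. Starting from blank memory and the zero
  matrix, entries are inserted, changed or (with value 0) deleted one at a time;
  \<open>stores upd m n A M\<close> holds for every memory content \<open>M\<close> that can arise for \<open>A\<close>.\<close>

inductive stores :: "com \<Rightarrow> nat \<Rightarrow> nat \<Rightarrow> real mat \<Rightarrow> memory \<Rightarrow> bool" for upd m n where
  blank: "stores upd m n (0\<^sub>m m n) (\<lambda>_. 0)"
| update: "stores upd m n A M \<Longrightarrow> i < m \<Longrightarrow> j < n \<Longrightarrow>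
    exec upd (init_regs [real m, real n, real i, real j, x], M, zero_state) t (R', M', \<psi>') \<Longrightarrow>
    stores upd m n (set_entry A i j x) M'"

text \<open>Shifted by one so that the value is at least 1 for all positive dimensions.\<close>

definition lg :: "nat \<Rightarrow> nat \<Rightarrow> real" where
  "lg m n = log 2 (real (m * n) + 1)"

text \<open>The memory is bounded both by the address range, relative to all \<open>m * n\<close> entries, and by
  the number of occupied cells, relative to the number of entries that are present.\<close>

definition efficient_qram_structure :: "com \<Rightarrow> bool" where
  "efficient_qram_structure upd \<longleftrightarrow>
     (\<exists>C::real. \<exists>k::nat. \<forall>m>0. \<forall>n>0. \<forall>A M. stores upd m n A M \<longrightarrow>
        (\<forall>a. M a \<noteq> 0 \<longrightarrow> real a < C * lg m n ^ k * real (m * n)) \<and>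
        real (card {a. M a \<noteq> 0}) \<le> C * lg m n ^ k * real (num_entries A) \<and>
        (\<forall>i<m. \<forall>j<n. \<forall>x. \<exists>t R' M' \<psi>'.
           exec upd (init_regs [real m, real n, real i, real j, x], M, zero_state) t (R', M', \<psi>') \<and>
           real t \<le> C * lg m n ^ k))"

section \<open>Singular value estimation\<close>

text \<open>Quantum cell 0 holds the vector, cell 1 the estimate, and all other cells are 0.\<close>

definition sve_config :: "nat \<Rightarrow> real \<Rightarrow> config" where
  "sve_config j s = (\<lambda>_. 0)(0 := real j, 1 := s)"

definition product_state :: "real vec \<Rightarrow> (real \<Rightarrow> complex) \<Rightarrow> qstate" where
  "product_state w \<chi> = (\<lambda>c. \<Sum>j<dim_vec w.
     if c = sve_config j (c 1) then complex_of_real (w $ j) * \<chi> (c 1) else 0)"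

text \<open>$\sum_{i<k} \beta_i |v_i\rangle |\chi_i\rangle$\<close>

definition sve_state ::
  "nat \<Rightarrow> (nat \<Rightarrow> complex) \<Rightarrow> (nat \<Rightarrow> real vec) \<Rightarrow> (nat \<Rightarrow> real \<Rightarrow> complex) \<Rightarrow> qstate" where
  "sve_state k \<beta> v \<chi> = (\<lambda>c. \<Sum>i<k. \<beta> i * product_state (v i) (\<chi> i) c)"

definition ket :: "real \<Rightarrow> real \<Rightarrow> complex" where
  "ket s = (\<lambda>x. if x = s then 1 else 0)"

definition unit_state_on :: "real set \<Rightarrow> (real \<Rightarrow> complex) \<Rightarrow> bool" where
  "unit_state_on S \<chi> \<longleftrightarrow> finite {s. \<chi> s \<noteq> 0} \<and> {s. \<chi> s \<noteq> 0} \<subseteq> S \<and>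
     (\<Sum>s | \<chi> s \<noteq> 0. (cmod (\<chi> s))\<^sup>2) = 1"

definition within_sqdist :: "real \<Rightarrow> qstate \<Rightarrow> qstate \<Rightarrow> bool" where
  "within_sqdist \<epsilon> \<psi> \<phi> \<longleftrightarrow> finite {c. \<psi> c \<noteq> \<phi> c} \<and>
     (\<Sum>c | \<psi> c \<noteq> \<phi> c. (cmod (\<psi> c - \<phi> c))\<^sup>2) \<le> \<epsilon>"

text \<open>Phase estimation never yields one basis state $|\overline\sigma_i\rangle$ exactly, but a
  superposition of estimates. Here every value that occurs in the ideal output
  $|\chi_i\rangle$ is within \<open>\<delta>\<close> of \<open>\<sigma> i\<close>, and the actual output differs from the ideal one by
  squared norm at most \<open>\<epsilon>\<close>, the failure parameter. The states $|\chi_i\rangle$ do not depend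
  on the input amplitudes \<open>\<beta>\<close>. The program must leave the data structure as it was.\<close>

definition performs_sve :: "com \<Rightarrow> real mat \<Rightarrow> memory \<Rightarrow> real \<Rightarrow> real \<Rightarrow> real \<Rightarrow> bool" where
  "performs_sve sve A M \<delta> \<epsilon> T \<longleftrightarrow>
     (let m = dim_row A; n = dim_col A; k = min m n in
      \<forall>\<sigma> u v. is_svd A \<sigma> u v \<longrightarrow>
        (\<exists>\<chi>. (\<forall>i<k. unit_state_on {s. \<bar>s - \<sigma> i\<bar> \<le> \<delta>} (\<chi> i)) \<and>
          (\<forall>\<beta>. (\<Sum>i<k. (cmod (\<beta> i))\<^sup>2) = 1 \<longrightarrow>
            (\<exists>t R' \<psi>'.
               exec sve (init_regs [real m, real n, \<delta>], M, sve_state k \<beta> v (\<lambda>_. ket 0)) t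
                        (R', M, \<psi>') \<and>
               real t \<le> T \<and> within_sqdist \<epsilon> \<psi>' (sve_state k \<beta> v \<chi>)))))"

end

theory Submission
  imports Defs "HOL-Library.Function_Algebras"
begin

text \<open>
  For every row \<open>i\<close> the data structure keeps a binary tree of partial sums of $|a_{ij}|^{2p}$, and for
  every column a tree of partial sums of $|a_{ij}|^{2(1-p)}$. Descending the trees prepares, for each
  column and for each row, a state; the inner products of these states are proportional to the $a_{ij}$,
  with constant of order $1/\mu$. Hence the product of the two corresponding reflections preserves, for
  each right singular vector $v_i$, a plane spanned by $X_i$ and $Y_i$, and rotates it by an angle
  $\theta_i$ with $\sin(\theta_i/2)$ proportional to $\sqrt{\sigma_i^2 + (\delta/8)^2}$; the second term, which
  comes from an additional identity block, keeps $\theta_i$ away from 0.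

  The angle is estimated in $L$ levels: at level $l$ the fraction of successful tests with the $2^l$-th
  power of the walk corrects the estimate and halves its error. As $X_i$ is an equal superposition of the
  eigenvectors for $\pm\theta_i$, the state acquires a $Y_i$ component. To move it back to $X_i$, this
  component is flagged in a fresh cell and the $2^l$-th power of the walk is applied to it, for
  $l = 0, \dots, L - 1$; what stays in $Y_i$ has been multiplied by
  $\prod_l \cos(2^l\theta_i) = \sin(2^L\theta_i)/(2^L\sin\theta_i)$, at most $1/2$ in absolute value. Repeating
  this makes it negligible, and then everything but the estimate is erased.
\<close>

text \<open>What shapes the construction is that the amplitudes of the input are unknown and that
  only the vector and the estimate may remain in the cells: nothing can be measured, and no record
  of the estimation may stay behind. The estimate is therefore kept as a function of the recorded
  outcomes, so that it can be undone by replaying them. The outcomes themselves are hidden in digits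
  below the accuracy, which is allowed because the ideal output may be any superposition of values
  close to the singular value, and possible because a cell holds an exact real number. One scale
  \<open>kq\<close> = \<open>\<delta> / 8\<close> serves as grid step and as weight of the identity
  block; the latter replaces \<open>\<sigma>\<close> by sqrt(\<open>\<sigma>\<close>^2 + kq^2),
  which differs by at most kq, and makes sin \<open>\<theta>\<close> at least kq / Dh even for
  \<open>\<sigma>\<close> = 0, as the return to X requires. A damping factor 1/4 on the matrix
  amplitudes keeps \<open>\<theta>\<close> at most 1, so that the estimation can start from the
  value 0. Both choices of \<open>\<mu>\<close> come from one parametrised structure; all that the
  walk needs to know about the parameters is one identity, \<open>balanced\<close>.\<close>

declare [[coercion_enabled = false]]

section \<open>Quantum states of finite support\<close>

definition fin :: "qstate \<Rightarrow> bool" where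
  "fin \<psi> \<longleftrightarrow> finite {c. \<psi> c \<noteq> 0}"

definition smul :: "complex \<Rightarrow> qstate \<Rightarrow> qstate" (infixr \<open>*q\<close> 75) where
  "a *q \<psi> = (\<lambda>c. a * \<psi> c)"

definition Ket :: "config \<Rightarrow> qstate" where
  "Ket c = (\<lambda>d. if d = c then 1 else 0)"

definition restr :: "(config \<Rightarrow> bool) \<Rightarrow> qstate \<Rightarrow> qstate" where
  "restr P \<psi> = (\<lambda>c. if P c then \<psi> c else 0)"

text \<open>The sum runs over the support of the first argument. Right linearity therefore holds for
  all states, while left linearity and conjugate symmetry are available for states of finite
  support.\<close>

definition ip :: "qstate \<Rightarrow> qstate \<Rightarrow> complex" where
  "ip \<psi> \<phi> = (\<Sum>c | \<psi> c \<noteq> 0. cnj (\<psi> c) * \<phi> c)"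

definition nsq :: "qstate \<Rightarrow> real" where
  "nsq \<psi> = (\<Sum>c | \<psi> c \<noteq> 0. (cmod (\<psi> c))\<^sup>2)"

lemma smul_apply [simp]: "(a *q \<psi>) c = a * \<psi> c"
  by (simp add: smul_def)

lemma sum_fun_apply': "(\<Sum>i\<in>I. f i) c = (\<Sum>i\<in>I. f i c :: complex)" for f :: "'i \<Rightarrow> qstate"
  by (induction I rule: infinite_finite_induct) auto

lemma smul_smul [simp]: "a *q (b *q \<psi>) = (a * b) *q \<psi>"
  by (auto simp: smul_def)

lemma smul_one [simp]: "1 *q \<psi> = \<psi>"
  by (auto simp: smul_def)

lemma smul_zero_left [simp]: "0 *q \<psi> = 0"
  by (auto simp: smul_def)

lemma smul_zero_right [simp]: "a *q 0 = 0"
  by (auto simp: smul_def)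

lemma smul_add: "a *q (\<psi> + \<phi>) = a *q \<psi> + a *q \<phi>"
  by (auto simp: smul_def algebra_simps)

lemma smul_sum: "a *q (\<Sum>i\<in>I. f i) = (\<Sum>i\<in>I. a *q f i)" for f :: "'i \<Rightarrow> qstate"
  using sum_comp_morphism[of "(*q) a" f I] by (simp add: smul_add o_def)

lemma fin_Ket [simp]: "fin (Ket c)"
  by (auto simp: fin_def Ket_def)

lemma fin_zero [simp]: "fin 0"
  by (auto simp: fin_def)

lemma fin_add [simp]: "fin \<psi> \<Longrightarrow> fin \<phi> \<Longrightarrow> fin (\<psi> + \<phi>)"
  unfolding fin_def by (rule finite_subset[of _ "{c. \<psi> c \<noteq> 0} \<union> {c. \<phi> c \<noteq> 0}"]) auto

lemma fin_diff [simp]: "fin \<psi> \<Longrightarrow> fin \<phi> \<Longrightarrow> fin (\<psi> - \<phi>)"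
  unfolding fin_def by (rule finite_subset[of _ "{c. \<psi> c \<noteq> 0} \<union> {c. \<phi> c \<noteq> 0}"]) auto

lemma fin_smul [simp]: "fin \<psi> \<Longrightarrow> fin (a *q \<psi>)"
  unfolding fin_def by (rule finite_subset[of _ "{c. \<psi> c \<noteq> 0}"]) auto

lemma fin_sum [simp]: "(\<And>i. i \<in> I \<Longrightarrow> fin (f i)) \<Longrightarrow> fin (\<Sum>i\<in>I. f i)" for f :: "'i \<Rightarrow> qstate"
  by (induction I rule: infinite_finite_induct) auto

lemma fin_restr [simp]: "fin \<psi> \<Longrightarrow> fin (restr P \<psi>)"
  unfolding fin_def restr_def by (rule finite_subset[of _ "{c. \<psi> c \<noteq> 0}"]) auto

lemma fin_expand: "fin \<psi> \<Longrightarrow> \<psi> = (\<Sum>c | \<psi> c \<noteq> 0. \<psi> c *q Ket c)"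
  by (rule ext) (auto simp: sum_fun_apply' Ket_def fin_def if_distrib cong: if_cong)

lemma ip_super:
  assumes "finite S" "\<And>c. c \<notin> S \<Longrightarrow> \<psi> c = 0 \<or> \<phi> c = 0" "fin \<psi>"
  shows "ip \<psi> \<phi> = (\<Sum>c\<in>S. cnj (\<psi> c) * \<phi> c)"
proof -
  have "ip \<psi> \<phi> = (\<Sum>c\<in>S \<union> {c. \<psi> c \<noteq> 0}. cnj (\<psi> c) * \<phi> c)"
    unfolding ip_def using assms by (intro sum.mono_neutral_left) (auto simp: fin_def)
  also have "\<dots> = (\<Sum>c\<in>S. cnj (\<psi> c) * \<phi> c)"
    using assms by (intro sum.mono_neutral_right) (auto simp: fin_def)
  finally show ?thesis .
qed

lemma ip_add_right: "ip \<psi> (\<phi> + \<phi>') = ip \<psi> \<phi> + ip \<psi> \<phi>'"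
  by (simp add: ip_def algebra_simps sum.distrib)

lemma ip_diff_right: "ip \<psi> (\<phi> - \<phi>') = ip \<psi> \<phi> - ip \<psi> \<phi>'"
  by (simp add: ip_def algebra_simps sum_subtractf)

lemma ip_smul_right: "ip \<psi> (a *q \<phi>) = a * ip \<psi> \<phi>"
  by (simp add: ip_def sum_distrib_left algebra_simps)

lemma ip_zero [simp]: "ip \<psi> 0 = 0" "ip 0 \<psi> = 0"
  by (simp_all add: ip_def)

lemma ip_sum_right: "ip \<psi> (\<Sum>i\<in>I. f i) = (\<Sum>i\<in>I. ip \<psi> (f i))" for f :: "'i \<Rightarrow> qstate"
  using sum_comp_morphism[of "ip \<psi>" f I] by (simp add: ip_add_right o_def)

lemma ip_cnj: "fin \<psi> \<Longrightarrow> fin \<phi> \<Longrightarrow> ip \<phi> \<psi> = cnj (ip \<psi> \<phi>)"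
proof -
  assume *: "fin \<psi>" "fin \<phi>"
  let ?S = "{c. \<psi> c \<noteq> 0} \<union> {c. \<phi> c \<noteq> 0}"
  have "finite ?S" using * by (auto simp: fin_def)
  then have "ip \<phi> \<psi> = (\<Sum>c\<in>?S. cnj (\<phi> c) * \<psi> c)" "ip \<psi> \<phi> = (\<Sum>c\<in>?S. cnj (\<psi> c) * \<phi> c)"
    using * by (auto intro!: ip_super)
  then show ?thesis by (simp add: mult.commute)
qed

lemma ip_add_left: "fin \<psi> \<Longrightarrow> fin \<psi>' \<Longrightarrow> fin \<phi> \<Longrightarrow> ip (\<psi> + \<psi>') \<phi> = ip \<psi> \<phi> + ip \<psi>' \<phi>"
  by (simp add: ip_cnj[of \<phi> "\<psi> + \<psi>'"] ip_cnj[of \<phi> \<psi>] ip_cnj[of \<phi> \<psi>'] ip_add_right)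

lemma ip_diff_left: "fin \<psi> \<Longrightarrow> fin \<psi>' \<Longrightarrow> fin \<phi> \<Longrightarrow> ip (\<psi> - \<psi>') \<phi> = ip \<psi> \<phi> - ip \<psi>' \<phi>"
  by (simp add: ip_cnj[of \<phi> "\<psi> - \<psi>'"] ip_cnj[of \<phi> \<psi>] ip_cnj[of \<phi> \<psi>'] ip_diff_right)

lemma ip_smul_left: "fin \<psi> \<Longrightarrow> fin \<phi> \<Longrightarrow> ip (a *q \<psi>) \<phi> = cnj a * ip \<psi> \<phi>"
  by (simp add: ip_cnj[of \<phi> "a *q \<psi>"] ip_cnj[of \<phi> \<psi>] ip_smul_right)

lemma ip_sum_left: "(\<And>i. i \<in> I \<Longrightarrow> fin (f i)) \<Longrightarrow> fin \<phi> \<Longrightarrow> ip (\<Sum>i\<in>I. f i) \<phi> = (\<Sum>i\<in>I. ip (f i) \<phi>)" for f :: "'i \<Rightarrow> qstate"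
  by (induction I rule: infinite_finite_induct) (auto simp: ip_add_left)

lemma ip_Ket_left [simp]: "ip (Ket c) \<psi> = \<psi> c"
proof -
  have "{d. Ket c d \<noteq> 0} = {c}" by (auto simp: Ket_def)
  then show ?thesis by (simp add: ip_def Ket_def)
qed

lemma ip_self: "ip \<psi> \<psi> = complex_of_real (nsq \<psi>)"
  by (simp add: ip_def nsq_def mult.commute[of "cnj _"] flip: complex_norm_square)

lemma ip_restr: "fin \<psi> \<Longrightarrow> ip \<psi> (restr P \<phi>) = ip (restr P \<psi>) \<phi>"
  using fin_restr[of \<psi> P]
  by (subst (2) ip_super[where S = "{c. \<psi> c \<noteq> 0}"]) (auto simp: restr_def ip_def fin_def intro!: sum.cong)

lemma nsq_nonneg [simp]: "nsq \<psi> \<ge> 0"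
  by (auto simp: nsq_def intro: sum_nonneg)

lemma nsq_super: "finite S \<Longrightarrow> (\<And>c. c \<notin> S \<Longrightarrow> \<psi> c = 0) \<Longrightarrow> nsq \<psi> = (\<Sum>c\<in>S. (cmod (\<psi> c))\<^sup>2)"
  unfolding nsq_def by (rule sum.mono_neutral_left) auto

lemma nsq_restr_split: "fin \<psi> \<Longrightarrow> nsq \<psi> = nsq (restr P \<psi>) + nsq (restr (\<lambda>c. \<not> P c) \<psi>)"
proof -
  assume "fin \<psi>"
  then have f: "finite {c. \<psi> c \<noteq> 0}" by (simp add: fin_def)
  have "nsq (restr P \<psi>) = (\<Sum>c | \<psi> c \<noteq> 0. (cmod (restr P \<psi> c))\<^sup>2)"
    "nsq (restr (\<lambda>c. \<not> P c) \<psi>) = (\<Sum>c | \<psi> c \<noteq> 0. (cmod (restr (\<lambda>c. \<not> P c) \<psi> c))\<^sup>2)"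
    using f by (auto intro!: nsq_super simp: restr_def split: if_splits)
  then have "nsq (restr P \<psi>) + nsq (restr (\<lambda>c. \<not> P c) \<psi>) =
      (\<Sum>c | \<psi> c \<noteq> 0. (cmod (restr P \<psi> c))\<^sup>2 + (cmod (restr (\<lambda>c. \<not> P c) \<psi> c))\<^sup>2)"
    by (simp add: sum.distrib)
  also have "\<dots> = nsq \<psi>" unfolding nsq_def by (rule sum.cong) (auto simp: restr_def)
  finally show ?thesis by simp
qed

lemma nsq_smul: "fin \<psi> \<Longrightarrow> nsq (a *q \<psi>) = (cmod a)\<^sup>2 * nsq \<psi>"
  by (subst nsq_super[of "{c. \<psi> c \<noteq> 0}"])
    (auto simp: nsq_def sum_distrib_left norm_mult power_mult_distrib fin_def)

section \<open>Elementary unitaries\<close>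

text \<open>What a gate does once registers and memory are fixed: shift, angle and phase become
  arbitrary functions of the configuration. This class is closed under inverses and under
  conjugation by a computation of temporary cells.\<close>

datatype qop = Tr nat "config \<Rightarrow> real" | Ro nat "config \<Rightarrow> real" | Ph "config \<Rightarrow> real"

fun ap :: "qop \<Rightarrow> qstate \<Rightarrow> qstate" where
  "ap (Tr k f) \<psi> = translate k f \<psi>"
| "ap (Ro k g) \<psi> = (\<lambda>c.
     if c k = 0 then complex_of_real (cos (g c)) * \<psi> (c(k := 0)) - complex_of_real (sin (g c)) * \<psi> (c(k := 1))
     else if c k = 1 then complex_of_real (sin (g c)) * \<psi> (c(k := 0)) + complex_of_real (cos (g c)) * \<psi> (c(k := 1))
     else \<psi> c)"
| "ap (Ph g) \<psi> = (\<lambda>c. cis (g c) * \<psi> c)"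

fun tgt :: "qop \<Rightarrow> nat set" where
  "tgt (Tr k f) = {k}" | "tgt (Ro k f) = {k}" | "tgt (Ph f) = {}"

fun ofn :: "qop \<Rightarrow> config \<Rightarrow> real" where
  "ofn (Tr k f) = f" | "ofn (Ro k f) = f" | "ofn (Ph f) = f"

fun oinv :: "qop \<Rightarrow> qop" where
  "oinv (Tr k f) = Tr k (\<lambda>c. - f c)" | "oinv (Ro k f) = Ro k (\<lambda>c. - f c)"
| "oinv (Ph f) = Ph (\<lambda>c. - f c)"

definition indep :: "nat set \<Rightarrow> (config \<Rightarrow> 'a) \<Rightarrow> bool" where
  "indep T f \<longleftrightarrow> (\<forall>c. \<forall>k\<in>T. \<forall>v. f (c(k := v)) = f c)"

definition dep :: "nat set \<Rightarrow> (config \<Rightarrow> 'a) \<Rightarrow> bool" where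
  "dep S f \<longleftrightarrow> (\<forall>c c'. (\<forall>k\<in>S. c k = c' k) \<longrightarrow> f c = f c')"

text \<open>The parameter must not read the target cell. It then has the same value before and after
  the operation, which makes the operation invertible and unitary.\<close>

definition wfo :: "qop \<Rightarrow> bool" where
  "wfo p \<longleftrightarrow> indep (tgt p) (ofn p)"

text \<open>All cells that are read or written lie in \<open>S\<close>. Lists on disjoint sets of
  cells commute (\<open>aps_commute\<close>), and a list commutes with every restriction that
  ignores \<open>S\<close> (\<open>restr_ops_on\<close>).\<close>

definition ops_on :: "nat set \<Rightarrow> qop list \<Rightarrow> bool" where
  "ops_on S xs \<longleftrightarrow> (\<forall>p\<in>set xs. wfo p \<and> tgt p \<subseteq> S \<and> dep S (ofn p))"

definition aps :: "qop list \<Rightarrow> qstate \<Rightarrow> qstate" where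
  "aps xs \<psi> = fold ap xs \<psi>"

definition invs :: "qop list \<Rightarrow> qop list" where
  "invs xs = rev (map oinv xs)"

abbreviation wfs :: "qop list \<Rightarrow> bool" where
  "wfs xs \<equiv> \<forall>p\<in>set xs. wfo p"

lemma aps_simps [simp]: "aps [] \<psi> = \<psi>" "aps (p # xs) \<psi> = aps xs (ap p \<psi>)"
    "aps (xs @ ys) \<psi> = aps ys (aps xs \<psi>)"
  by (simp_all add: aps_def)

lemma invs_simps [simp]: "invs [] = []" "invs (p # xs) = invs xs @ [oinv p]"
    "invs (xs @ ys) = invs ys @ invs xs"
  by (simp_all add: invs_def)

lemma tgt_oinv [simp]: "tgt (oinv p) = tgt p"
  by (cases p) auto

lemma oinv_oinv [simp]: "oinv (oinv p) = p"
  by (cases p) auto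

lemma invs_invs [simp]: "invs (invs xs) = xs"
  by (simp add: invs_def rev_map o_def)

lemma wfo_oinv [simp]: "wfo (oinv p) = wfo p"
  by (cases p) (auto simp: wfo_def indep_def)

lemma wfs_invs [simp]: "wfs (invs xs) = wfs xs"
  by (auto simp: invs_def)

lemma ops_on_simps [simp]: "ops_on S []" "ops_on S (p # xs) \<longleftrightarrow> wfo p \<and> tgt p \<subseteq> S \<and> dep S (ofn p) \<and> ops_on S xs"
    "ops_on S (xs @ ys) \<longleftrightarrow> ops_on S xs \<and> ops_on S ys"
  by (auto simp: ops_on_def)

lemma ops_on_invs [simp]: "ops_on S (invs xs) = ops_on S xs"
proof -
  have "dep S (ofn (oinv p)) = dep S (ofn p)" for p
    by (cases p) (auto simp: dep_def)
  then show ?thesis by (auto simp: ops_on_def invs_def)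
qed

lemma ops_on_concat: "(\<And>i. i \<in> set I \<Longrightarrow> ops_on S (f i)) \<Longrightarrow> ops_on S (concat (map f I))"
  by (auto simp: ops_on_def)

lemma ops_on_wfs: "ops_on S xs \<Longrightarrow> wfs xs"
  by (simp add: ops_on_def)

lemma dep_indep: "dep S f \<Longrightarrow> T \<inter> S = {} \<Longrightarrow> indep T f"
  unfolding dep_def indep_def by (metis disjoint_iff fun_upd_other)

lemma ap_add: "ap p (\<psi> + \<phi>) = ap p \<psi> + ap p \<phi>"
  by (cases p) (auto simp: translate_def algebra_simps fun_eq_iff)

lemma ap_smul: "ap p (a *q \<psi>) = a *q ap p \<psi>"
  by (cases p) (auto simp: translate_def algebra_simps fun_eq_iff)

lemma aps_add: "aps xs (\<psi> + \<phi>) = aps xs \<psi> + aps xs \<phi>"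
  by (induction xs arbitrary: \<psi> \<phi>) (auto simp: ap_add)

lemma aps_smul: "aps xs (a *q \<psi>) = a *q aps xs \<psi>"
  by (induction xs arbitrary: \<psi>) (auto simp: ap_smul)

lemma aps_zero [simp]: "aps xs 0 = 0"
  using aps_smul[of xs 0 0] by simp

lemma aps_diff: "aps xs (\<psi> - \<phi>) = aps xs \<psi> - aps xs \<phi>"
proof -
  have "\<psi> - \<phi> = \<psi> + (-1) *q \<phi>" for \<psi> \<phi> :: qstate by (auto simp: fun_eq_iff)
  then show ?thesis by (metis aps_add aps_smul)
qed

lemma aps_sum: "aps xs (\<Sum>i\<in>I. f i) = (\<Sum>i\<in>I. aps xs (f i))" for f :: "'i \<Rightarrow> qstate"
  using sum_comp_morphism[of "aps xs" f I] by (simp add: aps_add o_def)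

lemma cos_sin_sq_complex: "(complex_of_real (cos x))\<^sup>2 + (complex_of_real (sin x))\<^sup>2 = 1"
  by (metis of_real_1 of_real_add of_real_power sin_cos_squared_add2)

lemma ap_oinv: "wfo p \<Longrightarrow> ap (oinv p) (ap p \<psi>) = \<psi>"
proof (cases p)
  case (Tr k f)
  assume "wfo p"
  then have "f (c(k := v)) = f c" for c v by (auto simp: Tr wfo_def indep_def)
  then show ?thesis by (auto simp: Tr translate_def)
next
  case (Ro k g)
  assume "wfo p"
  then have g: "g (c(k := v)) = g c" for c v by (auto simp: Ro wfo_def indep_def)
  have cs: "complex_of_real (cos x) * (complex_of_real (cos x) * z) +
      complex_of_real (sin x) * (complex_of_real (sin x) * z) = z" for x z
  proof -
    have "complex_of_real (cos x) * (complex_of_real (cos x) * z) +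
      complex_of_real (sin x) * (complex_of_real (sin x) * z) =
      ((complex_of_real (cos x))\<^sup>2 + (complex_of_real (sin x))\<^sup>2) * z"
      by (simp add: algebra_simps power2_eq_square)
    then show ?thesis by (simp only: cos_sin_sq_complex mult_1)
  qed
  have "ap (oinv (Ro k g)) (ap (Ro k g) \<psi>) c = \<psi> c" for c
  proof -
    consider "c k = 0" | "c k = 1" | "c k \<noteq> 0" "c k \<noteq> 1" by blast
    then show ?thesis
    proof cases
      case 1
      then have "c(k := 0) = c" by auto
      then show ?thesis using 1 cs[of "g c" "\<psi> c"] by (simp add: g ring_distribs mult.left_commute add.commute)
    next
      case 2
      then have "c(k := 1) = c" by auto
      then show ?thesis using 2 cs[of "g c" "\<psi> c"] by (simp add: g ring_distribs mult.left_commute add.commute)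
    qed simp
  qed
  then show ?thesis by (auto simp: Ro)
next
  case (Ph g)
  then show ?thesis by (auto simp: fun_eq_iff cis_mult simp flip: mult.assoc)
qed

lemma aps_invs: "wfs xs \<Longrightarrow> aps (invs xs) (aps xs \<psi>) = \<psi>"
  by (induction xs arbitrary: \<psi>) (auto simp: ap_oinv)

lemma aps_invs': "wfs xs \<Longrightarrow> aps xs (aps (invs xs) \<psi>) = \<psi>"
  using aps_invs[of "invs xs"] by simp

lemma fin_ap: "wfo p \<Longrightarrow> fin \<psi> \<Longrightarrow> fin (ap p \<psi>)"
proof (cases p)
  case (Tr k f)
  assume "wfo p" and "fin \<psi>"
  then have f: "f (c(k := v)) = f c" for c v by (auto simp: Tr wfo_def indep_def)
  have "{c. translate k f \<psi> c \<noteq> 0} \<subseteq> (\<lambda>c. c(k := c k + f c)) ` {c. \<psi> c \<noteq> 0}"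
  proof
    fix c assume "c \<in> {c. translate k f \<psi> c \<noteq> 0}"
    then show "c \<in> (\<lambda>c. c(k := c k + f c)) ` {c. \<psi> c \<noteq> 0}"
      by (intro image_eqI[of _ _ "c(k := c k - f c)"]) (auto simp: translate_def f)
  qed
  then show ?thesis using \<open>fin \<psi>\<close> by (auto simp: Tr fin_def intro: finite_subset)
next
  case (Ro k g)
  assume "fin \<psi>"
  let ?S = "{c. \<psi> c \<noteq> 0}"
  have "{c. ap p \<psi> c \<noteq> 0} \<subseteq> ?S \<union> (\<lambda>c. c(k := 0)) ` ?S \<union> (\<lambda>c. c(k := 1)) ` ?S"
  proof
    fix c assume c: "c \<in> {c. ap p \<psi> c \<noteq> 0}"
    have "c \<in> (\<lambda>c. c(k := x)) ` ?S" if "\<psi> (c(k := y)) \<noteq> 0" "c k = x" for x y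
      using that by (intro image_eqI[of _ _ "c(k := y)"]) auto
    then show "c \<in> ?S \<union> (\<lambda>c. c(k := 0)) ` ?S \<union> (\<lambda>c. c(k := 1)) ` ?S"
      using c by (cases "\<psi> (c(k := 0)) = 0"; cases "\<psi> (c(k := 1)) = 0") (auto simp: Ro split: if_splits)
  qed
  then show ?thesis using \<open>fin \<psi>\<close> by (auto simp: fin_def intro: finite_subset)
next
  case (Ph g)
  assume "fin \<psi>"
  then show ?thesis by (auto simp: Ph fin_def)
qed

lemma fin_aps: "wfs xs \<Longrightarrow> fin \<psi> \<Longrightarrow> fin (aps xs \<psi>)"
  by (induction xs arbitrary: \<psi>) (auto simp: fin_ap)

lemma ip_ap:
  assumes "wfo p" "fin \<psi>" "fin \<phi>"
  shows "ip (ap p \<psi>) (ap p \<phi>) = ip \<psi> \<phi>"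
proof (cases p)
  case (Tr k f)
  have f: "f (c(k := v)) = f c" for c v using assms(1) by (auto simp: Tr wfo_def indep_def)
  have "ip (ap p \<psi>) (ap p \<phi>) = (\<Sum>c | \<psi> c \<noteq> 0. cnj (\<psi> c) * \<phi> c)"
    unfolding ip_def
    by (rule sum.reindex_bij_witness[of _ "\<lambda>c. c(k := c k + f c)" "\<lambda>c. c(k := c k - f c)"])
      (auto simp: Tr translate_def f)
  then show ?thesis by (simp add: ip_def)
next
  case (Ro k g)
  have g: "g (c(k := v)) = g c" for c v using assms(1) by (auto simp: Ro wfo_def indep_def)
  \<comment> \<open>The supports before and after, closed under setting cell \<open>k\<close> to 0
    and to 1, split into pairs on which the operation is an orthogonal 2x2 matrix, and a rest
    \<open>N\<close> on which it is the identity.\<close>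
  define S0 where "S0 = {c. \<psi> c \<noteq> 0} \<union> {c. ap p \<psi> c \<noteq> 0}"
  define S where "S = S0 \<union> (\<lambda>c. c(k := 0)) ` S0 \<union> (\<lambda>c. c(k := 1)) ` S0"
  have fS: "finite S" using assms fin_ap[OF assms(1,2)] by (auto simp: S_def S0_def fin_def)
  have S0: "c(k := 0) \<in> S" "c(k := 1) \<in> S" if "c \<in> S" for c
    using that by (auto simp: S_def)
  define Z where "Z = {c \<in> S. c k = 0}"
  define N where "N = {c \<in> S. c k \<noteq> 0 \<and> c k \<noteq> 1}"
  have SZ: "S = N \<union> (Z \<union> (\<lambda>c. c(k := 1)) ` Z)"
  proof -
    have "c = (c(k := 0))(k := 1) \<and> c(k := 0) \<in> Z" if "c \<in> S" "c k = 1" for c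
      using that S0(1)[of c] by (auto simp: Z_def fun_eq_iff)
    then have "c \<in> (\<lambda>c. c(k := 1)) ` Z" if "c \<in> S" "c k = 1" for c
      using that by blast
    then show ?thesis using S0 by (auto simp: Z_def N_def)
  qed
  have inj: "inj_on (\<lambda>c. c(k := 1)) Z"
  proof (rule inj_onI)
    fix c d assume cd: "c \<in> Z" "d \<in> Z" "c(k := 1) = d(k := 1)"
    from cd(1,2) have "c = (c(k := 1))(k := 0)" "d = (d(k := 1))(k := 0)" by (auto simp: Z_def)
    then show "c = d" using cd(3) by metis
  qed
  have split: "(\<Sum>c\<in>S. F c) = (\<Sum>c\<in>N. F c) + (\<Sum>c\<in>Z. F c + F (c(k := 1)))" for F :: "config \<Rightarrow> complex"
  proof -
    have "(\<Sum>c\<in>S. F c) = (\<Sum>c\<in>N. F c) + ((\<Sum>c\<in>Z. F c) + (\<Sum>c\<in>(\<lambda>c. c(k := 1)) ` Z. F c))"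
      unfolding SZ using fS
      by (subst sum.union_disjoint, auto simp: Z_def N_def) (subst sum.union_disjoint, auto simp: Z_def)
    then show ?thesis by (simp add: sum.reindex[OF inj] sum.distrib)
  qed
  have rot: "cnj (co * a - si * b) * (co * a' - si * b') + cnj (si * a + co * b) * (si * a' + co * b')
      = cnj a * a' + cnj b * b'" if "co = complex_of_real (cos x)" "si = complex_of_real (sin x)"
    for co si a b a' b' x
  proof -
    have 1: "co * co + si * si = 1" using that
      cos_sin_sq_complex[of x] by (simp flip: power2_eq_square)
    have "cnj co = co" "cnj si = si" using that by auto
    then have "cnj (co * a - si * b) * (co * a' - si * b') + cnj (si * a + co * b) * (si * a' + co * b')
      = (co * co + si * si) * (cnj a * a' + cnj b * b')" by (simp add: algebra_simps)
    then show ?thesis using 1 by simp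
  qed
  have "ip (ap p \<psi>) (ap p \<phi>) = (\<Sum>c\<in>S. cnj (ap p \<psi> c) * ap p \<phi> c)"
    using fS assms by (intro ip_super) (auto simp: S_def S0_def fin_ap)
  also have "\<dots> = (\<Sum>c\<in>S. cnj (\<psi> c) * \<phi> c)"
  proof -
    have *: "cnj (ap p \<psi> c) * ap p \<phi> c + cnj (ap p \<psi> (c(k := 1))) * ap p \<phi> (c(k := 1)) =
        cnj (\<psi> c) * \<phi> c + cnj (\<psi> (c(k := 1))) * \<phi> (c(k := 1))" if "c k = 0" for c
    proof -
      have "c(k := 0) = c" using that by auto
      then show ?thesis using that rot[OF refl refl, where x = "g c"] by (simp add: Ro g)
    qed
    have "(\<Sum>c\<in>N. cnj (ap p \<psi> c) * ap p \<phi> c) = (\<Sum>c\<in>N. cnj (\<psi> c) * \<phi> c)"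
      by (intro sum.cong refl) (auto simp: Ro N_def)
    moreover have "(\<Sum>c\<in>Z. cnj (ap p \<psi> c) * ap p \<phi> c + cnj (ap p \<psi> (c(k := 1))) * ap p \<phi> (c(k := 1))) =
        (\<Sum>c\<in>Z. cnj (\<psi> c) * \<phi> c + cnj (\<psi> (c(k := 1))) * \<phi> (c(k := 1)))"
      by (rule sum.cong[OF refl *]) (simp add: Z_def)
    ultimately show ?thesis unfolding split by simp
  qed
  also have "\<dots> = ip \<psi> \<phi>"
    using fS assms by (intro ip_super[symmetric]) (auto simp: S_def S0_def fin_ap)
  finally show ?thesis .
next
  case (Ph g)
  have "{c. ap p \<psi> c \<noteq> 0} = {c. \<psi> c \<noteq> 0}" by (auto simp: Ph)
  moreover have "cnj (cis x * a) * (cis x * b) = cnj a * b" for x a b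
  proof -
    have "cnj (cis x * a) * (cis x * b) = (cis (- x) * cis x) * (cnj a * b)"
      by (simp add: cis_cnj)
    then show ?thesis by (simp add: cis_mult)
  qed
  ultimately show ?thesis unfolding ip_def Ph ap.simps by (intro sum.cong) auto
qed

lemma ip_aps: "wfs xs \<Longrightarrow> fin \<psi> \<Longrightarrow> fin \<phi> \<Longrightarrow> ip (aps xs \<psi>) (aps xs \<phi>) = ip \<psi> \<phi>"
  by (induction xs arbitrary: \<psi> \<phi>) (auto simp: ip_ap fin_ap)

lemma ip_aps_adj: "wfs xs \<Longrightarrow> fin \<psi> \<Longrightarrow> fin \<phi> \<Longrightarrow> ip (aps xs \<psi>) \<phi> = ip \<psi> (aps (invs xs) \<phi>)"
  by (metis aps_invs' fin_aps ip_aps wfs_invs)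

lemma nsq_aps: "wfs xs \<Longrightarrow> fin \<psi> \<Longrightarrow> nsq (aps xs \<psi>) = nsq \<psi>"
  by (metis ip_aps ip_self of_real_eq_iff)

lemma ap_commute:
  assumes "tgt p \<inter> tgt p' = {}" "indep (tgt p) (ofn p')" "indep (tgt p') (ofn p)"
  shows "ap p (ap p' \<psi>) = ap p' (ap p \<psi>)"
proof -
  have *: "ap p (ap (Tr k f) \<psi>) = ap (Tr k f) (ap p \<psi>)"
    if "k \<notin> tgt p" "\<And>c v. ofn p (c(k := v)) = ofn p c" "\<And>k' c v. k' \<in> tgt p \<Longrightarrow> f (c(k' := v)) = f c" for k f p
  proof (cases p)
    case (Tr k' f')
    then show ?thesis using that by (auto simp: translate_def fun_eq_iff fun_upd_twist)
  next
    case (Ro k' f')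
    then have "k' \<noteq> k" "\<And>c v. f (c(k' := v)) = f c" "\<And>c v. f' (c(k := v)) = f' c" using that by auto
    then show ?thesis by (simp add: Ro translate_def fun_eq_iff fun_upd_twist[of k' k])
  next
    case (Ph f')
    then show ?thesis using that by (auto simp: translate_def fun_eq_iff)
  qed
  have **: "ap p (ap (Ph f) \<psi>) = ap (Ph f) (ap p \<psi>)"
    if "\<And>k' c v. k' \<in> tgt p \<Longrightarrow> f (c(k' := v)) = f c" for f p
    using that by (cases p) (simp_all add: translate_def fun_eq_iff algebra_simps)
  consider k f where "p = Tr k f" | k f where "p' = Tr k f" | f where "p = Ph f" | f where "p' = Ph f"
    | k f k' f' where "p = Ro k f" "p' = Ro k' f'" by (cases p; cases p') auto
  then show ?thesis
  proof cases
    case 1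
    then show ?thesis using *[of k p' f] assms by (simp add: indep_def disjoint_iff)
  next
    case 2
    then show ?thesis using *[of k p f] assms by (auto simp: indep_def disjoint_iff)
  next
    case 3
    then show ?thesis using **[of p' f] assms by (simp add: indep_def)
  next
    case 4
    then show ?thesis using **[of p f] assms by (simp add: indep_def)
  next
    case 5
    have k: "k \<noteq> k'" "\<And>c v. f (c(k' := v)) = f c" "\<And>c v. f' (c(k := v)) = f' c"
      using assms 5 by (auto simp: indep_def)
    have tw: "c(k := x, k' := y) = c(k' := y, k := x)" for c :: config and x y
      using k(1) by (rule fun_upd_twist)
    have "ap p (ap p' \<psi>) c = ap p' (ap p \<psi>) c" for c
    proof -
      consider "c k = 0" | "c k = 1" | "c k \<noteq> 0" "c k \<noteq> 1" by blast
      moreover consider "c k' = 0" | "c k' = 1" | "c k' \<noteq> 0" "c k' \<noteq> 1" by blast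
      ultimately show ?thesis
        by (cases; cases) (simp_all add: 5 k k(1)[symmetric] tw ring_distribs mult.left_commute)
    qed
    then show ?thesis by blast
  qed
qed

lemma aps_commute:
  assumes "ops_on S xs" "ops_on S' ys" "S \<inter> S' = {}"
  shows "aps xs (aps ys \<psi>) = aps ys (aps xs \<psi>)"
proof -
  have *: "ap p (aps ys \<psi>) = aps ys (ap p \<psi>)"
    if "wfo p" "tgt p \<subseteq> S" "dep S (ofn p)" "ops_on S' ys" for p ys \<psi>
    using that(4)
  proof (induction ys arbitrary: \<psi>)
    case (Cons p' ys)
    have "ap p (ap p' \<psi>) = ap p' (ap p \<psi>)"
      using that(1-3) Cons.prems assms(3) by (intro ap_commute) (auto intro!: dep_indep)
    then show ?case using Cons by simp
  qed simp
  show ?thesis using assms(1)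
    by (induction xs arbitrary: \<psi>) (auto simp: * assms(2))
qed

lemma restr_commute: "indep (tgt p) P \<Longrightarrow> restr P (ap p \<psi>) = ap p (restr P \<psi>)"
  by (cases p) (auto simp: indep_def translate_def fun_eq_iff restr_def)

lemma restr_aps: "(\<And>p. p \<in> set xs \<Longrightarrow> indep (tgt p) P) \<Longrightarrow> restr P (aps xs \<psi>) = aps xs (restr P \<psi>)"
  by (induction xs arbitrary: \<psi>) (auto simp: restr_commute)

lemma restr_ops_on: "ops_on S xs \<Longrightarrow> indep S P \<Longrightarrow> restr P (aps xs \<psi>) = aps xs (restr P \<psi>)"
  by (rule restr_aps) (simp add: ops_on_def indep_def subset_iff)

lemma restr_smul: "restr P (a *q \<psi>) = a *q restr P \<psi>"
  by (auto simp: restr_def)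

lemma restr_add: "restr P (\<psi> + \<phi>) = restr P \<psi> + restr P \<phi>"
  by (auto simp: restr_def)

lemma restr_diff: "restr P (\<psi> - \<phi>) = restr P \<psi> - restr P \<phi>"
  by (auto simp: restr_def)

lemma restr_sum: "restr P (\<Sum>i\<in>I. f i) = (\<Sum>i\<in>I. restr P (f i))" for f :: "'i \<Rightarrow> qstate"
  by (rule ext) (auto simp: restr_def sum_fun_apply')

lemma restr_restr: "restr P (restr Q \<psi>) = restr (\<lambda>c. P c \<and> Q c) \<psi>"
  by (auto simp: restr_def)

lemma restr_Ket: "restr P (Ket c) = (if P c then Ket c else 0)"
  by (auto simp: restr_def Ket_def)

lemma ap_Tr_Ket: "(\<And>v. f (c(k := v)) = f c) \<Longrightarrow> ap (Tr k f) (Ket c) = Ket (c(k := c k + f c))"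
proof -
  assume f: "\<And>v. f (c(k := v)) = f c"
  have "d(k := d k - f d) = c \<longleftrightarrow> d = c(k := c k + f c)" for d
  proof
    assume c: "d(k := d k - f d) = c"
    then have d: "d = c(k := d k)" by auto
    have "f d = f c" by (subst d) (rule f)
    moreover have "c k = d k - f d" using c by auto
    ultimately show "d = c(k := c k + f c)" by (subst d) simp
  next
    assume d: "d = c(k := c k + f c)"
    have "f d = f c" by (subst d) (rule f)
    then show "d(k := d k - f d) = c" using d by auto
  qed
  then show ?thesis by (auto simp: translate_def Ket_def)
qed

lemma ap_Ro_Ket0:
  assumes g: "\<And>v. g (c(k := v)) = g c" and c: "c k = 0"
  shows "ap (Ro k g) (Ket c) = complex_of_real (cos (g c)) *q Ket c + complex_of_real (sin (g c)) *q Ket (c(k := 1))"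
proof
  fix d :: config
  consider "d k = 0" | "d k = 1" | "d k \<noteq> 0" "d k \<noteq> 1" by blast
  then show "ap (Ro k g) (Ket c) d = (complex_of_real (cos (g c)) *q Ket c + complex_of_real (sin (g c)) *q Ket (c(k := 1))) d"
  proof cases
    case 1
    then have "d(k := 0) = d" "d(k := 1) \<noteq> c" "d \<noteq> c(k := 1)" using c by auto
    then show ?thesis using 1 by (simp add: Ket_def)
  next
    case 2
    then have 3: "d(k := 1) = d" "d \<noteq> c" using c by auto
    have "d(k := 0) = c \<longleftrightarrow> d = c(k := 1)"
    proof
      assume "d(k := 0) = c"
      then show "d = c(k := 1)" using 2 by auto
    qed (use c in auto)
    then show ?thesis using 2 3 g[of 1] by (simp add: Ket_def)
  next
    case 3
    then have "d \<noteq> c" "d \<noteq> c(k := 1)" using c by auto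
    then show ?thesis using 3 by (simp add: Ket_def)
  qed
qed

lemma ap_Ph_Ket: "ap (Ph g) (Ket c) = cis (g c) *q Ket c"
  by (auto simp: Ket_def)

lemma ap_Ph_cong: "(\<And>c. \<psi> c \<noteq> 0 \<Longrightarrow> g c = g' c) \<Longrightarrow> ap (Ph g) \<psi> = ap (Ph g') \<psi>"
  by (rule ext) (metis ap.simps(3) mult_zero_right)

section \<open>Execution of programs\<close>

text \<open>A gate whose target is also one of its operands becomes a phase 0, which is the
  identity.\<close>

fun rs :: "regs \<Rightarrow> memory \<Rightarrow> gate \<Rightarrow> qop" where
  "rs R M (QShift k r) = Tr (addr (R k)) (\<lambda>_. R r)"
| "rs R M (QAdd f k i j) =
    (if addr (R k) \<in> {addr (R i), addr (R j)} then Ph (\<lambda>_. 0)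
     else Tr (addr (R k)) (\<lambda>c. arith_val f (c (addr (R i))) (c (addr (R j)))))"
| "rs R M (QSub f k i j) =
    (if addr (R k) \<in> {addr (R i), addr (R j)} then Ph (\<lambda>_. 0)
     else Tr (addr (R k)) (\<lambda>c. - arith_val f (c (addr (R i))) (c (addr (R j)))))"
| "rs R M (Query k i) =
    (if addr (R k) = addr (R i) then Ph (\<lambda>_. 0) else Tr (addr (R k)) (\<lambda>c. M (addr (c (addr (R i))))))"
| "rs R M (Query_inv k i) =
    (if addr (R k) = addr (R i) then Ph (\<lambda>_. 0) else Tr (addr (R k)) (\<lambda>c. - M (addr (c (addr (R i))))))"
| "rs R M (Rot k i) =
    (if addr (R k) = addr (R i) then Ph (\<lambda>_. 0) else Ro (addr (R k)) (\<lambda>c. angle (c (addr (R i)))))"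
| "rs R M (Phase i) = Ph (\<lambda>c. angle (c (addr (R i))))"

lemma apply_gate_rs: "apply_gate g R M \<psi> = ap (rs R M g) \<psi>"
  by (cases g) (auto simp: Let_def rotate_cell_def fun_eq_iff)

lemma wfo_rs [simp]: "wfo (rs R M g)"
  by (cases g) (auto simp: wfo_def indep_def)

lemma exec_det: "exec P s t s' \<Longrightarrow> exec P s t2 s2 \<Longrightarrow> t2 = t \<and> s2 = s'"
proof (induction arbitrary: t2 s2 rule: exec.induct)
  case (seq P s t s' Q t' s'')
  from seq.prems show ?case by cases (use seq.IH in blast)
next
  case (while_true R r P M \<psi> t s' t' s'')
  from while_true.prems show ?case
    by cases (use while_true.hyps while_true.IH in blast)+
next
  case (if_true R r P M \<psi> t s' Q)
  from if_true.prems show ?case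
    by cases (use if_true.hyps if_true.IH in blast)+
next
  case (if_false R r Q M \<psi> t s' P)
  from if_false.prems show ?case
    by cases (use if_false.hyps if_false.IH in blast)+
qed (erule exec.cases; simp)+

section \<open>Triples for programs that perform a fixed list of unitaries\<close>

type_synonym asrt = "regs \<Rightarrow> memory \<Rightarrow> bool"

text \<open>Cells 11 to 39 are temporary: they are 0 between the blocks of a program.\<close>

definition cln :: "config \<Rightarrow> bool" where
  "cln c \<longleftrightarrow> (\<forall>k. 11 \<le> k \<and> k < 40 \<longrightarrow> c k = 0)"

definition clean :: "qstate \<Rightarrow> bool" where
  "clean \<psi> \<longleftrightarrow> (\<forall>c. \<psi> c \<noteq> 0 \<longrightarrow> cln c)"

definition pcl :: "qop list \<Rightarrow> bool" where
  "pcl xs \<longleftrightarrow> (\<forall>\<psi>. clean \<psi> \<longrightarrow> clean (aps xs \<psi>))"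

lemma pcl_Nil [simp]: "pcl []"
  by (simp add: pcl_def)

lemma pcl_append: "pcl xs \<Longrightarrow> pcl ys \<Longrightarrow> pcl (xs @ ys)"
  by (simp add: pcl_def)

lemma pcl_concat: "(\<And>x. x \<in> set xss \<Longrightarrow> pcl x) \<Longrightarrow> pcl (concat xss)"
  by (induction xss) (auto intro: pcl_append)

text \<open>Control flow never depends on the quantum state, so a program that starts in \<open>Pre\<close> performs a fixed
  list \<open>xs\<close> of elementary unitaries.\<close>

definition tr :: "asrt \<Rightarrow> com \<Rightarrow> real \<Rightarrow> qop list \<Rightarrow> asrt \<Rightarrow> bool" where
  "tr Pre P T xs Post \<longleftrightarrow> pcl xs \<and> (\<forall>R M. Pre R M \<longrightarrow> (\<exists>R' M' t. Post R' M' \<and> real t \<le> T \<and>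
     (\<forall>\<psi>. clean \<psi> \<longrightarrow> exec P (R, M, \<psi>) t (R', M', aps xs \<psi>))))"

lemma trD: "tr Pre P T xs Post \<Longrightarrow> Pre R M \<Longrightarrow> \<exists>R' M' t. Post R' M' \<and> real t \<le> T \<and>
     (\<forall>\<psi>. clean \<psi> \<longrightarrow> exec P (R, M, \<psi>) t (R', M', aps xs \<psi>))"
  unfolding tr_def by blast

lemma tr_pcl: "tr Pre P T xs Post \<Longrightarrow> pcl xs"
  by (simp add: tr_def)

lemma tr_exec: "(\<And>R M. Pre R M \<Longrightarrow> \<exists>R' M'. Post R' M' \<and> (\<forall>\<psi>. exec P (R, M, \<psi>) t (R', M', \<psi>))) \<Longrightarrow>
    tr Pre P (real t) [] Post"
  unfolding tr_def by (metis aps_simps(1) order_refl pcl_Nil)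

lemma tr_conseq:
  assumes "tr Pre' P T' xs' Post'" "\<And>R M. Pre R M \<Longrightarrow> Pre' R M" "\<And>R M. Post' R M \<Longrightarrow> Post R M"
    "T' \<le> T" "\<And>\<psi>. clean \<psi> \<Longrightarrow> aps xs' \<psi> = aps xs \<psi>"
  shows "tr Pre P T xs Post"
  unfolding tr_def
proof (intro conjI allI impI)
  show "pcl xs" using assms(1,5) by (auto simp: tr_def pcl_def)
  fix R M assume "Pre R M"
  from trD[OF assms(1) assms(2)[OF this]]
  obtain R' M' t where "Post' R' M'" "real t \<le> T'" "\<And>\<psi>. clean \<psi> \<Longrightarrow> exec P (R, M, \<psi>) t (R', M', aps xs' \<psi>)"
    by blast
  then show "\<exists>R' M' t. Post R' M' \<and> real t \<le> T \<and> (\<forall>\<psi>. clean \<psi> \<longrightarrow> exec P (R, M, \<psi>) t (R', M', aps xs \<psi>))"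
    using assms(3-5) by (intro exI[of _ R'] exI[of _ M'] exI[of _ t]) (auto intro: order_trans)
qed

lemma tr_pre: "tr Pre' P T xs Post \<Longrightarrow> (\<And>R M. Pre R M \<Longrightarrow> Pre' R M) \<Longrightarrow> tr Pre P T xs Post"
  by (erule tr_conseq) auto

lemma tr_post: "tr Pre P T xs Post' \<Longrightarrow> (\<And>R M. Post' R M \<Longrightarrow> Post R M) \<Longrightarrow> tr Pre P T xs Post"
  by (erule tr_conseq) auto

lemma tr_time: "tr Pre P T' xs Post \<Longrightarrow> T' \<le> T \<Longrightarrow> tr Pre P T xs Post"
  by (erule tr_conseq) auto

lemma tr_seq:
  assumes "tr Pre P T xs Mid" "tr Mid Q T' ys Post"
  shows "tr Pre (Seq P Q) (T + T') (xs @ ys) Post"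
  unfolding tr_def
proof (intro conjI allI impI)
  show "pcl (xs @ ys)" by (rule pcl_append[OF tr_pcl[OF assms(1)] tr_pcl[OF assms(2)]])
  fix R M assume "Pre R M"
  from trD[OF assms(1) this]
  obtain R1 M1 t where 1: "Mid R1 M1" "real t \<le> T" "\<And>\<psi>. clean \<psi> \<Longrightarrow> exec P (R, M, \<psi>) t (R1, M1, aps xs \<psi>)"
    by blast
  from trD[OF assms(2) 1(1)]
  obtain R2 M2 t' where 2: "Post R2 M2" "real t' \<le> T'" "\<And>\<psi>. clean \<psi> \<Longrightarrow> exec Q (R1, M1, \<psi>) t' (R2, M2, aps ys \<psi>)"
    by blast
  show "\<exists>R' M' t. Post R' M' \<and> real t \<le> T + T' \<and>
      (\<forall>\<psi>. clean \<psi> \<longrightarrow> exec (Seq P Q) (R, M, \<psi>) t (R', M', aps (xs @ ys) \<psi>))"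
    using 1 2 tr_pcl[OF assms(1)]
    by (intro exI[of _ R2] exI[of _ M2] exI[of _ "t + t'"]) (auto simp: pcl_def intro: exec.seq)
qed

lemma tr_skip: "tr Post Skip 0 [] Post"
  unfolding tr_def by (metis aps_simps(1) exec.skip of_nat_0 order_refl pcl_Nil)

type_synonym instr = "arith \<times> nat \<times> nat \<times> nat"

fun astep :: "instr \<Rightarrow> regs \<Rightarrow> regs" where
  "astep (f, r, a, b) R = R(r := arith_val f (R a) (R b))"

definition Ar :: "instr list \<Rightarrow> com" where
  "Ar is = foldr (\<lambda>(f, r, a, b). Seq (Arith f r a b)) is Skip"

definition Gs :: "gate list \<Rightarrow> com" where
  "Gs gs = foldr (\<lambda>g. Seq (Gate g)) gs Skip"

lemma tr_Ar: "tr (\<lambda>R M. Post (fold astep is R) M) (Ar is) (real (length is)) [] Post"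
proof (induction "is")
  case Nil
  then show ?case using tr_skip by (simp add: Ar_def)
next
  case (Cons i "is")
  obtain f r a b where i: "i = (f, r, a, b)" by (cases i)
  have "tr (\<lambda>R M. Post (fold astep is (R(r := arith_val f (R a) (R b)))) M) (Arith f r a b) 1 []
      (\<lambda>R M. Post (fold astep is R) M)"
    using tr_exec[where t = 1 and P = "Arith f r a b"] exec.arith by (metis (mono_tags, lifting) of_nat_1)
  from tr_seq[OF this Cons] show ?case by (simp add: i Ar_def)
qed

lemma exec_Gs: "exec (Gs gs) (R, M, \<psi>) (length gs) (R, M, aps (map (rs R M) gs) \<psi>)"
proof (induction gs arbitrary: \<psi>)
  case Nil
  then show ?case by (simp add: Gs_def exec.skip)
next
  case (Cons g gs)
  have "exec (Gate g) (R, M, \<psi>) 1 (R, M, ap (rs R M g) \<psi>)"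
    using exec.gate[of g R M \<psi>] by (simp add: apply_gate_rs)
  from exec.seq[OF this Cons.IH] show ?case by (simp add: Gs_def)
qed

lemma tr_Gs:
  assumes "pcl xs" "\<And>R M \<psi>. Pre R M \<Longrightarrow> clean \<psi> \<Longrightarrow> aps (map (rs R M) gs) \<psi> = aps xs \<psi>"
  shows "tr Pre (Gs gs) (real (length gs)) xs Pre"
  unfolding tr_def using assms exec_Gs by (metis order_refl)

lemma tr_Load: "tr (\<lambda>R M. Post (R(r := M (addr (R a)))) M) (Load r a) 1 [] Post"
  using tr_exec[where t = 1 and P = "Load r a"] exec.load by (metis (mono_tags, lifting) of_nat_1)

lemma tr_Store: "tr (\<lambda>R M. Post R (M(addr (R a) := R r))) (Store a r) 1 [] Post"
  using tr_exec[where t = 1 and P = "Store a r"] exec.store by (metis (mono_tags, lifting) of_nat_1)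

lemma tr_if_true:
  assumes "tr Pre P T xs Post" "\<And>R M. Pre R M \<Longrightarrow> R r \<noteq> 0"
  shows "tr Pre (If_nz r P Q) (T + 1) xs Post"
  unfolding tr_def
proof (intro conjI allI impI)
  show "pcl xs" by (rule tr_pcl[OF assms(1)])
  fix R M assume *: "Pre R M"
  from trD[OF assms(1) *]
  obtain R1 M1 t where 1: "Post R1 M1" "real t \<le> T" "\<And>\<psi>. clean \<psi> \<Longrightarrow> exec P (R, M, \<psi>) t (R1, M1, aps xs \<psi>)"
    by blast
  then show "\<exists>R' M' t. Post R' M' \<and> real t \<le> T + 1 \<and> (\<forall>\<psi>. clean \<psi> \<longrightarrow> exec (If_nz r P Q) (R, M, \<psi>) t (R', M', aps xs \<psi>))"
    using assms(2)[OF *] by (intro exI[of _ R1] exI[of _ M1] exI[of _ "t + 1"]) (auto intro: exec.if_true simp del: One_nat_def)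
qed

lemma tr_if_false:
  assumes "tr Pre Q T xs Post" "\<And>R M. Pre R M \<Longrightarrow> R r = 0"
  shows "tr Pre (If_nz r P Q) (T + 1) xs Post"
  unfolding tr_def
proof (intro conjI allI impI)
  show "pcl xs" by (rule tr_pcl[OF assms(1)])
  fix R M assume *: "Pre R M"
  from trD[OF assms(1) *]
  obtain R1 M1 t where 1: "Post R1 M1" "real t \<le> T" "\<And>\<psi>. clean \<psi> \<Longrightarrow> exec Q (R, M, \<psi>) t (R1, M1, aps xs \<psi>)"
    by blast
  then show "\<exists>R' M' t. Post R' M' \<and> real t \<le> T + 1 \<and> (\<forall>\<psi>. clean \<psi> \<longrightarrow> exec (If_nz r P Q) (R, M, \<psi>) t (R', M', aps xs \<psi>))"
    using assms(2)[OF *] by (intro exI[of _ R1] exI[of _ M1] exI[of _ "t + 1"]) (auto intro: exec.if_false simp del: One_nat_def)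
qed

lemma tr_while:
  assumes "\<And>k. k < n \<Longrightarrow> tr (I k) P (T k) (xs k) (I (Suc k))"
    "\<And>k R M. k < n \<Longrightarrow> I k R M \<Longrightarrow> R r \<noteq> 0" "\<And>R M. I n R M \<Longrightarrow> R r = 0"
  shows "tr (I 0) (While_nz r P) ((\<Sum>k<n. T k + 1) + 1) (concat (map xs [0..<n])) (I n)"
proof -
  \<comment> \<open>Induction on the number \<open>j\<close> of rounds still to come; each step
    prepends round \<open>n - j\<close> to the rest of the run.\<close>
  have "tr (I (n - j)) (While_nz r P) ((\<Sum>k\<in>{n - j..<n}. T k + 1) + 1) (concat (map xs [n - j..<n])) (I n)"
    if "j \<le> n" for j
    using that
  proof (induction j)
    case 0
    have "tr (I n) (While_nz r P) (real 1) [] (I n)"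
      by (rule tr_exec) (use assms(3) exec.while_false in blast)
    then show ?case by simp
  next
    case (Suc j)
    define k where "k = n - Suc j"
    have k: "k < n" "n - j = Suc k" "[k..<n] = k # [Suc k..<n]" "{k..<n} = insert k {Suc k..<n}"
      using Suc.prems by (auto simp: k_def upt_conv_Cons)
    have IH: "tr (I (Suc k)) (While_nz r P) ((\<Sum>k\<in>{Suc k..<n}. T k + 1) + 1) (concat (map xs [Suc k..<n])) (I n)"
      using Suc by (simp add: k(2))
    show ?case
      unfolding tr_def
    proof (intro conjI allI impI)
      show "pcl (concat (map xs [n - Suc j..<n]))"
        by (rule pcl_concat) (use assms(1)[THEN tr_pcl] in auto)
      fix R M assume *: "I (n - Suc j) R M"
      from trD[OF assms(1)[OF k(1)] *[folded k_def]]
      obtain R1 M1 t where 1: "I (Suc k) R1 M1" "real t \<le> T k" "\<And>\<psi>. clean \<psi> \<Longrightarrow> exec P (R, M, \<psi>) t (R1, M1, aps (xs k) \<psi>)"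
        by blast
      from trD[OF IH 1(1)]
      obtain R2 M2 t' where 2: "I n R2 M2" "real t' \<le> (\<Sum>k\<in>{Suc k..<n}. T k + 1) + 1"
        "\<And>\<psi>. clean \<psi> \<Longrightarrow> exec (While_nz r P) (R1, M1, \<psi>) t' (R2, M2, aps (concat (map xs [Suc k..<n])) \<psi>)"
        by blast
      have "exec (While_nz r P) (R, M, \<psi>) (t + t' + 1) (R2, M2, aps (concat (map xs [k..<n])) \<psi>)" if "clean \<psi>" for \<psi>
        using exec.while_true[OF assms(2)[OF k(1) *[folded k_def]] 1(3) 2(3)] that tr_pcl[OF assms(1)[OF k(1)]]
        by (simp add: k(3) pcl_def)
      then show "\<exists>R' M' t. I n R' M' \<and> real t \<le> (\<Sum>k\<in>{n - Suc j..<n}. T k + 1) + 1 \<and>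
         (\<forall>\<psi>. clean \<psi> \<longrightarrow> exec (While_nz r P) (R, M, \<psi>) t (R', M', aps (concat (map xs [n - Suc j..<n])) \<psi>))"
        using 1(2) 2(1,2)
        by (intro exI[of _ R2] exI[of _ M2] exI[of _ "t + t' + 1"]) (auto simp: k(4) simp flip: k_def)
    qed
  qed
  from this[of n] show ?thesis by (simp add: atLeast0LessThan)
qed

definition For :: "nat \<Rightarrow> com \<Rightarrow> com" where
  "For r P = While_nz r (Seq P (Ar [(Const 1, 90, 90, 90), (Sub, r, r, 90)]))"

text \<open>A round costs 3 more than its body: two instructions that decrement the counter and the
  loop test. The last 1 is the test that leaves the loop. Register 90 receives the constant 1, so
  the invariant has to ignore it as well as the counter.\<close>

lemma tr_for:
  assumes "\<And>k. k < n \<Longrightarrow> tr (\<lambda>R M. I k R M \<and> R r = real (n - k)) P (T k) (xs k)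
      (\<lambda>R M. I (Suc k) R M \<and> R r = real (n - k))"
    "\<And>k R M v w. k \<le> n \<Longrightarrow> I k R M \<Longrightarrow> I k (R(90 := v, r := w)) M" "r \<noteq> 90"
  shows "tr (\<lambda>R M. I 0 R M \<and> R r = real n) (For r P) ((\<Sum>k<n. T k + 3) + 1)
    (concat (map xs [0..<n])) (\<lambda>R M. I n R M \<and> R r = 0)"
proof -
  have "tr (\<lambda>R M. I 0 R M \<and> R r = real (n - 0)) (For r P) ((\<Sum>k<n. (T k + 2) + 1) + 1)
    (concat (map (\<lambda>k. xs k @ []) [0..<n])) (\<lambda>R M. I n R M \<and> R r = real (n - n))"
    unfolding For_def
  proof (rule tr_while)
    fix k assume k: "k < n"
    have "tr (\<lambda>R M. I (Suc k) R M \<and> R r = real (n - k)) (Ar [(Const 1, 90, 90, 90), (Sub, r, r, 90)]) 2 []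
      (\<lambda>R M. I (Suc k) R M \<and> R r = real (n - Suc k))"
      by (rule tr_conseq[OF tr_Ar]) (use k assms(2,3) in \<open>auto simp: of_nat_diff\<close>)
    from tr_seq[OF assms(1)[OF k] this]
    show "tr (\<lambda>R M. I k R M \<and> R r = real (n - k)) (Seq P (Ar [(Const 1, 90, 90, 90), (Sub, r, r, 90)]))
       (T k + 2) (xs k @ []) (\<lambda>R M. I (Suc k) R M \<and> R r = real (n - Suc k))" .
  qed auto
  then show ?thesis by (simp add: add.assoc)
qed

section \<open>Computing and uncomputing temporary cells\<close>

fun pre :: "(config \<Rightarrow> config) \<Rightarrow> qop \<Rightarrow> qop" where
  "pre h (Tr k f) = Tr k (\<lambda>c. f (h c))" | "pre h (Ro k f) = Ro k (\<lambda>c. f (h c))"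
| "pre h (Ph f) = Ph (\<lambda>c. f (h c))"

text \<open>For a list of well-formed shifts this is the permutation of basis states that the list
  performs (\<open>trs_Ket\<close>).\<close>

fun pm :: "qop list \<Rightarrow> config \<Rightarrow> config" where
  "pm [] c = c"
| "pm (Tr k f # xs) c = pm xs (c(k := c k + f c))"
| "pm (p # xs) c = pm xs c"

definition conj_ok :: "qop list \<Rightarrow> qop \<Rightarrow> bool" where
  "conj_ok cs p \<longleftrightarrow> (\<forall>x\<in>set cs. (\<exists>k f. x = Tr k f) \<and> wfo x \<and> tgt x \<inter> tgt p = {} \<and> indep (tgt p) (ofn x))"

lemma tgt_pre [simp]: "tgt (pre h p) = tgt p"
  by (cases p) auto

lemma conj_step:
  assumes "wfo (Tr k f)" "k \<notin> tgt p" "indep (tgt p) f"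
  shows "ap (Tr k (\<lambda>c. - f c)) (ap p (ap (Tr k f) \<psi>)) = ap (pre (\<lambda>c. c(k := c k + f c)) p) \<psi>"
proof -
  have f: "f (c(k := v)) = f c" "k' \<in> tgt p \<Longrightarrow> f (c(k' := v)) = f c" for c v k'
    using assms by (auto simp: wfo_def indep_def)
  show ?thesis
  proof (cases p)
    case (Tr k' f')
    then have "k' \<noteq> k" using assms by auto
    then show ?thesis using f(2)[of k'] by (auto simp: Tr translate_def fun_eq_iff f fun_upd_twist[of k' k])
  next
    case (Ro k' f')
    then have "k' \<noteq> k" using assms by auto
    then show ?thesis using f(2)[of k'] by (auto simp: Ro translate_def fun_eq_iff f fun_upd_twist[of k' k])
  qed (auto simp: translate_def fun_eq_iff f)
qed

lemma pre_id [simp]: "pre (\<lambda>c. c) p = p"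
  by (cases p) auto

lemma pre_pre: "pre h (pre h' p) = pre (\<lambda>c. h' (h c)) p"
  by (cases p) auto

lemma pm_Tr: "pm (Tr k f # cs) = (\<lambda>c. pm cs (c(k := c k + f c)))"
  by (rule ext) simp

text \<open>Compute, act, uncompute: as \<open>cs\<close> neither reads nor writes the target of
  \<open>p\<close>, undoing \<open>cs\<close> restores every cell that it wrote, and the net effect
  is \<open>p\<close> with its parameter evaluated on the computed values.\<close>

lemma conj_op:
  "conj_ok cs p \<Longrightarrow> aps (cs @ p # invs cs) \<psi> = ap (pre (pm cs) p) \<psi>"
proof (induction cs arbitrary: \<psi>)
  case Nil
  have "(\<lambda>c. c) = pm []" by (rule ext) simp
  then show ?case using pre_id by simp
next
  case (Cons x cs)
  then obtain k f where x: "x = Tr k f" "wfo (Tr k f)" "k \<notin> tgt p" "indep (tgt p) f" and ok: "conj_ok cs p"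
    by (auto simp: conj_ok_def)
  have "aps ((x # cs) @ p # invs (x # cs)) \<psi> = ap (oinv x) (aps (cs @ p # invs cs) (ap x \<psi>))"
    by simp
  also have "\<dots> = ap (oinv x) (ap (pre (pm cs) p) (ap x \<psi>))"
    by (simp only: Cons.IH[OF ok])
  also have "\<dots> = ap (pre (pm (x # cs)) p) \<psi>"
    unfolding x(1) oinv.simps by (subst conj_step) (use x in \<open>auto simp: pre_pre pm_Tr\<close>)
  finally show ?case .
qed

lemma conj_ops:
  "wfs cs \<Longrightarrow> (\<And>p. p \<in> set ps \<Longrightarrow> conj_ok cs p) \<Longrightarrow> aps (cs @ ps @ invs cs) \<psi> = aps (map (pre (pm cs)) ps) \<psi>"
proof (induction ps arbitrary: \<psi>)
  case Nil
  then show ?case by (simp add: aps_invs)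
next
  case (Cons p ps)
  then have ok: "conj_ok cs p" and wf: "wfs cs" by simp_all
  have "aps (cs @ (p # ps) @ invs cs) \<psi> = aps (cs @ ps @ invs cs) (aps (cs @ p # invs cs) \<psi>)"
    using aps_invs'[OF wf] by simp
  then show ?case using Cons conj_op[OF ok, of \<psi>] by simp
qed

text \<open>A shift by register \<open>r\<close> is undone by a shift by register
  \<open>Suc r\<close>, which has to hold the negated value (\<open>calc_gate\<close>). This is why
  the programs keep their constants in pairs of adjacent registers with opposite contents.\<close>

fun ginv :: "gate \<Rightarrow> gate" where
  "ginv (QShift k r) = QShift k (Suc r)"
| "ginv (QAdd f k i j) = QSub f k i j"
| "ginv (QSub f k i j) = QAdd f k i j"
| "ginv (Query k i) = Query_inv k i"
| "ginv (Query_inv k i) = Query k i"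
| "ginv g = g"

fun calc_gate :: "regs \<Rightarrow> gate \<Rightarrow> bool" where
  "calc_gate R (QShift k r) \<longleftrightarrow> R (Suc r) = - R r"
| "calc_gate R (Rot k i) \<longleftrightarrow> False"
| "calc_gate R (Phase i) \<longleftrightarrow> False"
| "calc_gate R g \<longleftrightarrow> True"

definition Cj :: "gate list \<Rightarrow> gate list \<Rightarrow> gate list" where
  "Cj cs gs = cs @ gs @ map ginv (rev cs)"

lemma rs_ginv: "calc_gate R g \<Longrightarrow> rs R M (ginv g) = oinv (rs R M g)"
  by (cases g) auto

lemma map_rs_Cj: "(\<And>g. g \<in> set cs \<Longrightarrow> calc_gate R g) \<Longrightarrow>
    map (rs R M) (Cj cs gs) = map (rs R M) cs @ map (rs R M) gs @ invs (map (rs R M) cs)"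
  by (auto simp: Cj_def invs_def rev_map rs_ginv)

section \<open>Classical subroutines\<close>

definition fr :: "nat set \<Rightarrow> (regs \<Rightarrow> bool) \<Rightarrow> bool" where
  "fr S F \<longleftrightarrow> (\<forall>R r v. r \<in> S \<longrightarrow> F (R(r := v)) = F R)"

lemma fr_upd: "fr S F \<Longrightarrow> r \<in> S \<Longrightarrow> F (R(r := v)) = F R"
  by (simp add: fr_def)

lemma fr_conj: "fr S F \<Longrightarrow> fr S G \<Longrightarrow> fr S (\<lambda>R. F R \<and> G R)"
  by (simp add: fr_def)

lemma fr_eq: "k \<notin> S \<Longrightarrow> fr S (\<lambda>R. R k = v)"
  by (auto simp: fr_def)

lemma fr_const: "fr S (\<lambda>R. P)"
  by (simp add: fr_def)

lemmas fr_intros = fr_conj fr_eq fr_const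

lemma concat_Nils [simp]: "concat (map (\<lambda>k. []) xs) = []"
  by (induction xs) auto

lemma addr_eq: "x = real k \<Longrightarrow> addr x = k"
  by (simp add: addr_def)

definition lgc :: "real \<Rightarrow> nat" where
  "lgc b = (LEAST d. b \<le> 2 ^ d)"

lemma lgc_ge: "b \<le> 2 ^ lgc b"
  unfolding lgc_def by (rule LeastI_ex) (metis real_arch_pow one_less_numeral_iff semiring_norm(76) less_imp_le)

lemma lgc_gt: "k < lgc b \<Longrightarrow> 2 ^ k < b"
  unfolding lgc_def using not_less_Least by (metis not_le)

lemma lgc_le: "1 \<le> b \<Longrightarrow> 2 ^ lgc b \<le> 2 * b"
proof (cases "lgc b")
  case (Suc k)
  then have "2 ^ k < b" using lgc_gt by auto
  then show ?thesis by (simp add: Suc)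
qed simp

text \<open>No arithmetic instruction rounds, so the next power of two is found by doubling. Both
  the power and the exponent are kept: the exponent serves as loop counter, the power as stride or
  starting value.\<close>

definition Pow2 :: "nat \<Rightarrow> nat \<Rightarrow> nat \<Rightarrow> com" where
  "Pow2 N D b = Seq (Ar [(Const 1, N, 0, 0), (Const 0, D, 0, 0), (Const 1, 91, 0, 0), (Leq, 92, b, N), (Sub, 92, 91, 92)])
     (While_nz 92 (Ar [(Add, N, N, N), (Add, D, D, 91), (Leq, 92, b, N), (Sub, 92, 91, 92)]))"

lemma tr_Pow2:
  assumes F: "fr {N, D, 91, 92} F" and d: "distinct [N, D, b, 91, 92]"
  shows "tr (\<lambda>R M. R b = \<beta> \<and> M = M0 \<and> F R) (Pow2 N D b) (6 + 5 * real (lgc \<beta>)) []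
    (\<lambda>R M. R N = 2 ^ lgc \<beta> \<and> R D = real (lgc \<beta>) \<and> R b = \<beta> \<and> M = M0 \<and> F R)"
proof -
  define I where "I k R M \<longleftrightarrow> R N = 2 ^ k \<and> R D = real k \<and> R 91 = 1 \<and> R b = \<beta> \<and> M = M0 \<and> F R \<and>
    R 92 = (if k < lgc \<beta> then 1 else 0)" for k :: nat and R :: regs and M :: memory
  have c: "(if \<beta> \<le> 2 ^ k then 1 else 0) = (if k < lgc \<beta> then 0 else (1::real))" for k
  proof (cases "k < lgc \<beta>")
    case True
    then show ?thesis using lgc_gt[OF True] by simp
  next
    case False
    then have "2 ^ lgc \<beta> \<le> (2::real) ^ k" by (intro power_increasing) auto
    from order_trans[OF lgc_ge this] show ?thesis using False by simp
  qed
  have nq: "N \<noteq> D" "D \<noteq> N" "N \<noteq> b" "b \<noteq> N" "D \<noteq> b" "b \<noteq> D" "N \<noteq> 91" "91 \<noteq> N" "N \<noteq> 92" "92 \<noteq> N"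
    "D \<noteq> 91" "91 \<noteq> D" "D \<noteq> 92" "92 \<noteq> D" "b \<noteq> 91" "91 \<noteq> b" "b \<noteq> 92" "92 \<noteq> b" using d by auto
  have 1: "tr (\<lambda>R M. R b = \<beta> \<and> M = M0 \<and> F R)
    (Ar [(Const 1, N, 0, 0), (Const 0, D, 0, 0), (Const 1, 91, 0, 0), (Leq, 92, b, N), (Sub, 92, 91, 92)]) 5 [] (I 0)"
    by (rule tr_conseq[OF tr_Ar]) (use c[of 0] in \<open>simp_all add: I_def fr_upd[OF F] nq\<close>)
  have 2: "tr (I 0) (While_nz 92 (Ar [(Add, N, N, N), (Add, D, D, 91), (Leq, 92, b, N), (Sub, 92, 91, 92)]))
     ((\<Sum>k<lgc \<beta>. 4 + 1) + 1) (concat (map (\<lambda>_. []) [0..<lgc \<beta>])) (I (lgc \<beta>))"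
  proof (rule tr_while)
    fix k assume "k < lgc \<beta>"
    show "tr (I k) (Ar [(Add, N, N, N), (Add, D, D, 91), (Leq, 92, b, N), (Sub, 92, 91, 92)]) 4 [] (I (Suc k))"
      by (rule tr_conseq[OF tr_Ar]) (use c[of "Suc k"] in \<open>simp_all add: I_def fr_upd[OF F] nq\<close>)
  qed (auto simp: I_def)
  show ?thesis unfolding Pow2_def
    by (rule tr_conseq[OF tr_seq[OF 1 2]]) (auto simp: I_def)
qed

definition powp :: "real \<Rightarrow> real \<Rightarrow> real" where
  "powp x y = (if 0 < x then x powr y else 0)"

lemma arith_val_Pow [simp]: "arith_val Pow x y = powp x y"
  by (simp add: powp_def)

declare arith_val.simps(6) [simp del]

text \<open>Trees branch on the least significant bit first: node \<open>2 ^ d + r\<close> covers the leaves \<open>j\<close> with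
  \<open>j mod 2 ^ d = r\<close>.\<close>

definition node :: "nat \<Rightarrow> nat \<Rightarrow> nat" where
  "node d j = 2 ^ d + j mod 2 ^ d"

definition on_path :: "nat \<Rightarrow> nat \<Rightarrow> nat \<Rightarrow> bool" where
  "on_path D j y \<longleftrightarrow> (\<exists>d\<le>D. y = node d j)"

text \<open>Nodes are 8 addresses apart because the memory interleaves several banks, one for each
  residue of the address modulo 8.\<close>

definition add_path :: "nat \<Rightarrow> nat \<Rightarrow> nat \<Rightarrow> real \<Rightarrow> memory \<Rightarrow> memory" where
  "add_path b D j w M = (\<lambda>a. M a + (if \<exists>d\<le>D. a = b + 8 * node d j then w else 0))"

text \<open>Climbs from the leaf to the root. At depth d, register 32 holds 2^d and register 31
  holds j mod 2^d; passing to the parent drops the highest bit of the residue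
  (\<open>mod_halve\<close>), which needs a comparison only.\<close>

definition TreeLoop :: com where
  "TreeLoop = For 33 (Seq (Ar [(Add, 42, 32, 31), (Mul, 42, 42, 40), (Add, 42, 42, 30)])
     (Seq (Load 43 42) (Seq (Ar [(Add, 43, 43, 34)]) (Seq (Store 42 43)
     (Ar [(Const (1/2), 44, 0, 0), (Mul, 32, 32, 44), (Leq, 45, 32, 31), (Mul, 45, 45, 32), (Sub, 31, 31, 45)])))))"

lemma mod_halve: "j mod 2 ^ Suc e = (if 2 ^ e \<le> j mod 2 ^ Suc e then 2 ^ e else 0) + j mod 2 ^ e" for j :: nat
proof -
  have "j mod 2 ^ Suc e mod 2 ^ e = j mod 2 ^ e"
    by (simp add: mod_mod_cancel)
  moreover have "j mod 2 ^ Suc e < 2 * 2 ^ e" by (metis mod_less_divisor power_Suc zero_less_numeral zero_less_power)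
  moreover have "j mod 2 ^ Suc e mod 2 ^ e = j mod 2 ^ Suc e - 2 ^ e" if "2 ^ e \<le> j mod 2 ^ Suc e"
  proof -
    have "x mod 2 ^ e = x - 2 ^ e" if "2 ^ e \<le> x" "x < 2 * 2 ^ e" for x :: nat
      using that by (subst le_mod_geq) auto
    then show ?thesis using that calculation(2) by blast
  qed
  ultimately show ?thesis by (cases "2 ^ e \<le> j mod 2 ^ Suc e") (simp_all add: mod_less)
qed

lemma tr_TreeLoop:
  assumes F: "fr {31, 32, 33, 42, 43, 44, 45, 90} F"
  shows "tr (\<lambda>R M. R 30 = real b \<and> R 31 = real j \<and> R 32 = 2 ^ D \<and> R 33 = real (Suc D) \<and> R 34 = w \<and> R 40 = 8
       \<and> j < 2 ^ D \<and> M = M0 \<and> F R) TreeLoop (14 * real (Suc D) + 1) []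
    (\<lambda>R M. M = add_path b D j w M0 \<and> F R)"
proof -
  \<comment> \<open>The memory after the \<open>k\<close> deepest nodes of the path, those of depth
    above \<open>D - k\<close>, have been updated.\<close>
  define Mk where "Mk k = (\<lambda>a. M0 a + (if \<exists>d\<le>D. D < d + k \<and> a = b + 8 * node d j then w else 0))" for k
  define I where "I k R M \<longleftrightarrow> R 30 = real b \<and> R 31 = real (j mod 2 ^ (D - k)) \<and> R 32 = 2 ^ D / 2 ^ k \<and>
     R 34 = w \<and> R 40 = 8 \<and> j < 2 ^ D \<and> M = Mk k \<and> F R" for k :: nat and R :: regs and M :: memory
  have ins: "I k R M \<Longrightarrow> I k (R(90 := v, 33 := u)) M" for k R M v u
    by (simp add: I_def fr_upd[OF F])
  have MD: "Mk (Suc D) = add_path b D j w M0" "Mk 0 = M0"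
    by (auto simp: Mk_def add_path_def fun_eq_iff)
  have "tr (\<lambda>R M. I 0 R M \<and> R 33 = real (Suc D)) TreeLoop ((\<Sum>k<Suc D. 11 + 3) + 1)
    (concat (map (\<lambda>k. []) [0..<Suc D])) (\<lambda>R M. I (Suc D) R M \<and> R 33 = 0)"
    unfolding TreeLoop_def
  proof (rule tr_for)
    fix k assume k: "k < Suc D"
    have e: "2 ^ D / 2 ^ k = (2::real) ^ (D - k)" using k by (simp add: power_diff)
    let ?a = "b + 8 * node (D - k) j"
    have a: "addr (2 ^ (D - k) * 8 + real (j mod 2 ^ (D - k)) * 8 + real b) = ?a"
      by (rule addr_eq) (simp add: node_def)
    have inj: "node d j = node d' j \<Longrightarrow> d = d'" for d d'
    proof -
      have "2 ^ d \<le> node d j" "node d j < 2 ^ Suc d" for d by (auto simp: node_def)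
      moreover assume "node d j = node d' j"
      ultimately have "(2::nat) ^ d < 2 ^ Suc d'" "(2::nat) ^ d' < 2 ^ Suc d" by (metis le_less_trans)+
      then show "d = d'" by (simp del: power_Suc)
    qed
    have Mk: "(Mk k)(?a := Mk k ?a + w) = Mk (Suc k)"
    proof
      fix a
      show "((Mk k)(?a := Mk k ?a + w)) a = Mk (Suc k) a"
      proof (cases "a = ?a")
        case True
        have "\<not> (\<exists>d\<le>D. D < d + k \<and> a = b + 8 * node d j)" using True inj[of "D - k"] k by fastforce
        moreover have "\<exists>d\<le>D. D < d + Suc k \<and> a = b + 8 * node d j" using True k by (intro exI[of _ "D - k"]) auto
        ultimately have "Mk k a = M0 a" "Mk (Suc k) a = M0 a + w" unfolding Mk_def by (simp_all only: if_True if_False add_0_right)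
        then show ?thesis using True by simp
      next
        case False
        have "(\<exists>d\<le>D. D < d + k \<and> a = b + 8 * node d j) = (\<exists>d\<le>D. D < d + Suc k \<and> a = b + 8 * node d j)"
        proof -
          have "d = D - k" if "D < d + Suc k" "\<not> D < d + k" for d using that by auto
          then show ?thesis using False by (metis add_Suc_right less_Suc_eq)
        qed
        then show ?thesis using False by (simp add: Mk_def)
      qed
    qed
    have r: "real (j mod 2 ^ (D - k)) - (if 2 ^ (D - k) / 2 \<le> real (j mod 2 ^ (D - k)) then 1 else 0) * (2 ^ (D - k) / 2) =
        real (j mod 2 ^ (D - Suc k))"
    proof (cases "D - k")
      case 0
      then show ?thesis by simp
    next
      case (Suc e)
      then have "D - Suc k = e" by auto
      moreover have "(2 ^ e \<le> real (j mod 2 ^ Suc e)) = (2 ^ e \<le> j mod 2 ^ Suc e)"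
        by (metis of_nat_le_iff of_nat_numeral of_nat_power)
      ultimately show ?thesis
        using arg_cong[OF mod_halve[of j e], of real] Suc by (auto split: if_splits simp del: mod_mod_cancel)
    qed
    define J where "J R M \<longleftrightarrow> I k R M \<and> R 33 = real (Suc D - k)" for R M
    have 1: "tr (\<lambda>R M. I k R M \<and> R 33 = real (Suc D - k)) (Ar [(Add, 42, 32, 31), (Mul, 42, 42, 40), (Add, 42, 42, 30)]) 3 []
        (\<lambda>R M. J R M \<and> addr (R 42) = ?a)"
      by (rule tr_conseq[OF tr_Ar]) (auto simp: J_def I_def fr_upd[OF F] a e)
    have 2: "tr (\<lambda>R M. J R M \<and> addr (R 42) = ?a) (Load 43 42) 1 [] (\<lambda>R M. J R M \<and> addr (R 42) = ?a \<and> R 43 = Mk k ?a)"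
      by (rule tr_conseq[OF tr_Load]) (auto simp: J_def I_def fr_upd[OF F])
    have 3: "tr (\<lambda>R M. J R M \<and> addr (R 42) = ?a \<and> R 43 = Mk k ?a) (Ar [(Add, 43, 43, 34)]) 1 []
      (\<lambda>R M. J R M \<and> addr (R 42) = ?a \<and> R 43 = Mk k ?a + w)"
      by (rule tr_conseq[OF tr_Ar]) (auto simp: J_def I_def fr_upd[OF F])
    have 4: "tr (\<lambda>R M. J R M \<and> addr (R 42) = ?a \<and> R 43 = Mk k ?a + w) (Store 42 43) 1 []
      (\<lambda>R M. J R (Mk k) \<and> M = Mk (Suc k))"
      by (rule tr_conseq[OF tr_Store]) (auto simp: J_def I_def Mk)
    have 5: "tr (\<lambda>R M. J R (Mk k) \<and> M = Mk (Suc k))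
      (Ar [(Const (1/2), 44, 0, 0), (Mul, 32, 32, 44), (Leq, 45, 32, 31), (Mul, 45, 45, 32), (Sub, 31, 31, 45)]) 5 []
      (\<lambda>R M. I (Suc k) R M \<and> R 33 = real (Suc D - k))"
      by (rule tr_conseq[OF tr_Ar]) (use r in \<open>auto simp: J_def I_def fr_upd[OF F] e\<close>)
    show "tr (\<lambda>R M. I k R M \<and> R 33 = real (Suc D - k)) (Seq (Ar [(Add, 42, 32, 31), (Mul, 42, 42, 40), (Add, 42, 42, 30)])
     (Seq (Load 43 42) (Seq (Ar [(Add, 43, 43, 34)]) (Seq (Store 42 43)
     (Ar [(Const (1/2), 44, 0, 0), (Mul, 32, 32, 44), (Leq, 45, 32, 31), (Mul, 45, 45, 32), (Sub, 31, 31, 45)])))))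
      11 [] (\<lambda>R M. I (Suc k) R M \<and> R 33 = real (Suc D - k))"
      by (rule tr_conseq[OF tr_seq[OF 1 tr_seq[OF 2 tr_seq[OF 3 tr_seq[OF 4 5]]]]]) auto
  qed (rule ins, assumption, simp)
  then show ?thesis
    by (elim tr_conseq) (auto simp: I_def MD)
qed

text \<open>Besides the path, a sum of powers of all roots is maintained, at the address in register
  37: the power of the old root is exchanged for that of the new one. The root is node 1, hence at
  offset 8 from the base.\<close>

definition TreeUpd :: com where
  "TreeUpd = Seq (Ar [(Const 8, 40, 0, 0), (Add, 41, 30, 40)]) (Seq (Load 35 41) (Seq TreeLoop (Seq (Load 36 41)
     (Seq (Ar [(Pow, 36, 36, 14), (Pow, 35, 35, 14), (Sub, 36, 36, 35)]) (Seq (Load 43 37)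
     (Seq (Ar [(Add, 43, 43, 36)]) (Store 37 43)))))))"

definition tree_upd :: "nat \<Rightarrow> nat \<Rightarrow> nat \<Rightarrow> real \<Rightarrow> nat \<Rightarrow> real \<Rightarrow> memory \<Rightarrow> memory" where
  "tree_upd b D j w a q M = (let M' = add_path b D j w M in
     M'(a := M' a + (powp (M' (b + 8)) q - powp (M (b + 8)) q)))"

lemma tr_TreeUpd:
  assumes F: "fr {31, 32, 33, 35, 36, 40, 41, 42, 43, 44, 45, 90} F"
  shows "tr (\<lambda>R M. R 30 = real b \<and> R 31 = real j \<and> R 32 = 2 ^ D \<and> R 33 = real (Suc D) \<and> R 34 = w \<and> R 14 = q
       \<and> R 37 = real a \<and> j < 2 ^ D \<and> M = M0 \<and> F R) TreeUpd (14 * real (Suc D) + 12) []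
    (\<lambda>R M. M = tree_upd b D j w a q M0 \<and> F R)"
proof -
  let ?F = "\<lambda>R. F R \<and> R 14 = q \<and> R 37 = real a \<and> R 41 = real (b + 8)"
  let ?I = "\<lambda>R. R 30 = real b \<and> R 31 = real j \<and> R 32 = 2 ^ D \<and> R 33 = real (Suc D) \<and> R 34 = w \<and> R 40 = 8 \<and> j < 2 ^ D"
  let ?G = "\<lambda>R. ?F R \<and> R 35 = M0 (b + 8)"
  let ?M = "add_path b D j w M0"
  have G: "fr {31, 32, 33, 42, 43, 44, 45, 90} ?G"
    using F by (intro fr_intros) (auto simp: fr_def)
  have ad: "addr (real (b + 8)) = b + 8" "addr (real a) = a" by (auto simp: addr_def)
  have 1: "tr (\<lambda>R M. R 30 = real b \<and> R 31 = real j \<and> R 32 = 2 ^ D \<and> R 33 = real (Suc D) \<and> R 34 = w \<and> R 14 = q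
       \<and> R 37 = real a \<and> j < 2 ^ D \<and> M = M0 \<and> F R) (Ar [(Const 8, 40, 0, 0), (Add, 41, 30, 40)]) 2 []
       (\<lambda>R M. ?I R \<and> ?F R \<and> M = M0)"
    by (rule tr_conseq[OF tr_Ar]) (auto simp: fr_upd[OF F])
  have 2: "tr (\<lambda>R M. ?I R \<and> ?F R \<and> M = M0) (Load 35 41) 1 [] (\<lambda>R M. ?I R \<and> ?G R \<and> M = M0)"
    by (rule tr_conseq[OF tr_Load]) (use ad in \<open>auto simp: fr_upd[OF F]\<close>)
  have 3: "tr (\<lambda>R M. ?I R \<and> ?G R \<and> M = M0) TreeLoop (14 * real (Suc D) + 1) [] (\<lambda>R M. M = ?M \<and> ?G R)"
    by (rule tr_pre[OF tr_TreeLoop[OF G]]) auto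
  have 4: "tr (\<lambda>R M. M = ?M \<and> ?G R) (Load 36 41) 1 [] (\<lambda>R M. M = ?M \<and> ?G R \<and> R 36 = ?M (b + 8))"
    by (rule tr_conseq[OF tr_Load]) (use ad in \<open>auto simp: fr_upd[OF F]\<close>)
  have 5: "tr (\<lambda>R M. M = ?M \<and> ?G R \<and> R 36 = ?M (b + 8)) (Ar [(Pow, 36, 36, 14), (Pow, 35, 35, 14), (Sub, 36, 36, 35)]) 3 []
    (\<lambda>R M. M = ?M \<and> ?F R \<and> R 36 = powp (?M (b + 8)) q - powp (M0 (b + 8)) q)"
    by (rule tr_conseq[OF tr_Ar]) (auto simp: fr_upd[OF F])
  have 6: "tr (\<lambda>R M. M = ?M \<and> ?F R \<and> R 36 = powp (?M (b + 8)) q - powp (M0 (b + 8)) q) (Load 43 37) 1 []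
    (\<lambda>R M. M = ?M \<and> ?F R \<and> R 36 = powp (?M (b + 8)) q - powp (M0 (b + 8)) q \<and> R 43 = ?M a)"
    by (rule tr_conseq[OF tr_Load]) (use ad in \<open>auto simp: fr_upd[OF F]\<close>)
  have 7: "tr (\<lambda>R M. M = ?M \<and> ?F R \<and> R 36 = powp (?M (b + 8)) q - powp (M0 (b + 8)) q \<and> R 43 = ?M a) (Ar [(Add, 43, 43, 36)]) 1 []
    (\<lambda>R M. M = ?M \<and> ?F R \<and> R 43 = ?M a + (powp (?M (b + 8)) q - powp (M0 (b + 8)) q))"
    by (rule tr_conseq[OF tr_Ar]) (auto simp: fr_upd[OF F])
  have 8: "tr (\<lambda>R M. M = ?M \<and> ?F R \<and> R 43 = ?M a + (powp (?M (b + 8)) q - powp (M0 (b + 8)) q)) (Store 37 43) 1 []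
    (\<lambda>R M. M = tree_upd b D j w a q M0 \<and> F R)"
    by (rule tr_conseq[OF tr_Store]) (use ad in \<open>auto simp: tree_upd_def Let_def\<close>)
  show ?thesis unfolding TreeUpd_def
    by (rule tr_conseq[OF tr_seq[OF 1 tr_seq[OF 2 tr_seq[OF 3 tr_seq[OF 4 tr_seq[OF 5 tr_seq[OF 6 tr_seq[OF 7 8]]]]]]]]) auto
qed

section \<open>The data structure\<close>

definition cost2 :: "nat \<Rightarrow> nat" where
  "cost2 n = lgc (real n)"

lemma le_cost2: "n \<le> 2 ^ cost2 n"
  using lgc_ge[of "real n"] by (metis cost2_def of_nat_le_iff of_nat_numeral of_nat_power)

lemma cost2_le: "0 < n \<Longrightarrow> 2 ^ cost2 n \<le> 2 * n"
proof -
  assume "0 < n"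
  then have "(2::real) ^ cost2 n \<le> 2 * real n" unfolding cost2_def by (intro lgc_le) auto
  then have "real (2 ^ cost2 n) \<le> real (2 * n)" by simp
  then show ?thesis by (simp only: of_nat_le_iff)
qed

text \<open>Covers both norms. For \<open>mu_p p\<close> the exponents are 2p and 2(1 - p), with
  \<open>xe\<close> = \<open>tau\<close> = 1. For the Frobenius norm both exponents are 2 and
  \<open>xe\<close> = \<open>tau\<close> = 0: all columns then share the tree number 0, whose leaves
  are the squared row norms, and the row factor drops out of the scale.\<close>

locale params =
  fixes q1 q2 xe :: real and tau :: nat
  assumes q1: "q1 \<ge> 0" and q2: "q2 \<ge> 0" and tau: "tau \<le> 1"
begin

text \<open>This is the q-th power of |a|. The square stands in for the absolute value, which is not
  an instruction, and \<open>powp\<close> yields 0 at a = 0 also for q = 0.\<close>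

definition wt :: "real \<Rightarrow> real \<Rightarrow> real" where
  "wt q a = powp (a * a) (q / 2)"

lemma wt_nonneg [simp]: "wt q a \<ge> 0"
  by (simp add: wt_def powp_def)

lemma wt_0 [simp]: "wt q 0 = 0"
  by (simp add: wt_def powp_def)

definition UW :: "real mat \<Rightarrow> nat \<Rightarrow> nat \<Rightarrow> real" where
  "UW A i y = (if i < dim_row A then
     \<Sum>j<dim_col A. if on_path (cost2 (dim_col A)) j y then wt q1 (A $$ (i, j)) else 0 else 0)"

definition VW :: "real mat \<Rightarrow> nat \<Rightarrow> nat \<Rightarrow> real" where
  "VW A t y = (\<Sum>i<dim_row A. \<Sum>j<dim_col A.
     if tau * j = t \<and> on_path (cost2 (dim_row A)) i y then wt q2 (A $$ (i, j)) else 0)"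

text \<open>A maximum cannot be maintained under deletions. The \<open>qe\<close>-norm of a vector can, and for vectors of
  length at most \<open>2 powr qe\<close> it exceeds the maximum at most by a factor of 2.\<close>

definition qe :: "nat \<Rightarrow> nat \<Rightarrow> real" where
  "qe m n = real (cost2 m) + real (cost2 n) + 1"

definition S1 :: "real mat \<Rightarrow> real" where
  "S1 A = (\<Sum>i<dim_row A. powp (UW A i 1) (qe (dim_row A) (dim_col A)))"

definition S2 :: "real mat \<Rightarrow> real" where
  "S2 A = (\<Sum>t<dim_col A. powp (VW A t 1) (qe (dim_row A) (dim_col A)))"

text \<open>The memory is a function of the matrix alone, independent of the order of updates:
  arithmetic is exact, so changing or deleting an entry leaves no trace in the sums. Residues 0, 1
  and 2 of the address hold entries, row trees and column trees.\<close>

definition enc :: "real mat \<Rightarrow> memory" where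
  "enc A a = (let m = dim_row A; n = dim_col A; u = a div 8; N = 2 ^ cost2 n; L = 2 ^ cost2 m in
     if a mod 8 = 0 then (if u < m * n then A $$ (u div n, u mod n) else 0)
     else if a mod 8 = 1 then UW A (u div (2 * N)) (u mod (2 * N))
     else if a mod 8 = 2 then VW A (u div (2 * L)) (u mod (2 * L))
     else if a = 3 then S1 A else if a = 4 then S2 A else 0)"

lemma UW_nonneg: "UW A i y \<ge> 0" and VW_nonneg: "VW A t y \<ge> 0"
  by (auto simp: UW_def VW_def intro!: sum_nonneg)

lemma node_lt: "d \<le> D \<Longrightarrow> node d j < 2 * 2 ^ D"
proof -
  assume "d \<le> D"
  then have "(2::nat) ^ d \<le> 2 ^ D" by (rule power_increasing) simp
  moreover have "j mod 2 ^ d < 2 ^ d" by simp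
  ultimately show ?thesis unfolding node_def by linarith
qed

lemma on_path_1 [simp]: "on_path D j 1"
  unfolding on_path_def by (rule exI[of _ 0]) (simp add: node_def)

lemma d8: "(8 * u + k) div 8 = u" "(8 * u + k) mod 8 = k" if "k < 8" for u k :: nat
  using that by simp_all

lemma mlex: "i * n + j < m * n" if "i < m" "j < n" for i j m n :: nat
proof -
  have "i * n + j < Suc i * n" using that by simp
  also have "\<dots> \<le> m * n" using that by (intro mult_le_mono1) simp
  finally show ?thesis .
qed

lemma tree_addr:
  assumes "k < 8"
  shows "(\<exists>d\<le>D. a = 8 * (i * (2 * 2 ^ D)) + k + 8 * node d j) \<longleftrightarrow>
    a mod 8 = k \<and> a div 8 div (2 * 2 ^ D) = i \<and> on_path D j (a div 8 mod (2 * 2 ^ D))"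
proof (intro iffI)
  assume "\<exists>d\<le>D. a = 8 * (i * (2 * 2 ^ D)) + k + 8 * node d j"
  then obtain d where d: "d \<le> D" "a = 8 * (i * (2 * 2 ^ D) + node d j) + k" by (auto simp: algebra_simps)
  then have "a div 8 = i * (2 * 2 ^ D) + node d j" "a mod 8 = k" using d8[OF assms, of "i * (2 * 2 ^ D) + node d j"] by simp_all
  moreover have "(i * (2 * 2 ^ D) + node d j) div (2 * 2 ^ D) = i"
    using node_lt[OF d(1), of j] by (simp add: div_mult_self3)
  moreover have "(i * (2 * 2 ^ D) + node d j) mod (2 * 2 ^ D) = node d j"
    using node_lt[OF d(1), of j] by simp
  ultimately show "a mod 8 = k \<and> a div 8 div (2 * 2 ^ D) = i \<and> on_path D j (a div 8 mod (2 * 2 ^ D))"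
    using d(1) by (auto simp: on_path_def)
next
  assume *: "a mod 8 = k \<and> a div 8 div (2 * 2 ^ D) = i \<and> on_path D j (a div 8 mod (2 * 2 ^ D))"
  then obtain d where "d \<le> D" "a div 8 mod (2 * 2 ^ D) = node d j" by (auto simp: on_path_def)
  moreover have "a = 8 * (a div 8) + a mod 8" "a div 8 = (a div 8 div (2 * 2 ^ D)) * (2 * 2 ^ D) + a div 8 mod (2 * 2 ^ D)"
    by (simp_all only: mult_div_mod_eq div_mult_mod_eq)
  ultimately show "\<exists>d\<le>D. a = 8 * (i * (2 * 2 ^ D)) + k + 8 * node d j"
    using * by (intro exI[of _ d] conjI) (assumption, simp add: algebra_simps)
qed

lemma set_entry_dim [simp]: "dim_row (set_entry A i j x) = dim_row A" "dim_col (set_entry A i j x) = dim_col A"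
  by (simp_all add: set_entry_def)

lemma set_entry_index: "i' < dim_row A \<Longrightarrow> j' < dim_col A \<Longrightarrow>
    set_entry A i j x $$ (i', j') = (if i' = i \<and> j' = j then x else A $$ (i', j'))"
  by (simp add: set_entry_def)

lemma sum_change:
  fixes f g :: "nat \<Rightarrow> real"
  assumes "finite I" "i \<in> I" "\<And>k. k \<in> I \<Longrightarrow> k \<noteq> i \<Longrightarrow> f k = g k"
  shows "sum f I = sum g I + (f i - g i)"
  using assms by (simp add: sum.remove[of I i])

lemma UW_set:
  assumes "i < dim_row A" "j < dim_col A"
  shows "UW (set_entry A i j x) i' y = UW A i' y +
    (if i' = i \<and> on_path (cost2 (dim_col A)) j y then wt q1 x - wt q1 (A $$ (i, j)) else 0)"
proof (cases "i' = i")
  case True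
  let ?F = "\<lambda>B j. if on_path (cost2 (dim_col A)) j y then wt q1 (B $$ (i, j)) else 0"
  have "(\<Sum>k<dim_col A. ?F (set_entry A i j x) k) = (\<Sum>k<dim_col A. ?F A k) + (?F (set_entry A i j x) j - ?F A j)"
    by (rule sum_change) (use assms in \<open>auto simp: set_entry_index\<close>)
  then show ?thesis using True assms by (simp add: UW_def set_entry_index)
next
  case False
  then show ?thesis using assms by (auto simp: UW_def set_entry_index intro!: sum.cong)
qed

lemma VW_set:
  assumes "i < dim_row A" "j < dim_col A"
  shows "VW (set_entry A i j x) t y = VW A t y +
    (if t = tau * j \<and> on_path (cost2 (dim_row A)) i y then wt q2 x - wt q2 (A $$ (i, j)) else 0)"
proof -
  let ?F = "\<lambda>B i. \<Sum>j<dim_col A. if tau * j = t \<and> on_path (cost2 (dim_row A)) i y then wt q2 (B $$ (i, j)) else 0"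
  have "VW (set_entry A i j x) t y = (\<Sum>k<dim_row A. ?F (set_entry A i j x) k)" by (simp add: VW_def)
  also have "\<dots> = (\<Sum>i<dim_row A. ?F A i) + (?F (set_entry A i j x) i - ?F A i)"
    by (rule sum_change) (use assms in \<open>auto simp: set_entry_index intro!: sum.cong\<close>)
  also have "?F (set_entry A i j x) i = ?F A i +
      ((if tau * j = t \<and> on_path (cost2 (dim_row A)) i y then wt q2 (set_entry A i j x $$ (i, j)) else 0) -
      (if tau * j = t \<and> on_path (cost2 (dim_row A)) i y then wt q2 (A $$ (i, j)) else 0))"
    by (rule sum_change) (use assms in \<open>auto simp: set_entry_index\<close>)
  finally show ?thesis using assms by (auto simp: VW_def set_entry_index)
qed

definition upd_mem :: "nat \<Rightarrow> nat \<Rightarrow> nat \<Rightarrow> nat \<Rightarrow> real \<Rightarrow> memory \<Rightarrow> memory" where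
  "upd_mem m n i j x M = (let D = cost2 n; E = cost2 m; o' = M (8 * (i * n + j)) in
     tree_upd (8 * ((tau * j) * (2 * 2 ^ E)) + 2) E i (wt q2 x - wt q2 o') 4 (qe m n)
      (tree_upd (8 * (i * (2 * 2 ^ D)) + 1) D j (wt q1 x - wt q1 o') 3 (qe m n)
       (M(8 * (i * n + j) := x))))"

lemma dm: "y < K \<Longrightarrow> (c * K + y) div K = c" "y < K \<Longrightarrow> (c * K + y) mod K = y" for c K y :: nat
  by (simp_all add: div_mult_self3)

lemma enc_raw: "i < dim_row A \<Longrightarrow> j < dim_col A \<Longrightarrow> enc A (8 * (i * dim_col A + j)) = A $$ (i, j)"
  using mlex[of i "dim_row A" j "dim_col A"] by (simp add: enc_def Let_def dm)

lemma enc_mod: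
  "enc A (8 * u + 1) = UW A (u div (2 * 2 ^ cost2 (dim_col A))) (u mod (2 * 2 ^ cost2 (dim_col A)))"
  "enc A (8 * u + 2) = VW A (u div (2 * 2 ^ cost2 (dim_row A))) (u mod (2 * 2 ^ cost2 (dim_row A)))"
  unfolding enc_def Let_def using d8[of 1 u] d8[of 2 u] by (simp_all del: mult_2 add_2_eq_Suc' One_nat_def)

lemma enc_U: "y < 2 * 2 ^ cost2 (dim_col A) \<Longrightarrow> enc A (8 * (i * (2 * 2 ^ cost2 (dim_col A)) + y) + 1) = UW A i y"
  by (simp only: enc_mod dm)

lemma enc_V: "y < 2 * 2 ^ cost2 (dim_row A) \<Longrightarrow> enc A (8 * (t * (2 * 2 ^ cost2 (dim_row A)) + y) + 2) = VW A t y"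
  by (simp only: enc_mod dm)

lemma enc_3: "enc A 3 = S1 A" and enc_4: "enc A 4 = S2 A"
  by (simp_all add: enc_def)

lemma S1_set:
  assumes "i < dim_row A" "j < dim_col A"
  shows "S1 (set_entry A i j x) = S1 A + (powp (UW (set_entry A i j x) i 1) (qe (dim_row A) (dim_col A)) -
    powp (UW A i 1) (qe (dim_row A) (dim_col A)))"
  unfolding S1_def using assms
  by (simp only: set_entry_dim) (rule sum_change, auto simp: UW_set)

lemma S2_set:
  assumes "i < dim_row A" "j < dim_col A"
  shows "S2 (set_entry A i j x) = S2 A + (powp (VW (set_entry A i j x) (tau * j) 1) (qe (dim_row A) (dim_col A)) -
    powp (VW A (tau * j) 1) (qe (dim_row A) (dim_col A)))"
proof -
  have "tau * j < dim_col A" using tau assms by (cases "tau = 0") (auto simp: le_Suc_eq)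
  then show ?thesis
    unfolding S2_def using assms
    by (simp only: set_entry_dim) (rule sum_change, auto simp: VW_set)
qed

text \<open>The parts that an update touches differ in the residue of their addresses modulo 8
  (entries 0, row trees 1, column trees 2, power sums 3 and 4), so that the successive changes
  \<open>M0\<close> to \<open>M4\<close> can be followed separately for each residue.\<close>

lemma enc_set:
  assumes "i < dim_row A" "j < dim_col A"
  shows "upd_mem (dim_row A) (dim_col A) i j x (enc A) = enc (set_entry A i j x)"
proof
  fix a :: nat
  let ?m = "dim_row A" and ?n = "dim_col A" and ?B = "set_entry A i j x"
  define D E q where "D = cost2 ?n" and "E = cost2 ?m" and "q = qe ?m ?n"
  define b1 b2 where "b1 = 8 * (i * (2 * 2 ^ D)) + 1" and "b2 = 8 * ((tau * j) * (2 * 2 ^ E)) + 2"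
  define w1 w2 where "w1 = wt q1 x - wt q1 (A $$ (i, j))" and "w2 = wt q2 x - wt q2 (A $$ (i, j))"
  define M0 where "M0 = (enc A)(8 * (i * ?n + j) := x)"
  define M1 where "M1 = add_path b1 D j w1 M0"
  define M2 where "M2 = M1(3 := M1 3 + (powp (M1 (b1 + 8)) q - powp (M0 (b1 + 8)) q))"
  define M3 where "M3 = add_path b2 E i w2 M2"
  define M4 where "M4 = M3(4 := M3 4 + (powp (M3 (b2 + 8)) q - powp (M2 (b2 + 8)) q))"
  have M4: "upd_mem ?m ?n i j x (enc A) = M4"
    unfolding upd_mem_def Let_def enc_raw[OF assms] tree_upd_def D_def[symmetric] E_def[symmetric] q_def[symmetric]
      b1_def[symmetric] b2_def[symmetric] w1_def[symmetric] w2_def[symmetric] M0_def[symmetric] M1_def[symmetric]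
      M2_def[symmetric] M3_def[symmetric] M4_def[symmetric] ..
  have M1: "M1 a = M0 a + (if a mod 8 = 1 \<and> a div 8 div (2 * 2 ^ D) = i \<and> on_path D j (a div 8 mod (2 * 2 ^ D)) then w1 else 0)" for a
    unfolding M1_def add_path_def b1_def by (simp only: tree_addr[of 1])
  have M3: "M3 a = M2 a + (if a mod 8 = 2 \<and> a div 8 div (2 * 2 ^ E) = tau * j \<and> on_path E i (a div 8 mod (2 * 2 ^ E)) then w2 else 0)" for a
    unfolding M3_def add_path_def b2_def by (simp only: tree_addr[of 2])
  have one: "(1::nat) < 2 * 2 ^ k" for k :: nat
    using less_le_trans[of 1 2 "2 * 2 ^ k :: nat"] by simp
  have b1_eq: "b1 + 8 = 8 * (i * (2 * 2 ^ D) + 1) + 1"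
    by (simp add: b1_def)
  have b1: "b1 + 8 = 8 * (i * (2 * 2 ^ D) + 1) + 1" "(b1 + 8) mod 8 = 1" "(b1 + 8) div 8 = i * (2 * 2 ^ D) + 1"
    unfolding b1_eq by (rule refl, (rule d8, simp)+)
  have b2_eq: "b2 + 8 = 8 * ((tau * j) * (2 * 2 ^ E) + 1) + 2"
    by (simp add: b2_def)
  have b2: "b2 + 8 = 8 * ((tau * j) * (2 * 2 ^ E) + 1) + 2" "(b2 + 8) mod 8 = 2" "(b2 + 8) div 8 = (tau * j) * (2 * 2 ^ E) + 1"
    unfolding b2_eq by (rule refl, (rule d8, simp)+)
  have M0': "M0 a = enc A a" if "a mod 8 \<noteq> 0" for a using that by (auto simp: M0_def)
  have "M0 (b1 + 8) = UW A i 1"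
    using M0'[of "b1 + 8"] b1(2) enc_U[of 1 A i] one[of D] unfolding b1(1) by (simp add: D_def)
  moreover from this have "M1 (b1 + 8) = UW ?B i 1"
    using UW_set[OF assms, of x i 1] one[of D] on_path_1[of D j] unfolding M1 b1(2,3) by (simp add: dm D_def w1_def del: mult_2 One_nat_def)
  moreover have "M1 3 = S1 A" using M0'[of 3] by (simp add: M1 enc_3)
  ultimately have M2_3: "M2 3 = S1 ?B" using S1_set[OF assms, of x] by (simp add: M2_def q_def)
  have "M2 (b2 + 8) = VW A (tau * j) 1"
  proof -
    have "b2 + 8 \<noteq> 3" using b2(2) by auto
    then show ?thesis
      using M0'[of "b2 + 8"] b2(2) enc_V[of 1 A "tau * j"] one[of E] M1[of "b2 + 8"] unfolding b2(1) by (simp add: E_def M2_def)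
  qed
  moreover from this have "M3 (b2 + 8) = VW ?B (tau * j) 1"
    using VW_set[OF assms, of x "tau * j" 1] one[of E] on_path_1[of E i] unfolding M3 b2(2,3) by (simp add: dm E_def w2_def del: mult_2 One_nat_def)
  moreover have "M3 4 = S2 A" using M0'[of 4] by (simp add: M3 M2_def M1 enc_4)
  ultimately have M4_4: "M4 4 = S2 ?B" using S2_set[OF assms, of x] by (simp add: M4_def q_def)
  consider "a = 3" | "a = 4" | "a mod 8 = 0" "a \<noteq> 3" "a \<noteq> 4" | "a mod 8 = 1" "a \<noteq> 3" "a \<noteq> 4" | "a mod 8 = 2" "a \<noteq> 3" "a \<noteq> 4"
    | "a \<noteq> 3" "a \<noteq> 4" "a mod 8 \<notin> {0, 1, 2}" by fastforce
  then have "M4 a = enc ?B a"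
  proof cases
    case 1
    then show ?thesis using M2_3 by (simp add: M4_def M3 enc_3)
  next
    case 2
    then show ?thesis using M4_4 by (simp add: enc_4)
  next
    case 3
    let ?u = "a div 8"
    have a: "(a = 8 * X) = (a div 8 = X)" for X using 3 by auto
    have "?n > 0" using assms by auto
    then have u: "?u = i * ?n + j \<longleftrightarrow> ?u div ?n = i \<and> ?u mod ?n = j"
      using assms by (metis dm div_mult_mod_eq)
    have M0a: "M0 a = (if ?u = i * ?n + j then x else enc A a)" unfolding M0_def fun_upd_apply a ..
    have "M4 a = M0 a" using 3 by (simp add: M4_def M3 M2_def M1)
    also have "\<dots> = enc ?B a"
    proof (cases "?u < ?m * ?n")
      case True
      then have "?u div ?n < ?m" "?u mod ?n < ?n" using \<open>?n > 0\<close> by (auto simp: less_mult_imp_div_less)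
      then show ?thesis using 3 True unfolding M0a u by (simp add: enc_def Let_def set_entry_index)
    next
      case False
      then have "?u \<noteq> i * ?n + j" using mlex[OF assms] by auto
      then show ?thesis using 3 False unfolding M0a by (simp add: enc_def Let_def)
    qed
    finally show ?thesis .
  next
    case 4
    then have "M4 a = enc A a + (if a div 8 div (2 * 2 ^ D) = i \<and> on_path D j (a div 8 mod (2 * 2 ^ D)) then w1 else 0)"
      by (simp add: M4_def M3 M2_def M1 M0')
    then show ?thesis using 4 by (simp add: enc_def Let_def UW_set[OF assms] D_def w1_def)
  next
    case 5
    then have "M4 a = enc A a + (if a div 8 div (2 * 2 ^ E) = tau * j \<and> on_path E i (a div 8 mod (2 * 2 ^ E)) then w2 else 0)"
      by (simp add: M4_def M3 M2_def M1 M0')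
    then show ?thesis using 5 by (simp add: enc_def Let_def VW_set[OF assms] E_def w2_def)
  next
    case 6
    then show ?thesis by (auto simp: M4_def M3 M2_def M1 M0' enc_def Let_def)
  qed
  then show "upd_mem ?m ?n i j x (enc A) a = enc ?B a" by (simp add: M4)
qed

end

section \<open>The update program and the efficiency of the structure\<close>

lemma clean_zero: "clean zero_state"
  by (auto simp: clean_def zero_state_def cln_def)

context params
begin

definition upd :: com where
  "upd = Seq (Pow2 10 11 1) (Seq (Pow2 12 13 0)
    (Seq (Ar [(Const 8, 40, 0, 0), (Const 1, 91, 0, 0), (Add, 14, 13, 11), (Add, 14, 14, 91),
       (Mul, 20, 2, 1), (Add, 20, 20, 3), (Mul, 20, 40, 20)])
    (Seq (Load 21 20) (Seq (Store 20 4)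
    (Seq (Ar [(Mul, 50, 4, 4), (Const (q1 / 2), 51, 0, 0), (Pow, 52, 50, 51), (Mul, 53, 21, 21), (Pow, 54, 53, 51),
       (Sub, 22, 52, 54), (Const (q2 / 2), 51, 0, 0), (Pow, 52, 50, 51), (Pow, 54, 53, 51), (Sub, 23, 52, 54),
       (Const 0, 93, 0, 0), (Const 16, 55, 0, 0),
       (Mul, 30, 2, 10), (Mul, 30, 55, 30), (Add, 30, 30, 91), (Add, 31, 3, 93), (Add, 32, 10, 93), (Add, 33, 11, 91),
       (Add, 34, 22, 93), (Const 3, 37, 0, 0)])
    (Seq TreeUpd
    (Seq (Ar [(Const (real tau), 56, 0, 0), (Mul, 30, 56, 3), (Mul, 30, 30, 12), (Mul, 30, 55, 30), (Const 2, 57, 0, 0),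
       (Add, 30, 30, 57), (Add, 31, 2, 93), (Add, 32, 12, 93), (Add, 33, 13, 91), (Add, 34, 23, 93), (Const 4, 37, 0, 0)])
      TreeUpd)))))))"

lemma tr_upd:
  assumes "i < m" "j < n"
  shows "tr (\<lambda>R M. R = init_regs [real m, real n, real i, real j, x] \<and> M = M0) upd
    (124 + 20 * (real (cost2 n) + real (cost2 m))) [] (\<lambda>R M. M = upd_mem m n i j x M0)"
proof -
  let ?D = "cost2 n" and ?E = "cost2 m"
  define F where "F = (\<lambda>R :: regs. R 0 = real m \<and> R 1 = real n \<and> R 2 = real i \<and> R 3 = real j)"
  define F1 where "F1 = (\<lambda>R :: regs. F R \<and> R 4 = x)"
  define F2 where "F2 = (\<lambda>R :: regs. F1 R \<and> R 10 = 2 ^ ?D \<and> R 11 = real ?D)"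
  define F3 where "F3 = (\<lambda>R :: regs. F R \<and> R 10 = 2 ^ ?D \<and> R 11 = real ?D \<and> R 12 = 2 ^ ?E \<and> R 13 = real ?E \<and>
      R 14 = qe m n \<and> R 91 = 1)"
  define ra where "ra = 8 * (i * n + j)"
  define w1 w2 where "w1 = wt q1 x - wt q1 (M0 ra)" and "w2 = wt q2 x - wt q2 (M0 ra)"
  define F4 where "F4 = (\<lambda>R :: regs. F3 R \<and> R 23 = w2 \<and> R 93 = 0 \<and> R 55 = 16)"
  define b1 b2 where "b1 = 8 * (i * (2 * 2 ^ ?D)) + 1" and "b2 = 8 * ((tau * j) * (2 * 2 ^ ?E)) + 2"
  define M1 where "M1 = M0(ra := x)"
  define M2 where "M2 = tree_upd b1 ?D j w1 3 (qe m n) M1"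
  have jl: "j < 2 ^ ?D" "i < 2 ^ ?E" using assms le_cost2[of n] le_cost2[of m] by auto
  have ad: "addr (8 * (real i * real n) + 8 * real j) = ra" by (rule addr_eq) (simp add: ra_def)
  have 1: "tr (\<lambda>R M. R 1 = real n \<and> M = M0 \<and> F1 R) (Pow2 10 11 1) (6 + 5 * real (lgc (real n))) []
     (\<lambda>R M. R 10 = 2 ^ lgc (real n) \<and> R 11 = real (lgc (real n)) \<and> R 1 = real n \<and> M = M0 \<and> F1 R)"
    by (rule tr_Pow2) (unfold F_def F1_def, (intro fr_intros)?, auto)
  have 2: "tr (\<lambda>R M. R 0 = real m \<and> M = M0 \<and> F2 R) (Pow2 12 13 0) (6 + 5 * real (lgc (real m))) []
     (\<lambda>R M. R 12 = 2 ^ lgc (real m) \<and> R 13 = real (lgc (real m)) \<and> R 0 = real m \<and> M = M0 \<and> F2 R)"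
    by (rule tr_Pow2) (unfold F_def F1_def F2_def, (intro fr_intros)?, auto)
  have 3: "tr (\<lambda>R M. R 12 = 2 ^ lgc (real m) \<and> R 13 = real (lgc (real m)) \<and> R 0 = real m \<and> M = M0 \<and> F2 R)
    (Ar [(Const 8, 40, 0, 0), (Const 1, 91, 0, 0), (Add, 14, 13, 11), (Add, 14, 14, 91),
       (Mul, 20, 2, 1), (Add, 20, 20, 3), (Mul, 20, 40, 20)]) 7 [] (\<lambda>R M. F3 R \<and> R 4 = x \<and> addr (R 20) = ra \<and> M = M0)"
    by (rule tr_conseq[OF tr_Ar]) (auto simp: F_def F1_def F2_def F3_def ad cost2_def qe_def)
  have 4: "tr (\<lambda>R M. F3 R \<and> R 4 = x \<and> addr (R 20) = ra \<and> M = M0) (Load 21 20) 1 []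
    (\<lambda>R M. F3 R \<and> R 4 = x \<and> addr (R 20) = ra \<and> R 21 = M0 ra \<and> M = M0)"
    by (rule tr_conseq[OF tr_Load]) (auto simp: F_def F3_def)
  have 5: "tr (\<lambda>R M. F3 R \<and> R 4 = x \<and> addr (R 20) = ra \<and> R 21 = M0 ra \<and> M = M0) (Store 20 4) 1 []
    (\<lambda>R M. F3 R \<and> R 4 = x \<and> R 21 = M0 ra \<and> M = M1)"
    by (rule tr_conseq[OF tr_Store]) (auto simp: M1_def)
  have 6: "tr (\<lambda>R M. F3 R \<and> R 4 = x \<and> R 21 = M0 ra \<and> M = M1)
    (Ar [(Mul, 50, 4, 4), (Const (q1 / 2), 51, 0, 0), (Pow, 52, 50, 51), (Mul, 53, 21, 21), (Pow, 54, 53, 51),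
       (Sub, 22, 52, 54), (Const (q2 / 2), 51, 0, 0), (Pow, 52, 50, 51), (Pow, 54, 53, 51), (Sub, 23, 52, 54),
       (Const 0, 93, 0, 0), (Const 16, 55, 0, 0),
       (Mul, 30, 2, 10), (Mul, 30, 55, 30), (Add, 30, 30, 91), (Add, 31, 3, 93), (Add, 32, 10, 93), (Add, 33, 11, 91),
       (Add, 34, 22, 93), (Const 3, 37, 0, 0)]) 20 []
    (\<lambda>R M. R 30 = real b1 \<and> R 31 = real j \<and> R 32 = 2 ^ ?D \<and> R 33 = real (Suc ?D) \<and> R 34 = w1 \<and> R 14 = qe m n
       \<and> R 37 = real 3 \<and> j < 2 ^ ?D \<and> M = M1 \<and> F4 R)"
    by (rule tr_conseq[OF tr_Ar]) (use jl in \<open>simp_all add: F_def F3_def F4_def b1_def w1_def w2_def wt_def\<close>)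
  have 7: "tr (\<lambda>R M. R 30 = real b1 \<and> R 31 = real j \<and> R 32 = 2 ^ ?D \<and> R 33 = real (Suc ?D) \<and> R 34 = w1 \<and> R 14 = qe m n
       \<and> R 37 = real 3 \<and> j < 2 ^ ?D \<and> M = M1 \<and> F4 R) TreeUpd (14 * real (Suc ?D) + 12) [] (\<lambda>R M. M = M2 \<and> F4 R)"
    unfolding M2_def by (rule tr_TreeUpd) (unfold F_def F3_def F4_def, intro fr_intros, simp_all)
  have 8: "tr (\<lambda>R M. M = M2 \<and> F4 R)
    (Ar [(Const (real tau), 56, 0, 0), (Mul, 30, 56, 3), (Mul, 30, 30, 12), (Mul, 30, 55, 30), (Const 2, 57, 0, 0),
       (Add, 30, 30, 57), (Add, 31, 2, 93), (Add, 32, 12, 93), (Add, 33, 13, 91), (Add, 34, 23, 93), (Const 4, 37, 0, 0)]) 11 []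
    (\<lambda>R M. R 30 = real b2 \<and> R 31 = real i \<and> R 32 = 2 ^ ?E \<and> R 33 = real (Suc ?E) \<and> R 34 = w2 \<and> R 14 = qe m n
       \<and> R 37 = real 4 \<and> i < 2 ^ ?E \<and> M = M2 \<and> True)"
    by (rule tr_conseq[OF tr_Ar]) (use jl in \<open>simp_all add: F_def F3_def F4_def b2_def\<close>)
  have 9: "tr (\<lambda>R M. R 30 = real b2 \<and> R 31 = real i \<and> R 32 = 2 ^ ?E \<and> R 33 = real (Suc ?E) \<and> R 34 = w2 \<and> R 14 = qe m n
       \<and> R 37 = real 4 \<and> i < 2 ^ ?E \<and> M = M2 \<and> True) TreeUpd (14 * real (Suc ?E) + 12) []
       (\<lambda>R M. M = tree_upd b2 ?E i w2 4 (qe m n) M2 \<and> True)"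
    by (rule tr_TreeUpd) (rule fr_const)
  have mem: "tree_upd b2 ?E i w2 4 (qe m n) M2 = upd_mem m n i j x M0"
    by (simp add: upd_mem_def Let_def M2_def M1_def b1_def b2_def w1_def w2_def ra_def)
  have init: "R = init_regs [real m, real n, real i, real j, x] \<Longrightarrow> F1 R" for R
    by (simp add: F1_def F_def init_regs_def numeral_eq_Suc)
  have 21: "tr (\<lambda>R M. R 10 = 2 ^ lgc (real n) \<and> R 11 = real (lgc (real n)) \<and> R 1 = real n \<and> M = M0 \<and> F1 R) (Pow2 12 13 0) (6 + 5 * real (lgc (real m))) []
     (\<lambda>R M. R 12 = 2 ^ lgc (real m) \<and> R 13 = real (lgc (real m)) \<and> R 0 = real m \<and> M = M0 \<and> F2 R)"
    by (rule tr_pre[OF 2]) (auto simp: F1_def F2_def F_def cost2_def)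
  show ?thesis unfolding upd_def
    by (rule tr_conseq[OF tr_seq[OF 1 tr_seq[OF 21 tr_seq[OF 3 tr_seq[OF 4 tr_seq[OF 5 tr_seq[OF 6 tr_seq[OF 7 tr_seq[OF 8 9]]]]]]]]])
      (use init in \<open>simp_all add: mem F_def F1_def flip: cost2_def\<close>)
qed

text \<open>The definition of \<open>stores\<close> speaks of any terminating run of the update
  program. Programs are deterministic (\<open>exec_det\<close>), so that run is the one described by
  \<open>tr_upd\<close>, and the invariant follows from \<open>enc_set\<close>.\<close>

lemma stores_enc:
  assumes "stores upd m n A M"
  shows "A \<in> carrier_mat m n \<and> M = enc A"
  using assms
proof induction
  case blank
  have "enc (0\<^sub>m m n) = (\<lambda>_. 0)"
  proof
    fix a
    have u: "a div 8 div n < m \<and> a div 8 mod n < n" if "a div 8 < m * n"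
      using that by (metis less_mult_imp_div_less mod_less_divisor mult_0_right not_gr_zero not_less_zero)
    have 1: "UW (0\<^sub>m m n) i y = 0" for i y by (auto simp: UW_def intro!: sum.neutral)
    have 2: "VW (0\<^sub>m m n) t y = 0" for t y by (auto simp: VW_def intro!: sum.neutral)
    show "enc (0\<^sub>m m n) a = 0"
      using u by (auto simp: enc_def Let_def 1 2 S1_def S2_def powp_def)
  qed
  then show ?case by simp
next
  case (update A M i j x t R' M' \<psi>')
  then have A: "dim_row A = m" "dim_col A = n" and M: "M = enc A" by auto
  obtain R2 M2 t2 where "M2 = upd_mem m n i j x M"
    "\<And>\<psi>. clean \<psi> \<Longrightarrow> exec upd (init_regs [real m, real n, real i, real j, x], M, \<psi>) t2 (R2, M2, aps [] \<psi>)"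
    using trD[OF tr_upd[OF update.hyps(2,3)] conjI[OF refl refl], of x M] by blast
  then have "M' = upd_mem m n i j x M" using exec_det[OF update.hyps(4)] clean_zero by blast
  then have "M' = enc (set_entry A i j x)" using enc_set[of i A j x] update.hyps(2,3) A M by simp
  then show ?case using A by (intro conjI carrier_matI) simp_all
qed

lemma lg_ge_1: "0 < m \<Longrightarrow> 0 < n \<Longrightarrow> 1 \<le> lg m n"
proof -
  assume "0 < m" "0 < n"
  then have "0 < m * n" by simp
  then have "2 \<le> real (m * n) + 1" by linarith
  then have "log 2 2 \<le> log 2 (real (m * n) + 1)" by (intro log_mono) auto
  then show ?thesis by (simp add: lg_def)
qed

text \<open>Rounding up adds at most 1 to the logarithm, and this is absorbed by a second copy of
  \<open>lg m n\<close>, which is at least 1.\<close>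

lemma cost2_lg:
  assumes "0 < m" "0 < n"
  shows "real (cost2 m) \<le> 2 * lg m n" "real (cost2 n) \<le> 2 * lg m n"
proof -
  have *: "real (cost2 k) \<le> 2 * lg m n" if "0 < k" "k \<le> m * n" for k
  proof (cases "cost2 k")
    case 0
    then show ?thesis using lg_ge_1[OF assms] by simp
  next
    case (Suc e)
    then have "2 ^ e < real k" using lgc_gt[of e "real k"] by (simp add: cost2_def)
    also have "\<dots> \<le> real (m * n)" using that(2) by (simp only: of_nat_le_iff)
    finally have "2 powr real e \<le> real (m * n) + 1" by (simp add: powr_realpow)
    then have "real e \<le> lg m n" unfolding lg_def by (subst le_log_iff) (auto intro: add_nonneg_pos)
    then show ?thesis using Suc lg_ge_1[OF assms] by simp
  qed
  show "real (cost2 m) \<le> 2 * lg m n" "real (cost2 n) \<le> 2 * lg m n"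
    using assms by (auto intro!: *)
qed

text \<open>Charges every occupied cell to a nonzero entry: a nonzero node or power sum has such an
  entry below it. As each entry is charged for few cells, the occupied memory is proportional to the
  number of entries, up to a logarithm.\<close>

lemma enc_supp:
  assumes "enc A a \<noteq> 0"
  shows "\<exists>i<dim_row A. \<exists>j<dim_col A. A $$ (i, j) \<noteq> 0 \<and>
    a \<in> {8 * (i * dim_col A + j), 3, 4} \<union> (\<lambda>d. 8 * (i * (2 * 2 ^ cost2 (dim_col A))) + 1 + 8 * node d j) ` {..cost2 (dim_col A)}
      \<union> (\<lambda>d. 8 * ((tau * j) * (2 * 2 ^ cost2 (dim_row A))) + 2 + 8 * node d i) ` {..cost2 (dim_row A)}"
proof -
  let ?m = "dim_row A" and ?n = "dim_col A"
  let ?u = "a div 8"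
  have wt: "A $$ (i, j) \<noteq> 0" if "wt q (A $$ (i, j)) \<noteq> 0" for q i j using that by auto
  have U: "\<exists>i'<?m. \<exists>j<?n. i' = i \<and> A $$ (i, j) \<noteq> 0 \<and> on_path (cost2 ?n) j y" if "UW A i y \<noteq> 0" for i y
  proof -
    have "i < ?m" using that by (rule contrapos_np) (simp add: UW_def)
    then have "(\<Sum>j<?n. if on_path (cost2 ?n) j y then wt q1 (A $$ (i, j)) else 0) \<noteq> 0"
      using that by (simp add: UW_def)
    then obtain j where "j \<in> {..<?n}" "(if on_path (cost2 ?n) j y then wt q1 (A $$ (i, j)) else 0) \<noteq> 0"
      by (rule sum.not_neutral_contains_not_neutral)
    then show ?thesis using \<open>i < ?m\<close> wt[of q1 i j] by (auto split: if_splits)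
  qed
  have V: "\<exists>i<?m. \<exists>j<?n. tau * j = t \<and> A $$ (i, j) \<noteq> 0 \<and> on_path (cost2 ?m) i y" if "VW A t y \<noteq> 0" for t y
  proof -
    from that obtain i where i: "i \<in> {..<?m}"
      "(\<Sum>j<?n. if tau * j = t \<and> on_path (cost2 ?m) i y then wt q2 (A $$ (i, j)) else 0) \<noteq> 0"
      unfolding VW_def by (rule sum.not_neutral_contains_not_neutral)
    from i(2) obtain j where "j \<in> {..<?n}" "(if tau * j = t \<and> on_path (cost2 ?m) i y then wt q2 (A $$ (i, j)) else 0) \<noteq> 0"
      by (rule sum.not_neutral_contains_not_neutral)
    then show ?thesis using i(1) wt[of q2 i j] by (auto split: if_splits)
  qed
  consider "a mod 8 = 0" | "a mod 8 = 1" | "a mod 8 = 2" | "a = 3" | "a = 4"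
    using assms by (auto simp: enc_def Let_def split: if_splits)
  then show ?thesis
  proof cases
    case 1
    then have u: "?u < ?m * ?n" "A $$ (?u div ?n, ?u mod ?n) \<noteq> 0"
      using assms by (auto simp: enc_def Let_def split: if_splits)
    then have "0 < ?n" by (cases "?n = 0") auto
    then have "?u div ?n < ?m" "?u mod ?n < ?n" "a = 8 * (?u div ?n * ?n + ?u mod ?n)"
      using u 1 by (auto simp: less_mult_imp_div_less)
    then show ?thesis using u by blast
  next
    case 2
    then have "UW A (?u div (2 * 2 ^ cost2 ?n)) (?u mod (2 * 2 ^ cost2 ?n)) \<noteq> 0"
      using assms by (simp add: enc_def Let_def)
    then obtain i j where *: "i < ?m" "j < ?n" "?u div (2 * 2 ^ cost2 ?n) = i" "A $$ (i, j) \<noteq> 0"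
      "on_path (cost2 ?n) j (?u mod (2 * 2 ^ cost2 ?n))"
      using U by metis
    then have "\<exists>d\<le>cost2 ?n. a = 8 * (i * (2 * 2 ^ cost2 ?n)) + 1 + 8 * node d j"
      using 2 by (subst tree_addr) auto
    then show ?thesis using * by blast
  next
    case 3
    then have "VW A (?u div (2 * 2 ^ cost2 ?m)) (?u mod (2 * 2 ^ cost2 ?m)) \<noteq> 0"
      using assms by (simp add: enc_def Let_def)
    then obtain i j where *: "i < ?m" "j < ?n" "tau * j = ?u div (2 * 2 ^ cost2 ?m)" "A $$ (i, j) \<noteq> 0"
      "on_path (cost2 ?m) i (?u mod (2 * 2 ^ cost2 ?m))"
      using V by metis
    then have "\<exists>d\<le>cost2 ?m. a = 8 * ((tau * j) * (2 * 2 ^ cost2 ?m)) + 2 + 8 * node d i"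
      using 3 by (subst tree_addr) auto
    then show ?thesis using * by blast
  next
    case 4
    then have "(\<Sum>i<?m. powp (UW A i 1) (qe ?m ?n)) \<noteq> 0" using assms by (simp add: enc_3 S1_def)
    then obtain i where "powp (UW A i 1) (qe ?m ?n) \<noteq> 0" by (rule sum.not_neutral_contains_not_neutral)
    then have "UW A i 1 \<noteq> 0" by (auto simp: powp_def)
    then show ?thesis using U 4 by blast
  next
    case 5
    then have "(\<Sum>t<?n. powp (VW A t 1) (qe ?m ?n)) \<noteq> 0" using assms by (simp add: enc_4 S2_def)
    then obtain t where "powp (VW A t 1) (qe ?m ?n) \<noteq> 0" by (rule sum.not_neutral_contains_not_neutral)
    then have "VW A t 1 \<noteq> 0" by (auto simp: powp_def)
    then show ?thesis using V 5 by blast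
  qed
qed

lemma efficient_upd: "efficient_qram_structure upd"
  unfolding efficient_qram_structure_def
\<comment> \<open>The constant 300 covers the time 124 + 20 (D + E), at most 204 lg, the D + E + 5
  cells charged to each entry, at most 9 lg, and the address range 40 m n.\<close>
proof (rule exI[of _ 300], rule exI[of _ 1], intro allI impI)
  fix m n :: nat and A M
  assume pos: "0 < m" "0 < n" and st: "stores upd m n A M"
  have A: "dim_row A = m" "dim_col A = n" "M = enc A" using stores_enc[OF st] by auto
  have lg: "1 \<le> lg m n" using pos by (rule lg_ge_1)
  have lgs: "lg m n ^ 1 = lg m n" by simp
  let ?D = "cost2 n" and ?E = "cost2 m"
  define S where "S = (\<lambda>(i, j). {8 * (i * n + j), 3, 4} \<union> (\<lambda>d. 8 * (i * (2 * 2 ^ ?D)) + 1 + 8 * node d j) ` {..?D}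
      \<union> (\<lambda>d. 8 * ((tau * j) * (2 * 2 ^ ?E)) + 2 + 8 * node d i) ` {..?E})"
  define I where "I = {(i, j). i < m \<and> j < n \<and> A $$ (i, j) \<noteq> 0}"
  have sub: "{a. M a \<noteq> 0} \<subseteq> (\<Union>p\<in>I. S p)"
  proof
    fix a assume "a \<in> {a. M a \<noteq> 0}"
    then obtain i j where ij: "i < m" "j < n" "A $$ (i, j) \<noteq> 0" "a \<in> S (i, j)"
      using enc_supp[of A a] unfolding A S_def prod.case by blast
    then show "a \<in> (\<Union>p\<in>I. S p)" by (intro UN_I[of "(i, j)"]) (simp_all add: I_def)
  qed
  have finI: "finite I" by (rule finite_subset[of _ "{..<m} \<times> {..<n}"]) (auto simp: I_def)
  have cI: "card I = num_entries A" by (simp add: I_def num_entries_def A)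
  have cS: "card (S p) \<le> ?D + ?E + 5" for p
  proof (cases p)
    case (Pair i j)
    have "card (S p) \<le> card {8 * (i * n + j), 3, 4} + card ((\<lambda>d. 8 * (i * (2 * 2 ^ ?D)) + 1 + 8 * node d j) ` {..?D})
      + card ((\<lambda>d. 8 * ((tau * j) * (2 * 2 ^ ?E)) + 2 + 8 * node d i) ` {..?E})"
      unfolding S_def Pair prod.case by (intro order_trans[OF card_Un_le] add_mono order_refl)
    also have "\<dots> \<le> 3 + card {..?D} + card {..?E}"
      by (intro add_mono card_image_le) (auto simp: card_insert_if)
    finally show ?thesis by simp
  qed
  have fS: "finite (S p)" for p by (cases p) (simp add: S_def)
  have "card {a. M a \<noteq> 0} \<le> card (\<Union>p\<in>I. S p)"
    using sub finI fS by (intro card_mono) auto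
  also have "\<dots> \<le> (\<Sum>p\<in>I. card (S p))" by (rule card_UN_le[OF finI])
  also have "\<dots> \<le> (\<Sum>p\<in>I. ?D + ?E + 5)" by (intro sum_mono cS)
  finally have "card {a. M a \<noteq> 0} \<le> (?D + ?E + 5) * num_entries A" by (simp add: cI mult.commute)
  then have "real (card {a. M a \<noteq> 0}) \<le> real ((?D + ?E + 5) * num_entries A)" by (simp only: of_nat_le_iff)
  also have "\<dots> = (real ?D + real ?E + 5) * real (num_entries A)" by simp
  also have "\<dots> \<le> (300 * lg m n ^ 1) * real (num_entries A)"
    using cost2_lg[OF pos] lg by (intro mult_right_mono) auto
  finally have c2: "real (card {a. M a \<noteq> 0}) \<le> 300 * lg m n ^ 1 * real (num_entries A)" .
  have c1: "real a < 300 * lg m n ^ 1 * real (m * n)" if "M a \<noteq> 0" for a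
  proof -
    have "\<exists>i j. i < m \<and> j < n \<and> a \<in> S (i, j)"
    proof -
      have "a \<in> (\<Union>p\<in>I. S p)" using sub that by blast
      then obtain p where "p \<in> I" "a \<in> S p" by blast
      then show ?thesis by (cases p) (auto simp: I_def)
    qed
    then obtain i j where ij: "i < m" "j < n" "a \<in> S (i, j)" by blast
    have t: "tau * j < n" using tau ij by (cases "tau = 0") (auto simp: le_Suc_eq)
    have D: "2 ^ ?D \<le> 2 * n" "2 ^ ?E \<le> 2 * m" using cost2_le pos by auto
    have u0: "i * n + j < m * n" using ij by (intro mlex) auto
    have D': "m * (2 * 2 ^ ?D) \<le> 4 * (m * n)" "n * (2 * 2 ^ ?E) \<le> 4 * (m * n)"
      using D mult_le_mono2[OF D(1), of "2 * m"] mult_le_mono2[OF D(2), of "2 * n"] by (simp_all add: algebra_simps)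
    have u1: "i * (2 * 2 ^ ?D) + node d j < 4 * (m * n)" if "d \<le> ?D" for d
      using ij node_lt[OF that] by (intro less_le_trans[OF mlex D'(1)]) auto
    have u2: "(tau * j) * (2 * 2 ^ ?E) + node d i < 4 * (m * n)" if "d \<le> ?E" for d
      using t node_lt[OF that] by (intro less_le_trans[OF mlex D'(2)]) auto
    have u3: "1 \<le> m * n" using pos by simp
    consider "a = 8 * (i * n + j)" | "a \<le> 4" | d where "d \<le> ?D" "a = 8 * (i * (2 * 2 ^ ?D) + node d j) + 1" |
      d where "d \<le> ?E" "a = 8 * ((tau * j) * (2 * 2 ^ ?E) + node d i) + 2"
      using ij(3) by (auto simp: S_def algebra_simps)
    then have "a < 40 * (m * n)"
    proof cases
      case 1
      have "8 * X < 40 * Y" if "X < Y" for X Y :: nat using that by linarith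
      from this[OF u0] show ?thesis using 1 by simp
    next
      case 2
      then show ?thesis using u3 by linarith
    next
      case (3 d)
      have "8 * X + 1 < 40 * Y" if "X < 4 * Y" for X Y :: nat using that by linarith
      from this[OF u1[OF 3(1)]] show ?thesis using 3(2) by simp
    next
      case (4 d)
      have "8 * X + 2 < 40 * Y" if "X < 4 * Y" for X Y :: nat using that by linarith
      from this[OF u2[OF 4(1)]] show ?thesis using 4(2) by simp
    qed
    then have "real a < real (40 * (m * n))" by (simp only: of_nat_less_iff)
    also have "\<dots> = 40 * real (m * n)" by simp
    also have "\<dots> \<le> 300 * lg m n ^ 1 * real (m * n)" using lg by (intro mult_right_mono) auto
    finally show ?thesis .
  qed
  have c3: "\<exists>t R' M' \<psi>'. exec upd (init_regs [real m, real n, real i, real j, x], M, zero_state) t (R', M', \<psi>') \<and>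
      real t \<le> 300 * lg m n ^ 1" if ij: "i < m" "j < n" for i j x
  proof -
    obtain R' M' t where "real t \<le> 124 + 20 * (real ?D + real ?E)"
      "\<And>\<psi>. clean \<psi> \<Longrightarrow> exec upd (init_regs [real m, real n, real i, real j, x], M, \<psi>) t (R', M', aps [] \<psi>)"
      using trD[OF tr_upd[OF ij] conjI[OF refl refl], of x M] by blast
    moreover have "124 + 20 * (real ?D + real ?E) \<le> 300 * lg m n ^ 1"
      using cost2_lg[OF pos] lg by simp
    ultimately show ?thesis using clean_zero by (meson order_trans)
  qed
  show "(\<forall>a. M a \<noteq> 0 \<longrightarrow> real a < 300 * lg m n ^ 1 * real (m * n)) \<and>
    real (card {a. M a \<noteq> 0}) \<le> 300 * lg m n ^ 1 * real (num_entries A) \<and>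
    (\<forall>i<m. \<forall>j<n. \<forall>x. \<exists>t R' M' \<psi>'.
       exec upd (init_regs [real m, real n, real i, real j, x], M, zero_state) t (R', M', \<psi>') \<and>
       real t \<le> 300 * lg m n ^ 1)"
    using c1 c2 c3 by blast
qed

end

lemma tr_ArI: "(\<And>R M. Pre R M \<Longrightarrow> Post (fold astep is R) M) \<Longrightarrow> real (length is) \<le> T \<Longrightarrow> tr Pre (Ar is) T [] Post"
  by (rule tr_conseq[OF tr_Ar]) auto

section \<open>Gate blocks with temporary cells\<close>

text \<open>Agreement of two operations as long as the temporary cells are 0. Demanding that the
  target is not temporary keeps clean states clean, so lists can be compared member by member
  (\<open>ceqs\<close>).\<close>

fun ceq :: "qop \<Rightarrow> qop \<Rightarrow> bool" where
  "ceq (Tr k f) (Tr k' f') \<longleftrightarrow> k = k' \<and> (k < 11 \<or> 40 \<le> k) \<and> (\<forall>c. cln c \<longrightarrow> f c = f' c)"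
| "ceq (Ro k f) (Ro k' f') \<longleftrightarrow> k = k' \<and> (k < 11 \<or> 40 \<le> k) \<and> (\<forall>c. cln c \<longrightarrow> f c = f' c)"
| "ceq (Ph f) (Ph f') \<longleftrightarrow> (\<forall>c. cln c \<longrightarrow> f c = f' c)"
| "ceq _ _ \<longleftrightarrow> False"

lemma cln_upd [simp]:
  assumes "k < 11 \<or> 40 \<le> k"
  shows "cln (c(k := v)) = cln c"
proof -
  have "j \<noteq> k" if "11 \<le> j \<and> j < 40" for j using assms that by arith
  then have "(c(k := v)) j = c j" if "11 \<le> j \<and> j < 40" for j using that by simp
  then show ?thesis unfolding cln_def by metis
qed

lemma indep_cln:
  assumes "T \<inter> {11..<40} = {}"
  shows "indep T cln"
  unfolding indep_def
proof (intro allI ballI)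
  fix c k and v :: real assume "k \<in> T"
  then have "k \<notin> {11..<40}" using assms by blast
  then have "k < 11 \<or> 40 \<le> k" by simp arith
  then show "cln (c(k := v)) = cln c" by (rule cln_upd)
qed

lemma clean_restr: "clean \<psi> \<longleftrightarrow> restr cln \<psi> = \<psi>"
  unfolding clean_def restr_def fun_eq_iff by auto

lemma clean_aps: "(\<And>p. p \<in> set xs \<Longrightarrow> tgt p \<inter> {11..<40} = {}) \<Longrightarrow> clean \<psi> \<Longrightarrow> clean (aps xs \<psi>)"
  unfolding clean_restr by (subst restr_aps) (auto intro: indep_cln)

lemma pcl_ops: "(\<And>p. p \<in> set xs \<Longrightarrow> tgt p \<inter> {11..<40} = {}) \<Longrightarrow> pcl xs"
  unfolding pcl_def using clean_aps by blast

lemma ceq_ap: "ceq p p' \<Longrightarrow> clean \<psi> \<Longrightarrow> ap p \<psi> = ap p' \<psi> \<and> tgt p' \<inter> {11..<40} = {}"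
proof (induction p p' rule: ceq.induct)
  case (1 k f k' f')
  have "translate k f \<psi> c = translate k f' \<psi> c" for c
  proof (cases "cln c")
    case True
    then show ?thesis using 1 by (simp add: translate_def)
  next
    case False
    then have "\<not> cln (c(k := v))" for v using 1 by auto
    then show ?thesis using 1 by (metis clean_def translate_def)
  qed
  then show ?case using 1 by auto
next
  case (2 k f k' f')
  have "ap (Ro k f) \<psi> c = ap (Ro k f') \<psi> c" for c
  proof (cases "cln c")
    case True
    then show ?thesis using 2 by simp
  next
    case False
    then have "\<not> cln (c(k := v))" for v using 2 by auto
    then have "\<psi> (c(k := v)) = 0" for v using 2 by (metis clean_def)
    then show ?thesis by simp
  qed
  then show ?case using 2 by auto
next
  case (3 f f')
  then show ?case by (auto intro!: ap_Ph_cong[unfolded ap.simps] simp: clean_def)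
qed auto

lemma ceqs: "list_all2 ceq xs ys \<Longrightarrow> clean \<psi> \<Longrightarrow> aps xs \<psi> = aps ys \<psi>"
proof (induction arbitrary: \<psi> rule: list_all2_induct)
  case (Cons p xs p' ys)
  then show ?case using ceq_ap[OF Cons(1) Cons(4)] clean_aps[of "[p']" \<psi>] by simp
qed simp

text \<open>The obligation for a block \<open>Cj cs gs\<close> to act as \<open>ys\<close> on clean
  states: \<open>cs\<close> can be uncomputed, does not interfere with the targets of
  \<open>gs\<close>, and yields the parameters in \<open>ys\<close>. For concrete gates all of it is
  settled by simplification.\<close>

definition blk :: "regs \<Rightarrow> memory \<Rightarrow> gate list \<Rightarrow> gate list \<Rightarrow> qop list \<Rightarrow> bool" where
  "blk R M cs gs ys \<longleftrightarrow> (\<forall>g\<in>set cs. calc_gate R g) \<and>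
     (\<forall>p\<in>set (map (rs R M) gs). conj_ok (map (rs R M) cs) p) \<and>
     list_all2 ceq (map (\<lambda>g. pre (pm (map (rs R M) cs)) (rs R M g)) gs) ys"

lemma tr_Cj:
  assumes "\<And>R M. Pre R M \<Longrightarrow> blk R M cs gs ys" "pcl ys"
  shows "tr Pre (Gs (Cj cs gs)) (2 * real (length cs) + real (length gs)) ys Pre"
proof -
  have "tr Pre (Gs (Cj cs gs)) (real (length (Cj cs gs))) ys Pre"
  proof (rule tr_Gs)
    fix R M \<psi> assume "Pre R M" "clean \<psi>"
    from assms(1)[OF this(1)] have b: "blk R M cs gs ys" .
    have "aps (map (rs R M) (Cj cs gs)) \<psi> = aps (map (rs R M) cs @ map (rs R M) gs @ invs (map (rs R M) cs)) \<psi>"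
      using b by (subst map_rs_Cj) (auto simp: blk_def)
    also have "\<dots> = aps (map (pre (pm (map (rs R M) cs))) (map (rs R M) gs)) \<psi>"
      using b by (intro conj_ops) (auto simp: blk_def)
    also have "\<dots> = aps ys \<psi>"
      using b \<open>clean \<psi>\<close> by (intro ceqs) (auto simp: blk_def o_def)
    finally show "aps (map (rs R M) (Cj cs gs)) \<psi> = aps ys \<psi>" .
  qed (rule assms(2))
  then show ?thesis by (rule tr_time) (simp add: Cj_def)
qed

lemma conj_ok_simps [simp]: "conj_ok [] p"
    "conj_ok (Tr k f # cs) p \<longleftrightarrow> wfo (Tr k f) \<and> k \<notin> tgt p \<and> indep (tgt p) f \<and> conj_ok cs p"
  by (auto simp: conj_ok_def)

lemma indep_insert: "indep (insert k T) f \<longleftrightarrow> (\<forall>c v. f (c(k := v)) = f c) \<and> indep T f"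
  and indep_empty: "indep {} f"
  by (auto simp: indep_def)

text \<open>Gates name cells through registers. Registers 100 to 139 permanently name the cells 0 to
  39, while register 140 is used as a moving pointer into the outcome cells.\<close>

definition cs_ok :: "regs \<Rightarrow> bool" where
  "cs_ok R \<longleftrightarrow> (\<forall>k<40. R (100 + k) = real k)"

lemma cs_ok_addr: "cs_ok R \<Longrightarrow> 100 \<le> r \<Longrightarrow> r < 140 \<Longrightarrow> addr (R r) = r - 100"
proof -
  assume *: "cs_ok R" "100 \<le> r" "r < 140"
  then have "r - 100 < 40" by auto
  then have "R (100 + (r - 100)) = real (r - 100)" using *(1) unfolding cs_ok_def by blast
  then show ?thesis using \<open>100 \<le> r\<close> by (intro addr_eq) simp
qed

lemma fr_cs_ok: "(\<And>r. r \<in> S \<Longrightarrow> r < 100) \<Longrightarrow> fr S cs_ok"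
  unfolding fr_def cs_ok_def by (metis fun_upd_other le_add1 not_le)

definition leqr :: "real \<Rightarrow> real \<Rightarrow> real" where
  "leqr x y = (if x \<le> y then 1 else 0)"

definition acs :: "real \<Rightarrow> real" where
  "acs x = (if \<bar>x\<bar> \<le> 1 then arccos x else 0)"

lemma arith_val_Leq [simp]: "arith_val Leq x y = leqr x y"
  by (simp add: leqr_def)

lemma arith_val_Arccos [simp]: "arith_val Arccos x y = acs x"
  by (simp add: acs_def)

declare arith_val.simps(9,10) [simp del]

lemma angle_acs [simp]: "angle (acs x) = acs x" "angle (- acs x) = - acs x"
  using arccos_lbound[of x] arccos_ubound[of x] pi_gt_zero by (auto simp: angle_def acs_def abs_le_iff)

lemma clnD: "cln c \<Longrightarrow> 11 \<le> k \<Longrightarrow> k < 40 \<Longrightarrow> c k = 0"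
  by (simp add: cln_def)

lemmas blk_simps = cs_ok_addr wfo_def indep_insert indep_empty

lemma blkI:
  assumes "\<forall>g\<in>set cs. calc_gate R g" "\<forall>p\<in>set (map (rs R M) gs). conj_ok (map (rs R M) cs) p"
    "list_all2 ceq (map (\<lambda>g. pre (pm (map (rs R M) cs)) (rs R M g)) gs) ys"
  shows "blk R M cs gs ys"
  using assms by (simp add: blk_def)

lemma all_cln: "(\<And>c. cln c \<Longrightarrow> (\<And>k. 11 \<le> k \<Longrightarrow> k < 40 \<Longrightarrow> c k = 0) \<Longrightarrow> P c) \<Longrightarrow> \<forall>c. cln c \<longrightarrow> P c"
  using clnD by blast

definition gA :: "arith \<Rightarrow> nat \<Rightarrow> nat \<Rightarrow> nat \<Rightarrow> gate" where "gA f k i j = QAdd f (100 + k) (100 + i) (100 + j)"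
definition gS :: "arith \<Rightarrow> nat \<Rightarrow> nat \<Rightarrow> nat \<Rightarrow> gate" where "gS f k i j = QSub f (100 + k) (100 + i) (100 + j)"
definition gQ :: "nat \<Rightarrow> nat \<Rightarrow> gate" where "gQ k i = Query (100 + k) (100 + i)"
definition gR :: "nat \<Rightarrow> nat \<Rightarrow> gate" where "gR k i = Rot (100 + k) (100 + i)"
definition gP :: "nat \<Rightarrow> gate" where "gP i = Phase (100 + i)"
definition gH :: "nat \<Rightarrow> nat \<Rightarrow> gate" where "gH k r = QShift (100 + k) r"

lemmas g_defs = gA_def gS_def gQ_def gR_def gP_def gH_def

section \<open>The walk operator as a program\<close>

text \<open>Cells: 0 column index, 2 row index, 3 branch of the identity block, 4 junk flag, 5 tree qubit,
  6 control and test qubit, 9 phase estimate, 10 grid index of the singular value, 8 scratch, 40 + \<open>t\<close>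
  outcome of test \<open>t\<close>.\<close>

definition ang_gates :: "nat \<Rightarrow> nat \<Rightarrow> gate list" where
  "ang_gates ro x = [gH 11 60, gA Mul 12 ro 11, gA (Const 8) 13 19 19, gA Mul 12 x 13, gH 12 62, gQ 14 12,
     gH 12 64, gQ 15 12, gA Div 16 15 14, gA (Const (1/2)) 17 19 19, gA Pow 18 16 17]"

text \<open>Bits of the index are appended at the top: once 2^d has been added, the tree qubit
  equals the test 2^d \<le> x, and a comparison resets it to 0. Branching on the least significant
  bit first is what makes this erasure so simple.\<close>

definition levF :: "nat \<Rightarrow> nat \<Rightarrow> com" where
  "levF ro x = Seq (Gs (Cj (ang_gates ro x @ [gA Arccos 27 18 18]) [gR 5 27]))
     (Gs (Cj [gH 11 66] [gA Mul x 5 11, gS Leq 5 11 x]))"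

definition levB :: "nat \<Rightarrow> nat \<Rightarrow> com" where
  "levB ro x = Seq (Gs (Cj [gH 11 66] [gA Leq 5 11 x, gS Mul x 5 11]))
     (Gs (Cj (ang_gates ro x @ [gS Arccos 27 18 18]) [gR 5 27]))"

definition treeF :: "nat \<Rightarrow> nat \<Rightarrow> nat \<Rightarrow> nat \<Rightarrow> nat \<Rightarrow> com" where
  "treeF kind ro x Sr Dr = Seq (Ar [(Const (real kind), 95, 0, 0), (Add, 60, Sr, 93), (Sub, 61, 93, 60), (Const 1, 66, 0, 0),
       (Add, 33, Dr, 93)])
     (For 33 (Seq (Ar [(Sub, 67, 93, 66), (Mul, 64, 94, 66), (Sub, 65, 93, 64), (Add, 62, 64, 95), (Sub, 63, 93, 62)])
       (Seq (levF ro x) (Ar [(Add, 66, 66, 66)]))))"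

definition treeB :: "nat \<Rightarrow> nat \<Rightarrow> nat \<Rightarrow> nat \<Rightarrow> nat \<Rightarrow> nat \<Rightarrow> com" where
  "treeB kind ro x Sr Nr Dr = Seq (Ar [(Const (real kind), 95, 0, 0), (Add, 60, Sr, 93), (Sub, 61, 93, 60), (Add, 66, Nr, 93),
       (Add, 33, Dr, 93)])
     (For 33 (Seq (Ar [(Mul, 66, 66, 96), (Sub, 67, 93, 66), (Mul, 64, 94, 66), (Sub, 65, 93, 64), (Add, 62, 64, 95), (Sub, 63, 93, 62)])
       (levB ro x)))"

text \<open>The final angle leaves the amplitude sign(a) sqrt(U^xe V / Sh) / 4 with flag 0, for the
  row root U and the column root V. It restores the sign, which the trees of absolute values lose,
  and trades the norms of the individual trees for one common constant. The addresses end in 9 and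
  10 since the root is node 1, in banks 1 and 2.\<close>

definition junk_gates :: "real \<Rightarrow> gate list" where
  "junk_gates xe = [gH 11 68, gA Mul 12 2 11, gA Add 12 0 19, gA (Const 8) 13 19 19, gA Mul 14 12 13, gQ 15 14,
     gA Leq 16 19 15, gA Add 17 16 16, gS (Const 1) 17 19 19,
     gH 18 70, gA Mul 20 2 18, gA (Const 9) 20 19 19, gQ 21 20,
     gH 22 72, gA Mul 23 0 22, gA (Const 10) 23 19 19, gQ 24 23,
     gA (Const xe) 26 19 19, gA Pow 25 21 26, gA Mul 27 25 24, gH 28 74, gA Div 29 27 28,
     gA (Const (1/2)) 30 19 19, gA Pow 31 29 30, gA Mul 32 31 17, gA (Const (1/4)) 33 19 19, gA Mul 34 32 33]"

definition prepG :: "real \<Rightarrow> com" where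
  "prepG xe = Seq (Gs (Cj [gH 11 76] [gR 3 11])) (Seq (treeF 2 0 2 72 13)
     (Gs (Cj (junk_gates xe @ [gA Arccos 35 34 34]) [gR 4 35])))"

definition unprepG :: "real \<Rightarrow> com" where
  "unprepG xe = Seq (Gs (Cj (junk_gates xe @ [gS Arccos 35 34 34]) [gR 4 35]))
     (Seq (treeB 2 0 2 72 12 13) (Gs (Cj [gH 11 77] [gR 3 11])))"

definition reflG :: com where
  "reflG = Gs (Cj [gA Mul 11 4 4, gA Mul 11 0 0, gA Mul 11 5 5, gA (Const 1) 12 19 19, gS Add 12 3 19, gA Mul 13 11 12,
     gA Leq 14 13 19, gA Mul 15 14 6, gA (Const pi) 16 19 19, gA Mul 17 15 16] [gP 17])"

definition anc_gates :: "gate list" where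
  "anc_gates = [gA Mul 11 2 2, gA Mul 11 3 3, gA Mul 11 4 4, gA Mul 11 5 5, gA (Const 1) 12 19 19, gS Leq 12 11 19]"

definition reflZ :: com where
  "reflZ = Gs (Cj (anc_gates @ [gA Mul 15 12 6, gA (Const pi) 16 19 19, gA Mul 17 15 16]) [gP 17])"

definition flagZ :: com where
  "flagZ = Gs (Cj anc_gates [gA Add 6 12 19])"

definition cWalk :: "real \<Rightarrow> com" where
  "cWalk xe = Seq (prepG xe) (Seq (treeB 1 2 0 70 10 11) (Seq reflG (Seq (treeF 1 2 0 70 11) (Seq (unprepG xe) reflZ))))"

locale walk =
  fixes M0 :: memory and n SU SV Sh beta xe :: real and D E :: nat
  assumes beta: "\<bar>beta\<bar> \<le> 2 * pi"
begin

definition WE :: "regs \<Rightarrow> bool" where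
  "WE = (\<lambda>R. R 93 = 0 \<and> R 94 = 8 \<and> R 96 = 1/2 \<and> R 68 = n \<and> R 69 = - n \<and> R 70 = SU \<and> R 71 = - SU \<and> R 72 = SV \<and>
     R 73 = - SV \<and> R 74 = Sh \<and> R 75 = - Sh \<and> R 76 = beta \<and> R 77 = - beta \<and> R 78 = beta \<and> R 10 = 2 ^ D \<and>
     R 11 = real D \<and> R 12 = 2 ^ E \<and> R 13 = real E \<and> cs_ok R)"

definition wscr :: "nat set" where
  "wscr = {33, 60, 61, 62, 63, 64, 65, 66, 67, 90, 95}"

lemma fr_WE: "fr wscr WE"
  unfolding WE_def by (intro fr_conj fr_eq fr_cs_ok) (auto simp: wscr_def)

text \<open>Node 2^d + x has the children 2^(d+1) + x and 2^(d+1) + 2^d + x, so the child for bit 0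
  lies 8 * 2^d addresses above the node. The cosine of the angle is the square root of this child's
  share of the weight.\<close>

definition Ang :: "real \<Rightarrow> real \<Rightarrow> real \<Rightarrow> real \<Rightarrow> real \<Rightarrow> real" where
  "Ang kind S p o' x = acs (powp (M0 (addr (o' * S + x * 8 + (8 * p + kind) + 8 * p)) /
     M0 (addr (o' * S + x * 8 + (8 * p + kind)))) (1/2))"

definition lev :: "real \<Rightarrow> real \<Rightarrow> nat \<Rightarrow> nat \<Rightarrow> real \<Rightarrow> qop list" where
  "lev kind S ro x p = [Ro 5 (\<lambda>c. Ang kind S p (c ro) (c x)), Tr x (\<lambda>c. c 5 * p), Tr 5 (\<lambda>c. - leqr p (c x))]"

definition tree :: "real \<Rightarrow> real \<Rightarrow> nat \<Rightarrow> nat \<Rightarrow> nat \<Rightarrow> qop list" where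
  "tree kind S ro x K = concat (map (\<lambda>d. lev kind S ro x (2 ^ d)) [0..<K])"

definition EAng :: "real \<Rightarrow> real \<Rightarrow> real" where
  "EAng x r = acs (powp (powp (M0 (addr (r * SU + 9))) xe * M0 (addr (x * SV + 10)) / Sh) (1/2) *
     (2 * leqr 0 (M0 (addr ((r * n + x) * 8))) - 1) * (1/4))"

definition Gops :: "qop list" where
  "Gops = [Ro 3 (\<lambda>_. beta)] @ tree 2 SV 0 2 E @ [Ro 4 (\<lambda>c. EAng (c 0) (c 2))]"

text \<open>After \<open>Gops\<close> has prepared the state of a column, undoing the row tree sends
  its overlap with the state of row r to the configuration with cell 0 equal to 0. In this way
  products of column and row amplitudes become amplitudes of \<open>good\<close>
  configurations.\<close>

definition Kops :: "qop list" where
  "Kops = Gops @ invs (tree 1 SU 2 0 D)"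

text \<open>A sum of squares is compared with 0, so that one comparison tests several cells. In the
  branch of the identity block, where cell 3 is 1, every configuration counts.\<close>

definition good :: "config \<Rightarrow> bool" where
  "good c \<longleftrightarrow> (c 4 * c 4 + c 0 * c 0 + c 5 * c 5) * (1 - c 3) \<le> 0"

definition anc0 :: "config \<Rightarrow> bool" where
  "anc0 c \<longleftrightarrow> c 2 * c 2 + c 3 * c 3 + c 4 * c 4 + c 5 * c 5 \<le> 0"

text \<open>The phases are two reflections, controlled by cell 6: a sign on the good subspace and a
  sign off the subspace where the ancillas are 0. \<open>Kops\<close> itself carries no control,
  because with trivial phases it cancels against its inverse.\<close>

definition Wops :: "qop list" where
  "Wops = Kops @ [Ph (\<lambda>c. angle (leqr ((c 4 * c 4 + c 0 * c 0 + c 5 * c 5) * (1 - c 3)) 0 * c 6 * pi))] @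
     invs Kops @ [Ph (\<lambda>c. angle ((1 - leqr (c 2 * c 2 + c 3 * c 3 + c 4 * c 4 + c 5 * c 5) 0) * c 6 * pi))]"

definition Fops :: "qop list" where
  "Fops = [Tr 6 (\<lambda>c. 1 - leqr (c 2 * c 2 + c 3 * c 3 + c 4 * c 4 + c 5 * c 5) 0)]"

definition MC :: "nat set" where "MC = {0, 2, 3, 4, 5}"

lemma lev_on: "ro \<in> MC - {5} \<Longrightarrow> x \<in> MC - {5} \<Longrightarrow> ro \<noteq> x \<Longrightarrow> ops_on MC (lev kind S ro x p)"
  by (auto simp: lev_def MC_def wfo_def indep_def dep_def)

lemma tree_on: "ro \<in> MC - {5} \<Longrightarrow> x \<in> MC - {5} \<Longrightarrow> ro \<noteq> x \<Longrightarrow> ops_on MC (tree kind S ro x K)"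
  unfolding tree_def by (intro ops_on_concat lev_on)

lemma Kops_on: "ops_on MC Kops" and Gops_on: "ops_on MC Gops"
proof -
  show "ops_on MC Gops"
    unfolding Gops_def ops_on_simps by (auto simp: MC_def intro!: tree_on[unfolded MC_def]) (auto simp: wfo_def indep_def dep_def)
  then show "ops_on MC Kops"
    unfolding Kops_def ops_on_simps ops_on_invs by (auto simp: MC_def intro!: tree_on[unfolded MC_def])
qed

lemma invs_tree: "invs (tree kind S ro x K) = concat (map (\<lambda>k. invs (lev kind S ro x (2 ^ (K - Suc k)))) [0..<K])"
proof -
  have "invs (concat xss) = concat (map invs (rev xss))" for xss by (induction xss) auto
  moreover have "rev [0..<K] = map (\<lambda>k. K - Suc k) [0..<K]"
    by (rule nth_equalityI) (auto simp: rev_nth)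
  ultimately show ?thesis by (simp add: tree_def rev_map o_def)
qed

definition lenv :: "real \<Rightarrow> real \<Rightarrow> real \<Rightarrow> regs \<Rightarrow> bool" where
  "lenv kind S p R \<longleftrightarrow> WE R \<and> R 60 = S \<and> R 61 = - S \<and> R 62 = 8 * p + kind \<and> R 63 = - (8 * p + kind) \<and>
     R 64 = 8 * p \<and> R 65 = - (8 * p) \<and> R 66 = p \<and> R 67 = - p"

lemma ang_beta: "angle beta = beta" "angle (- beta) = - beta"
  using beta by (simp_all add: angle_def)

lemma lenvD:
  assumes "lenv kind S p R"
  shows "cs_ok R" "R 60 = S" "R 61 = - S" "R 62 = 8 * p + kind" "R 63 = - (8 * p + kind)" "R 64 = 8 * p" "R 65 = - (8 * p)"
    "R 66 = p" "R 67 = - p"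
  using assms by (simp_all add: lenv_def WE_def)

lemma WED:
  assumes "WE R"
  shows "cs_ok R" "R 68 = n" "R 69 = - n" "R 70 = SU" "R 71 = - SU" "R 72 = SV" "R 73 = - SV" "R 74 = Sh" "R 75 = - Sh"
    "R 76 = beta" "R 77 = - beta" "R 78 = beta"
  using assms by (simp_all add: WE_def)

lemma
  assumes "lenv kind S p R"
  shows blk_ang20gA: "blk R M0 (ang_gates 2 0 @ [gA Arccos 27 18 18]) [gR 5 27] [Ro 5 (\<lambda>c. Ang kind S p (c 2) (c 0))]"
    and blk_ang20gS: "blk R M0 (ang_gates 2 0 @ [gS Arccos 27 18 18]) [gR 5 27] [Ro 5 (\<lambda>c. - Ang kind S p (c 2) (c 0))]"
    and blk_push0: "blk R M0 [gH 11 66] [gA Mul 0 5 11, gS Leq 5 11 0] [Tr 0 (\<lambda>c. c 5 * p), Tr 5 (\<lambda>c. - leqr p (c 0))]"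
    and blk_pop0: "blk R M0 [gH 11 66] [gA Leq 5 11 0, gS Mul 0 5 11] [Tr 5 (\<lambda>c. leqr p (c 0)), Tr 0 (\<lambda>c. - (c 5 * p))]"
    and blk_ang02gA: "blk R M0 (ang_gates 0 2 @ [gA Arccos 27 18 18]) [gR 5 27] [Ro 5 (\<lambda>c. Ang kind S p (c 0) (c 2))]"
    and blk_ang02gS: "blk R M0 (ang_gates 0 2 @ [gS Arccos 27 18 18]) [gR 5 27] [Ro 5 (\<lambda>c. - Ang kind S p (c 0) (c 2))]"
    and blk_push2: "blk R M0 [gH 11 66] [gA Mul 2 5 11, gS Leq 5 11 2] [Tr 2 (\<lambda>c. c 5 * p), Tr 5 (\<lambda>c. - leqr p (c 2))]"
    and blk_pop2: "blk R M0 [gH 11 66] [gA Leq 5 11 2, gS Mul 2 5 11] [Tr 5 (\<lambda>c. leqr p (c 2)), Tr 2 (\<lambda>c. - (c 5 * p))]"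
  by (rule blkI, simp add: ang_gates_def g_defs lenvD[OF assms], simp add: ang_gates_def g_defs blk_simps lenvD[OF assms],
    (simp add: ang_gates_def g_defs cs_ok_addr lenvD[OF assms]; (intro conjI all_cln)?; simp add: Ang_def lenvD[OF assms]))+

lemma
  assumes "WE R"
  shows blk_beta: "blk R M0 [gH 11 76] [gR 3 11] [Ro 3 (\<lambda>_. beta)]"
    and blk_beta': "blk R M0 [gH 11 77] [gR 3 11] [Ro 3 (\<lambda>_. - beta)]"
    and blk_junk: "blk R M0 (junk_gates xe @ [gA Arccos 35 34 34]) [gR 4 35] [Ro 4 (\<lambda>c. EAng (c 0) (c 2))]"
    and blk_junk': "blk R M0 (junk_gates xe @ [gS Arccos 35 34 34]) [gR 4 35] [Ro 4 (\<lambda>c. - EAng (c 0) (c 2))]"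
    and blk_reflG: "blk R M0 [gA Mul 11 4 4, gA Mul 11 0 0, gA Mul 11 5 5, gA (Const 1) 12 19 19, gS Add 12 3 19, gA Mul 13 11 12,
     gA Leq 14 13 19, gA Mul 15 14 6, gA (Const pi) 16 19 19, gA Mul 17 15 16] [gP 17] [Ph (\<lambda>c. angle (leqr ((c 4 * c 4 + c 0 * c 0 + c 5 * c 5) * (1 - c 3)) 0 * c 6 * pi))]"
    and blk_reflZ: "blk R M0 (anc_gates @ [gA Mul 15 12 6, gA (Const pi) 16 19 19, gA Mul 17 15 16]) [gP 17] [Ph (\<lambda>c. angle ((1 - leqr (c 2 * c 2 + c 3 * c 3 + c 4 * c 4 + c 5 * c 5) 0) * c 6 * pi))]"
    and blk_flagZ: "blk R M0 anc_gates [gA Add 6 12 19] Fops"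
  by (rule blkI, simp add: junk_gates_def anc_gates_def Fops_def g_defs WED[OF assms],
    simp add: junk_gates_def anc_gates_def Fops_def g_defs blk_simps WED[OF assms],
    (simp add: junk_gates_def anc_gates_def Fops_def g_defs cs_ok_addr WED[OF assms]; (intro conjI all_cln)?; simp add: EAng_def ang_beta WED[OF assms]))+

lemma oinv_lev: "invs (lev kind S ro x p) =
    [Tr 5 (\<lambda>c. leqr p (c x)), Tr x (\<lambda>c. - (c 5 * p))] @ [Ro 5 (\<lambda>c. - Ang kind S p (c ro) (c x))]"
  by (simp add: lev_def)

lemma tr_levF:
  assumes "(ro, x) \<in> {(2, 0), (0, 2)}"
  shows "tr (\<lambda>R M. lenv kind S p R \<and> M = M0 \<and> F R) (levF ro x) 29 (lev kind S ro x p) (\<lambda>R M. lenv kind S p R \<and> M = M0 \<and> F R)"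
proof -
  have l: "lev kind S ro x p = [Ro 5 (\<lambda>c. Ang kind S p (c ro) (c x))] @ [Tr x (\<lambda>c. c 5 * p), Tr 5 (\<lambda>c. - leqr p (c x))]"
    by (simp add: lev_def)
  show ?thesis unfolding levF_def l
    by (rule tr_time[OF tr_seq[OF tr_Cj tr_Cj]])
      (use assms in \<open>auto simp: ang_gates_def intro!: pcl_ops
        intro: blk_ang20gA[unfolded ang_gates_def append.simps] blk_ang02gA[unfolded ang_gates_def append.simps] blk_push0 blk_push2\<close>)
qed

lemma tr_levB:
  assumes "(ro, x) \<in> {(2, 0), (0, 2)}"
  shows "tr (\<lambda>R M. lenv kind S p R \<and> M = M0 \<and> F R) (levB ro x) 29 (invs (lev kind S ro x p)) (\<lambda>R M. lenv kind S p R \<and> M = M0 \<and> F R)"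
  unfolding levB_def oinv_lev
  by (rule tr_time[OF tr_seq[OF tr_Cj tr_Cj]])
    (use assms in \<open>auto simp: ang_gates_def intro!: pcl_ops
        intro: blk_ang20gS[unfolded ang_gates_def append.simps] blk_ang02gS[unfolded ang_gates_def append.simps] blk_pop0 blk_pop2\<close>)

definition wpar :: "nat \<Rightarrow> nat \<Rightarrow> nat \<Rightarrow> nat \<Rightarrow> nat \<Rightarrow> nat \<Rightarrow> real \<Rightarrow> nat \<Rightarrow> bool" where
  "wpar kind ro x Sr Nr Dr S K \<longleftrightarrow> (kind, ro, x, Sr, Nr, Dr, S, K) \<in> {(1, 2, 0, 70, 10, 11, SU, D), (2, 0, 2, 72, 12, 13, SV, E)}"

lemma tr_treeF:
  assumes p: "wpar kind ro x Sr Nr Dr S K" and F: "fr wscr F"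
  shows "tr (\<lambda>R M. WE R \<and> M = M0 \<and> F R) (treeF kind ro x Sr Dr) (38 * real K + 6) (tree (real kind) S ro x K)
    (\<lambda>R M. WE R \<and> M = M0 \<and> F R)"
proof -
  have rx: "(ro, x) \<in> {(2, 0), (0, 2)}" using p by (auto simp: wpar_def)
  have regs: "R Sr = S" "R Dr = real K" "R 93 = 0" "R 94 = 8" if "WE R" for R using p that by (auto simp: wpar_def WE_def)
  have ne: "Sr \<notin> {60, 66, 95}" "Dr \<notin> {60, 61, 66, 95}" using p by (auto simp: wpar_def)
  define F' where "F' = (\<lambda>R. WE R \<and> F R)"
  have WF: "WE R" if "F' R" for R using that by (simp add: F'_def)
  have F': "fr wscr F'" unfolding F'_def by (intro fr_conj fr_WE F)
  have u: "F' (R(r := v)) = F' R" if "r \<in> {33, 60, 61, 62, 63, 64, 65, 66, 67, 90, 95}" for R r v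
    using fr_upd[OF F', of r R v] that by (simp add: wscr_def)
  define I where "I k R M \<longleftrightarrow> F' R \<and> M = M0 \<and> R 60 = S \<and> R 61 = - S \<and> R 66 = 2 ^ k \<and> R 95 = real kind"
    for k :: nat and R :: regs and M :: memory
  have 1: "tr (\<lambda>R M. F' R \<and> M = M0) (Ar [(Const (real kind), 95, 0, 0), (Add, 60, Sr, 93), (Sub, 61, 93, 60), (Const 1, 66, 0, 0),
       (Add, 33, Dr, 93)]) 5 [] (\<lambda>R M. I 0 R M \<and> R 33 = real K)"
    by (rule tr_conseq[OF tr_Ar]) (use ne regs[OF WF] in \<open>auto simp: I_def u\<close>)
  have 2: "tr (\<lambda>R M. I 0 R M \<and> R 33 = real K) (For 33 (Seq (Ar [(Sub, 67, 93, 66), (Mul, 64, 94, 66), (Sub, 65, 93, 64),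
      (Add, 62, 64, 95), (Sub, 63, 93, 62)]) (Seq (levF ro x) (Ar [(Add, 66, 66, 66)]))))
     ((\<Sum>k<K. 35 + 3) + 1) (concat (map (\<lambda>k. lev (real kind) S ro x (2 ^ k)) [0..<K])) (\<lambda>R M. I K R M \<and> R 33 = 0)"
  proof (rule tr_for, goal_cases)
    case (1 k)
    let ?G = "\<lambda>R. F R \<and> R 33 = real (K - k) \<and> R 95 = real kind"
    have a: "tr (\<lambda>R M. I k R M \<and> R 33 = real (K - k)) (Ar [(Sub, 67, 93, 66), (Mul, 64, 94, 66), (Sub, 65, 93, 64),
      (Add, 62, 64, 95), (Sub, 63, 93, 62)]) 5 [] (\<lambda>R M. lenv (real kind) S (2 ^ k) R \<and> M = M0 \<and> ?G R)"
    proof (rule tr_ArI, goal_cases)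
      case (1 R M)
      then have "F' R" and i: "M = M0" "R 60 = S" "R 61 = - S" "R 66 = 2 ^ k" "R 95 = real kind" "R 33 = real (K - k)"
        by (auto simp: I_def)
      then have "WE R" "F R" by (auto simp: F'_def)
      then show ?case using i
        by (simp add: lenv_def regs fr_upd[OF fr_WE] fr_upd[OF F] wscr_def)
    qed auto
    have c: "tr (\<lambda>R M. lenv (real kind) S (2 ^ k) R \<and> M = M0 \<and> ?G R) (Ar [(Add, 66, 66, 66)]) 1 []
      (\<lambda>R M. I (Suc k) R M \<and> R 33 = real (K - k))"
    proof (rule tr_ArI, goal_cases)
      case (1 R M)
      then show ?case
        by (simp add: lenv_def I_def F'_def fr_upd[OF fr_WE] fr_upd[OF F] wscr_def)
    qed auto
    show ?case
      by (rule tr_conseq[OF tr_seq[OF a tr_seq[OF tr_levF[OF rx] c]]]) auto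
  next
    fix k R M v w assume "I k R M"
    then show "I k (R(90 := v, 33 := w)) M" by (simp add: I_def u)
  qed simp
  show ?thesis unfolding treeF_def tree_def
    by (rule tr_conseq[OF tr_seq[OF 1 2]]) (auto simp: I_def F'_def)
qed

lemma tr_treeB:
  assumes p: "wpar kind ro x Sr Nr Dr S K" and F: "fr wscr F"
  shows "tr (\<lambda>R M. WE R \<and> M = M0 \<and> F R) (treeB kind ro x Sr Nr Dr) (38 * real K + 6) (invs (tree (real kind) S ro x K))
    (\<lambda>R M. WE R \<and> M = M0 \<and> F R)"
proof -
  have rx: "(ro, x) \<in> {(2, 0), (0, 2)}" using p by (auto simp: wpar_def)
  have regs: "R Sr = S" "R Dr = real K" "R Nr = 2 ^ K" "R 93 = 0" "R 94 = 8" "R 96 = 1 / 2" if "WE R" for R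
    using p that by (auto simp: wpar_def WE_def)
  have ne: "Sr \<notin> {60, 66, 95}" "Nr \<notin> {60, 61, 95}" "Dr \<notin> {60, 61, 66, 95}" using p by (auto simp: wpar_def)
  define F' where "F' = (\<lambda>R. WE R \<and> F R)"
  have WF: "WE R" if "F' R" for R using that by (simp add: F'_def)
  have F': "fr wscr F'" unfolding F'_def by (intro fr_conj fr_WE F)
  have u: "F' (R(r := v)) = F' R" if "r \<in> {33, 60, 61, 62, 63, 64, 65, 66, 67, 90, 95}" for R r v
    using fr_upd[OF F', of r R v] that by (simp add: wscr_def)
  define I where "I k R M \<longleftrightarrow> F' R \<and> M = M0 \<and> R 60 = S \<and> R 61 = - S \<and> R 66 = 2 ^ K / 2 ^ k \<and> R 95 = real kind"
    for k :: nat and R :: regs and M :: memory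
  have 1: "tr (\<lambda>R M. F' R \<and> M = M0) (Ar [(Const (real kind), 95, 0, 0), (Add, 60, Sr, 93), (Sub, 61, 93, 60), (Add, 66, Nr, 93),
       (Add, 33, Dr, 93)]) 5 [] (\<lambda>R M. I 0 R M \<and> R 33 = real K)"
    by (rule tr_conseq[OF tr_Ar]) (use ne regs[OF WF] in \<open>auto simp: I_def u\<close>)
  have 2: "tr (\<lambda>R M. I 0 R M \<and> R 33 = real K) (For 33 (Seq (Ar [(Mul, 66, 66, 96), (Sub, 67, 93, 66), (Mul, 64, 94, 66), (Sub, 65, 93, 64),
      (Add, 62, 64, 95), (Sub, 63, 93, 62)]) (levB ro x)))
     ((\<Sum>k<K. 35 + 3) + 1) (concat (map (\<lambda>k. invs (lev (real kind) S ro x (2 ^ (K - Suc k)))) [0..<K])) (\<lambda>R M. I K R M \<and> R 33 = 0)"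
  proof (rule tr_for, goal_cases)
    case (1 k)
    note k = 1
    have e: "2 ^ K / (2 * 2 ^ k) = (2::real) ^ (K - Suc k)" using power_diff[of "2::real" "Suc k" K] k by simp
    let ?G = "\<lambda>R. F R \<and> R 33 = real (K - k) \<and> R 95 = real kind"
    have a: "tr (\<lambda>R M. I k R M \<and> R 33 = real (K - k)) (Ar [(Mul, 66, 66, 96), (Sub, 67, 93, 66), (Mul, 64, 94, 66), (Sub, 65, 93, 64),
      (Add, 62, 64, 95), (Sub, 63, 93, 62)]) 6 [] (\<lambda>R M. lenv (real kind) S (2 ^ (K - Suc k)) R \<and> M = M0 \<and> ?G R)"
    proof (rule tr_ArI, goal_cases)
      case (1 R M)
      then have "F' R" and i: "M = M0" "R 60 = S" "R 61 = - S" "R 66 = 2 ^ K / 2 ^ k" "R 95 = real kind" "R 33 = real (K - k)"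
        by (auto simp: I_def)
      then have "WE R" "F R" by (auto simp: F'_def)
      then show ?case using i
        by (simp add: lenv_def regs fr_upd[OF fr_WE] fr_upd[OF F] wscr_def e mult.commute[of _ 2])
    qed auto
    have c: "lenv (real kind) S (2 ^ (K - Suc k)) R \<and> M = M0 \<and> ?G R \<Longrightarrow> I (Suc k) R M \<and> R 33 = real (K - k)" for R M
      by (simp add: lenv_def I_def F'_def e)
    show ?case
      by (rule tr_conseq[OF tr_seq[OF a tr_levB[OF rx]]]) (use c in auto)
  next
    fix k R M v w assume "I k R M"
    then show "I k (R(90 := v, 33 := w)) M" by (simp add: I_def u)
  qed simp
  show ?thesis unfolding treeB_def invs_tree
    by (rule tr_conseq[OF tr_seq[OF 1 2]]) (auto simp: I_def F'_def)
qed

lemma tr_cWalk: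
  assumes F: "fr wscr F"
  shows "tr (\<lambda>R M. WE R \<and> M = M0 \<and> F R) (cWalk xe) (200 + 76 * (real D + real E)) Wops (\<lambda>R M. WE R \<and> M = M0 \<and> F R)"
proof -
  let ?P = "\<lambda>R M. WE R \<and> M = M0 \<and> F R"
  have w: "wpar 1 2 0 70 10 11 SU D" "wpar 2 0 2 72 12 13 SV E" by (auto simp: wpar_def)
  have cj: "tr ?P (Gs (Cj cs gs)) (2 * real (length cs) + real (length gs)) ys ?P"
    if "\<And>R. WE R \<Longrightarrow> blk R M0 cs gs ys" "\<And>p. p \<in> set ys \<Longrightarrow> tgt p \<inter> {11..<40} = {}" for cs gs ys
    by (rule tr_Cj) (use that in \<open>auto intro!: pcl_ops\<close>)
  note steps = tr_seq[OF tr_seq[OF cj[OF blk_beta] tr_seq[OF tr_treeF[OF w(2) F] cj[OF blk_junk]]]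
      tr_seq[OF tr_treeB[OF w(1) F] tr_seq[OF cj[OF blk_reflG] tr_seq[OF tr_treeF[OF w(1) F]
      tr_seq[OF tr_seq[OF cj[OF blk_junk'] tr_seq[OF tr_treeB[OF w(2) F] cj[OF blk_beta']]] cj[OF blk_reflZ]]]]]]
  show ?thesis
    unfolding cWalk_def prepG_def unprepG_def reflG_def reflZ_def
    by (rule tr_conseq[OF steps]) (auto simp: Wops_def Kops_def Gops_def junk_gates_def anc_gates_def)
qed

lemma tr_flagZ: "tr (\<lambda>R M. WE R \<and> M = M0 \<and> F R) flagZ 13 Fops (\<lambda>R M. WE R \<and> M = M0 \<and> F R)"
  unfolding flagZ_def by (rule tr_time[OF tr_Cj]) (auto intro!: blk_flagZ[unfolded Fops_def anc_gates_def] pcl_ops simp: Fops_def anc_gates_def)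

end

section \<open>The walk on basis states\<close>

context walk
begin

fun amp :: "real \<Rightarrow> real \<Rightarrow> real \<Rightarrow> nat \<Rightarrow> nat \<Rightarrow> real" where
  "amp kind S o' 0 r = (if r = 0 then 1 else 0)"
| "amp kind S o' (Suc d) r = (if r < 2 ^ d then amp kind S o' d r * cos (Ang kind S (2 ^ d) o' (real r))
     else amp kind S o' d (r - 2 ^ d) * sin (Ang kind S (2 ^ d) o' (real (r - 2 ^ d))))"

lemma lev_Ket:
  assumes "ro \<noteq> x" "ro \<noteq> 5" "x \<noteq> 5" "c 5 = 0" "c x = real r" "r < 2 ^ d"
  shows "aps (lev kind S ro x (2 ^ d)) (Ket c) =
    complex_of_real (cos (Ang kind S (2 ^ d) (c ro) (real r))) *q Ket c +
    complex_of_real (sin (Ang kind S (2 ^ d) (c ro) (real r))) *q Ket (c(x := real (r + 2 ^ d)))"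
proof -
  have r: "\<not> (2 ^ d \<le> real r)" "2 ^ d \<le> real r + 2 ^ d"
    using assms(6) by (simp_all add: not_le)
  have e: "c(x := real r) = c" using assms(5) by auto
  have 1: "ap (Ro 5 (\<lambda>c. Ang kind S (2 ^ d) (c ro) (c x))) (Ket c) =
    complex_of_real (cos (Ang kind S (2 ^ d) (c ro) (real r))) *q Ket c +
    complex_of_real (sin (Ang kind S (2 ^ d) (c ro) (real r))) *q Ket (c(5 := 1))"
    by (subst ap_Ro_Ket0) (use assms in simp_all)
  have 2: "ap (Tr x (\<lambda>c. c 5 * 2 ^ d)) (Ket c) = Ket c"
    by (subst ap_Tr_Ket) (use assms e in simp_all)
  have 3: "ap (Tr x (\<lambda>c. c 5 * 2 ^ d)) (Ket (c(5 := 1))) = Ket (c(5 := 1, x := real r + 2 ^ d))"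
    by (subst ap_Tr_Ket) (use assms in simp_all)
  have 4: "ap (Tr 5 (\<lambda>c. - leqr (2 ^ d) (c x))) (Ket c) = Ket c"
    by (subst ap_Tr_Ket) (use assms r in \<open>simp_all add: leqr_def fun_upd_idem\<close>)
  have "(c(5 := 1, x := real r + 2 ^ d))(5 := 0) = c(x := real r + 2 ^ d)"
    using assms by (auto simp: fun_eq_iff)
  then have 5: "ap (Tr 5 (\<lambda>c. - leqr (2 ^ d) (c x))) (Ket (c(5 := 1, x := real r + 2 ^ d))) = Ket (c(x := real r + 2 ^ d))"
    by (subst ap_Tr_Ket) (use assms r in \<open>simp_all add: leqr_def\<close>)
  show ?thesis unfolding lev_def
    by (simp only: aps_simps 1 2 3 4 5 ap_add ap_smul of_nat_add of_nat_power of_nat_numeral)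
qed

lemma tree_Suc: "tree kind S ro x (Suc K) = tree kind S ro x K @ lev kind S ro x (2 ^ K)"
  by (simp add: tree_def)

lemma tree_Ket:
  assumes "ro \<noteq> x" "ro \<noteq> 5" "x \<noteq> 5" "c 5 = 0" "c x = 0"
  shows "aps (tree kind S ro x K) (Ket c) =
    (\<Sum>r<2 ^ K. complex_of_real (amp kind S (c ro) K r) *q Ket (c(x := real r)))"
proof (induction K)
  case 0
  then show ?case using assms by (simp add: tree_def lessThan_Suc fun_upd_idem)
next
  case (Suc K)
  let ?a = "\<lambda>r. amp kind S (c ro) K r" and ?A = "\<lambda>r. Ang kind S (2 ^ K) (c ro) (real r)"
  have "aps (tree kind S ro x (Suc K)) (Ket c) =
    (\<Sum>r<2 ^ K. complex_of_real (?a r) *q aps (lev kind S ro x (2 ^ K)) (Ket (c(x := real r))))"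
    by (simp only: tree_Suc aps_simps Suc.IH aps_sum aps_smul)
  also have "\<dots> = (\<Sum>r<2 ^ K. complex_of_real (?a r * cos (?A r)) *q Ket (c(x := real r)) +
      complex_of_real (?a r * sin (?A r)) *q Ket (c(x := real (r + 2 ^ K))))"
  proof (rule sum.cong[OF refl])
    fix r :: nat assume "r \<in> {..<2 ^ K}"
    then have "aps (lev kind S ro x (2 ^ K)) (Ket (c(x := real r))) = complex_of_real (cos (?A r)) *q Ket (c(x := real r)) +
      complex_of_real (sin (?A r)) *q Ket (c(x := real (r + 2 ^ K)))"
      using assms by (subst lev_Ket[where r = r]) simp_all
    then show "complex_of_real (?a r) *q aps (lev kind S ro x (2 ^ K)) (Ket (c(x := real r))) =
      complex_of_real (?a r * cos (?A r)) *q Ket (c(x := real r)) +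
      complex_of_real (?a r * sin (?A r)) *q Ket (c(x := real (r + 2 ^ K)))"
      by (simp only: smul_add smul_smul of_real_mult)
  qed
  also have "\<dots> = (\<Sum>r<2 ^ K. complex_of_real (amp kind S (c ro) (Suc K) r) *q Ket (c(x := real r))) +
     (\<Sum>r<2 ^ K. complex_of_real (amp kind S (c ro) (Suc K) (r + 2 ^ K)) *q Ket (c(x := real (r + 2 ^ K))))"
    unfolding sum.distrib by (intro arg_cong2[of _ _ _ _ "(+)"] sum.cong) auto
  also have "(\<Sum>r<2 ^ K. complex_of_real (amp kind S (c ro) (Suc K) (r + 2 ^ K)) *q Ket (c(x := real (r + 2 ^ K)))) =
     (\<Sum>r\<in>{2 ^ K..<2 ^ Suc K}. complex_of_real (amp kind S (c ro) (Suc K) r) *q Ket (c(x := real r)))"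
    by (rule sum.reindex_bij_witness[of _ "\<lambda>r. r - 2 ^ K" "\<lambda>r. r + 2 ^ K"]) auto
  also have "(\<Sum>r<2 ^ K. complex_of_real (amp kind S (c ro) (Suc K) r) *q Ket (c(x := real r))) +
     (\<Sum>r\<in>{2 ^ K..<2 ^ Suc K}. complex_of_real (amp kind S (c ro) (Suc K) r) *q Ket (c(x := real r))) =
     (\<Sum>r<2 ^ Suc K. complex_of_real (amp kind S (c ro) (Suc K) r) *q Ket (c(x := real r)))"
    by (subst sum.union_disjoint[symmetric]) (auto intro!: sum.cong)
  finally show ?case .
qed

text \<open>The amplitude with which column index \<open>x\<close> reaches the good configuration of
  row \<open>r\<close> in the branch where cell 3 is 0: column tree, junk rotation, row tree. The
  last sum merely selects the leaf j with x = j, as a cell may hold any real number.\<close>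

definition co :: "real \<Rightarrow> nat \<Rightarrow> real" where
  "co x r = amp 2 SV x E r * cos (EAng x (real r)) * (\<Sum>j<2 ^ D. if x = real j then amp 1 SU (real r) D j else 0)"

text \<open>The matrix, between states with ancillas 0, of the projection obtained by conjugating
  the good subspace with \<open>Kops\<close>. The first summand is the identity block.\<close>

definition Bm :: "real \<Rightarrow> real \<Rightarrow> real" where
  "Bm x x' = (sin beta)\<^sup>2 * (if x = x' then 1 else 0) + (cos beta)\<^sup>2 * (\<Sum>r<2 ^ E. co x r * co x' r)"

definition anc :: "config \<Rightarrow> bool" where
  "anc c \<longleftrightarrow> c 2 = 0 \<and> c 3 = 0 \<and> c 4 = 0 \<and> c 5 = 0"

lemma anc0_anc: "anc0 c = anc c"
proof -
  have "c 2 * c 2 + c 3 * c 3 + c 4 * c 4 + c 5 * c 5 \<le> 0 \<longleftrightarrow> c 2 * c 2 = 0 \<and> c 3 * c 3 = 0 \<and> c 4 * c 4 = 0 \<and> c 5 * c 5 = 0"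
    using zero_le_square[of "c 2"] zero_le_square[of "c 3"] zero_le_square[of "c 4"] zero_le_square[of "c 5"] by linarith
  then show ?thesis by (simp add: anc0_def anc_def)
qed

lemma good_a0:
  assumes "c 3 = 0"
  shows "good c \<longleftrightarrow> c 4 = 0 \<and> c 0 = 0 \<and> c 5 = 0"
proof -
  have "c 4 * c 4 + c 0 * c 0 + c 5 * c 5 \<le> 0 \<longleftrightarrow> c 4 * c 4 = 0 \<and> c 0 * c 0 = 0 \<and> c 5 * c 5 = 0"
    using zero_le_square[of "c 4"] zero_le_square[of "c 0"] zero_le_square[of "c 5"] by linarith
  then show ?thesis using assms by (simp add: good_def)
qed

lemma good_a1: "c 3 = 1 \<Longrightarrow> good c"
  by (simp add: good_def)

definition G1 :: "qop list" where
  "G1 = tree 2 SV 0 2 E @ [Ro 4 (\<lambda>c. EAng (c 0) (c 2))]"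

definition K1 :: "qop list" where
  "K1 = G1 @ invs (tree 1 SU 2 0 D)"

lemma lev_on': "{ro, x, 5} \<subseteq> S \<Longrightarrow> ro \<noteq> x \<Longrightarrow> ro \<noteq> 5 \<Longrightarrow> x \<noteq> 5 \<Longrightarrow> ops_on S (lev kind S' ro x p)"
  by (auto simp: lev_def wfo_def indep_def dep_def)

lemma tree_on': "{ro, x, 5} \<subseteq> S \<Longrightarrow> ro \<noteq> x \<Longrightarrow> ro \<noteq> 5 \<Longrightarrow> x \<noteq> 5 \<Longrightarrow> ops_on S (tree kind S' ro x K)"
  unfolding tree_def by (intro ops_on_concat lev_on')

lemma G1_on: "ops_on {0, 2, 4, 5} G1"
  unfolding G1_def ops_on_simps by (auto intro!: tree_on') (auto simp: wfo_def indep_def dep_def)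

lemma K1_on: "ops_on {0, 2, 4, 5} K1"
  unfolding K1_def ops_on_simps ops_on_invs by (auto intro!: tree_on' G1_on)

lemma Kops_K1: "Kops = Ro 3 (\<lambda>_. beta) # K1"
  by (simp add: Kops_def Gops_def K1_def G1_def)

lemma K_Ket:
  assumes "c 3 = 0"
  shows "aps Kops (Ket c) = complex_of_real (cos beta) *q aps K1 (Ket c) + complex_of_real (sin beta) *q aps K1 (Ket (c(3 := 1)))"
proof -
  have "ap (Ro 3 (\<lambda>_. beta)) (Ket c) = complex_of_real (cos beta) *q Ket c + complex_of_real (sin beta) *q Ket (c(3 := 1))"
    by (rule ap_Ro_Ket0) (use assms in simp_all)
  then show ?thesis by (simp only: Kops_K1 aps_simps aps_add aps_smul)
qed

lemma restr_K1: "(\<And>c k v. k \<in> {0, 2, 4, 5} \<Longrightarrow> P (c(k := v)) = P c) \<Longrightarrow> restr P (aps K1 \<psi>) = aps K1 (restr P \<psi>)"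
  by (rule restr_ops_on[OF K1_on]) (simp add: indep_def)

lemma K1_supp: "aps K1 (Ket c) d \<noteq> 0 \<Longrightarrow> k \<notin> {0, 2, 4, 5} \<Longrightarrow> d k = c k"
proof (rule ccontr)
  assume *: "aps K1 (Ket c) d \<noteq> 0" "k \<notin> {0, 2, 4, 5}" "d k \<noteq> c k"
  have "restr (\<lambda>d. d k = c k) (aps K1 (Ket c)) = aps K1 (Ket c)"
    using *(2) by (subst restr_K1) (auto simp: restr_Ket)
  then have "restr (\<lambda>d. d k = c k) (aps K1 (Ket c)) d = aps K1 (Ket c) d" by simp
  then show False using * by (simp add: restr_def)
qed

lemma good_K1:
  assumes c: "anc c"
  shows "restr good (aps K1 (Ket c)) = (\<Sum>r<2 ^ E. complex_of_real (co (c 0) r) *q Ket (c(0 := 0, 2 := real r)))"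
proof
  fix d
  have wf: "wfs (tree 1 SU 2 0 D)" "wfs G1" using tree_on'[of 2 0 UNIV] G1_on by (auto simp: ops_on_def)
  let ?R = "(\<Sum>r<2 ^ E. complex_of_real (co (c 0) r) *q Ket (c(0 := 0, 2 := real r)))"
  have R0: "?R d = 0" if "\<And>r. d \<noteq> c(0 := 0, 2 := real r)"
    using that by (simp add: sum_fun_apply' Ket_def)
  show "restr good (aps K1 (Ket c)) d = ?R d"
  proof (cases "d 3 = 0 \<and> good d")
    case False
    have "good (c(0 := 0, 2 := real r))" "(c(0 := 0, 2 := real r)) 3 = 0" for r
      using c by (simp_all add: good_a0 anc_def)
    then have "?R d = 0" using False by (intro R0) auto
    moreover have "restr good (aps K1 (Ket c)) d = 0"
      using False K1_supp[of c d 3] c by (auto simp: restr_def anc_def)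
    ultimately show ?thesis by simp
  next
    case True
    then have d: "d 3 = 0" "d 4 = 0" "d 0 = 0" "d 5 = 0" using good_a0[of d] by auto
    let ?a = "\<lambda>r. amp 2 SV (c 0) E r" and ?E = "\<lambda>r. EAng (c 0) (real r)"
    have T2: "aps (tree 2 SV 0 2 E) (Ket c) = (\<Sum>r<2 ^ E. complex_of_real (?a r) *q Ket (c(2 := real r)))"
      by (rule tree_Ket) (use c in \<open>simp_all add: anc_def\<close>)
    have R4: "ap (Ro 4 (\<lambda>c. EAng (c 0) (c 2))) (Ket (c(2 := real r))) = complex_of_real (cos (?E r)) *q Ket (c(2 := real r))
      + complex_of_real (sin (?E r)) *q Ket (c(2 := real r, 4 := 1))" for r
      by (subst ap_Ro_Ket0) (use c in \<open>simp_all add: anc_def\<close>)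
    have G: "aps G1 (Ket c) = (\<Sum>r<2 ^ E. complex_of_real (?a r) *q (complex_of_real (cos (?E r)) *q Ket (c(2 := real r))
      + complex_of_real (sin (?E r)) *q Ket (c(2 := real r, 4 := 1))))"
      unfolding G1_def aps_simps T2 aps_sum[of "[Ro 4 (\<lambda>c. EAng (c 0) (c 2))]", unfolded aps_simps] ap_smul R4 ..
    have N: "aps (tree 1 SU 2 0 D) (Ket d) = (\<Sum>j<2 ^ D. complex_of_real (amp 1 SU (d 2) D j) *q Ket (d(0 := real j)))"
      by (rule tree_Ket) (use d in simp_all)
    have "aps K1 (Ket c) d = ip (Ket d) (aps (invs (tree 1 SU 2 0 D)) (aps G1 (Ket c)))"
      by (simp add: K1_def)
    \<comment> \<open>The inverse row tree is moved to the other side of the inner product, where it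
      acts forwards on a basis state and is known by \<open>tree_Ket\<close>.\<close>
    also have "\<dots> = ip (aps (tree 1 SU 2 0 D) (Ket d)) (aps G1 (Ket c))"
      using wf by (subst ip_aps_adj) (auto intro: fin_aps)
    also have "\<dots> = (\<Sum>j<2 ^ D. complex_of_real (amp 1 SU (d 2) D j) * aps G1 (Ket c) (d(0 := real j)))"
      using wf by (simp only: N ip_sum_left[OF fin_smul[OF fin_Ket] fin_aps[OF _ fin_Ket]] ip_smul_left[OF fin_Ket fin_aps[OF _ fin_Ket]]
        ip_Ket_left complex_cnj_complex_of_real simp_thms)
    also have "\<dots> = (\<Sum>j<2 ^ D. \<Sum>r<2 ^ E. complex_of_real (amp 1 SU (d 2) D j) *
      (if d(0 := real j) = c(2 := real r) then complex_of_real (?a r * cos (?E r)) else 0))"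
    proof (rule sum.cong[OF refl])
      fix j
      have "d(0 := real j) \<noteq> c(2 := real r, 4 := 1)" for r
        using d(2) by (metis fun_upd_other fun_upd_same zero_neq_numeral zero_neq_one)
      then show "complex_of_real (amp 1 SU (d 2) D j) * aps G1 (Ket c) (d(0 := real j)) = (\<Sum>r<2 ^ E. complex_of_real (amp 1 SU (d 2) D j) *
        (if d(0 := real j) = c(2 := real r) then complex_of_real (?a r * cos (?E r)) else 0))"
        unfolding G sum_fun_apply' sum_distrib_left by (intro sum.cong) (auto simp: Ket_def)
    qed
    also have "\<dots> = (\<Sum>r<2 ^ E. \<Sum>j<2 ^ D. (if d = c(0 := 0, 2 := real r) then
       complex_of_real (?a r * cos (?E r) * (if c 0 = real j then amp 1 SU (real r) D j else 0)) else 0))"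
    proof (subst sum.swap, intro sum.cong refl)
      fix r j
      have "d(0 := real j) = c(2 := real r) \<longleftrightarrow> c 0 = real j \<and> d = c(0 := 0, 2 := real r)"
      proof
        assume a: "d(0 := real j) = c(2 := real r)"
        then have "c 0 = real j" by (metis fun_upd_other fun_upd_same zero_neq_numeral)
        moreover have "d = (d(0 := real j))(0 := 0)" using d(3) by auto
        then have "d = c(0 := 0, 2 := real r)" using a by (simp add: fun_upd_twist)
        ultimately show "c 0 = real j \<and> d = c(0 := 0, 2 := real r)" by simp
      next
        assume "c 0 = real j \<and> d = c(0 := 0, 2 := real r)"
        then show "d(0 := real j) = c(2 := real r)" by (auto simp: fun_eq_iff)
      qed
      then show "complex_of_real (amp 1 SU (d 2) D j) * (if d(0 := real j) = c(2 := real r) then complex_of_real (?a r * cos (?E r)) else 0) =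
        (if d = c(0 := 0, 2 := real r) then complex_of_real (?a r * cos (?E r) * (if c 0 = real j then amp 1 SU (real r) D j else 0)) else 0)"
        by (auto simp: algebra_simps)
    qed
    also have "\<dots> = (\<Sum>r<2 ^ E. if d = c(0 := 0, 2 := real r) then complex_of_real (co (c 0) r) else 0)"
      by (intro sum.cong refl) (simp add: co_def sum_distrib_left)
    also have "\<dots> = ?R d"
      by (auto simp: sum_fun_apply' Ket_def intro!: sum.cong)
    finally show ?thesis using True by (simp add: restr_def)
  qed
qed

text \<open>The branches with cell 3 equal to 0 and to 1 are orthogonal, so there are no cross
  terms. The branch 1 is good throughout and unitary, and gives the identity block; the branch 0
  gives the Gram matrix of \<open>co\<close>.\<close>

lemma K_ip:
  assumes c: "anc c" "anc c'"
  shows "ip (aps Kops (Ket c)) (restr good (aps Kops (Ket c'))) =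
    (if c(0 := 0) = c'(0 := 0) then complex_of_real (Bm (c 0) (c' 0)) else 0)"
proof -
  let ?C = "complex_of_real (cos beta)" and ?S = "complex_of_real (sin beta)"
  let ?p = "aps K1 (Ket c)" and ?q = "aps K1 (Ket (c(3 := 1)))" and ?p' = "aps K1 (Ket c')" and ?q' = "aps K1 (Ket (c'(3 := 1)))"
  have wf: "wfs K1" using K1_on by (simp add: ops_on_def)
  have f: "fin ?p" "fin ?q" "fin ?p'" "fin ?q'" using wf by (auto intro: fin_aps)
  have q: "restr good ?q' = ?q'"
  proof
    fix x show "restr good ?q' x = ?q' x"
      using K1_supp[of "c'(3 := 1)" x 3] good_a1[of x] by (cases "?q' x = 0") (auto simp: restr_def)
  qed
  have disj: "ip \<psi> \<phi> = 0" if "\<And>d. \<psi> d \<noteq> 0 \<Longrightarrow> \<phi> d = 0" for \<psi> \<phi>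
    using that by (auto simp: ip_def intro!: sum.neutral)
  have s0: "d 3 = 0" if "aps K1 (Ket b) d \<noteq> 0" "anc b" for b d
    using K1_supp[of b d 3] that by (simp add: anc_def)
  have s1: "d 3 = 1" if "aps K1 (Ket (b(3 := 1))) d \<noteq> 0" for b d
    using K1_supp[of "b(3 := 1)" d 3] that by simp
  have z1: "ip ?p ?q' = 0"
  proof (rule disj)
    fix d assume "?p d \<noteq> 0"
    then show "?q' d = 0" using s0[of c d] s1[of c' d] c by force
  qed
  have z2: "ip ?q (restr good ?p') = 0"
  proof (rule disj)
    fix d assume "?q d \<noteq> 0"
    then have "?p' d = 0" using s0[of c' d] s1[of c d] c by force
    then show "restr good ?p' d = 0" by (simp add: restr_def)
  qed
  have qq: "ip ?q ?q' = (if c = c' then 1 else 0)"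
  proof -
    have "ip ?q ?q' = Ket (c'(3 := 1)) (c(3 := 1))" using wf by (simp add: ip_aps)
    moreover have "c(3 := 1) = c'(3 := 1) \<longleftrightarrow> c = c'"
    proof
      assume a: "c(3 := 1) = c'(3 := 1)"
      have "c = (c(3 := 1))(3 := 0)" "c' = (c'(3 := 1))(3 := 0)" using c by (auto simp: anc_def)
      then show "c = c'" using a by metis
    qed simp
    ultimately show ?thesis by (simp add: Ket_def)
  qed
  have "ip ?p (restr good ?p') = ip (restr good ?p) (restr good ?p')"
    using f ip_restr[of ?p good "restr good ?p'"] by (simp add: restr_restr)
  also have "\<dots> = (\<Sum>r<2 ^ E. complex_of_real (co (c 0) r) * restr good ?p' (c(0 := 0, 2 := real r)))"
    unfolding good_K1[OF c(1)]
    by (subst ip_sum_left) (use f in \<open>auto simp: ip_smul_left\<close>)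
  also have "\<dots> = (\<Sum>r<2 ^ E. complex_of_real (co (c 0) r) * (if c(0 := 0) = c'(0 := 0) then complex_of_real (co (c' 0) r) else 0))"
  proof (intro sum.cong refl arg_cong2[of _ _ _ _ "(*)"])
    fix r :: nat assume r: "r \<in> {..<2 ^ E}"
    have e: "c(0 := 0, 2 := real r) = c'(0 := 0, 2 := real r') \<longleftrightarrow> r = r' \<and> c(0 := 0) = c'(0 := 0)" for r'
    proof
      assume a: "c(0 := 0, 2 := real r) = c'(0 := 0, 2 := real r')"
      then have "r = r'" by (metis fun_upd_same of_nat_eq_iff)
      moreover have "c(0 := 0) = (c(0 := 0, 2 := real r))(2 := 0)" "c'(0 := 0) = (c'(0 := 0, 2 := real r'))(2 := 0)"
        using c by (auto simp: anc_def)
      ultimately show "r = r' \<and> c(0 := 0) = c'(0 := 0)" using a by metis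
    qed simp
    show "restr good ?p' (c(0 := 0, 2 := real r)) = (if c(0 := 0) = c'(0 := 0) then complex_of_real (co (c' 0) r) else 0)"
      unfolding good_K1[OF c(2)] using r by (simp add: sum_fun_apply' Ket_def e if_distrib if_distribR cong: if_cong)
  qed
  finally have pp: "ip ?p (restr good ?p') = (if c(0 := 0) = c'(0 := 0) then complex_of_real (\<Sum>r<2 ^ E. co (c 0) r * co (c' 0) r) else 0)"
    by auto
  have cc: "c = c' \<longleftrightarrow> c(0 := 0) = c'(0 := 0) \<and> c 0 = c' 0" by (metis fun_upd_idem_iff fun_upd_triv fun_upd_upd)
  have k: "aps Kops (Ket c) = ?C *q ?p + ?S *q ?q" "aps Kops (Ket c') = ?C *q ?p' + ?S *q ?q'"
    using c by (auto intro!: K_Ket simp: anc_def)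
  have "ip (aps Kops (Ket c)) (restr good (aps Kops (Ket c'))) = ?C * ?C * ip ?p (restr good ?p') + ?S * ?S * ip ?q ?q'"
    unfolding k restr_add restr_smul q
    using f by (simp add: ip_add_left ip_add_right ip_smul_left ip_smul_right z1 z2)
  then show ?thesis
    unfolding pp qq by (auto simp: cc Bm_def power2_eq_square)
qed

end

section \<open>The invariant planes\<close>

context walk
begin

definition Qop :: "qstate \<Rightarrow> qstate" where
  "Qop \<psi> = aps (invs Kops) (restr good (aps Kops \<psi>))"

lemma wf_K: "wfs Kops"
  using Kops_on by (simp add: ops_on_def)

lemma fin_K: "fin \<psi> \<Longrightarrow> fin (aps Kops \<psi>)" and fin_K': "fin \<psi> \<Longrightarrow> fin (aps (invs Kops) \<psi>)"
  using fin_aps[of Kops] fin_aps[of "invs Kops"] wf_K wfs_invs[of Kops] by blast+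

lemma fin_Qop: "fin \<psi> \<Longrightarrow> fin (Qop \<psi>)"
  unfolding Qop_def by (intro fin_K' fin_restr fin_K)

lemma Qop_add: "Qop (\<psi> + \<phi>) = Qop \<psi> + Qop \<phi>"
  by (simp only: Qop_def aps_add restr_add)

lemma Qop_smul: "Qop (a *q \<psi>) = a *q Qop \<psi>"
  by (simp only: Qop_def aps_smul restr_smul)

lemma Qop_diff: "Qop (\<psi> - \<phi>) = Qop \<psi> - Qop \<phi>"
  by (simp only: Qop_def aps_diff restr_diff)

lemma Qop_Qop: "Qop (Qop \<psi>) = Qop \<psi>"
  unfolding Qop_def by (simp only: aps_invs'[OF wf_K] restr_restr conj_absorb)

lemma ip_Qop: "fin \<psi> \<Longrightarrow> fin \<phi> \<Longrightarrow> ip \<psi> (Qop \<phi>) = ip (aps Kops \<psi>) (restr good (aps Kops \<phi>))"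
  unfolding Qop_def using wf_K by (subst ip_aps_adj) (auto intro!: fin_restr fin_K)

lemma ip_Qop': "fin \<psi> \<Longrightarrow> fin \<phi> \<Longrightarrow> ip (Qop \<psi>) \<phi> = ip \<psi> (Qop \<phi>)"
proof -
  assume f: "fin \<psi>" "fin \<phi>"
  have "ip (Qop \<psi>) \<phi> = cnj (ip (aps Kops \<phi>) (restr good (aps Kops \<psi>)))"
    using f by (subst ip_cnj[of \<phi>]) (simp_all add: fin_Qop ip_Qop)
  also have "\<dots> = ip (restr good (aps Kops \<psi>)) (aps Kops \<phi>)"
    using f by (subst ip_cnj[of "aps Kops \<phi>"]) (simp_all add: fin_K)
  also have "\<dots> = ip \<psi> (Qop \<phi>)" using f by (simp add: ip_Qop ip_restr fin_K)
  finally show ?thesis .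
qed

text \<open>The tensor product of the vector \<open>w\<close> in cell 0, ancillas equal to 0, and a
  state \<alpha> of the remaining cells. Keeping \<alpha> general allows control, outcomes and
  estimate to evolve alongside the plane.\<close>

definition Xs :: "nat \<Rightarrow> (nat \<Rightarrow> real) \<Rightarrow> qstate \<Rightarrow> qstate" where
  "Xs N w \<alpha> = (\<lambda>c. if anc c then (\<Sum>j<N. if c 0 = real j then complex_of_real (w j) else 0) * \<alpha> (c(0 := 0)) else 0)"

definition gz :: "qstate \<Rightarrow> bool" where
  "gz \<alpha> \<longleftrightarrow> fin \<alpha> \<and> (\<forall>c. \<alpha> c \<noteq> 0 \<longrightarrow> anc c \<and> c 0 = 0)"

lemma Xs_add: "Xs N w (\<alpha> + \<alpha>') = Xs N w \<alpha> + Xs N w \<alpha>'"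
  by (auto simp: Xs_def fun_eq_iff algebra_simps)

lemma Xs_smul: "Xs N w (a *q \<alpha>) = a *q Xs N w \<alpha>"
  by (auto simp: Xs_def fun_eq_iff algebra_simps)

lemma Xs_zero: "Xs N w 0 = 0"
  by (auto simp: Xs_def fun_eq_iff)

lemma Xs_sum: "Xs N w (\<Sum>i\<in>I. f i) = (\<Sum>i\<in>I. Xs N w (f i))" for f :: "'i \<Rightarrow> qstate"
  using sum_comp_morphism[of "Xs N w" f I] by (simp add: Xs_add Xs_zero o_def)

lemma Xs_Ket:
  assumes "anc c" "c 0 = 0"
  shows "Xs N w (Ket c) = (\<Sum>j<N. complex_of_real (w j) *q Ket (c(0 := real j)))"
proof
  fix d
  have e: "d = c(0 := real j) \<longleftrightarrow> anc d \<and> d(0 := 0) = c \<and> d 0 = real j" for j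
  proof
    assume "d = c(0 := real j)"
    then show "anc d \<and> d(0 := 0) = c \<and> d 0 = real j" using assms by (auto simp: anc_def)
  qed auto
  show "Xs N w (Ket c) d = (\<Sum>j<N. complex_of_real (w j) *q Ket (c(0 := real j))) d"
    unfolding sum_fun_apply' smul_apply Ket_def e Xs_def by (auto simp: sum_distrib_right intro!: sum.cong)
qed

lemma gz_expand: "gz \<alpha> \<Longrightarrow> Xs N w \<alpha> = (\<Sum>c | \<alpha> c \<noteq> 0. \<alpha> c *q Xs N w (Ket c))"
  by (subst fin_expand[of \<alpha>]) (simp_all only: gz_def Xs_sum Xs_smul)

lemma gz_add: "gz \<alpha> \<Longrightarrow> gz \<beta> \<Longrightarrow> gz (\<alpha> + \<beta>)"
  unfolding gz_def by (auto intro!: fin_add) (metis add_0)+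

lemma gz_smul: "gz \<alpha> \<Longrightarrow> gz (a *q \<alpha>)"
  unfolding gz_def by auto

lemma gz_restr: "gz \<alpha> \<Longrightarrow> gz (restr P \<alpha>)"
proof -
  assume a: "gz \<alpha>"
  then have "fin (restr P \<alpha>)" by (simp add: gz_def)
  moreover have "anc c \<and> c 0 = 0" if "restr P \<alpha> c \<noteq> 0" for c
    using a that by (auto simp: gz_def restr_def split: if_splits)
  ultimately show ?thesis unfolding gz_def by blast
qed

lemma gz_Ket: "anc c \<Longrightarrow> c 0 = 0 \<Longrightarrow> gz (Ket c)"
proof -
  assume a: "anc c" "c 0 = 0"
  have "anc d \<and> d 0 = 0" if "Ket c d \<noteq> 0" for d
    using a that by (auto simp: Ket_def split: if_splits)
  then show ?thesis unfolding gz_def by (simp add: a)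
qed

lemma fin_Xs: "gz \<alpha> \<Longrightarrow> fin (Xs N w \<alpha>)"
  by (subst gz_expand) (auto intro!: fin_sum fin_smul simp: gz_def Xs_Ket)

lemma restr_anc_Xs: "restr anc (Xs N w \<alpha>) = Xs N w \<alpha>"
  by (auto simp: restr_def Xs_def)

lemma ip_Xs:
  assumes "gz \<alpha>" "gz \<alpha>'"
  shows "ip (Xs N w \<alpha>) (Xs N w' \<alpha>') = complex_of_real (\<Sum>j<N. w j * w' j) * ip \<alpha> \<alpha>'"
proof -
  have 1: "ip (Xs N w (Ket c)) \<psi> = (\<Sum>j<N. complex_of_real (w j) * \<psi> (c(0 := real j)))" if "anc c" "c 0 = 0" "fin \<psi>" for c \<psi>
    using that by (simp add: Xs_Ket ip_sum_left ip_smul_left)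
  have 2: "Xs N w' \<alpha>' (c(0 := real j)) = complex_of_real (w' j) * \<alpha>' c" if "anc c" "c 0 = 0" "j < N" for c j
  proof -
    have "anc (c(0 := real j))" "(c(0 := 0)) = c" using that by (auto simp: anc_def)
    then show ?thesis using that by (simp add: Xs_def)
  qed
  have s: "anc c" "c 0 = 0" if "\<alpha> c \<noteq> 0" for c using assms(1) that by (auto simp: gz_def)
  have "ip (Xs N w \<alpha>) (Xs N w' \<alpha>') = (\<Sum>c | \<alpha> c \<noteq> 0. cnj (\<alpha> c) * ip (Xs N w (Ket c)) (Xs N w' \<alpha>'))"
    unfolding gz_expand[OF assms(1), of N w] using assms s
    by (subst ip_sum_left, (auto intro!: fin_smul fin_Xs gz_Ket)[2])
      (intro sum.cong refl ip_smul_left, auto intro!: fin_Xs gz_Ket)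
  also have "\<dots> = (\<Sum>c | \<alpha> c \<noteq> 0. cnj (\<alpha> c) * (complex_of_real (\<Sum>j<N. w j * w' j) * \<alpha>' c))"
    using assms s by (intro sum.cong refl) (simp add: 1 2 fin_Xs sum_distrib_right mult.assoc)
  finally show ?thesis by (simp add: ip_def sum_distrib_left algebra_simps)
qed

lemma Xs_commute:
  assumes xs: "ops_on S xs" and S: "S \<inter> MC = {}"
  shows "aps xs (Xs N w \<alpha>) = Xs N w (aps xs \<alpha>)"
proof -
  have *: "ap p (Xs N w \<alpha>) = Xs N w (ap p \<alpha>)" if p: "wfo p" "tgt p \<subseteq> S" "dep S (ofn p)" for p \<alpha>
  proof -
    have f: "ofn p (c(0 := 0)) = ofn p c" for c
      using dep_indep[OF p(3), of "{0}"] S by (auto simp: MC_def indep_def)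
    have a: "anc (c(k := v)) = anc c" "(c(k := v)) 0 = c 0" "(c(k := v))(0 := 0) = (c(0 := 0))(k := v)" "k \<noteq> 0"
      if "k \<in> tgt p" for c k v
    proof -
      have k: "k \<notin> MC" using that p(2) S by auto
      show "(c(k := v))(0 := 0) = (c(0 := 0))(k := v)" using k by (intro fun_upd_twist) (auto simp: MC_def)
      show "anc (c(k := v)) = anc c" "(c(k := v)) 0 = c 0" "k \<noteq> 0"
        using k by (auto simp: anc_def MC_def)
    qed
    show ?thesis
    proof (cases p)
      case (Tr k g)
      then have k: "k \<in> tgt p" by simp
      show ?thesis unfolding Tr using f[unfolded Tr] a[OF k] by (intro ext) (simp add: Xs_def translate_def)
    next
      case (Ro k g)
      then have k: "k \<in> tgt p" by simp
      show ?thesis unfolding Ro using f[unfolded Ro] a[OF k] by (intro ext) (simp add: Xs_def algebra_simps)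
    next
      case (Ph g)
      then show ?thesis using f by (auto simp: Xs_def fun_eq_iff)
    qed
  qed
  show ?thesis using xs by (induction xs arbitrary: \<alpha>) (auto simp: *)
qed

lemma Qop_commute:
  assumes xs: "ops_on S xs" and S: "S \<inter> MC = {}"
  shows "aps xs (Qop \<psi>) = Qop (aps xs \<psi>)"
proof -
  have "indep S good" using S by (auto simp: indep_def good_def MC_def)
  then have r: "aps xs (restr good \<phi>) = restr good (aps xs \<phi>)" for \<phi> by (rule restr_ops_on[OF xs, symmetric])
  have k: "aps xs (aps Kops \<phi>) = aps Kops (aps xs \<phi>)" "aps xs (aps (invs Kops) \<phi>) = aps (invs Kops) (aps xs \<phi>)" for \<phi>
    using aps_commute[OF xs Kops_on S] aps_commute[OF xs, of MC "invs Kops"] S Kops_on by simp_all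
  show ?thesis by (simp only: Qop_def r k)
qed

lemma gz_aps:
  assumes xs: "ops_on S xs" and S: "S \<inter> MC = {}" and "gz \<alpha>"
  shows "gz (aps xs \<alpha>)"
proof -
  let ?P = "\<lambda>c. anc c \<and> c 0 = 0"
  have g: "gz \<beta> \<longleftrightarrow> fin \<beta> \<and> restr ?P \<beta> = \<beta>" for \<beta>
    by (auto simp: gz_def restr_def fun_eq_iff)
  have "indep S ?P" using S by (auto simp: indep_def anc_def MC_def)
  then have "restr ?P (aps xs \<alpha>) = aps xs \<alpha>" using assms(3) by (subst restr_ops_on[OF xs]) (auto simp: g)
  then show ?thesis using assms(3) fin_aps[OF ops_on_wfs[OF xs]] by (auto simp: g)
qed

text \<open>The normalised component of Q X orthogonal to X: if Q has the value s^2 on X, then Q X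
  has squared norm s^2 and its remainder has squared norm s^2 - s^4 (for X of norm 1).\<close>

definition Ys :: "nat \<Rightarrow> (nat \<Rightarrow> real) \<Rightarrow> real \<Rightarrow> qstate \<Rightarrow> qstate" where
  "Ys N w s \<alpha> = complex_of_real (1 / (s * sqrt (1 - s\<^sup>2))) *q (Qop (Xs N w \<alpha>) - complex_of_real (s\<^sup>2) *q Xs N w \<alpha>)"

end

text \<open>Cell 0 may hold any real number, so the eigenvalue equation is imposed at every real
  index \<open>x\<close>; where \<open>x\<close> is not an index below \<open>N\<close>, it says
  that the left side vanishes.\<close>

locale plane = walk +
  fixes N :: nat and w :: "nat \<Rightarrow> real" and s :: real
  assumes s: "0 < s" "s < 1"
    and eig: "\<And>x. (\<Sum>j<N. Bm x (real j) * w j) = s\<^sup>2 * (\<Sum>j<N. if x = real j then w j else 0)"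
begin

abbreviation "X \<equiv> Xs N w"

abbreviation "Y \<equiv> Ys N w s"

text \<open>Within the plane, X makes an angle with cosine s with the range of Q, hence the angle
  arcsin s with its complement; the product of the two reflections rotates by twice that
  angle.\<close>

definition th :: real where
  "th = 2 * arcsin s"

lemma sin_th: "sin th = 2 * s * sqrt (1 - s\<^sup>2)" and cos_th: "cos th = 1 - 2 * s\<^sup>2"
  using s by (simp_all add: th_def sin_double cos_double_sin cos_arcsin)

lemma sq_pos: "0 < sqrt (1 - s\<^sup>2)" "(sqrt (1 - s\<^sup>2))\<^sup>2 = 1 - s\<^sup>2"
  using s abs_square_less_1[of s] by auto

lemma restr_Q_Ket:
  assumes "anc c" "c 0 = 0"
  shows "restr anc (Qop (X (Ket c))) = complex_of_real (s\<^sup>2) *q X (Ket c)"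
proof
  fix d
  show "restr anc (Qop (X (Ket c))) d = (complex_of_real (s\<^sup>2) *q X (Ket c)) d"
  proof (cases "anc d")
    case False
    then show ?thesis by (simp add: restr_def Xs_def)
  next
    case True
    have fx: "fin (X (Ket c))" using assms by (auto intro: fin_Xs gz_Ket)
    have a: "anc (c(0 := real j))" for j using assms by (simp add: anc_def)
    have "Qop (X (Ket c)) d = ip (Ket d) (Qop (X (Ket c)))" by simp
    also have "\<dots> = ip (aps Kops (Ket d)) (restr good (aps Kops (X (Ket c))))"
      using fx by (intro ip_Qop) auto
    also have "\<dots> = (\<Sum>j<N. complex_of_real (w j) * ip (aps Kops (Ket d)) (restr good (aps Kops (Ket (c(0 := real j))))))"
      by (simp only: Xs_Ket[OF assms] aps_sum aps_smul restr_sum restr_smul ip_sum_right ip_smul_right)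
    also have "\<dots> = (\<Sum>j<N. complex_of_real (w j) * (if d(0 := 0) = c then complex_of_real (Bm (d 0) (real j)) else 0))"
    proof -
      have "c(0 := 0) = c" using assms by auto
      then show ?thesis using True a by (intro sum.cong refl arg_cong2[of _ _ _ _ "(*)"]) (subst K_ip, simp_all)
    qed
    also have "\<dots> = (if d(0 := 0) = c then complex_of_real (\<Sum>j<N. Bm (d 0) (real j) * w j) else 0)"
      by (auto simp: mult.commute)
    also have "\<dots> = complex_of_real (s\<^sup>2) * X (Ket c) d"
      unfolding eig Xs_def Ket_def using True by (auto simp: if_distrib cong: if_cong)
    finally show ?thesis using True by (simp add: restr_def)
  qed
qed

lemma restr_Q: "gz \<alpha> \<Longrightarrow> restr anc (Qop (X \<alpha>)) = complex_of_real (s\<^sup>2) *q X \<alpha>"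
proof -
  assume a: "gz \<alpha>"
  have Qs: "Qop (\<Sum>i\<in>I. f i) = (\<Sum>i\<in>I. Qop (f i))" for f :: "config \<Rightarrow> qstate" and I
    by (simp only: Qop_def aps_sum restr_sum)
  show ?thesis
    unfolding gz_expand[OF a] Qs Qop_smul restr_sum restr_smul smul_sum
    using a by (intro sum.cong refl) (auto simp: gz_def restr_Q_Ket mult.commute)
qed

lemma QX: "Qop (X \<alpha>) = complex_of_real (s\<^sup>2) *q X \<alpha> + complex_of_real (s * sqrt (1 - s\<^sup>2)) *q Y \<alpha>"
proof -
  have "complex_of_real (s * sqrt (1 - s\<^sup>2)) * complex_of_real (1 / (s * sqrt (1 - s\<^sup>2))) = 1"
    using s sq_pos(1) by (simp flip: of_real_mult)
  then have "complex_of_real (s * sqrt (1 - s\<^sup>2)) *q Y \<alpha> = Qop (X \<alpha>) - complex_of_real (s\<^sup>2) *q X \<alpha>"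
    by (simp only: Ys_def smul_smul smul_one)
  then show ?thesis by (auto simp: fun_eq_iff)
qed

text \<open>Q is idempotent, so its value on Y is a multiple of its value on X: the range of Q meets
  the plane in a line.\<close>

lemma QY: "Qop (Y \<alpha>) = complex_of_real (sqrt (1 - s\<^sup>2) / s) *q Qop (X \<alpha>)"
proof -
  have "1 / (s * sqrt (1 - s\<^sup>2)) * (1 - s\<^sup>2) = sqrt (1 - s\<^sup>2) / s"
    using s sq_pos by (simp add: field_simps power2_eq_square)
  then have e: "complex_of_real (1 / (s * sqrt (1 - s\<^sup>2))) * (1 - complex_of_real (s\<^sup>2)) = complex_of_real (sqrt (1 - s\<^sup>2) / s)"
    by (metis of_real_1 of_real_diff of_real_mult)
  have "Qop (Y \<alpha>) = complex_of_real (1 / (s * sqrt (1 - s\<^sup>2))) *q (Qop (X \<alpha>) - complex_of_real (s\<^sup>2) *q Qop (X \<alpha>))"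
    by (simp only: Ys_def Qop_smul Qop_diff Qop_Qop)
  also have "Qop (X \<alpha>) - complex_of_real (s\<^sup>2) *q Qop (X \<alpha>) = (1 - complex_of_real (s\<^sup>2)) *q Qop (X \<alpha>)"
    by (auto simp: fun_eq_iff algebra_simps)
  finally show ?thesis by (simp only: smul_smul e)
qed

lemma restr_Y: "gz \<alpha> \<Longrightarrow> restr anc (Y \<alpha>) = 0"
  by (simp only: Ys_def restr_smul restr_diff restr_Q restr_anc_Xs diff_self smul_zero_right)

lemma fin_Y: "gz \<alpha> \<Longrightarrow> fin (Y \<alpha>)"
  unfolding Ys_def by (intro fin_smul fin_diff fin_Qop fin_Xs)

lemma Y_add: "Y (\<alpha> + \<beta>) = Y \<alpha> + Y \<beta>"
  unfolding Ys_def Xs_add Qop_add by (auto simp: fun_eq_iff algebra_simps)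

lemma Y_smul: "Y (a *q \<alpha>) = a *q Y \<alpha>"
  unfolding Ys_def Xs_smul Qop_smul by (auto simp: fun_eq_iff algebra_simps)

lemma Y_commute:
  assumes "ops_on S xs" "S \<inter> MC = {}"
  shows "aps xs (Y \<alpha>) = Y (aps xs \<alpha>)"
  unfolding Ys_def aps_smul aps_diff Qop_commute[OF assms] Xs_commute[OF assms] ..

text \<open>For control value 0 both phases are trivial and \<open>Kops\<close> cancels. For control
  value 1 they are the signs of two reflections, written with the projections \<open>Qop\<close> and
  \<open>restr anc\<close>.\<close>

lemma Wops_b:
  assumes "\<And>c. \<psi> c \<noteq> 0 \<Longrightarrow> c 6 = b"
  shows "b = 0 \<Longrightarrow> aps Wops \<psi> = \<psi>"
    "b = 1 \<Longrightarrow> aps Wops \<psi> = complex_of_real 2 *q restr anc (\<psi> - complex_of_real 2 *q Qop \<psi>) - (\<psi> - complex_of_real 2 *q Qop \<psi>)"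
proof -
  let ?P = "\<lambda>c :: config. c 6 = b"
  have i: "indep MC ?P" by (auto simp: indep_def MC_def)
  have r: "restr ?P \<psi> = \<psi>" using assms by (auto simp: restr_def fun_eq_iff)
  have rK: "restr ?P (aps Kops \<phi>) = aps Kops (restr ?P \<phi>)" "restr ?P (aps (invs Kops) \<phi>) = aps (invs Kops) (restr ?P \<phi>)" for \<phi>
    using i by (auto intro!: restr_ops_on simp: Kops_on)
  have supp: "\<phi> c \<noteq> 0 \<Longrightarrow> c 6 = b" if "restr ?P \<phi> = \<phi>" for \<phi> c
    using fun_cong[OF that, of c] unfolding restr_def by argo
  let ?g1 = "\<lambda>c :: config. angle (leqr ((c 4 * c 4 + c 0 * c 0 + c 5 * c 5) * (1 - c 3)) 0 * c 6 * pi)"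
  let ?g2 = "\<lambda>c :: config. angle ((1 - leqr (c 2 * c 2 + c 3 * c 3 + c 4 * c 4 + c 5 * c 5) 0) * c 6 * pi)"
  have ang: "angle pi = pi" "angle 0 = 0" by (simp_all add: angle_def)
  have s1: "c 6 = b" if "aps Kops \<psi> c \<noteq> 0" for c using supp[of "aps Kops \<psi>" c] that r by (simp add: rK)
  have Ph0: "ap (Ph (\<lambda>_. 0)) \<phi> = \<phi>" for \<phi> by simp
  {
    assume b: "b = 0"
    have "ap (Ph ?g1) (aps Kops \<psi>) = ap (Ph (\<lambda>_. 0)) (aps Kops \<psi>)"
    proof (rule ap_Ph_cong)
      fix c assume "aps Kops \<psi> c \<noteq> 0"
      then have "c 6 = 0" using s1[of c] b by simp
      then show "?g1 c = 0" by (simp add: ang)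
    qed
    moreover have "ap (Ph ?g2) \<psi> = ap (Ph (\<lambda>_. 0)) \<psi>"
    proof (rule ap_Ph_cong)
      fix c assume "\<psi> c \<noteq> 0"
      then have "c 6 = 0" using assms[of c] b by simp
      then show "?g2 c = 0" by (simp add: ang)
    qed
    ultimately show "aps Wops \<psi> = \<psi>"
      by (simp only: Wops_def aps_simps aps_invs[OF wf_K] Ph0)
  }
  {
    assume b: "b = 1"
    have 1: "ap (Ph ?g1) (aps Kops \<psi>) = aps Kops \<psi> - complex_of_real 2 *q restr good (aps Kops \<psi>)"
    proof
      fix c
      show "ap (Ph ?g1) (aps Kops \<psi>) c = (aps Kops \<psi> - complex_of_real 2 *q restr good (aps Kops \<psi>)) c"
        using s1[of c] b by (cases "aps Kops \<psi> c = 0") (auto simp: restr_def good_def leqr_def ang)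
    qed
    define \<chi> where "\<chi> = \<psi> - complex_of_real 2 *q Qop \<psi>"
    have 2: "aps (invs Kops) (aps Kops \<psi> - complex_of_real 2 *q restr good (aps Kops \<psi>)) = \<chi>"
      by (simp only: \<chi>_def aps_diff aps_smul aps_invs[OF wf_K] Qop_def)
    have "restr ?P (Qop \<psi>) = Qop \<psi>"
      unfolding Qop_def rK restr_restr
      by (simp add: conj_commute[of "_ = b"] flip: restr_restr) (simp add: rK r)
    then have rc: "restr ?P \<chi> = \<chi>" by (simp only: \<chi>_def restr_diff restr_smul r)
    have 3: "ap (Ph ?g2) \<chi> = complex_of_real 2 *q restr anc \<chi> - \<chi>"
    proof
      fix c
      show "ap (Ph ?g2) \<chi> c = (complex_of_real 2 *q restr anc \<chi> - \<chi>) c"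
        using supp[OF rc, of c] b anc0_anc[of c]
        by (cases "\<chi> c = 0") (auto simp: restr_def anc0_def leqr_def ang)
    qed
    show "aps Wops \<psi> = complex_of_real 2 *q restr anc (\<psi> - complex_of_real 2 *q Qop \<psi>) - (\<psi> - complex_of_real 2 *q Qop \<psi>)"
      unfolding Wops_def by (simp only: aps_simps 1 2 3 flip: \<chi>_def)
  }
qed

lemma restr6:
  assumes "\<And>c. \<alpha> c \<noteq> 0 \<Longrightarrow> c 6 = b"
  shows "X \<alpha> c \<noteq> 0 \<Longrightarrow> c 6 = b" "Y \<alpha> c \<noteq> 0 \<Longrightarrow> c 6 = b"
proof -
  let ?P = "\<lambda>c :: config. c 6 = b"
  have i: "indep MC ?P" by (auto simp: indep_def MC_def)
  have r: "restr ?P (X \<alpha>) = X \<alpha>" using assms by (auto simp: restr_def fun_eq_iff Xs_def)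
  have rK: "restr ?P (aps Kops \<phi>) = aps Kops (restr ?P \<phi>)" "restr ?P (aps (invs Kops) \<phi>) = aps (invs Kops) (restr ?P \<phi>)" for \<phi>
    using i by (auto intro!: restr_ops_on simp: Kops_on)
  have rr: "restr ?P (restr good \<phi>) = restr good (restr ?P \<phi>)" for \<phi>
    unfolding restr_restr by (rule arg_cong[of _ _ "\<lambda>P. restr P \<phi>"]) (rule ext, rule conj_commute)
  have "restr ?P (Y \<alpha>) = Y \<alpha>"
    unfolding Ys_def Qop_def restr_smul restr_diff rK rr r ..
  then have "restr ?P (X \<alpha>) c = X \<alpha> c" "restr ?P (Y \<alpha>) c = Y \<alpha> c" unfolding r by simp_all
  then show "X \<alpha> c \<noteq> 0 \<Longrightarrow> c 6 = b" "Y \<alpha> c \<noteq> 0 \<Longrightarrow> c 6 = b"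
    unfolding restr_def by argo+
qed

lemma Wops_0:
  assumes "\<And>c. \<alpha> c \<noteq> 0 \<Longrightarrow> c 6 = 0"
  shows "aps Wops (X \<alpha>) = X \<alpha>" "aps Wops (Y \<alpha>) = Y \<alpha>"
proof -
  have "c 6 = 0" if "X \<alpha> c \<noteq> 0" for c using restr6(1)[OF _ that] assms by blast
  then show "aps Wops (X \<alpha>) = X \<alpha>" by (rule Wops_b(1)[OF _ refl])
  have "c 6 = 0" if "Y \<alpha> c \<noteq> 0" for c using restr6(2)[OF _ that] assms by blast
  then show "aps Wops (Y \<alpha>) = Y \<alpha>" by (rule Wops_b(1)[OF _ refl])
qed

lemma Wops_1:
  assumes "\<And>c. \<alpha> c \<noteq> 0 \<Longrightarrow> c 6 = 1" "gz \<alpha>"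
  shows "aps Wops (X \<alpha>) = complex_of_real (cos th) *q X \<alpha> + complex_of_real (sin th) *q Y \<alpha>"
    "aps Wops (Y \<alpha>) = complex_of_real (cos th) *q Y \<alpha> - complex_of_real (sin th) *q X \<alpha>"
proof -
  let ?s = "complex_of_real s" and ?r = "complex_of_real (sqrt (1 - s\<^sup>2))"
  have r2: "?r * ?r = 1 - ?s * ?s" using sq_pos(2) by (metis of_real_1 of_real_diff of_real_mult power2_eq_square)
  have s0: "?s \<noteq> 0" using s by simp
  have x6: "c 6 = 1" if "X \<alpha> c \<noteq> 0" for c using restr6(1)[OF _ that] assms(1) by blast
  have y6: "c 6 = 1" if "Y \<alpha> c \<noteq> 0" for c using restr6(2)[OF _ that] assms(1) by blast
  have W1: "aps Wops \<psi> = complex_of_real 2 *q restr anc (\<psi> - complex_of_real 2 *q Qop \<psi>) - (\<psi> - complex_of_real 2 *q Qop \<psi>)"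
    if "\<psi> \<in> {X \<alpha>, Y \<alpha>}" for \<psi>
    by (rule Wops_b(2)[of \<psi> 1]) (use that x6 y6 in auto)
  have "aps Wops (X \<alpha>) c = (complex_of_real (cos th) *q X \<alpha> + complex_of_real (sin th) *q Y \<alpha>) c" for c
  proof -
    have 1: "restr anc (X \<alpha> - complex_of_real 2 *q Qop (X \<alpha>)) = X \<alpha> - complex_of_real 2 *q complex_of_real (s\<^sup>2) *q X \<alpha>"
      by (simp only: restr_diff restr_smul restr_anc_Xs restr_Q[OF assms(2)])
    have "aps Wops (X \<alpha>) c = 2 * (X \<alpha> c - 2 * (?s * ?s * X \<alpha> c)) - (X \<alpha> c - 2 * Qop (X \<alpha>) c)"
      unfolding W1[of "X \<alpha>", OF insertI1] 1 by (simp add: power2_eq_square)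
    then show ?thesis by (simp add: QX cos_th sin_th algebra_simps power2_eq_square)
  qed
  then show "aps Wops (X \<alpha>) = complex_of_real (cos th) *q X \<alpha> + complex_of_real (sin th) *q Y \<alpha>" ..
  have "aps Wops (Y \<alpha>) c = (complex_of_real (cos th) *q Y \<alpha> - complex_of_real (sin th) *q X \<alpha>) c" for c
  proof -
    have 1: "restr anc (Y \<alpha> - complex_of_real 2 *q Qop (Y \<alpha>)) =
        0 - complex_of_real 2 *q complex_of_real (sqrt (1 - s\<^sup>2) / s) *q complex_of_real (s\<^sup>2) *q X \<alpha>"
      by (simp only: QY restr_diff restr_smul restr_Y[OF assms(2)] restr_Q[OF assms(2)])
    have "aps Wops (Y \<alpha>) c = 2 * (0 - 2 * (?r / ?s * (?s * ?s * X \<alpha> c))) - (Y \<alpha> c - 2 * (?r / ?s * Qop (X \<alpha>) c))"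
      unfolding W1[of "Y \<alpha>", OF insertI2[OF singletonI]] 1 unfolding QY by (simp add: power2_eq_square)
    also have "\<dots> = - (4 * (?r / ?s * (?s * ?s)) * X \<alpha> c) - Y \<alpha> c
        + 2 * (?r / ?s) * (?s * ?s * X \<alpha> c + ?s * ?r * Y \<alpha> c)"
      by (simp add: QX power2_eq_square)
    also have "\<dots> = - (2 * ?s * ?r * X \<alpha> c) + (2 * (?r * ?r) - 1) * Y \<alpha> c"
      using s0 by (simp add: field_simps)
    also have "\<dots> = (1 - 2 * (?s * ?s)) * Y \<alpha> c - 2 * ?s * ?r * X \<alpha> c"
      unfolding r2 by (simp add: algebra_simps)
    finally show ?thesis by (simp add: cos_th sin_th power2_eq_square)
  qed
  then show "aps Wops (Y \<alpha>) = complex_of_real (cos th) *q Y \<alpha> - complex_of_real (sin th) *q X \<alpha>" ..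
qed

text \<open>X has ancillas 0, and Y has no component with ancillas 0 (\<open>restr_Y\<close>). The
  test of the ancillas therefore separates the two parts exactly, and the flag can be set on Y
  alone.\<close>

lemma Fops_X: "aps Fops (X \<alpha>) = X \<alpha>"
  and Fops_Y: "gz \<alpha> \<Longrightarrow> aps Fops (Y \<alpha>) = Y (ap (Tr 6 (\<lambda>_. 1)) \<alpha>)"
proof -
  let ?f = "\<lambda>c :: config. 1 - leqr (c 2 * c 2 + c 3 * c 3 + c 4 * c 4 + c 5 * c 5) 0"
  have f: "?f c = (if anc c then 0 else 1)" for c
    using anc0_anc[of c] by (simp add: leqr_def anc0_def)
  have a6: "anc (c(6 := v)) = anc c" for c v by (simp add: anc_def)
  have F: "aps Fops \<psi> c = (if anc c then \<psi> c else \<psi> (c(6 := c 6 - 1)))" for \<psi> c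
    by (simp add: Fops_def translate_def f)
  show "aps Fops (X \<alpha>) = X \<alpha>"
  proof
    fix c show "aps Fops (X \<alpha>) c = X \<alpha> c" unfolding F by (simp add: Xs_def a6)
  qed
  assume g: "gz \<alpha>"
  have z: "Y \<alpha> c = 0" if "anc c" for c
    using fun_cong[OF restr_Y[OF g], of c] that by (simp add: restr_def)
  have "aps [Tr 6 (\<lambda>_. 1)] (Y \<alpha>) = Y (aps [Tr 6 (\<lambda>_. 1)] \<alpha>)"
    by (rule Y_commute[of "{6}"]) (auto simp: wfo_def indep_def dep_def MC_def)
  moreover have "aps Fops (Y \<alpha>) = aps [Tr 6 (\<lambda>_. 1)] (Y \<alpha>)"
  proof
    fix c show "aps Fops (Y \<alpha>) c = aps [Tr 6 (\<lambda>_. 1)] (Y \<alpha>) c"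
      unfolding F by (simp add: translate_def z a6)
  qed
  ultimately show "aps Fops (Y \<alpha>) = Y (ap (Tr 6 (\<lambda>_. 1)) \<alpha>)" by (simp del: ap.simps)
qed

lemma ip_Y:
  assumes "gz \<alpha>" "fin \<psi>" "restr anc \<psi> = \<psi>"
  shows "ip \<psi> (Y \<alpha>) = 0"
proof -
  have "ip \<psi> (Y \<alpha>) = ip \<psi> (restr anc (Y \<alpha>))" using assms by (simp add: ip_restr)
  then show ?thesis using assms(1) by (simp add: restr_Y)
qed

lemma ip_Q:
  assumes "gz \<alpha>" "fin \<psi>" "restr anc \<psi> = \<psi>"
  shows "ip \<psi> (Qop (X \<alpha>)) = complex_of_real (s\<^sup>2) * ip \<psi> (X \<alpha>)"
proof -
  have "ip \<psi> (Qop (X \<alpha>)) = ip \<psi> (restr anc (Qop (X \<alpha>)))" using assms by (simp add: ip_restr)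
  then show ?thesis using assms(1) by (simp add: restr_Q ip_smul_right)
qed

end

locale planes = walk +
  fixes k N :: nat and w :: "nat \<Rightarrow> nat \<Rightarrow> real" and s :: "nat \<Rightarrow> real"
  assumes plane: "\<And>i. i < k \<Longrightarrow> plane M0 n SU SV Sh beta xe D E N (w i) (s i)"
    and ortho: "\<And>i i'. i < k \<Longrightarrow> i' < k \<Longrightarrow> (\<Sum>j<N. w i j * w i' j) = (if i = i' then 1 else 0)"
begin

lemma ip_XX:
  "i < k \<Longrightarrow> i' < k \<Longrightarrow> gz \<alpha> \<Longrightarrow> gz \<alpha>' \<Longrightarrow> ip (Xs N (w i) \<alpha>) (Xs N (w i') \<alpha>') = (if i = i' then ip \<alpha> \<alpha>' else 0)"
  by (simp add: ip_Xs ortho)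

lemma ip_XY:
  assumes "i < k" "i' < k" "gz \<alpha>" "gz \<alpha>'"
  shows "ip (Xs N (w i) \<alpha>) (Ys N (w i') (s i') \<alpha>') = 0"
  using assms by (intro plane.ip_Y[OF plane] fin_Xs restr_anc_Xs)

text \<open>Q is symmetric and takes Y to a multiple of Q X, whose component with ancillas 0 is a
  multiple of X. Inner products of Y parts thus reduce to those of X parts, where orthonormality of
  the vectors applies.\<close>

lemma ip_YY:
  assumes i: "i < k" "i' < k" and g: "gz \<alpha>" "gz \<alpha>'"
  shows "ip (Ys N (w i) (s i) \<alpha>) (Ys N (w i') (s i') \<alpha>') = (if i = i' then ip \<alpha> \<alpha>' else 0)"
proof -
  interpret P: plane M0 n SU SV Sh beta xe D E N "w i" "s i" by (rule plane[OF i(1)])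
  interpret P': plane M0 n SU SV Sh beta xe D E N "w i'" "s i'" by (rule plane[OF i(2)])
  note f = fin_Xs[OF g(1)] fin_Xs[OF g(2)] P.fin_Y[OF g(1)] P'.fin_Y[OF g(2)]
  have x: "ip (Xs N (w i) \<alpha>) (Ys N (w i') (s i') \<alpha>') = 0" by (rule ip_XY[OF i g])
  have "ip (Qop (Xs N (w i) \<alpha>)) (P'.Y \<alpha>') = ip (Xs N (w i) \<alpha>) (complex_of_real (sqrt (1 - (s i')\<^sup>2) / s i') *q Qop (P'.X \<alpha>'))"
    by (simp only: ip_Qop'[OF f(1,4)] P'.QY)
  also have "\<dots> = complex_of_real (sqrt (1 - (s i')\<^sup>2) / s i') * (complex_of_real ((s i')\<^sup>2) * ip (P.X \<alpha>) (P'.X \<alpha>'))"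
    by (simp only: ip_smul_right P'.ip_Q[OF g(2) fin_Xs[OF g(1)] restr_anc_Xs])
  finally have q: "ip (Qop (P.X \<alpha>)) (P'.Y \<alpha>') =
    (if i = i' then complex_of_real (s i' * sqrt (1 - (s i')\<^sup>2)) * ip \<alpha> \<alpha>' else 0)"
    using P'.s by (simp add: ip_XX[OF i g] power2_eq_square)
  have "ip (P.Y \<alpha>) (P'.Y \<alpha>') = complex_of_real (1 / (s i * sqrt (1 - (s i)\<^sup>2))) *
      (ip (Qop (P.X \<alpha>)) (P'.Y \<alpha>') - complex_of_real ((s i)\<^sup>2) * ip (P.X \<alpha>) (P'.Y \<alpha>'))"
    by (subst (1) Ys_def) (simp add: ip_smul_left ip_diff_left f fin_Qop)
  then show ?thesis
    using P'.s P'.sq_pos(1) unfolding q x by (simp flip: of_real_mult)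
qed

text \<open>Pythagoras over mutually orthogonal planes. It bounds the error on a superposition of
  singular vectors by the largest error on a single one.\<close>

lemma nsq_planes:
  assumes a: "\<And>i. i < k \<Longrightarrow> gz (a i)" and b: "\<And>i. i < k \<Longrightarrow> gz (b i)"
  shows "nsq (\<Sum>i<k. x i *q (Xs N (w i) (a i) + Ys N (w i) (s i) (b i))) =
    (\<Sum>i<k. (cmod (x i))\<^sup>2 * (nsq (a i) + nsq (b i)))"
proof -
  let ?f = "\<lambda>i. Xs N (w i) (a i) + Ys N (w i) (s i) (b i)"
  have f: "fin (Xs N (w i) (a i))" "fin (Ys N (w i) (s i) (b i))" if "i < k" for i
    using that a b by (auto intro: fin_Xs plane.fin_Y[OF plane])
  have Y0: "ip (Ys N (w i) (s i) (b i)) (Xs N (w j) (a j)) = 0" if "i < k" "j < k" for i j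
    using that ip_XY[of j i "a j" "b i"] ip_cnj[of "Xs N (w j) (a j)" "Ys N (w i) (s i) (b i)"] a b f by simp
  have ff: "ip (?f i) (?f j) = (if i = j then complex_of_real (nsq (a i) + nsq (b i)) else 0)" if "i < k" "j < k" for i j
    using that a b f by (simp add: ip_add_left ip_add_right ip_XX ip_YY ip_XY Y0 ip_self)
  have "complex_of_real (nsq (\<Sum>i<k. x i *q ?f i)) = (\<Sum>i<k. \<Sum>j<k. cnj (x i) * (x j * ip (?f i) (?f j)))"
  proof -
    let ?S = "\<Sum>i<k. x i *q ?f i"
    have fS: "fin ?S" using f by (intro fin_sum fin_smul fin_add) auto
    have "ip ?S ?S = (\<Sum>i<k. ip (x i *q ?f i) ?S)"
      using f fS by (intro ip_sum_left fin_smul fin_add) auto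
    also have "\<dots> = (\<Sum>i<k. \<Sum>j<k. cnj (x i) * (x j * ip (?f i) (?f j)))"
      using f fS by (intro sum.cong refl) (subst ip_smul_left, auto simp: ip_sum_right ip_smul_right sum_distrib_left)
    finally show ?thesis by (simp only: ip_self)
  qed
  also have "\<dots> = (\<Sum>i<k. cnj (x i) * (x i * complex_of_real (nsq (a i) + nsq (b i))))"
  proof (rule sum.cong[OF refl])
    fix i assume i: "i \<in> {..<k}"
    have "(\<Sum>j<k. cnj (x i) * (x j * ip (?f i) (?f j))) = (\<Sum>j<k. if i = j then cnj (x i) * (x i * complex_of_real (nsq (a i) + nsq (b i))) else 0)"
      using i by (intro sum.cong refl) (simp add: ff)
    then show "(\<Sum>j<k. cnj (x i) * (x j * ip (?f i) (?f j))) = cnj (x i) * (x i * complex_of_real (nsq (a i) + nsq (b i)))"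
      using i by simp
  qed
  also have "\<dots> = complex_of_real (\<Sum>i<k. (cmod (x i))\<^sup>2 * (nsq (a i) + nsq (b i)))"
  proof -
    have "cnj z * (z * r) = complex_of_real ((cmod z)\<^sup>2) * r" for z r
      using complex_norm_square[of z] by (simp add: mult.commute mult.left_commute)
    then show ?thesis by (simp only: of_real_sum of_real_mult)
  qed
  finally show ?thesis by (simp only: of_real_eq_iff)
qed

end

section \<open>One phase test\<close>

definition rep :: "nat \<Rightarrow> (nat \<Rightarrow> qop list) \<Rightarrow> qop list" where
  "rep j f = concat (map f [0..<j])"

lemma rep_simps [simp]: "rep 0 f = []" "rep (Suc j) f = rep j f @ f j"
  by (simp_all add: rep_def)

text \<open>Moves the bit of cell 6 into cell \<open>k\<close>, provided that \<open>k\<close> holds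
  0, and thereby frees cell 6 for the next use.\<close>

definition mv :: "nat \<Rightarrow> qop list" where
  "mv k = [Tr k (\<lambda>c. c 6), Tr 6 (\<lambda>c. - c k)]"

text \<open>A Hadamard test of the 2^l-th power of the walk relative to the estimate in cell 9. The
  extra phase pi/2 turns the response into a sine, which near 0 shows both sign and size of the
  deviation. The estimate is compensated after each walk step, not once at the end, because angles
  are limited to 2 pi.\<close>

definition testops :: "qop list \<Rightarrow> nat \<Rightarrow> nat \<Rightarrow> qop list" where
  "testops W l k = [Ro 6 (\<lambda>_. pi / 4)] @ rep (2 ^ l) (\<lambda>_. W @ [Ph (\<lambda>c. angle (- (c 6 * c 9)))]) @
     [Ph (\<lambda>c. angle (pi / 2 * c 6)), Ro 6 (\<lambda>_. - (pi / 4))] @ mv k"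

definition Ex :: "(config \<Rightarrow> real) \<Rightarrow> qstate \<Rightarrow> real" where
  "Ex f \<alpha> = (\<Sum>c | \<alpha> c \<noteq> 0. f c * (cmod (\<alpha> c))\<^sup>2)"

definition sp :: "qstate \<Rightarrow> (config \<Rightarrow> bool) \<Rightarrow> bool" where
  "sp \<alpha> P \<longleftrightarrow> fin \<alpha> \<and> (\<forall>c. \<alpha> c \<noteq> 0 \<longrightarrow> P c)"

lemma spI: "fin \<alpha> \<Longrightarrow> (\<And>c. \<alpha> c \<noteq> 0 \<Longrightarrow> P c) \<Longrightarrow> sp \<alpha> P"
  and spD: "sp \<alpha> P \<Longrightarrow> \<alpha> c \<noteq> 0 \<Longrightarrow> P c"
  and sp_fin: "sp \<alpha> P \<Longrightarrow> fin \<alpha>"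
  by (simp_all add: sp_def)

lemma sp_mono: "sp \<alpha> P \<Longrightarrow> (\<And>c. P c \<Longrightarrow> Q c) \<Longrightarrow> sp \<alpha> Q"
  by (simp add: sp_def)

lemma sp_zero: "sp \<alpha> P \<Longrightarrow> \<not> P c \<Longrightarrow> \<alpha> c = 0"
  by (auto simp: sp_def)

lemma Ex_super: "finite S \<Longrightarrow> (\<And>c. c \<notin> S \<Longrightarrow> \<alpha> c = 0) \<Longrightarrow> Ex f \<alpha> = (\<Sum>c\<in>S. f c * (cmod (\<alpha> c))\<^sup>2)"
  unfolding Ex_def by (rule sum.mono_neutral_left) auto

lemma Ex_mono: "(\<And>c. \<alpha> c \<noteq> 0 \<Longrightarrow> f c \<le> g c) \<Longrightarrow> Ex f \<alpha> \<le> Ex g \<alpha>"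
  unfolding Ex_def by (intro sum_mono mult_right_mono) auto

lemma Ex_add: "Ex (\<lambda>c. f c + g c) \<alpha> = Ex f \<alpha> + Ex g \<alpha>"
  by (simp add: Ex_def sum.distrib distrib_right)

lemma Ex_const: "Ex (\<lambda>c. a) \<alpha> = a * nsq \<alpha>"
  by (simp add: Ex_def nsq_def sum_distrib_left)

lemma Ex_restr: "fin \<alpha> \<Longrightarrow> nsq (restr P \<alpha>) = Ex (\<lambda>c. if P c then 1 else 0) \<alpha>"
  unfolding Ex_def by (subst nsq_super[of "{c. \<alpha> c \<noteq> 0}"]) (auto simp: fin_def restr_def intro!: sum.cong)

lemma ap_Ro_Ket1:
  assumes g: "\<And>v. g (c(k := v)) = g c" and c: "c k = 1"
  shows "ap (Ro k g) (Ket c) = complex_of_real (- sin (g c)) *q Ket (c(k := 0)) + complex_of_real (cos (g c)) *q Ket c"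
proof
  fix d :: config
  consider "d k = 0" | "d k = 1" | "d k \<noteq> 0" "d k \<noteq> 1" by blast
  then show "ap (Ro k g) (Ket c) d = (complex_of_real (- sin (g c)) *q Ket (c(k := 0)) + complex_of_real (cos (g c)) *q Ket c) d"
  proof cases
    case 1
    then have 3: "d(k := 0) = d" "d \<noteq> c" using c by auto
    have "d(k := 1) = c \<longleftrightarrow> d = c(k := 0)"
    proof
      assume "d(k := 1) = c"
      then show "d = c(k := 0)" using 1 by auto
    qed (use c in auto)
    then show ?thesis using 1 3 g[of 0] by (simp add: Ket_def)
  next
    case 2
    then have "d(k := 1) = d" "d(k := 0) \<noteq> c" "d \<noteq> c(k := 0)" using c by auto
    then show ?thesis using 2 by (simp add: Ket_def)
  next
    case 3
    then have "d \<noteq> c" "d \<noteq> c(k := 0)" using c by auto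
    then show ?thesis using 3 by (simp add: Ket_def)
  qed
qed

lemma angle_id: "\<bar>x\<bar> \<le> 2 * pi \<Longrightarrow> angle x = x"
  by (simp add: angle_def)

definition amp1 :: "real \<Rightarrow> real \<Rightarrow> nat \<Rightarrow> complex" where
  "amp1 \<phi> mid l = cis (2 ^ l * (\<phi> - mid) + pi / 2)"

definition prb :: "real \<Rightarrow> real \<Rightarrow> nat \<Rightarrow> real" where
  "prb \<phi> mid l = (1 + sin (2 ^ l * (\<phi> - mid))) / 2"

text \<open>The test with the walk replaced by the phase \<phi> of an eigenvector, controlled by
  cell 6. It is analysed by itself and carried over to the walk by \<open>lift_test\<close>.\<close>

abbreviation gtest :: "real \<Rightarrow> nat \<Rightarrow> nat \<Rightarrow> qop list" where
  "gtest \<phi> \<equiv> testops [Ph (\<lambda>c. \<phi> * c 6)]"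

lemma cmod_amp1: "(cmod ((1 + amp1 \<phi> mid l) / 2))\<^sup>2 = 1 - prb \<phi> mid l" "(cmod ((amp1 \<phi> mid l - 1) / 2))\<^sup>2 = prb \<phi> mid l"
proof -
  let ?x = "2 ^ l * (\<phi> - mid)"
  have c: "cos (?x + pi / 2) = - sin ?x" by (simp add: cos_add)
  have "(cmod (1 + cis y))\<^sup>2 = 2 + 2 * cos y" "(cmod (cis y - 1))\<^sup>2 = 2 - 2 * cos y" for y
    unfolding cmod_power2 using sin_cos_squared_add[of y] by (simp_all add: power2_eq_square algebra_simps)
  note this[of "?x + pi / 2", unfolded c]
  then show "(cmod ((1 + amp1 \<phi> mid l) / 2))\<^sup>2 = 1 - prb \<phi> mid l" "(cmod ((amp1 \<phi> mid l - 1) / 2))\<^sup>2 = prb \<phi> mid l"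
    unfolding amp1_def prb_def norm_divide power_divide by (simp_all add: field_simps)
qed

lemma gtest_Ket:
  assumes c: "c 6 = 0" "c k = 0" "\<bar>c 9\<bar> \<le> 2 * pi" and k: "k \<noteq> 6" "k \<noteq> 9"
  shows "aps (gtest \<phi> l k) (Ket c) = ((1 + amp1 \<phi> (c 9) l) / 2) *q Ket c + ((amp1 \<phi> (c 9) l - 1) / 2) *q Ket (c(k := 1))"
proof -
  let ?r = "complex_of_real (cos (pi / 4))" and ?c1 = "c(6 := 1)"
  have cs: "sin (pi / 4) = cos (pi / 4)" by (simp add: cos_45 sin_45)
  have r2: "?r * ?r = 1 / 2" by (simp add: cos_45 flip: of_real_mult)
  have c0: "c(6 := 0) = c" using c by auto
  have 1: "ap (Ro 6 (\<lambda>_. pi / 4)) (Ket c) = ?r *q Ket c + ?r *q Ket ?c1"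
    by (subst ap_Ro_Ket0) (simp_all add: c cs)
  have ph: "aps (rep j (\<lambda>_. [Ph (\<lambda>c. \<phi> * c 6)] @ [Ph (\<lambda>c. angle (- (c 6 * c 9)))])) (Ket d) = cis (real j * (\<phi> * d 6 - d 6 * d 9)) *q Ket d"
    if "d 6 = 0 \<or> d 6 = 1" "\<bar>d 9\<bar> \<le> 2 * pi" for j d
  proof (induction j)
    case (Suc j)
    have "angle (- (d 6 * d 9)) = - (d 6 * d 9)" using that by (auto simp: angle_id)
    then show ?case
      by (simp only: rep_simps aps_simps Suc ap_smul ap_Ph_Ket smul_smul cis_mult) (simp add: algebra_simps)
  qed (simp only: rep_simps aps_simps of_nat_0 mult_zero_left cis_zero smul_one)
  let ?e = "cis (2 ^ l * (\<phi> - c 9))"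
  have 2: "aps (rep (2 ^ l) (\<lambda>_. [Ph (\<lambda>c. \<phi> * c 6)] @ [Ph (\<lambda>c. angle (- (c 6 * c 9)))])) (Ket c) = Ket c"
    "aps (rep (2 ^ l) (\<lambda>_. [Ph (\<lambda>c. \<phi> * c 6)] @ [Ph (\<lambda>c. angle (- (c 6 * c 9)))])) (Ket ?c1) = ?e *q Ket ?c1"
    using ph[of c "2 ^ l"] ph[of ?c1 "2 ^ l"] c by (simp_all del: aps_simps)
  have 3: "ap (Ph (\<lambda>c. angle (pi / 2 * c 6))) (Ket c) = Ket c" "ap (Ph (\<lambda>c. angle (pi / 2 * c 6))) (Ket ?c1) = cis (pi / 2) *q Ket ?c1"
    unfolding ap_Ph_Ket using c by (simp_all add: angle_id del: cis_pi_half)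
  have 4: "ap (Ro 6 (\<lambda>_. - (pi / 4))) (Ket c) = ?r *q Ket c + (- ?r) *q Ket ?c1"
    "ap (Ro 6 (\<lambda>_. - (pi / 4))) (Ket ?c1) = ?r *q Ket c + ?r *q Ket ?c1"
    by (subst ap_Ro_Ket0 ap_Ro_Ket1; simp add: c c0 cs)+
  have 5: "aps (mv k) (Ket c) = Ket c" "aps (mv k) (Ket ?c1) = Ket (c(k := 1))"
  proof -
    have a: "ap (Tr k (\<lambda>c. c 6)) (Ket c) = Ket c" "ap (Tr 6 (\<lambda>c. - c k)) (Ket c) = Ket c"
      using c k by (simp_all add: ap_Tr_Ket[of "\<lambda>c. c 6"] ap_Tr_Ket[of "\<lambda>c. - c k"] fun_upd_idem del: ap.simps)
    have b: "ap (Tr k (\<lambda>c. c 6)) (Ket ?c1) = Ket (?c1(k := 1))"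
      using c k by (subst ap_Tr_Ket) simp_all
    have "?c1(k := 1, 6 := 0) = c(k := 1)" using c k by (auto simp: fun_eq_iff)
    then have d: "ap (Tr 6 (\<lambda>c. - c k)) (Ket (?c1(k := 1))) = Ket (c(k := 1))"
      using k by (subst ap_Tr_Ket) simp_all
    show "aps (mv k) (Ket c) = Ket c" "aps (mv k) (Ket ?c1) = Ket (c(k := 1))"
      unfolding mv_def by (simp_all only: aps_simps a b d)
  qed
  have e: "cis (pi / 2) * ?e = amp1 \<phi> (c 9) l" by (simp add: amp1_def cis_mult add.commute del: cis_pi_half)
  let ?E = "amp1 \<phi> (c 9) l"
  have "aps (gtest \<phi> l k) (Ket c) = ?r *q (?r *q Ket c + (- ?r) *q Ket (c(k := 1)))
      + ?r *q ?e *q cis (pi / 2) *q (?r *q Ket c + ?r *q Ket (c(k := 1)))"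
    unfolding testops_def by (simp only: aps_simps 1 2 3 4 5 ap_add ap_smul aps_add aps_smul)
  also have "\<dots> = (?r * ?r) *q (Ket c + (- 1) *q Ket (c(k := 1))) + (?r * ?r * (cis (pi / 2) * ?e)) *q (Ket c + Ket (c(k := 1)))"
    by (auto simp: fun_eq_iff algebra_simps)
  also have "\<dots> = ((1 + ?E) / 2) *q Ket c + ((?E - 1) / 2) *q Ket (c(k := 1))"
    unfolding e r2 by (rule ext) (simp add: algebra_simps add_divide_distrib diff_divide_distrib)
  finally show ?thesis .
qed

text \<open>The outcome goes to a fresh cell, so the two branches of all configurations are distinct
  basis states and do not interfere. Expectations then evolve as for a classical coin with success
  probability \<open>prb\<close>.\<close>

lemma gtest_state:
  assumes a: "sp \<alpha> (\<lambda>c. c 6 = 0 \<and> c k = 0 \<and> \<bar>c 9\<bar> \<le> 2 * pi)" and k: "k \<noteq> 6" "k \<noteq> 9"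
  shows "Ex f (aps (gtest \<phi> l k) \<alpha>) = Ex (\<lambda>c. (1 - prb \<phi> (c 9) l) * f c + prb \<phi> (c 9) l * f (c(k := 1))) \<alpha>" (is ?A)
    and "aps (gtest \<phi> l k) \<alpha> d \<noteq> 0 \<Longrightarrow> \<exists>c. \<alpha> c \<noteq> 0 \<and> (d = c \<or> d = c(k := 1))" (is "?B \<Longrightarrow> ?C")
proof -
  let ?T = "{c. \<alpha> c \<noteq> 0}" and ?u = "\<lambda>c. c(k := 1)"
  define A where "A c = \<alpha> c * ((1 + amp1 \<phi> (c 9) l) / 2)" for c
  define B where "B c = \<alpha> c * ((amp1 \<phi> (c 9) l - 1) / 2)" for c
  have fT: "finite ?T" using a by (simp add: sp_def fin_def)
  have ck: "c k = 0" if "c \<in> ?T" for c using that a by (auto simp: sp_def)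
  have out: "aps (gtest \<phi> l k) \<alpha> = (\<Sum>c\<in>?T. A c *q Ket c + B c *q Ket (?u c))"
  proof -
    have "aps (gtest \<phi> l k) \<alpha> = (\<Sum>c\<in>?T. \<alpha> c *q aps (gtest \<phi> l k) (Ket c))"
      by (subst fin_expand[OF sp_fin[OF a]]) (simp only: aps_sum aps_smul)
    also have "\<dots> = (\<Sum>c\<in>?T. A c *q Ket c + B c *q Ket (?u c))"
    proof (rule sum.cong[OF refl])
      fix c assume "c \<in> ?T"
      then have "c 6 = 0" "c k = 0" "\<bar>c 9\<bar> \<le> 2 * pi" using a by (auto simp: sp_def)
      from gtest_Ket[OF this k, of \<phi> l] show "\<alpha> c *q aps (gtest \<phi> l k) (Ket c) = A c *q Ket c + B c *q Ket (?u c)"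
        by (simp only: smul_add smul_smul A_def B_def)
    qed
    finally show ?thesis .
  qed
  have inj: "inj_on ?u ?T"
  proof (rule inj_onI)
    fix c d assume cd: "c \<in> ?T" "d \<in> ?T" "?u c = ?u d"
    have "c = (?u c)(k := 0)" "d = (?u d)(k := 0)" using ck[OF cd(1)] ck[OF cd(2)] by auto
    then show "c = d" using cd(3) by metis
  qed
  have disj: "d \<noteq> ?u c" if "c \<in> ?T" "d \<in> ?T" for c d using ck[OF that(2)] by auto
  have val: "aps (gtest \<phi> l k) \<alpha> d = (\<Sum>c\<in>?T. (if c = d then A c else 0) + (if ?u c = d then B c else 0))" for d
    unfolding out sum_fun_apply' by (intro sum.cong refl) (auto simp: Ket_def)
  have v1: "aps (gtest \<phi> l k) \<alpha> d = A d" if "d \<in> ?T" for d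
    unfolding val sum.distrib using that disj fT by (auto simp: eq_commute[of _ d] intro!: sum.neutral)
  have v2: "aps (gtest \<phi> l k) \<alpha> (?u c) = B c" if "c \<in> ?T" for c
  proof -
    have "(\<Sum>c'\<in>?T. if ?u c' = ?u c then B c' else 0) = (\<Sum>c'\<in>?T. if c' = c then B c' else 0)"
      by (intro sum.cong refl if_cong) (use inj that in \<open>auto dest: inj_onD\<close>)
    moreover have "(\<Sum>c'\<in>?T. if c' = ?u c then A c' else 0) = 0" using disj that by (intro sum.neutral) auto
    ultimately show ?thesis unfolding val sum.distrib using that fT by simp
  qed
  have v3: "aps (gtest \<phi> l k) \<alpha> d = 0" if "d \<notin> ?T \<union> ?u ` ?T" for d
    unfolding val using that by (intro sum.neutral) auto
  show "?B \<Longrightarrow> ?C" using v3[of d] by auto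
  have "Ex f (aps (gtest \<phi> l k) \<alpha>) = (\<Sum>d\<in>?T \<union> ?u ` ?T. f d * (cmod (aps (gtest \<phi> l k) \<alpha> d))\<^sup>2)"
    using fT v3 by (intro Ex_super) auto
  also have "\<dots> = (\<Sum>d\<in>?T. f d * (cmod (aps (gtest \<phi> l k) \<alpha> d))\<^sup>2) + (\<Sum>d\<in>?u ` ?T. f d * (cmod (aps (gtest \<phi> l k) \<alpha> d))\<^sup>2)"
    using fT disj by (intro sum.union_disjoint) auto
  also have "(\<Sum>d\<in>?u ` ?T. f d * (cmod (aps (gtest \<phi> l k) \<alpha> d))\<^sup>2) = (\<Sum>c\<in>?T. f (?u c) * (cmod (B c))\<^sup>2)"
    by (subst sum.reindex[OF inj]) (intro sum.cong refl, simp only: o_def v2)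
  also have "(\<Sum>d\<in>?T. f d * (cmod (aps (gtest \<phi> l k) \<alpha> d))\<^sup>2) = (\<Sum>c\<in>?T. f c * (cmod (A c))\<^sup>2)"
    by (intro sum.cong refl) (simp only: v1)
  also have "(\<Sum>c\<in>?T. f c * (cmod (A c))\<^sup>2) + (\<Sum>c\<in>?T. f (?u c) * (cmod (B c))\<^sup>2) =
      Ex (\<lambda>c. (1 - prb \<phi> (c 9) l) * f c + prb \<phi> (c 9) l * f (?u c)) \<alpha>"
    unfolding Ex_def sum.distrib[symmetric] A_def B_def norm_mult power_mult_distrib cmod_amp1
    by (intro sum.cong refl) (simp add: algebra_simps)
  finally show ?A .
qed

section \<open>Permutations of basis states\<close>

lemma pm_append [simp]: "pm (xs @ ys) c = pm ys (pm xs c)"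
  by (induction xs c rule: pm.induct) (simp_all only: append_Nil append_Cons pm.simps)

definition trs :: "qop list \<Rightarrow> bool" where
  "trs xs \<longleftrightarrow> (\<forall>p\<in>set xs. wfo p \<and> (\<exists>k f. p = Tr k f))"

lemma trs_simps [simp]: "trs []" "trs (xs @ ys) \<longleftrightarrow> trs xs \<and> trs ys" "trs (Tr k f # xs) \<longleftrightarrow> wfo (Tr k f) \<and> trs xs"
  by (auto simp: trs_def)

lemma trs_rep: "(\<And>i. i < j \<Longrightarrow> trs (f i)) \<Longrightarrow> trs (rep j f)"
  by (induction j) auto

lemma trs_Ket: "trs xs \<Longrightarrow> aps xs (Ket c) = Ket (pm xs c)"
proof (induction xs arbitrary: c)
  case (Cons p xs)
  then obtain k f where p: "p = Tr k f" "wfo (Tr k f)" "trs xs" by (auto simp: trs_def)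
  have "ap (Tr k f) (Ket c) = Ket (c(k := c k + f c))"
    by (rule ap_Tr_Ket) (use p in \<open>auto simp: wfo_def indep_def\<close>)
  then show ?case by (simp only: p(1) aps_simps Cons.IH[OF p(3)] pm.simps)
qed simp

lemma trs_wfs: "trs xs \<Longrightarrow> wfs xs"
  by (auto simp: trs_def)

lemma pm_inj:
  assumes "trs xs" "pm xs c = pm xs d"
  shows "c = d"
proof -
  have "aps (invs xs) (aps xs (Ket c)) = aps (invs xs) (aps xs (Ket d))"
    using assms by (simp add: trs_Ket)
  then have "Ket c = Ket d" using trs_wfs[OF assms(1)] by (simp add: aps_invs)
  then have "Ket c c = Ket d c" by simp
  then show ?thesis by (simp add: Ket_def split: if_splits)
qed

lemma pm_state:
  assumes "trs xs" "fin \<alpha>"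
  shows "aps xs \<alpha> (pm xs c) = \<alpha> c" and "aps xs \<alpha> d \<noteq> 0 \<Longrightarrow> \<exists>c. d = pm xs c \<and> \<alpha> c \<noteq> 0"
proof -
  have f: "finite {c. \<alpha> c \<noteq> 0}" using assms by (simp add: fin_def)
  have "aps xs \<alpha> = (\<Sum>c | \<alpha> c \<noteq> 0. \<alpha> c *q Ket (pm xs c))"
    by (subst fin_expand[OF assms(2)]) (simp only: aps_sum aps_smul trs_Ket[OF assms(1)])
  then have v: "aps xs \<alpha> d = (\<Sum>c | \<alpha> c \<noteq> 0. if d = pm xs c then \<alpha> c else 0)" for d
    by (simp add: sum_fun_apply' Ket_def if_distrib cong: if_cong)
  have "aps xs \<alpha> (pm xs c) = (\<Sum>c' | \<alpha> c' \<noteq> 0. if c = c' then \<alpha> c' else 0)"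
    unfolding v by (intro sum.cong refl if_cong) (use pm_inj[OF assms(1)] in auto)
  then show "aps xs \<alpha> (pm xs c) = \<alpha> c" using f by simp
  assume a: "aps xs \<alpha> d \<noteq> 0"
  show "\<exists>c. d = pm xs c \<and> \<alpha> c \<noteq> 0"
  proof (rule ccontr)
    assume "\<nexists>c. d = pm xs c \<and> \<alpha> c \<noteq> 0"
    then have "aps xs \<alpha> d = 0" unfolding v by (intro sum.neutral) auto
    then show False using a by simp
  qed
qed

lemma pm_Ex:
  assumes "trs xs" "fin \<alpha>"
  shows "Ex f (aps xs \<alpha>) = Ex (\<lambda>c. f (pm xs c)) \<alpha>"
proof -
  have f: "finite {c. \<alpha> c \<noteq> 0}" using assms by (simp add: fin_def)
  have "Ex f (aps xs \<alpha>) = (\<Sum>d\<in>pm xs ` {c. \<alpha> c \<noteq> 0}. f d * (cmod (aps xs \<alpha> d))\<^sup>2)"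
    using f pm_state(2)[OF assms] by (intro Ex_super) auto
  also have "\<dots> = Ex (\<lambda>c. f (pm xs c)) \<alpha>"
    unfolding Ex_def by (subst sum.reindex) (auto intro!: inj_onI pm_inj[OF assms(1)] simp: pm_state(1)[OF assms])
  finally show ?thesis .
qed

section \<open>Estimating a phase\<close>

lemma exp_le_quad:
  fixes y :: real
  assumes "\<bar>y\<bar> \<le> 1"
  shows "exp y \<le> 1 + y + y\<^sup>2"
proof (cases "0 \<le> y")
  case True
  then show ?thesis using exp_bound[of y] assms by simp
next
  case False
  define z where "z = - y"
  have z: "0 \<le> z" "z \<le> 1" using False assms by (auto simp: z_def)
  have "exp y * exp z = 1" by (simp add: z_def exp_minus)
  moreover have "1 + z \<le> exp z" by (rule exp_ge_add_one_self)
  ultimately have "exp y * (1 + z) \<le> 1" by (metis exp_ge_zero mult_left_mono)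
  moreover have "1 \<le> (1 - z + z\<^sup>2) * (1 + z)" using z by (simp add: power2_eq_square algebra_simps)
  ultimately have "exp y * (1 + z) \<le> (1 - z + z\<^sup>2) * (1 + z)" by simp
  then have "exp y \<le> 1 - z + z\<^sup>2" using z by (simp add: mult_le_cancel_right)
  then show ?thesis by (simp add: z_def)
qed

text \<open>Bounds the exponential moment of a centred coin toss; a crude form of the Hoeffding
  estimate, enough for small y.\<close>

lemma bernoulli_mgf:
  fixes y p :: real
  assumes "\<bar>y\<bar> \<le> 1" "0 \<le> p" "p \<le> 1"
  shows "(1 - p) * exp (- (y * p)) + p * exp (y * (1 - p)) \<le> exp (y\<^sup>2)"
proof -
  have b: "\<bar>- (y * p)\<bar> \<le> 1" "\<bar>y * (1 - p)\<bar> \<le> 1"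
    using assms by (simp_all add: abs_mult mult_le_one)
  have "(1 - p) * exp (- (y * p)) + p * exp (y * (1 - p)) \<le>
      (1 - p) * (1 + - (y * p) + (- (y * p))\<^sup>2) + p * (1 + y * (1 - p) + (y * (1 - p))\<^sup>2)"
    by (rule add_mono; rule mult_left_mono[OF exp_le_quad]) (use b assms in auto)
  also have "\<dots> = 1 + y\<^sup>2 * (p * (1 - p))" by (simp add: power2_eq_square algebra_simps)
  also have "\<dots> \<le> 1 + y\<^sup>2"
    using assms mult_left_mono[of "p * (1 - p)" 1 "y\<^sup>2"] mult_le_one[of p "1 - p"] by simp
  also have "\<dots> \<le> exp (y\<^sup>2)" by (rule exp_ge_add_one_self)
  finally show ?thesis .
qed

lemma sin_near: "\<bar>x\<bar> \<le> 1 \<Longrightarrow> \<bar>x - sin x\<bar> \<le> 1 / 6" for x :: real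
proof -
  assume x: "\<bar>x\<bar> \<le> 1"
  have "(\<Sum>m<3. sin_coeff m * x ^ m) = x" by (simp add: numeral_3_eq_3 sin_coeff_def)
  then have "\<bar>sin x - x\<bar> \<le> inverse (fact 3) * \<bar>x\<bar> ^ 3" using Maclaurin_sin_bound[of x 3] by simp
  also have "\<dots> \<le> inverse (fact 3) * 1" using x by (intro mult_left_mono power_le_one) auto
  finally show ?thesis by (simp add: fact_numeral abs_minus_commute)
qed

locale sched =
  fixes R :: "nat \<Rightarrow> nat"
  assumes R_pos: "0 < R l"
begin

definition offs :: "nat \<Rightarrow> nat" where
  "offs l = (\<Sum>j<l. R j)"

text \<open>With a fraction q of successes at level l, the estimate changes by (2 q - 1) / 2^l, an
  approximation of sin(2^l (\<phi> - mid)) / 2^l and so of \<phi> - mid. The weight is the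
  contribution of one success to this.\<close>

definition wt :: "nat \<Rightarrow> real" where
  "wt l = 2 / (2 ^ l * real (R l))"

definition cnt :: "nat \<Rightarrow> nat \<Rightarrow> config \<Rightarrow> real" where
  "cnt l i c = (\<Sum>j<i. c (40 + offs l + j))"

text \<open>The estimate as a function of the outcomes alone. Cell 9 can therefore be cleared in the
  end by running the updates with the opposite sign.\<close>

definition midf :: "nat \<Rightarrow> config \<Rightarrow> real" where
  "midf l c = (\<Sum>l'<l. wt l' * cnt l' (R l') c - 1 / 2 ^ l')"

definition updops :: "real \<Rightarrow> nat \<Rightarrow> qop list" where
  "updops sg l = rep (R l) (\<lambda>i. [Tr 9 (\<lambda>c. sg * wt l * c (40 + offs l + i))]) @ [Tr 9 (\<lambda>_. - (sg / 2 ^ l))]"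

definition levelops :: "qop list \<Rightarrow> nat \<Rightarrow> qop list" where
  "levelops W l = rep (R l) (\<lambda>i. testops W l (40 + offs l + i)) @ updops 1 l"

definition base :: "config \<Rightarrow> bool" where
  "base c \<longleftrightarrow> (\<forall>j<40. j \<noteq> 9 \<longrightarrow> c j = 0) \<and> (\<forall>j\<ge>40. c j = 0 \<or> c j = 1)"

definition linv :: "nat \<Rightarrow> nat \<Rightarrow> config \<Rightarrow> bool" where
  "linv l i c \<longleftrightarrow> base c \<and> (\<forall>j\<ge>40 + offs l + i. c j = 0) \<and> c 9 = midf l c"

lemma offs_Suc [simp]: "offs (Suc l) = offs l + R l" "offs 0 = 0"
  by (simp_all add: offs_def)

lemma offs_mono: "l \<le> l' \<Longrightarrow> offs l \<le> offs l'"
  unfolding offs_def by (rule sum_mono2) auto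

lemma cnt_bound: "base c \<Longrightarrow> 0 \<le> cnt l i c \<and> cnt l i c \<le> real i"
proof -
  assume "base c"
  then have b: "0 \<le> c (40 + j) \<and> c (40 + j) \<le> 1" for j
    unfolding base_def by (metis le_add1 order_refl zero_le_one)
  have "cnt l i c \<le> (\<Sum>j<i. 1)" unfolding cnt_def using b by (intro sum_mono) (metis add.assoc)
  moreover have "0 \<le> cnt l i c" unfolding cnt_def using b by (intro sum_nonneg) (metis add.assoc)
  ultimately show ?thesis by simp
qed

text \<open>Level l moves the estimate by at most 1/2^l whatever the outcomes are, and these bounds
  add up to less than 2. The angle in cell 9 thus never reaches the limit beyond which
  \<open>angle\<close> would replace it by 0.\<close>

lemma midf_bound: "base c \<Longrightarrow> \<bar>midf l c\<bar> \<le> 2"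
proof -
  assume b: "base c"
  have t: "\<bar>wt l' * cnt l' (R l') c - 1 / 2 ^ l'\<bar> \<le> 1 / 2 ^ l'" for l'
  proof -
    have "0 \<le> wt l'" by (simp add: wt_def)
    then have "wt l' * cnt l' (R l') c \<le> wt l' * real (R l')" "0 \<le> wt l' * cnt l' (R l') c"
      using cnt_bound[OF b] by (auto intro: mult_left_mono)
    moreover have "wt l' * real (R l') = 2 / 2 ^ l'" using R_pos[of l'] by (simp add: wt_def)
    ultimately show ?thesis by (simp add: abs_le_iff)
  qed
  have "\<bar>midf l c\<bar> \<le> (\<Sum>l'<l. 1 / 2 ^ l')" unfolding midf_def using t by (intro order_trans[OF sum_abs] sum_mono)
  also have "\<dots> = 2 - 2 / 2 ^ l" by (induction l) (simp_all add: field_simps)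
  also have "\<dots> \<le> 2" by simp
  finally show ?thesis .
qed

lemma midf_upd: "offs l + 40 \<le> k \<Longrightarrow> midf l (c(k := v)) = midf l c"
proof -
  assume k: "offs l + 40 \<le> k"
  have "40 + offs l' + j \<noteq> k" if "l' < l" "j < R l'" for l' j
    using k that offs_mono[of "Suc l'" l] by simp
  then show ?thesis unfolding midf_def cnt_def by (intro sum.cong refl arg_cong2[of _ _ _ _ "(-)"] arg_cong2[of _ _ _ _ "(*)"]) simp
qed

lemma midf_upd9: "midf l (c(9 := v)) = midf l c" "cnt l i (c(9 := v)) = cnt l i c"
  by (simp_all add: midf_def cnt_def)

lemma linvD: "linv l i c \<Longrightarrow> c 6 = 0" "linv l i c \<Longrightarrow> \<bar>c 9\<bar> \<le> 2 * pi" "linv l i c \<Longrightarrow> c (40 + offs l + i) = 0"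
  "linv l i c \<Longrightarrow> base c"
  using midf_bound[of c l] pi_ge_two by (auto simp: linv_def base_def)

lemma linv_step: "linv l i c \<Longrightarrow> linv l (Suc i) c" "linv l i c \<Longrightarrow> linv l (Suc i) (c(40 + offs l + i := 1))"
  by (auto simp: linv_def base_def midf_upd)

lemma pm_upd: "pm (updops sg l) c = c(9 := c 9 + sg * (wt l * cnt l (R l) c - 1 / 2 ^ l))"
proof -
  have "pm (rep j (\<lambda>i. [Tr 9 (\<lambda>c. sg * wt l * c (40 + offs l + i))])) c = c(9 := c 9 + sg * (wt l * cnt l j c))" for j
  proof (induction j)
    case (Suc j)
    show ?case unfolding rep_simps pm_append pm.simps Suc by (rule ext) (simp add: cnt_def algebra_simps)
  qed (simp add: cnt_def)
  then show ?thesis unfolding updops_def pm_append pm.simps by (intro ext) (simp add: algebra_simps)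
qed

lemma trs_upd: "trs (updops sg l)"
  unfolding updops_def by (auto intro!: trs_rep simp: wfo_def indep_def)

lemma linv_upd: "linv l (R l) c \<Longrightarrow> linv (Suc l) 0 (pm (updops 1 l) c)"
proof -
  assume a: "linv l (R l) c"
  have "midf (Suc l) c = c 9 + (wt l * cnt l (R l) c - 1 / 2 ^ l)" using a by (simp add: midf_def linv_def)
  then show ?thesis using a unfolding pm_upd linv_def midf_upd9 by (auto simp: base_def)
qed

section \<open>A potential function for the tests of one level\<close>

definition far :: "real \<Rightarrow> nat \<Rightarrow> config \<Rightarrow> real" where
  "far \<phi> l c = (if \<bar>\<phi> - c 9\<bar> \<le> 1 / 2 ^ l then 0 else 1)"

text \<open>An exponential supermartingale for the deviation of the success count, with a factor
  exp(y^2) set aside for each test still to come. With |y| = 1/12 its final value is at least 1 when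
  the deviation has the sign of y and is at least R/6, because R/72 = (1/12)(R/6).\<close>

definition tail :: "real \<Rightarrow> real \<Rightarrow> nat \<Rightarrow> nat \<Rightarrow> config \<Rightarrow> real" where
  "tail y \<phi> l i c = exp (real (R l - i) * y\<^sup>2 + y * (cnt l i c - real i * prb \<phi> (c 9) l) - real (R l) / 72)"

text \<open>A union bound in the form of a potential: it starts at the old failure indicator plus 2
  exp(-R/144), does not increase in expectation (\<open>pot_step\<close>), and finally dominates the
  new failure indicator (\<open>pot_end\<close>).\<close>

definition pot :: "real \<Rightarrow> nat \<Rightarrow> nat \<Rightarrow> config \<Rightarrow> real" where
  "pot \<phi> l i c = far \<phi> l c + tail (1 / 12) \<phi> l i c + tail (- 1 / 12) \<phi> l i c"

lemma prb_nonneg: "0 \<le> prb \<phi> mid l"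
proof -
  have y: "- 1 \<le> y \<Longrightarrow> 0 \<le> (1 + y) / 2" for y :: real by simp
  show ?thesis unfolding prb_def by (rule y[OF sin_ge_minus_one])
qed

lemma prb_le_1: "prb \<phi> mid l \<le> 1"
proof -
  have y: "y \<le> 1 \<Longrightarrow> (1 + y) / 2 \<le> 1" for y :: real by simp
  show ?thesis unfolding prb_def by (rule y[OF sin_le_one])
qed

lemma cnt_upd: "cnt l (Suc i) (c(40 + offs l + i := v)) = cnt l i c + v"
  by (simp add: cnt_def)

lemma tail_step:
  assumes i: "i < R l" and c: "c (40 + offs l + i) = 0" and y: "\<bar>y\<bar> \<le> 1"
  shows "(1 - prb \<phi> (c 9) l) * tail y \<phi> l (Suc i) c + prb \<phi> (c 9) l * tail y \<phi> l (Suc i) (c(40 + offs l + i := 1)) \<le> tail y \<phi> l i c"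
proof -
  let ?p = "prb \<phi> (c 9) l"
  define B where "B = exp (real (R l - Suc i) * y\<^sup>2 + y * (cnt l i c - real i * ?p) - real (R l) / 72)"
  have c0: "cnt l (Suc i) c = cnt l i c" using c by (simp add: cnt_def)
  have 1: "tail y \<phi> l (Suc i) c = B * exp (- (y * ?p))"
    unfolding tail_def B_def exp_add[symmetric] c0 by (simp add: algebra_simps)
  have 2: "tail y \<phi> l (Suc i) (c(40 + offs l + i := 1)) = B * exp (y * (1 - ?p))"
    unfolding tail_def B_def exp_add[symmetric] cnt_upd by (simp add: algebra_simps)
  have 3: "tail y \<phi> l i c = B * exp (y\<^sup>2)"
  proof -
    have "real (R l - i) = real (R l - Suc i) + 1" using i by (simp add: of_nat_diff)
    then show ?thesis unfolding tail_def B_def exp_add[symmetric] by (simp add: algebra_simps)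
  qed
  have "B * ((1 - ?p) * exp (- (y * ?p)) + ?p * exp (y * (1 - ?p))) \<le> B * exp (y\<^sup>2)"
    using bernoulli_mgf[OF y prb_nonneg prb_le_1] by (intro mult_left_mono) (auto simp: B_def)
  then show ?thesis unfolding 1 2 3 by (simp add: algebra_simps)
qed

lemma pot_step:
  assumes i: "i < R l" and c: "c (40 + offs l + i) = 0"
  shows "(1 - prb \<phi> (c 9) l) * pot \<phi> l (Suc i) c + prb \<phi> (c 9) l * pot \<phi> l (Suc i) (c(40 + offs l + i := 1)) \<le> pot \<phi> l i c"
  using tail_step[of i l c "1 / 12" \<phi>] tail_step[of i l c "- 1 / 12" \<phi>] i c
  by (simp add: pot_def far_def algebra_simps)

text \<open>Replacing x by sin x costs at most 1/6 for |x| \<le> 1, and an error of 1/6 in the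
  frequency counts twice in 2 q - 1. The total of 1/2 is what halves the error from level to
  level.\<close>

lemma pot_end:
  "far \<phi> (Suc l) (pm (updops 1 l) c) \<le> pot \<phi> l (R l) c"
proof (cases "\<bar>\<phi> - c 9\<bar> \<le> 1 / 2 ^ l \<and> \<bar>cnt l (R l) c - real (R l) * prb \<phi> (c 9) l\<bar> \<le> real (R l) / 6")
  case True
  define x where "x = 2 ^ l * (\<phi> - c 9)"
  define q where "q = cnt l (R l) c / real (R l)"
  have "\<bar>x\<bar> = 2 ^ l * \<bar>\<phi> - c 9\<bar>" unfolding x_def abs_mult by simp
  then have x: "\<bar>x\<bar> \<le> 1" using True by (simp add: field_simps)
  have q: "\<bar>q - prb \<phi> (c 9) l\<bar> \<le> 1 / 6"
  proof -
    have "q - prb \<phi> (c 9) l = (cnt l (R l) c - real (R l) * prb \<phi> (c 9) l) / real (R l)"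
      using R_pos[of l] by (simp add: q_def field_simps)
    then have "\<bar>q - prb \<phi> (c 9) l\<bar> = \<bar>cnt l (R l) c - real (R l) * prb \<phi> (c 9) l\<bar> / real (R l)"
      by (simp only: abs_divide abs_of_nat)
    also have "\<dots> \<le> (real (R l) / 6) / real (R l)" using True by (intro divide_right_mono) auto
    finally show ?thesis using R_pos[of l] by simp
  qed
  have "\<phi> - pm (updops 1 l) c 9 = (x - (2 * q - 1)) / 2 ^ l"
    using R_pos[of l] by (simp add: pm_upd wt_def x_def q_def field_simps)
  also have "\<dots> = ((x - sin x) - 2 * (q - prb \<phi> (c 9) l)) / 2 ^ l"
    by (simp add: prb_def x_def field_simps)
  finally have "\<bar>\<phi> - pm (updops 1 l) c 9\<bar> = \<bar>(x - sin x) - 2 * (q - prb \<phi> (c 9) l)\<bar> / 2 ^ l"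
    by (simp add: abs_divide)
  also have "\<dots> \<le> (1 / 2) / 2 ^ l"
  proof -
    have "\<bar>a\<bar> \<le> 1 / 6 \<Longrightarrow> \<bar>b\<bar> \<le> 1 / 6 \<Longrightarrow> \<bar>a - 2 * b\<bar> \<le> 1 / 2" for a b :: real by arith
    from this[OF sin_near[OF x] q] show ?thesis by (intro divide_right_mono) auto
  qed
  finally have "far \<phi> (Suc l) (pm (updops 1 l) c) = 0" by (simp add: far_def)
  then show ?thesis by (simp add: pot_def far_def tail_def)
next
  case False
  have 1: "far \<phi> (Suc l) (pm (updops 1 l) c) \<le> 1" by (simp add: far_def)
  show ?thesis
  proof (cases "\<bar>\<phi> - c 9\<bar> \<le> 1 / 2 ^ l")
    case False
    then have "1 \<le> pot \<phi> l (R l) c" by (simp add: pot_def far_def tail_def)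
    then show ?thesis using 1 by simp
  next
    case True
    let ?d = "cnt l (R l) c - real (R l) * prb \<phi> (c 9) l"
    have "real (R l) / 6 \<le> \<bar>?d\<bar>" using False True by simp
    moreover have "r / 6 \<le> \<bar>d\<bar> \<Longrightarrow> r / 72 \<le> 1 / 12 * d \<or> r / 72 \<le> (- 1 / 12) * d" for r d :: real by arith
    ultimately have "1 / 12 * ?d \<ge> real (R l) / 72 \<or> (- 1 / 12) * ?d \<ge> real (R l) / 72" by blast
    then have "1 \<le> tail (1 / 12) \<phi> l (R l) c \<or> 1 \<le> tail (- 1 / 12) \<phi> l (R l) c"
      unfolding tail_def by simp
    moreover have "0 \<le> far \<phi> l c" "0 \<le> tail y \<phi> l (R l) c" for y by (simp_all add: far_def tail_def)
    ultimately have "1 \<le> pot \<phi> l (R l) c" unfolding pot_def by (metis add_increasing add_increasing2)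
    then show ?thesis using 1 by simp
  qed
qed

lemma pot_start: "pot \<phi> l 0 c = far \<phi> l c + 2 * exp (- (real (R l) / 144))"
  by (simp add: pot_def tail_def cnt_def power2_eq_square)

lemma level_tests:
  assumes "sp \<alpha> (linv l 0)" "i \<le> R l"
  shows "sp (aps (rep i (\<lambda>i. gtest \<phi> l (40 + offs l + i))) \<alpha>) (linv l i) \<and>
    Ex (pot \<phi> l i) (aps (rep i (\<lambda>i. gtest \<phi> l (40 + offs l + i))) \<alpha>) \<le> Ex (pot \<phi> l 0) \<alpha>"
  using assms(2)
proof (induction i)
  case (Suc i)
  let ?\<beta> = "aps (rep i (\<lambda>i. gtest \<phi> l (40 + offs l + i))) \<alpha>" and ?k = "40 + offs l + i"
  have IH: "sp ?\<beta> (linv l i)" "Ex (pot \<phi> l i) ?\<beta> \<le> Ex (pot \<phi> l 0) \<alpha>" and i: "i < R l" using Suc by auto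
  have s: "sp ?\<beta> (\<lambda>c. c 6 = 0 \<and> c ?k = 0 \<and> \<bar>c 9\<bar> \<le> 2 * pi)"
    by (rule sp_mono[OF IH(1)]) (use linvD in blast)
  have k: "?k \<noteq> 6" "?k \<noteq> 9" by simp_all
  have f: "fin (aps (gtest \<phi> l ?k) ?\<beta>)"
  proof (rule fin_aps[OF _ sp_fin[OF s]])
    have "wfs (rep j (\<lambda>_. [Ph (\<lambda>c. \<phi> * c 6)] @ [Ph (\<lambda>c. angle (- (c 6 * c 9)))]))" for j
      by (induction j) (auto simp: wfo_def indep_def)
    then show "wfs (gtest \<phi> l ?k)" by (auto simp: testops_def mv_def wfo_def indep_def)
  qed
  have "sp (aps (gtest \<phi> l ?k) ?\<beta>) (linv l (Suc i))"
  proof (rule spI[OF f])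
    fix d assume "aps (gtest \<phi> l ?k) ?\<beta> d \<noteq> 0"
    from gtest_state(2)[OF s k this] obtain c where "?\<beta> c \<noteq> 0" "d = c \<or> d = c(?k := 1)" by blast
    then show "linv l (Suc i) d" using linv_step[OF spD[OF IH(1)]] by auto
  qed
  moreover have "Ex (pot \<phi> l (Suc i)) (aps (gtest \<phi> l ?k) ?\<beta>) \<le> Ex (pot \<phi> l i) ?\<beta>"
    unfolding gtest_state(1)[OF s k]
    by (rule Ex_mono, rule pot_step[OF i]) (use spD[OF IH(1)] linvD(3) in blast)
  ultimately show ?case using IH(2) by simp
qed (use assms in simp)

lemma level_err:
  assumes "sp \<alpha> (linv l 0)"
  shows "sp (aps (levelops [Ph (\<lambda>c. \<phi> * c 6)] l) \<alpha>) (linv (Suc l) 0)"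
    "Ex (far \<phi> (Suc l)) (aps (levelops [Ph (\<lambda>c. \<phi> * c 6)] l) \<alpha>) \<le> Ex (far \<phi> l) \<alpha> + 2 * exp (- (real (R l) / 144)) * nsq \<alpha>"
proof -
  let ?\<beta> = "aps (rep (R l) (\<lambda>i. gtest \<phi> l (40 + offs l + i))) \<alpha>"
  have t: "sp ?\<beta> (linv l (R l))" "Ex (pot \<phi> l (R l)) ?\<beta> \<le> Ex (pot \<phi> l 0) \<alpha>"
    using level_tests[OF assms order_refl] by auto
  have e: "aps (levelops [Ph (\<lambda>c. \<phi> * c 6)] l) \<alpha> = aps (updops 1 l) ?\<beta>" by (simp add: levelops_def)
  show "sp (aps (levelops [Ph (\<lambda>c. \<phi> * c 6)] l) \<alpha>) (linv (Suc l) 0)"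
    unfolding e
  proof (rule spI)
    show "fin (aps (updops 1 l) ?\<beta>)" by (rule fin_aps[OF trs_wfs[OF trs_upd] sp_fin[OF t(1)]])
    fix d assume "aps (updops 1 l) ?\<beta> d \<noteq> 0"
    from pm_state(2)[OF trs_upd sp_fin[OF t(1)] this]
    obtain c where "d = pm (updops 1 l) c" "?\<beta> c \<noteq> 0" by blast
    then show "linv (Suc l) 0 d" using linv_upd spD[OF t(1)] by blast
  qed
  have "Ex (far \<phi> (Suc l)) (aps (updops 1 l) ?\<beta>) = Ex (\<lambda>c. far \<phi> (Suc l) (pm (updops 1 l) c)) ?\<beta>"
    by (rule pm_Ex[OF trs_upd sp_fin[OF t(1)]])
  also have "\<dots> \<le> Ex (pot \<phi> l (R l)) ?\<beta>" by (rule Ex_mono) (rule pot_end)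
  also have "\<dots> \<le> Ex (pot \<phi> l 0) \<alpha>" by (rule t(2))
  also have "\<dots> = Ex (far \<phi> l) \<alpha> + 2 * exp (- (real (R l) / 144)) * nsq \<alpha>"
    unfolding pot_start Ex_add Ex_const ..
  finally show "Ex (far \<phi> (Suc l)) (aps (levelops [Ph (\<lambda>c. \<phi> * c 6)] l) \<alpha>) \<le> Ex (far \<phi> l) \<alpha> + 2 * exp (- (real (R l) / 144)) * nsq \<alpha>"
    unfolding e .
qed

definition estops :: "qop list \<Rightarrow> nat \<Rightarrow> qop list" where
  "estops W L = rep L (levelops W)"

abbreviation gest :: "real \<Rightarrow> nat \<Rightarrow> qop list" where
  "gest \<phi> \<equiv> estops [Ph (\<lambda>c. \<phi> * c 6)]"

lemma wfs_levelops: "wfs W \<Longrightarrow> wfs (levelops W l)"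
proof -
  assume W: "wfs W"
  have r: "wfs (rep j f)" if "\<And>i. i < j \<Longrightarrow> wfs (f i)" for j f
    using that by (auto simp: rep_def)
  have "wfs (testops W l (40 + t))" for t
  proof -
    have "wfs (rep (2 ^ l) (\<lambda>_. W @ [Ph (\<lambda>c. angle (- (c 6 * c 9)))]))"
      using W by (intro r) (auto simp: wfo_def indep_def)
    then show ?thesis by (auto simp: testops_def mv_def wfo_def indep_def)
  qed
  then have "wfs (rep (R l) (\<lambda>i. testops W l (40 + offs l + i)))" by (intro r) (metis add.assoc)
  then show "wfs (levelops W l)" using trs_wfs[OF trs_upd] by (auto simp: levelops_def)
qed

lemma wfs_estops: "wfs W \<Longrightarrow> wfs (estops W L)"
  unfolding estops_def using wfs_levelops by (induction L) auto

text \<open>Level 0 starts from the estimate 0 and expects an error of at most 1 = 1/2^0; this is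
  where the bound on \<phi> enters.\<close>

lemma est_err:
  assumes "\<bar>\<phi>\<bar> \<le> 1"
  shows "sp (aps (gest \<phi> L) (Ket (\<lambda>_. 0))) (linv L 0)"
    "Ex (far \<phi> L) (aps (gest \<phi> L) (Ket (\<lambda>_. 0))) \<le> (\<Sum>l<L. 2 * exp (- (real (R l) / 144)))"
proof -
  have "sp (aps (gest \<phi> L) (Ket (\<lambda>_. 0))) (linv L 0) \<and>
    Ex (far \<phi> L) (aps (gest \<phi> L) (Ket (\<lambda>_. 0))) \<le> (\<Sum>l<L. 2 * exp (- (real (R l) / 144)))"
  proof (induction L)
    case 0
    have "sp (Ket (\<lambda>_. 0)) (linv 0 0)" by (rule spI[OF fin_Ket]) (auto simp: Ket_def linv_def base_def midf_def split: if_splits)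
    moreover have "Ex (far \<phi> 0) (Ket (\<lambda>_. 0)) = 0"
      unfolding Ex_def by (rule sum.neutral) (use assms in \<open>auto simp: Ket_def far_def\<close>)
    ultimately show ?case by (simp add: estops_def)
  next
    case (Suc L)
    have n1: "nsq (Ket (\<lambda>_. 0)) = 1" by (subst nsq_super[of "{\<lambda>_. 0}"]) (auto simp: Ket_def)
    have "wfs (gest \<phi> L)" by (rule wfs_estops) (auto simp: wfo_def indep_def)
    then have n: "nsq (aps (gest \<phi> L) (Ket (\<lambda>_. 0))) = 1" by (simp add: nsq_aps n1)
    have e: "aps (gest \<phi> (Suc L)) \<alpha> = aps (levelops [Ph (\<lambda>c. \<phi> * c 6)] L) (aps (gest \<phi> L) \<alpha>)" for \<alpha>
      by (simp add: estops_def)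
    show ?case unfolding e using level_err[of "aps (gest \<phi> L) (Ket (\<lambda>_. 0))" L \<phi>] Suc n by simp
  qed
  then show "sp (aps (gest \<phi> L) (Ket (\<lambda>_. 0))) (linv L 0)"
    "Ex (far \<phi> L) (aps (gest \<phi> L) (Ket (\<lambda>_. 0))) \<le> (\<Sum>l<L. 2 * exp (- (real (R l) / 144)))" by auto
qed

end

section \<open>Phase estimation on an invariant plane\<close>

definition driveops :: "qop list \<Rightarrow> qop list \<Rightarrow> nat \<Rightarrow> nat \<Rightarrow> qop list" where
  "driveops W F l k = F @ rep (2 ^ l) (\<lambda>_. W) @ mv k"

lemma nsq_restr_commute: "ops_on S xs \<Longrightarrow> indep S P \<Longrightarrow> fin \<alpha> \<Longrightarrow> nsq (restr P (aps xs \<alpha>)) = nsq (restr P \<alpha>)"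
  by (simp add: restr_ops_on nsq_aps ops_on_wfs)

lemma nsq_disjoint:
  assumes "fin x" "fin y" "\<And>c. x c = 0 \<or> y c = 0"
  shows "nsq (x - a *q y) = nsq x + (cmod a)\<^sup>2 * nsq y"
proof -
  let ?S = "{c. x c \<noteq> 0} \<union> {c. y c \<noteq> 0}"
  have f: "finite ?S" using assms by (simp add: fin_def)
  have "nsq (x - a *q y) = (\<Sum>c\<in>?S. (cmod ((x - a *q y) c))\<^sup>2)" using f by (intro nsq_super) auto
  also have "\<dots> = (\<Sum>c\<in>?S. (cmod (x c))\<^sup>2 + (cmod a)\<^sup>2 * (cmod (y c))\<^sup>2)"
  proof (rule sum.cong[OF refl])
    fix c show "(cmod ((x - a *q y) c))\<^sup>2 = (cmod (x c))\<^sup>2 + (cmod a)\<^sup>2 * (cmod (y c))\<^sup>2"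
      using assms(3)[of c] by (auto simp: norm_mult power_mult_distrib)
  qed
  also have "\<dots> = nsq x + (cmod a)\<^sup>2 * nsq y"
    using f by (subst (1 2) nsq_super[of ?S]) (auto simp: sum.distrib sum_distrib_left)
  finally show ?thesis .
qed

lemma nsq_parallelogram:
  assumes "fin x" "fin y" "cmod u = 1"
  shows "nsq ((1/2) *q (x + y)) + nsq ((u / 2) *q (x - y)) = (nsq x + nsq y) / 2"
proof -
  let ?S = "{c. x c \<noteq> 0} \<union> {c. y c \<noteq> 0}"
  have f: "finite ?S" using assms by (simp add: fin_def)
  have *: "(cmod ((1/2) * (a + b)))\<^sup>2 + (cmod (u / 2 * (a - b)))\<^sup>2 = ((cmod a)\<^sup>2 + (cmod b)\<^sup>2) / 2" for a b
  proof -
    have "(cmod (a + b))\<^sup>2 + (cmod (a - b))\<^sup>2 = 2 * (cmod a)\<^sup>2 + 2 * (cmod b)\<^sup>2"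
      unfolding cmod_power2 by (simp add: power2_eq_square algebra_simps)
    moreover have "cmod ((1/2) * (a + b)) = cmod (a + b) / 2" "cmod (u / 2 * (a - b)) = cmod (a - b) / 2"
      using assms(3) by (simp_all only: norm_mult norm_divide) simp_all
    ultimately show ?thesis by (simp add: power_divide field_simps)
  qed
  have "nsq ((1/2) *q (x + y)) + nsq ((u / 2) *q (x - y)) =
    (\<Sum>c\<in>?S. (cmod (((1/2) *q (x + y)) c))\<^sup>2 + (cmod (((u/2) *q (x - y)) c))\<^sup>2)"
    unfolding sum.distrib using f by (intro arg_cong2[of _ _ _ _ "(+)"] nsq_super) auto
  also have "\<dots> = (\<Sum>c\<in>?S. ((cmod (x c))\<^sup>2 + (cmod (y c))\<^sup>2) / 2)"
    by (intro sum.cong refl) (use * in simp)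
  also have "\<dots> = (nsq x + nsq y) / 2"
    using f by (subst (1 2) nsq_super[of ?S]) (auto simp: sum.distrib simp flip: sum_divide_distrib)
  finally show ?thesis .
qed

lemma pm_cong:
  assumes "trs xs" "trs ys" "sp \<alpha> P" "\<And>c. P c \<Longrightarrow> pm xs c = pm ys c"
  shows "aps xs \<alpha> = aps ys \<alpha>"
proof -
  have "aps zs \<alpha> = (\<Sum>c | \<alpha> c \<noteq> 0. \<alpha> c *q Ket (pm zs c))" if "trs zs" for zs
    by (subst fin_expand[OF sp_fin[OF assms(3)]]) (simp only: aps_sum aps_smul trs_Ket[OF that])
  then show ?thesis using assms by (auto intro!: sum.cong simp: sp_def)
qed

lemma trs_sp:
  assumes "trs xs" "sp \<alpha> P" "\<And>c. P c \<Longrightarrow> Q (pm xs c)"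
  shows "sp (aps xs \<alpha>) Q"
proof (rule spI)
  show "fin (aps xs \<alpha>)" by (rule fin_aps[OF trs_wfs[OF assms(1)] sp_fin[OF assms(2)]])
  fix d assume "aps xs \<alpha> d \<noteq> 0"
  from pm_state(2)[OF assms(1) sp_fin[OF assms(2)] this] show "Q d" using assms(2,3) by (auto simp: sp_def)
qed

lemma mv_on: "40 \<le> k \<Longrightarrow> ops_on {6, k} (mv k)"
  by (auto simp: mv_def wfo_def indep_def dep_def)

lemma trs_mv: "k \<noteq> 6 \<Longrightarrow> trs (mv k)"
  by (auto simp: mv_def wfo_def indep_def)

locale algo = plane + sched
begin

definition Z :: "real \<Rightarrow> qstate \<Rightarrow> qstate" where
  "Z sg \<alpha> = X \<alpha> - (\<i> * complex_of_real sg) *q Y \<alpha>"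

lemma Z_add: "Z sg (\<alpha> + \<beta>) = Z sg \<alpha> + Z sg \<beta>"
  unfolding Z_def Xs_add Y_add by (auto simp: fun_eq_iff algebra_simps)

lemma Z_smul: "Z sg (a *q \<alpha>) = a *q Z sg \<alpha>"
  unfolding Z_def Xs_smul Y_smul by (auto simp: fun_eq_iff algebra_simps)

lemma Z_commute: "ops_on S xs \<Longrightarrow> S \<inter> MC = {} \<Longrightarrow> aps xs (Z sg \<alpha>) = Z sg (aps xs \<alpha>)"
  unfolding Z_def aps_diff aps_smul by (simp only: Xs_commute Y_commute)

text \<open>The combinations of X and Y are eigenvectors of the walk, so on each of them the walk acts like
  a phase on the control qubit.\<close>

lemma Z_walk:
  assumes a: "gz \<alpha>" "\<And>c. \<alpha> c \<noteq> 0 \<Longrightarrow> c 6 = 0 \<or> c 6 = 1" and sg: "sg = 1 \<or> sg = - 1"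
  shows "aps Wops (Z sg \<alpha>) = Z sg (ap (Ph (\<lambda>c. sg * th * c 6)) \<alpha>)"
proof -
  let ?\<alpha>0 = "restr (\<lambda>c. c 6 = 0) \<alpha>" and ?\<alpha>1 = "restr (\<lambda>c. c 6 = 1) \<alpha>"
  have r0: "?\<alpha>0 c \<noteq> 0 \<Longrightarrow> c 6 = 0" for c by (auto simp: restr_def split: if_splits)
  have W0: "aps Wops (X ?\<alpha>0) = X ?\<alpha>0" "aps Wops (Y ?\<alpha>0) = Y ?\<alpha>0"
    by (rule Wops_0, erule r0)+
  have 0: "aps Wops (Z sg ?\<alpha>0) = Z sg ?\<alpha>0"
    unfolding Z_def aps_diff aps_smul W0 ..
  have r1: "?\<alpha>1 c \<noteq> 0 \<Longrightarrow> c 6 = 1" for c by (auto simp: restr_def split: if_splits)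
  have W: "aps Wops (X ?\<alpha>1) = complex_of_real (cos th) *q X ?\<alpha>1 + complex_of_real (sin th) *q Y ?\<alpha>1"
    "aps Wops (Y ?\<alpha>1) = complex_of_real (cos th) *q Y ?\<alpha>1 - complex_of_real (sin th) *q X ?\<alpha>1"
    by (rule Wops_1, erule r1, rule gz_restr[OF a(1)])+
  have cs: "cis (sg * th) = complex_of_real (cos th) + \<i> * complex_of_real sg * complex_of_real (sin th)"
    using sg by (auto simp: complex_eq_iff)
  have s2: "complex_of_real sg * complex_of_real sg = 1" using sg by auto
  have 1: "aps Wops (Z sg ?\<alpha>1) = cis (sg * th) *q Z sg ?\<alpha>1"
  proof
    fix c
    have s3: "complex_of_real sg * (complex_of_real sg * z) = z" for z using s2 by (simp flip: mult.assoc)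
    have i3: "\<i> * (\<i> * z) = - z" for z by (simp flip: mult.assoc)
    show "aps Wops (Z sg ?\<alpha>1) c = (cis (sg * th) *q Z sg ?\<alpha>1) c"
      unfolding Z_def aps_diff aps_smul W cs by (simp add: algebra_simps s3 i3)
  qed
  have s: "\<alpha> = ?\<alpha>0 + ?\<alpha>1"
  proof
    fix c show "\<alpha> c = (?\<alpha>0 + ?\<alpha>1) c" using a(2)[of c] by (cases "\<alpha> c = 0") (auto simp: restr_def)
  qed
  have p: "ap (Ph (\<lambda>c. sg * th * c 6)) \<alpha> = ?\<alpha>0 + cis (sg * th) *q ?\<alpha>1"
  proof
    fix c show "ap (Ph (\<lambda>c. sg * th * c 6)) \<alpha> c = (?\<alpha>0 + cis (sg * th) *q ?\<alpha>1) c"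
      using a(2)[of c] by (cases "\<alpha> c = 0") (auto simp: restr_def)
  qed
  show ?thesis
    unfolding p by (subst s) (simp only: Z_add Z_smul aps_add 0 1)
qed

text \<open>On \<open>Z\<close> the walk acts as a phase of the second factor, and all other
  operations of the test avoid the cells of the plane. Hence the test passes through
  \<open>Z\<close> step by step and becomes the test with a phase.\<close>

lemma lift_test:
  assumes a: "gz \<alpha>" "\<forall>c. \<alpha> c \<noteq> 0 \<longrightarrow> c 6 = 0" and sg: "sg = 1 \<or> sg = - 1" and k: "40 \<le> k"
  shows "aps (testops Wops l k) (Z sg \<alpha>) = Z sg (aps (gtest (sg * th) l k) \<alpha>)"
proof -
  let ?G = "\<lambda>\<alpha>. gz \<alpha> \<and> (\<forall>c. \<alpha> c \<noteq> 0 \<longrightarrow> c 6 = 0 \<or> c 6 = 1)"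
  let ?ph = "Ph (\<lambda>c. angle (- (c 6 * c 9)))" and ?gw = "Ph (\<lambda>c. sg * th * c 6)"
  have r_on: "ops_on {6} [Ro 6 (\<lambda>_. pi / 4)]" by (simp add: wfo_def indep_def dep_def)
  have ph_on: "ops_on {6, 9} [?ph]" by (simp add: wfo_def indep_def dep_def)
  have gw_on: "ops_on {6} [?gw]" by (simp add: wfo_def indep_def dep_def)
  define \<alpha>1 where "\<alpha>1 = ap (Ro 6 (\<lambda>_. pi / 4)) \<alpha>"
  have 1: "aps [Ro 6 (\<lambda>_. pi / 4)] (Z sg \<alpha>) = Z sg \<alpha>1"
    using Z_commute[OF r_on, of sg \<alpha>] by (simp only: \<alpha>1_def aps_simps) (simp add: MC_def)
  have g1: "?G \<alpha>1"
  proof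
    show "gz \<alpha>1" using gz_aps[OF r_on _ a(1)] by (simp only: \<alpha>1_def aps_simps) (simp add: MC_def)
    show "\<forall>c. \<alpha>1 c \<noteq> 0 \<longrightarrow> c 6 = 0 \<or> c 6 = 1"
    proof (intro allI impI)
      fix c assume "\<alpha>1 c \<noteq> 0"
      then show "c 6 = 0 \<or> c 6 = 1" using a(2) by (auto simp: \<alpha>1_def split: if_splits)
    qed
  qed
  have st: "aps Wops (Z sg \<beta>) = Z sg (ap ?gw \<beta>)" "aps [?ph] (Z sg \<beta>) = Z sg (aps [?ph] \<beta>)" "?G (ap ?gw \<beta>)" "?G (aps [?ph] \<beta>)"
    if "?G \<beta>" for \<beta>
  proof -
    show "aps Wops (Z sg \<beta>) = Z sg (ap ?gw \<beta>)" using that by (intro Z_walk sg) auto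
    show "aps [?ph] (Z sg \<beta>) = Z sg (aps [?ph] \<beta>)" by (rule Z_commute[OF ph_on]) (simp add: MC_def)
    show "?G (ap ?gw \<beta>)" using that gz_aps[OF gw_on, of \<beta>] by (simp add: MC_def)
    show "?G (aps [?ph] \<beta>)" using that gz_aps[OF ph_on, of \<beta>] by (simp add: MC_def)
  qed
  have 2: "aps (rep j (\<lambda>_. Wops @ [?ph])) (Z sg \<alpha>1) = Z sg (aps (rep j (\<lambda>_. [?gw] @ [?ph])) \<alpha>1) \<and>
     ?G (aps (rep j (\<lambda>_. [?gw] @ [?ph])) \<alpha>1)" for j
  proof (induction j)
    case (Suc j)
    let ?\<beta> = "aps (rep j (\<lambda>_. [?gw] @ [?ph])) \<alpha>1"
    have G: "?G ?\<beta>" and I: "aps (rep j (\<lambda>_. Wops @ [?ph])) (Z sg \<alpha>1) = Z sg ?\<beta>" using Suc by blast+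
    have e: "aps (rep (Suc j) (\<lambda>_. [?gw] @ [?ph])) \<alpha>1 = aps [?ph] (ap ?gw ?\<beta>)" by (simp only: rep_simps aps_simps)
    have "aps (rep (Suc j) (\<lambda>_. Wops @ [?ph])) (Z sg \<alpha>1) = aps [?ph] (aps Wops (Z sg ?\<beta>))"
      by (simp only: rep_simps aps_simps I)
    also have "\<dots> = Z sg (aps [?ph] (ap ?gw ?\<beta>))" by (simp only: st(1)[OF G] st(2)[OF st(3)[OF G]])
    finally show ?case unfolding e using st(4)[OF st(3)[OF G]] by blast
  qed (use g1 in simp)
  have on3: "ops_on {6, k} ([Ph (\<lambda>c. angle (pi / 2 * c 6)), Ro 6 (\<lambda>_. - (pi / 4))] @ mv k)"
    using mv_on[OF k] by (simp add: wfo_def indep_def dep_def)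
  have "aps (testops Wops l k) (Z sg \<alpha>) = aps ([Ph (\<lambda>c. angle (pi / 2 * c 6)), Ro 6 (\<lambda>_. - (pi / 4))] @ mv k)
    (aps (rep (2 ^ l) (\<lambda>_. Wops @ [?ph])) (aps [Ro 6 (\<lambda>_. pi / 4)] (Z sg \<alpha>)))"
    unfolding testops_def by (simp only: aps_simps)
  also have "\<dots> = Z sg (aps ([Ph (\<lambda>c. angle (pi / 2 * c 6)), Ro 6 (\<lambda>_. - (pi / 4))] @ mv k)
    (aps (rep (2 ^ l) (\<lambda>_. [?gw] @ [?ph])) \<alpha>1))"
    unfolding 1 using 2 Z_commute[OF on3] k by (simp only:) (simp add: MC_def)
  finally show ?thesis unfolding testops_def \<alpha>1_def by (simp only: aps_simps)
qed

lemma linv_gz: "sp \<alpha> (linv l i) \<Longrightarrow> gz \<alpha> \<and> (\<forall>c. \<alpha> c \<noteq> 0 \<longrightarrow> c 6 = 0)"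
  unfolding sp_def gz_def linv_def base_def anc_def by simp

lemma upd_on: "ops_on ({9} \<union> {40..}) (updops sg l)"
proof -
  have "ops_on ({9} \<union> {40..}) (rep j (\<lambda>i. [Tr 9 (\<lambda>c. sg * wt l * c (40 + offs l + i))]))" for j
    by (induction j) (auto simp: wfo_def indep_def dep_def)
  then show ?thesis by (auto simp: updops_def wfo_def indep_def dep_def)
qed

lemma lift_level:
  assumes a: "sp \<alpha> (linv l 0)" and sg: "sg = 1 \<or> sg = - 1"
  shows "aps (levelops Wops l) (Z sg \<alpha>) = Z sg (aps (levelops [Ph (\<lambda>c. sg * th * c 6)] l) \<alpha>)"
proof -
  have "aps (rep i (\<lambda>i. testops Wops l (40 + offs l + i))) (Z sg \<alpha>) =
      Z sg (aps (rep i (\<lambda>i. gtest (sg * th) l (40 + offs l + i))) \<alpha>)" if "i \<le> R l" for i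
    using that
  proof (induction i)
    case (Suc i)
    let ?\<beta> = "aps (rep i (\<lambda>i. gtest (sg * th) l (40 + offs l + i))) \<alpha>"
    have "sp ?\<beta> (linv l i)" using level_tests[OF a, of i] Suc by simp
    then have "gz ?\<beta>" "\<forall>c. ?\<beta> c \<noteq> 0 \<longrightarrow> c 6 = 0" using linv_gz by blast+
    from lift_test[OF this sg, of "40 + offs l + i" l] show ?case
      using Suc by (simp only: rep_simps aps_simps Suc_leD)
  qed simp
  moreover have "aps (updops 1 l) (Z sg \<beta>) = Z sg (aps (updops 1 l) \<beta>)" for \<beta>
    by (rule Z_commute[OF upd_on]) (auto simp: MC_def)
  ultimately show ?thesis unfolding levelops_def by (simp only: aps_simps order_refl)
qed

lemma lift_est:
  assumes th: "\<bar>th\<bar> \<le> 1" and sg: "sg = 1 \<or> sg = - 1"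
  shows "aps (estops Wops L) (Z sg (Ket (\<lambda>_. 0))) = Z sg (aps (gest (sg * th) L) (Ket (\<lambda>_. 0)))"
proof (induction L)
  case (Suc L)
  have "\<bar>sg * th\<bar> \<le> 1" using th sg by auto
  from lift_level[OF est_err(1)[OF this, of L] sg] show ?case
    using Suc unfolding estops_def by (simp only: rep_simps aps_simps)
qed (simp add: estops_def)

lemma est_state:
  assumes th: "\<bar>th\<bar> \<le> 1"
  obtains a b where "aps (estops Wops L) (X (Ket (\<lambda>_. 0))) = X a + Y b" "sp a (linv L 0)" "sp b (linv L 0)"
    "nsq a + nsq b = 1"
    "nsq (restr (\<lambda>c. 1 / 2 ^ L < \<bar>th - c 9\<bar> \<and> 1 / 2 ^ L < \<bar>th + c 9\<bar>) a) +
     nsq (restr (\<lambda>c. 1 / 2 ^ L < \<bar>th - c 9\<bar> \<and> 1 / 2 ^ L < \<bar>th + c 9\<bar>) b) \<le> (\<Sum>l<L. 2 * exp (- (real (R l) / 144)))"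
proof -
  let ?K = "Ket (\<lambda>_. 0)" and ?B = "\<lambda>c. 1 / 2 ^ L < \<bar>th - c 9\<bar> \<and> 1 / 2 ^ L < \<bar>th + c 9\<bar>"
  define p where "p = aps (gest (1 * th) L) ?K"
  define q where "q = aps (gest (- 1 * th) L) ?K"
  \<comment> \<open>The start X is the mean of the eigenvectors for th and -th, so the state is (Z 1
    p + Z (-1) q) / 2; \<open>a\<close> and \<open>b\<close> are what multiplies X and Y after
    sorting.\<close>
  define a where "a = (1/2) *q (p + q)"
  define b where "b = (- \<i> / 2) *q (p - q)"
  have t: "\<bar>1 * th\<bar> \<le> 1" "\<bar>- 1 * th\<bar> \<le> 1" using th by auto
  have pq: "sp p (linv L 0)" "sp q (linv L 0)" unfolding p_def q_def by (intro est_err(1) t)+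
  then have f: "fin p" "fin q" by (auto simp: sp_def)
  have "X ?K = (1/2) *q (Z 1 ?K + Z (- 1) ?K)"
    unfolding Z_def by (rule ext) simp
  then have "aps (estops Wops L) (X ?K) = (1/2) *q (Z 1 p + Z (- 1) q)"
    unfolding p_def q_def using lift_est[OF th, of 1 L] lift_est[OF th, of "- 1" L] by (simp only: aps_smul aps_add) simp
  also have "\<dots> = X a + Y b"
  proof -
    have Yd: "Y (p - q) = Y p - Y q" using Y_add[of "p - q" q] by simp
    have i2: "\<i> * (\<i> * z) = - z" for z by (simp flip: mult.assoc)
    show ?thesis unfolding a_def b_def Xs_smul Y_smul Xs_add Yd Z_def
      by (rule ext) (simp add: algebra_simps)
  qed
  finally have 1: "aps (estops Wops L) (X ?K) = X a + Y b" .
  have "sp a (linv L 0)" "sp b (linv L 0)"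
  proof -
    have z: "linv L 0 c" if "p c \<noteq> 0 \<or> q c \<noteq> 0" for c using that pq by (auto simp: sp_def)
    show "sp a (linv L 0)" unfolding a_def using f by (intro spI fin_smul fin_add z) auto
    show "sp b (linv L 0)" unfolding b_def using f by (intro spI fin_smul fin_diff z) auto
  qed
  moreover have par: "nsq (restr P a) + nsq (restr P b) = (nsq (restr P p) + nsq (restr P q)) / 2" for P
    unfolding a_def b_def restr_smul restr_add restr_diff using f by (intro nsq_parallelogram) auto
  have n1: "nsq ?K = 1" by (subst nsq_super[of "{\<lambda>_. 0}"]) (auto simp: Ket_def)
  have wf: "wfs (gest \<phi> L)" for \<phi> by (rule wfs_estops) (auto simp: wfo_def indep_def)
  have n: "nsq p = 1" "nsq q = 1" unfolding p_def q_def nsq_aps[OF wf fin_Ket] by (rule n1)+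
  have "nsq a + nsq b = 1" using par[of "\<lambda>_. True"] n by (simp add: restr_def)
  moreover have "nsq (restr ?B a) + nsq (restr ?B b) \<le> (\<Sum>l<L. 2 * exp (- (real (R l) / 144)))"
  proof -
    \<comment> \<open>\<open>?B\<close> demands distance from both th and -th, hence implies failure
      whichever of the two phases a branch has.\<close>
    have "nsq (restr ?B p) \<le> Ex (far (1 * th) L) p" "nsq (restr ?B q) \<le> Ex (far (- 1 * th) L) q"
      unfolding Ex_restr[OF f(1)] Ex_restr[OF f(2)] by (rule Ex_mono; auto simp: far_def abs_if split: if_splits)+
    then show ?thesis
      unfolding par using est_err(2)[OF t(1), of L] est_err(2)[OF t(2), of L] by (simp add: p_def q_def)
  qed
  ultimately show ?thesis using that 1 by blast
qed

end

section \<open>Returning the Y part to X\<close>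

lemma sin_prod: "sin (2 ^ L * x) = 2 ^ L * sin x * (\<Prod>l<L. cos (2 ^ l * x))" for x :: real
proof (induction L)
  case (Suc L)
  have "sin (2 ^ Suc L * x) = sin (2 * (2 ^ L * x))" by (simp add: mult.assoc)
  also have "\<dots> = 2 * sin (2 ^ L * x) * cos (2 ^ L * x)" by (rule sin_double)
  finally show ?case by (simp add: Suc)
qed simp

definition drive :: "qop list \<Rightarrow> qop list \<Rightarrow> nat \<Rightarrow> nat \<Rightarrow> nat \<Rightarrow> qop list" where
  "drive W F L K0 t = rep K0 (\<lambda>p. rep L (\<lambda>l. driveops W F l (40 + (t + p * L + l))))"

context sched
begin

definition dinv :: "nat \<Rightarrow> nat \<Rightarrow> config \<Rightarrow> bool" where
  "dinv L t c \<longleftrightarrow> base c \<and> (\<forall>j\<ge>40 + t. c j = 0) \<and> c 9 = midf L c \<and> offs L \<le> t"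

lemma linv_dinv: "linv L 0 c \<Longrightarrow> dinv L (offs L) c"
  by (simp add: linv_def dinv_def)

lemma dinv_upd: "dinv L t c \<Longrightarrow> dinv L (Suc t) (c(40 + t := 1))"
  by (auto simp: dinv_def base_def midf_upd)

lemma dinv_Suc: "dinv L t c \<Longrightarrow> dinv L (Suc t) c"
  by (auto simp: dinv_def)

end

context algo
begin

lemma dinv_gz: "sp \<alpha> (dinv L t) \<Longrightarrow> gz \<alpha>"
  unfolding sp_def gz_def dinv_def base_def anc_def by simp

lemma Walk_Y:
  assumes "\<And>c. \<alpha> c \<noteq> 0 \<Longrightarrow> c 6 = 1" "gz \<alpha>"
  shows "aps (rep j (\<lambda>_. Wops)) (Y \<alpha>) = complex_of_real (cos (real j * th)) *q Y \<alpha> - complex_of_real (sin (real j * th)) *q X \<alpha>"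
proof (induction j)
  case (Suc j)
  have W: "aps Wops (X \<alpha>) = complex_of_real (cos th) *q X \<alpha> + complex_of_real (sin th) *q Y \<alpha>"
    "aps Wops (Y \<alpha>) = complex_of_real (cos th) *q Y \<alpha> - complex_of_real (sin th) *q X \<alpha>"
    by (rule Wops_1, erule assms(1), rule assms(2))+
  have r: "real (Suc j) * th = real j * th + th" by (simp add: algebra_simps)
  show ?case
    unfolding rep_simps aps_simps Suc.IH aps_diff aps_smul W r cos_add sin_add
    by (rule ext) (simp add: algebra_simps)
qed simp

text \<open>The flag in cell 6, set exactly on Y, controls the walk, so only this part rotates, by
  the angle 2^l th. Moving the flag to the fresh cell \<open>40 + t\<close> marks everything that
  comes from it, including the share that has arrived in X.\<close>

lemma drive_step:
  assumes a: "sp a (dinv L t)" and b: "sp b (dinv L t)"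
  shows "aps (driveops Wops Fops l (40 + t)) (X a + Y b) =
    X (a - complex_of_real (sin (2 ^ l * th)) *q aps [Tr (40 + t) (\<lambda>_. 1)] b) +
    Y (complex_of_real (cos (2 ^ l * th)) *q aps [Tr (40 + t) (\<lambda>_. 1)] b)"
proof -
  let ?fl = "aps [Tr (40 + t) (\<lambda>_. 1)] b"
  define b1 where "b1 = aps [Tr 6 (\<lambda>_. 1)] b"
  have t6: "trs [Tr 6 (\<lambda>_. 1)]" by (simp add: wfo_def indep_def)
  have b6: "sp b1 (\<lambda>c. c 6 = 1)"
    unfolding b1_def by (rule trs_sp[OF t6 b]) (simp add: dinv_def base_def)
  have g1: "gz b1"
    unfolding b1_def by (rule gz_aps[of "{6}", OF _ _ dinv_gz[OF b]]) (auto simp: wfo_def indep_def dep_def MC_def)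
  have 1: "aps Fops (X a + Y b) = X a + Y b1"
    unfolding aps_add Fops_X Fops_Y[OF dinv_gz[OF b]] b1_def aps_simps ..
  have a0: "aps (rep j (\<lambda>_. Wops)) (X a) = X a" for j
  proof (induction j)
    case (Suc j)
    have "aps Wops (X a) = X a" by (rule Wops_0) (use a in \<open>auto simp: sp_def dinv_def base_def\<close>)
    then show ?case using Suc by (simp only: rep_simps aps_simps)
  qed simp
  have m: "aps (mv (40 + t)) (X \<beta>) = X (aps (mv (40 + t)) \<beta>)" "aps (mv (40 + t)) (Y \<beta>) = Y (aps (mv (40 + t)) \<beta>)" for \<beta>
    by (rule Xs_commute Y_commute, rule mv_on, simp, simp add: MC_def)+
  have tr: "trs (mv (40 + t))" "trs []" "trs ([Tr 6 (\<lambda>_. 1)] @ mv (40 + t))" "trs [Tr (40 + t) (\<lambda>_. 1)]"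
    using t6 trs_mv[of "40 + t"] by (simp_all add: wfo_def indep_def)
  have ma: "aps (mv (40 + t)) a = a"
  proof -
    have "aps (mv (40 + t)) a = aps [] a"
      by (rule pm_cong[OF tr(1,2) a]) (auto simp: mv_def dinv_def base_def fun_upd_idem)
    then show ?thesis by simp
  qed
  have mb: "aps (mv (40 + t)) b1 = ?fl"
  proof -
    have "aps ([Tr 6 (\<lambda>_. 1)] @ mv (40 + t)) b = ?fl"
    proof (rule pm_cong[OF tr(3,4) b])
      fix c assume "dinv L t c"
      then have "c 6 = 0" "c (40 + t) = 0" by (auto simp: dinv_def base_def)
      then show "pm ([Tr 6 (\<lambda>_. 1)] @ mv (40 + t)) c = pm [Tr (40 + t) (\<lambda>_. 1)] c"
        unfolding mv_def pm_append pm.simps by (intro ext) simp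
    qed
    then show ?thesis by (simp only: b1_def aps_simps)
  qed
  have wy: "aps (rep (2 ^ l) (\<lambda>_. Wops)) (Y b1) =
      complex_of_real (cos (real (2 ^ l) * th)) *q Y b1 - complex_of_real (sin (real (2 ^ l) * th)) *q X b1"
    by (rule Walk_Y[OF _ g1]) (erule spD[OF b6])
  have Xd: "X (a - r *q \<beta>) = X a - r *q X \<beta>" for r \<beta>
    using Xs_add[of N w "a - r *q \<beta>" "r *q \<beta>"] by (simp add: Xs_smul)
  have r2: "real (2 ^ l) = 2 ^ l" by simp
  have "aps (driveops Wops Fops l (40 + t)) (X a + Y b) =
      aps (mv (40 + t)) (aps (rep (2 ^ l) (\<lambda>_. Wops)) (aps Fops (X a + Y b)))"
    unfolding driveops_def by (simp only: aps_simps(3))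
  also have "\<dots> = X a + (complex_of_real (cos (2 ^ l * th)) *q Y ?fl -
      complex_of_real (sin (2 ^ l * th)) *q X ?fl)"
    unfolding 1 unfolding aps_add a0 wy aps_diff aps_smul m ma mb r2 ..
  finally show ?thesis unfolding Xd Y_smul by (auto simp: fun_eq_iff)
qed

text \<open>Two facts are carried along: the weight of Y shrinks by the factor \<open>r\<close>, and
  the total weight of any set of estimates in cell 9 is conserved. The second one preserves the
  error bound of the estimation during the return to X.\<close>

definition DP :: "nat \<Rightarrow> nat \<Rightarrow> real \<Rightarrow> qstate \<Rightarrow> qstate \<Rightarrow> qstate \<Rightarrow> qstate \<Rightarrow> qstate \<Rightarrow> bool" where
  "DP L t r a b \<psi> a' b' \<longleftrightarrow> \<psi> = X a' + Y b' \<and> sp a' (dinv L t) \<and> sp b' (dinv L t) \<and>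
     (\<forall>Q. nsq (restr (\<lambda>c. Q (c 9)) a') + nsq (restr (\<lambda>c. Q (c 9)) b') = nsq (restr (\<lambda>c. Q (c 9)) a) + nsq (restr (\<lambda>c. Q (c 9)) b)) \<and>
     nsq b' = r * nsq b"

definition DR :: "nat \<Rightarrow> nat \<Rightarrow> nat \<Rightarrow> real \<Rightarrow> qop list \<Rightarrow> bool" where
  "DR L t t' r xs \<longleftrightarrow> (\<forall>a b. sp a (dinv L t) \<longrightarrow> sp b (dinv L t) \<longrightarrow> (\<exists>a' b'. DP L t' r a b (aps xs (X a + Y b)) a' b'))"

lemma DR_step: "DR L t (Suc t) ((cos (2 ^ l * th))\<^sup>2) (driveops Wops Fops l (40 + t))"
  unfolding DR_def
proof (intro allI impI)
  fix a b assume a: "sp a (dinv L t)" and b: "sp b (dinv L t)"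
  let ?fl = "aps [Tr (40 + t) (\<lambda>_. 1)]"
  let ?s = "complex_of_real (sin (2 ^ l * th))" and ?c = "complex_of_real (cos (2 ^ l * th))"
  have tr: "trs [Tr (40 + t) (\<lambda>_. 1)]" by (simp add: wfo_def indep_def)
  have on: "ops_on {40 + t} [Tr (40 + t) (\<lambda>_. 1)]" by (simp add: wfo_def indep_def dep_def)
  have f: "fin a" "fin b" "fin (?fl b)" using a b fin_aps[OF trs_wfs[OF tr]] by (auto simp: sp_def)
  have fl: "sp (?fl b) (\<lambda>c. dinv L (Suc t) c \<and> c (40 + t) = 1)"
  proof (rule trs_sp[OF tr b])
    fix c assume c: "dinv L t c"
    then have "c (40 + t) = 0" by (simp add: dinv_def)
    then show "dinv L (Suc t) (pm [Tr (40 + t) (\<lambda>_. 1)] c) \<and> pm [Tr (40 + t) (\<lambda>_. 1)] c (40 + t) = 1"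
      using dinv_upd[OF c] by simp
  qed
  show "\<exists>a' b'. DP L (Suc t) ((cos (2 ^ l * th))\<^sup>2) a b (aps (driveops Wops Fops l (40 + t)) (X a + Y b)) a' b'"
    unfolding DP_def
  proof (intro exI conjI allI)
    show "aps (driveops Wops Fops l (40 + t)) (X a + Y b) = X (a - ?s *q ?fl b) + Y (?c *q ?fl b)"
      by (rule drive_step[OF a b])
    have z: "dinv L (Suc t) c" if "a c \<noteq> 0 \<or> ?fl b c \<noteq> 0" for c
      using that spD[OF a, of c] dinv_Suc spD[OF fl, of c] by blast
    show "sp (a - ?s *q ?fl b) (dinv L (Suc t))" using f by (intro spI fin_diff fin_smul z) auto
    show "sp (?c *q ?fl b) (dinv L (Suc t))" using f by (intro spI fin_smul z) auto
    show "nsq (?c *q ?fl b) = (cos (2 ^ l * th))\<^sup>2 * nsq b"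
      using f nsq_aps[OF trs_wfs[OF tr] f(2)] by (simp add: nsq_smul)
    fix Q :: "real \<Rightarrow> bool"
    let ?Q = "\<lambda>c :: config. Q (c 9)"
    have i: "indep {40 + t} ?Q" by (simp add: indep_def)
    \<comment> \<open>Cell \<open>40 + t\<close> is 0 in \<open>a\<close> and 1 in the flagged part.
      The two do not interfere, squared norms add, and the squares of sine and cosine sum to
      1.\<close>
    have d: "restr ?Q a c = 0 \<or> restr ?Q (?fl b) c = 0" for c
    proof (cases "c (40 + t) = 1")
      case True
      then have "\<not> dinv L t c" by (auto simp: dinv_def)
      then have "a c = 0" by (rule sp_zero[OF a])
      then show ?thesis by (simp add: restr_def)
    next
      case False
      then have "?fl b c = 0" using spD[OF fl, of c] by blast
      then show ?thesis by (simp add: restr_def)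
    qed
    have n: "nsq (restr ?Q (?fl b)) = nsq (restr ?Q b)" by (rule nsq_restr_commute[OF on i f(2)])
    have sc: "(sin (2 ^ l * th))\<^sup>2 * x + (cos (2 ^ l * th))\<^sup>2 * x = x" for x :: real
      using sin_cos_squared_add[of "2 ^ l * th"] by (metis distrib_right mult_1)
    show "nsq (restr ?Q (a - ?s *q ?fl b)) + nsq (restr ?Q (?c *q ?fl b)) = nsq (restr ?Q a) + nsq (restr ?Q b)"
      unfolding restr_diff restr_smul using f sc[of "nsq (restr ?Q b)"]
      by (subst nsq_disjoint[OF _ _ d]) (simp_all add: nsq_smul n del: aps_simps)
  qed
qed

lemma DR_append: "DR L t t' r xs \<Longrightarrow> DR L t' t'' r' ys \<Longrightarrow> DR L t t'' (r * r') (xs @ ys)"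
  unfolding DR_def
proof (intro allI impI)
  fix a b
  assume xs: "\<forall>a b. sp a (dinv L t) \<longrightarrow> sp b (dinv L t) \<longrightarrow> (\<exists>a' b'. DP L t' r a b (aps xs (X a + Y b)) a' b')"
    and ys: "\<forall>a b. sp a (dinv L t') \<longrightarrow> sp b (dinv L t') \<longrightarrow> (\<exists>a' b'. DP L t'' r' a b (aps ys (X a + Y b)) a' b')"
    and ab: "sp a (dinv L t)" "sp b (dinv L t)"
  from xs[rule_format, OF ab] obtain a1 b1 where 1: "DP L t' r a b (aps xs (X a + Y b)) a1 b1" by blast
  then have "sp a1 (dinv L t')" "sp b1 (dinv L t')" by (auto simp: DP_def)
  from ys[rule_format, OF this] obtain a2 b2 where 2: "DP L t'' r' a1 b1 (aps ys (X a1 + Y b1)) a2 b2" by blast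
  show "\<exists>a' b'. DP L t'' (r * r') a b (aps (xs @ ys) (X a + Y b)) a' b'"
    using 1 2 by (intro exI[of _ a2] exI[of _ b2]) (simp add: DP_def)
qed

lemma DR_Nil: "DR L t t 1 []"
  unfolding DR_def DP_def by auto

lemma DR_rep: "(\<And>i. i < j \<Longrightarrow> DR L (f i) (f (Suc i)) (r i) (g i)) \<Longrightarrow> DR L (f 0) (f j) (\<Prod>i<j. r i) (rep j g)"
proof (induction j)
  case (Suc j)
  have "DR L (f 0) (f j) (\<Prod>i<j. r i) (rep j g)" using Suc by simp
  from DR_append[OF this Suc.prems[of j]] show ?case by simp
qed (simp add: DR_Nil)

lemma DR_drive: "DR L t (t + K0 * L) ((\<Prod>l<L. (cos (2 ^ l * th))\<^sup>2) ^ K0) (drive Wops Fops L K0 t)"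
proof -
  have "DR L (t + p * L) (t + Suc p * L) (\<Prod>l<L. (cos (2 ^ l * th))\<^sup>2) (rep L (\<lambda>l. driveops Wops Fops l (40 + (t + p * L + l))))" for p
  proof -
    have "DR L (t + p * L + 0) (t + p * L + L) (\<Prod>l<L. (cos (2 ^ l * th))\<^sup>2) (rep L (\<lambda>l. driveops Wops Fops l (40 + (t + p * L + l))))"
      by (rule DR_rep[of L L "\<lambda>l. t + p * L + l"]) (simp only: add_Suc_right DR_step)
    then show ?thesis by (simp add: add.commute add.left_commute)
  qed
  then show ?thesis
    using DR_rep[of K0 L "\<lambda>p. t + p * L" "\<lambda>p. \<Prod>l<L. (cos (2 ^ l * th))\<^sup>2"] unfolding drive_def by simp
qed

lemma drive_factor:
  assumes "0 < sin th" "2 \<le> 2 ^ L * sin th"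
  shows "(\<Prod>l<L. (cos (2 ^ l * th))\<^sup>2) ^ K0 \<le> 1 / 4 ^ K0"
proof -
  let ?P = "\<Prod>l<L. cos (2 ^ l * th)"
  have "2 ^ L * sin th * \<bar>?P\<bar> = \<bar>sin (2 ^ L * th)\<bar>" using assms(1) by (simp add: sin_prod abs_mult)
  also have "\<dots> \<le> 1" by simp
  finally have "2 * \<bar>?P\<bar> \<le> 1" using mult_right_mono[OF assms(2), of "\<bar>?P\<bar>"] by simp
  then have "\<bar>?P\<bar>\<^sup>2 \<le> (1 / 2)\<^sup>2" by (intro power_mono) auto
  then have "(\<Prod>l<L. (cos (2 ^ l * th))\<^sup>2) \<le> 1 / 4" by (simp add: prod_power_distrib power_divide)
  then have "(\<Prod>l<L. (cos (2 ^ l * th))\<^sup>2) ^ K0 \<le> (1 / 4) ^ K0" by (intro power_mono prod_nonneg) auto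
  then show ?thesis by (simp add: power_divide)
qed

end

section \<open>Packing the history into the estimate\<close>

text \<open>The test outcomes are a by-product that must not survive in cells of its own. They are written into
  the low-order binary digits of the estimate, from which they can be read off and hence erased.\<close>

definition yf :: "real \<Rightarrow> real \<Rightarrow> real" where
  "yf Dh x = \<bar>Dh * sin (angle (x * (1 / 2)))\<bar>"

text \<open>Division by \<open>kq\<close> with rounding down, capped at \<open>j\<close>, by
  counting comparisons. The count 2^L that is needed later is of the order of the number of walk
  steps, so this simple method does not spoil the running time.\<close>

definition ngrid :: "nat \<Rightarrow> real \<Rightarrow> real \<Rightarrow> real" where
  "ngrid j kq y = (\<Sum>k<j. leqr (real (Suc k) * kq) y)"

text \<open>The place value of outcome t. All place values together stay below \<open>kq\<close>, so
  the packed outcomes never reach the next grid point.\<close>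

definition eta :: "real \<Rightarrow> nat \<Rightarrow> real" where
  "eta kq t = kq / 2 ^ Suc t"

definition packA :: "nat \<Rightarrow> real \<Rightarrow> real \<Rightarrow> qop list" where
  "packA j kq Dh = rep j (\<lambda>k. [Tr 10 (\<lambda>c. leqr (real (Suc k) * kq) (yf Dh (c 9)))])"

definition packC :: "real \<Rightarrow> nat \<Rightarrow> qop list" where
  "packC kq T = [Tr 1 (\<lambda>c. kq * c 10)] @ rep T (\<lambda>t. [Tr 1 (\<lambda>c. eta kq t * c (40 + t))])"

text \<open>Cell 8 starts as a copy of cell 1, and the bits are subtracted from it beginning with
  the last. After bit u, the difference of cells 1 and 8 is the packed value of the bits from u on;
  those after u total less than the place value of u, so comparing with that place value recovers
  bit u and erases its cell.\<close>

definition packD :: "real \<Rightarrow> nat \<Rightarrow> qop list" where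
  "packD kq T = [Tr 8 (\<lambda>c. c 1)] @ rep T (\<lambda>t. [Tr 8 (\<lambda>c. - (eta kq (T - Suc t) * c (40 + (T - Suc t)))),
     Tr (40 + (T - Suc t)) (\<lambda>c. - leqr (eta kq (T - Suc t)) (c 1 - c 8))])"

text \<open>Cell 8 now holds \<open>kq\<close> times cell 10 and is cleared from it. Cell 10 comes
  last: the grid index can be recomputed from cell 1, since the packed bits add less than one grid
  step (\<open>ngrid_pack\<close>).\<close>

definition packE :: "nat \<Rightarrow> real \<Rightarrow> qop list" where
  "packE j kq = [Tr 8 (\<lambda>c. - (kq * c 10))] @ rep j (\<lambda>k. [Tr 10 (\<lambda>c. - leqr (real (Suc k) * kq) (c 1))])"

definition bitsum :: "real \<Rightarrow> nat \<Rightarrow> config \<Rightarrow> real" where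
  "bitsum kq j c = (\<Sum>t<j. eta kq t * c (40 + t))"

lemma ngrid_eq:
  assumes "0 < kq" "0 \<le> y"
  shows "ngrid j kq y = real (min j (nat \<lfloor>y / kq\<rfloor>))"
proof -
  have "leqr (real (Suc k) * kq) y = (if k < nat \<lfloor>y / kq\<rfloor> then 1 else 0)" for k
  proof -
    have "real (Suc k) * kq \<le> y \<longleftrightarrow> real (Suc k) \<le> y / kq" using assms by (simp add: pos_le_divide_eq)
    also have "\<dots> \<longleftrightarrow> int (Suc k) \<le> \<lfloor>y / kq\<rfloor>" by (simp add: le_floor_iff)
    also have "\<dots> \<longleftrightarrow> k < nat \<lfloor>y / kq\<rfloor>" by linarith
    finally show ?thesis by (simp add: leqr_def)
  qed
  then have "ngrid j kq y = (\<Sum>k<j. if k < nat \<lfloor>y / kq\<rfloor> then 1 else 0)" by (simp add: ngrid_def)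
  also have "\<dots> = real (card ({..<j} \<inter> {k. k < nat \<lfloor>y / kq\<rfloor>}))" by (simp add: sum.If_cases)
  also have "{..<j} \<inter> {k. k < nat \<lfloor>y / kq\<rfloor>} = {..<min j (nat \<lfloor>y / kq\<rfloor>)}" by auto
  finally show ?thesis by simp
qed

lemma ngrid_bounds:
  assumes "0 < kq" "0 \<le> y" "y \<le> real j * kq"
  shows "kq * ngrid j kq y \<le> y" "y < kq * ngrid j kq y + kq"
proof -
  have "y / kq \<le> real j" using assms by (simp add: pos_divide_le_eq)
  then have "\<lfloor>y / kq\<rfloor> \<le> int j" by linarith
  moreover have "0 \<le> \<lfloor>y / kq\<rfloor>" using assms by simp
  ultimately have "ngrid j kq y = real_of_int \<lfloor>y / kq\<rfloor>" unfolding ngrid_eq[OF assms(1,2)] by simp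
  then show "kq * ngrid j kq y \<le> y" "y < kq * ngrid j kq y + kq"
    using assms floor_divide_lower[of kq y] floor_divide_upper[of kq y] by (simp_all add: algebra_simps)
qed

lemma ngrid_pack:
  assumes "0 < kq" "0 \<le> y" "0 \<le> e" "e < kq"
  shows "ngrid j kq (kq * ngrid j kq y + e) = ngrid j kq y"
proof -
  define g where "g = min j (nat \<lfloor>y / kq\<rfloor>)"
  have n: "ngrid j kq y = real g" by (simp add: ngrid_eq[OF assms(1,2)] g_def)
  have "(kq * real g + e) / kq = real g + e / kq" using assms by (simp add: add_divide_distrib)
  moreover have "0 \<le> e / kq" "e / kq < 1" using assms by simp_all
  ultimately have "\<lfloor>(kq * real g + e) / kq\<rfloor> = int g" by linarith
  moreover have "0 \<le> kq * real g + e" using assms by simp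
  ultimately show ?thesis unfolding n by (subst ngrid_eq[OF assms(1)]) (auto simp: g_def)
qed

lemma eta_sum: "v \<le> T \<Longrightarrow> (\<Sum>t\<in>{v..<T}. eta kq t) = kq / 2 ^ v - kq / 2 ^ T"
proof (induction T)
  case (Suc T)
  show ?case
  proof (cases "v = Suc T")
    case False
    then have "(\<Sum>t\<in>{v..<Suc T}. eta kq t) = kq / 2 ^ v - kq / 2 ^ T + eta kq T" using Suc by simp
    then show ?thesis by (simp add: eta_def field_simps)
  qed simp
qed (simp add: eta_def)

lemma bitsum_split: "u \<le> T \<Longrightarrow> bitsum kq T c = bitsum kq u c + (\<Sum>t\<in>{u..<T}. eta kq t * c (40 + t))"
  unfolding bitsum_def using sum.atLeastLessThan_concat[of 0 u T "\<lambda>t. eta kq t * c (40 + t)"] by (simp add: atLeast0LessThan)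

lemma bits_tail:
  assumes "0 < kq" "\<And>t. c (40 + t) = 0 \<or> c (40 + t) = (1 :: real)" "u \<le> T"
  shows "0 \<le> (\<Sum>t\<in>{u..<T}. eta kq t * c (40 + t))" "(\<Sum>t\<in>{u..<T}. eta kq t * c (40 + t)) < kq / 2 ^ u"
proof -
  have e: "0 < eta kq t" for t using assms(1) by (simp add: eta_def)
  have b: "0 \<le> eta kq t * c (40 + t) \<and> eta kq t * c (40 + t) \<le> eta kq t" for t
    using assms(2)[of t] e[of t] by auto
  then show "0 \<le> (\<Sum>t\<in>{u..<T}. eta kq t * c (40 + t))" by (intro sum_nonneg) auto
  have "(\<Sum>t\<in>{u..<T}. eta kq t * c (40 + t)) \<le> (\<Sum>t\<in>{u..<T}. eta kq t)" using b by (intro sum_mono) auto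
  also have "\<dots> < kq / 2 ^ u" using assms by (simp add: eta_sum)
  finally show "(\<Sum>t\<in>{u..<T}. eta kq t * c (40 + t)) < kq / 2 ^ u" .
qed

lemma pm_packA: "pm (packA j kq Dh) c = c(10 := c 10 + ngrid j kq (yf Dh (c 9)))"
  unfolding packA_def
proof (induction j)
  case (Suc j)
  show ?case unfolding rep_simps pm_append pm.simps Suc by (rule ext) (simp add: ngrid_def)
qed (simp add: ngrid_def)

lemma pm_packC: "pm (packC kq T) c = c(1 := c 1 + kq * c 10 + bitsum kq T c)"
proof -
  have "pm (rep T (\<lambda>t. [Tr 1 (\<lambda>c. eta kq t * c (40 + t))])) c = c(1 := c 1 + bitsum kq T c)" for c
  proof (induction T)
    case (Suc T)
    show ?case unfolding rep_simps pm_append pm.simps Suc by (rule ext) (simp add: bitsum_def)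
  qed (simp add: bitsum_def)
  then show ?thesis unfolding packC_def pm_append pm.simps by (intro ext) (simp add: bitsum_def)
qed

lemma pm_packD:
  assumes kq: "0 < kq" and c: "\<And>t. c (40 + t) = 0 \<or> c (40 + t) = 1" "\<And>i. 40 + T \<le> i \<Longrightarrow> c i = 0" "c 8 = 0"
    "c 1 = kq * c 10 + bitsum kq T c"
  shows "pm (packD kq T) c = (\<lambda>i. if i = 8 then kq * c 10 else if 40 \<le> i then 0 else c i)"
proof -
  let ?e = "\<lambda>j i. if i = 8 then kq * c 10 + bitsum kq (T - j) c else if 40 + (T - j) \<le> i then 0 else c i"
  have "pm (rep j (\<lambda>t. [Tr 8 (\<lambda>c. - (eta kq (T - Suc t) * c (40 + (T - Suc t)))),
     Tr (40 + (T - Suc t)) (\<lambda>c. - leqr (eta kq (T - Suc t)) (c 1 - c 8))])) (?e 0) = ?e j" if "j \<le> T" for j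
    using that
  proof (induction j)
    case (Suc j)
    define u where "u = T - Suc j"
    have u: "T - j = Suc u" "u < T" using Suc.prems by (auto simp: u_def)
    define x where "x = (\<lambda>i. if i = 8 then kq * c 10 + bitsum kq u c else if 40 + Suc u \<le> i then 0 else c i)"
    have 1: "(?e j)(8 := ?e j 8 + - (eta kq u * ?e j (40 + u))) = x"
      by (rule ext) (simp add: x_def u bitsum_def)
    have d: "x 1 - x 8 = (\<Sum>t\<in>{u..<T}. eta kq t * c (40 + t))"
      unfolding x_def using c(4) bitsum_split[of u T kq c] u by simp
    have dd: "(\<Sum>t\<in>{u..<T}. eta kq t * c (40 + t)) = eta kq u * c (40 + u) + (\<Sum>t\<in>{Suc u..<T}. eta kq t * c (40 + t))"
      using u by (simp add: sum.atLeast_Suc_lessThan)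
    have l: "leqr (eta kq u) (x 1 - x 8) = c (40 + u)"
      unfolding d dd using bits_tail[of kq c "Suc u" T, OF kq c(1)] u c(1)[of u] by (auto simp: leqr_def eta_def)
    have 2: "x(40 + u := x (40 + u) + - leqr (eta kq u) (x 1 - x 8)) = ?e (Suc j)"
      unfolding l by (rule ext) (auto simp: x_def u simp flip: u_def)
    show ?case
      using Suc by (simp only: rep_simps pm_append pm.simps Suc_leD 1 2 flip: u_def)
  qed simp
  from this[OF order_refl] have r: "pm (rep T (\<lambda>t. [Tr 8 (\<lambda>c. - (eta kq (T - Suc t) * c (40 + (T - Suc t)))),
     Tr (40 + (T - Suc t)) (\<lambda>c. - leqr (eta kq (T - Suc t)) (c 1 - c 8))])) (?e 0) = ?e T" .
  have "c(8 := c 8 + c 1) = ?e 0" using c by (intro ext) simp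
  moreover have "?e T = (\<lambda>i. if i = 8 then kq * c 10 else if 40 \<le> i then 0 else c i)"
    by (rule ext) (simp add: bitsum_def)
  ultimately show ?thesis unfolding packD_def pm_append pm.simps using r by (simp only:)
qed

lemma pm_packE: "pm (packE j kq) c = c(8 := c 8 - kq * c 10, 10 := c 10 - ngrid j kq (c 1))"
proof -
  have "pm (rep j (\<lambda>k. [Tr 10 (\<lambda>c. - leqr (real (Suc k) * kq) (c 1))])) c = c(10 := c 10 - ngrid j kq (c 1))" for c
  proof (induction j)
    case (Suc j)
    show ?case unfolding rep_simps pm_append pm.simps Suc by (rule ext) (simp add: ngrid_def)
  qed (simp add: ngrid_def)
  then show ?thesis unfolding packE_def pm_append pm.simps by (intro ext) simp
qed

lemma trs_pack: "trs (packA j kq Dh)" "trs (packC kq T)" "trs (packD kq T)" "trs (packE j kq)"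
  unfolding packA_def packC_def packD_def packE_def by (auto intro!: trs_rep simp: wfo_def indep_def)

context sched
begin

text \<open>The order is forced by what each erasure reads: the grid index comes from cell 9, so it
  is computed before cell 9 is unwound, and unwinding reads the outcomes, so it precedes their
  erasure.\<close>

definition finish :: "nat \<Rightarrow> real \<Rightarrow> real \<Rightarrow> nat \<Rightarrow> nat \<Rightarrow> qop list" where
  "finish j kq Dh L T = packA j kq Dh @ rep L (updops (- 1)) @ packC kq T @ packD kq T @ packE j kq"

text \<open>The value Dh |sin(x/2)| of \<open>yf\<close> converts an estimate x of the phase into
  one of sqrt(\<sigma>^2 + kq^2), as \<open>Dh * s\<close> equals that root and s = sin(th/2). The
  absolute value removes the undetermined sign of the phase.\<close>

definition outv :: "nat \<Rightarrow> real \<Rightarrow> real \<Rightarrow> nat \<Rightarrow> config \<Rightarrow> real" where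
  "outv j kq Dh T c = kq * ngrid j kq (yf Dh (c 9)) + bitsum kq T c"

lemma pm_unwind: "pm (rep L (updops (- 1))) c = c(9 := c 9 - midf L c)"
proof (induction L)
  case (Suc L)
  show ?case unfolding rep_simps pm_append Suc pm_upd midf_upd9 by (rule ext) (simp add: midf_def)
qed (simp add: midf_def)

lemma pm_finish:
  assumes c: "dinv L T c" and kq: "0 < kq"
  shows "pm (finish j kq Dh L T) c = (\<lambda>_. 0)(1 := outv j kq Dh T c)"
proof -
  define g where "g = ngrid j kq (yf Dh (c 9))"
  have z: "c i = 0" if "i < 40" "i \<noteq> 9" for i using that c by (simp add: dinv_def base_def)
  define c1 where "c1 = c(10 := g, 9 := 0)"
  have bs: "bitsum kq T (d(k := v)) = bitsum kq T d" if "k < 40" for d k v using that by (simp add: bitsum_def)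
  have 1: "pm (packA j kq Dh @ rep L (updops (- 1))) c = c1"
  proof -
    have "midf L (c(10 := g)) = midf L c" by (simp add: midf_def cnt_def)
    then show ?thesis
      unfolding pm_append pm_packA pm_unwind c1_def g_def using z[of 10] c by (intro ext) (simp add: dinv_def g_def)
  qed
  define v where "v = kq * g + bitsum kq T c"
  define c2 where "c2 = c1(1 := v)"
  have 2: "pm (packC kq T) c1 = c2"
    unfolding pm_packC c2_def v_def c1_def using z[of 1] by (intro ext) (simp add: bs)
  have bits: "c (40 + t) = 0 \<or> c (40 + t) = 1" for t using c by (auto simp: dinv_def base_def)
  have 3: "pm (packD kq T) c2 = (\<lambda>i. if i = 8 then kq * c2 10 else if 40 \<le> i then 0 else c2 i)"
  proof (rule pm_packD[OF kq])
    show "c2 (40 + t) = 0 \<or> c2 (40 + t) = 1" for t using bits by (simp add: c2_def c1_def)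
    show "c2 i = 0" if "40 + T \<le> i" for i using that c by (simp add: c2_def c1_def dinv_def)
    show "c2 8 = 0" using z by (simp add: c2_def c1_def)
    show "c2 1 = kq * c2 10 + bitsum kq T c2" by (simp add: c2_def c1_def v_def bs)
  qed
  have "bitsum kq T c = (\<Sum>t\<in>{0..<T}. eta kq t * c (40 + t))" by (simp add: bitsum_def atLeast0LessThan)
  then have e: "0 \<le> bitsum kq T c" "bitsum kq T c < kq"
    using bits_tail[of kq c 0 T, OF kq bits] by simp_all
  have gv: "ngrid j kq v = g" unfolding v_def g_def by (rule ngrid_pack[OF kq _ e]) (simp add: yf_def)
  have "pm (finish j kq Dh L T) c = pm (packE j kq) (pm (packD kq T) c2)"
    unfolding finish_def using 1 2 by (simp only: pm_append)
  also have "\<dots> = (\<lambda>_. 0)(1 := v)"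
    unfolding 3 pm_packE using z gv by (intro ext) (simp add: c2_def c1_def)
  finally show ?thesis by (simp add: v_def outv_def g_def)
qed

lemma trs_finish: "trs (finish j kq Dh L T)"
  unfolding finish_def using trs_pack trs_upd by (auto intro!: trs_rep)

lemma finish_on: "ops_on ({1, 8, 9, 10} \<union> {40..}) (finish j kq Dh L T)"
proof -
  have r: "ops_on S (rep i f)" if "\<And>k. ops_on S (f k)" for S i f using that by (induction i) auto
  have u: "ops_on ({1, 8, 9, 10} \<union> {40..}) (updops (- 1) l)" for l
    unfolding updops_def ops_on_simps(3) by (intro conjI r) (auto simp: wfo_def indep_def dep_def)
  show ?thesis
    unfolding finish_def packA_def packC_def packD_def packE_def ops_on_simps(3)
    by (intro conjI r u) (auto simp: wfo_def indep_def dep_def)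
qed

text \<open>Rounding down subtracts less than \<open>kq\<close> and the packed outcomes add less
  than \<open>kq\<close>, so the two effects never exceed \<open>kq\<close> in either
  direction.\<close>

lemma outv_error:
  assumes "dinv L T c" "0 < kq" "0 \<le> Dh" "Dh \<le> real j * kq"
  shows "\<bar>outv j kq Dh T c - \<bar>Dh * sin (c 9 / 2)\<bar>\<bar> \<le> kq"
proof -
  have "\<bar>c 9\<bar> \<le> 2" using assms(1) midf_bound[of c L] by (simp add: dinv_def)
  then have "angle (c 9 * (1 / 2)) = c 9 / 2" using pi_ge_two by (subst angle_id) auto
  then have y: "yf Dh (c 9) = \<bar>Dh * sin (c 9 / 2)\<bar>" by (simp only: yf_def)
  have "\<bar>Dh * sin (c 9 / 2)\<bar> \<le> Dh * 1" unfolding abs_mult using assms(3) by (intro mult_mono) auto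
  then have "yf Dh (c 9) \<le> real j * kq" using assms(4) y by simp
  from ngrid_bounds[OF assms(2) _ this] have n: "kq * ngrid j kq (yf Dh (c 9)) \<le> yf Dh (c 9)" "yf Dh (c 9) < kq * ngrid j kq (yf Dh (c 9)) + kq"
    by (simp_all add: yf_def)
  have bits: "c (40 + t) = 0 \<or> c (40 + t) = 1" for t using assms(1) by (auto simp: dinv_def base_def)
  have "bitsum kq T c = (\<Sum>t\<in>{0..<T}. eta kq t * c (40 + t))" by (simp add: bitsum_def atLeast0LessThan)
  then have "0 \<le> bitsum kq T c" "bitsum kq T c < kq"
    using bits_tail[of kq c 0 T, OF assms(2) bits] by simp_all
  then show ?thesis using n unfolding y outv_def by (simp add: abs_le_iff)
qed

end

section \<open>Error of the estimate\<close>

definition sveops :: "(nat \<Rightarrow> nat) \<Rightarrow> qop list \<Rightarrow> qop list \<Rightarrow> nat \<Rightarrow> nat \<Rightarrow> real \<Rightarrow> real \<Rightarrow> qop list" where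
  "sveops R W F L K0 kq Dh = sched.estops R W L @ drive W F L K0 (sched.offs R L) @
     sched.finish R (2 ^ L) kq Dh L (sched.offs R L + K0 * L)"

definition outk :: "(real \<Rightarrow> complex) \<Rightarrow> qstate" where
  "outk \<chi> = (\<lambda>c. if c = (\<lambda>_. 0)(1 := c 1) then \<chi> (c 1) else 0)"

text \<open>This is the reason for 144 (K0 + L - l) tests at level l. A test there costs 2^l walk
  steps, so the cheap early levels receive more tests; the failure bounds form a geometric series
  dominated by the last levels, and the total cost stays of order K0 2^L.\<close>

lemma geometric_tail: "(\<Sum>l<L. 2 * exp (- (real (144 * (K0 + (L - l))) / 144))) \<le> 2 / 2 ^ K0"
proof -
  have e: "exp (- real j) \<le> 1 / 2 ^ j" for j
  proof -
    have "(2::real) \<le> exp 1" using exp_ge_add_one_self[of 1] by simp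
    then have "(2::real) ^ j \<le> exp 1 ^ j" by (intro power_mono) auto
    then have "(2::real) ^ j \<le> exp (real j)" by (simp flip: exp_of_nat_mult)
    then show ?thesis by (simp add: exp_minus field_simps)
  qed
  have "(\<Sum>l<L. 2 * exp (- (real (144 * (K0 + (L - l))) / 144))) \<le> (\<Sum>l<L. 2 / 2 ^ (K0 + (L - l)))"
  proof (rule sum_mono)
    fix l
    have r: "real (144 * (K0 + (L - l))) / 144 = real (K0 + (L - l))" by (simp only: of_nat_mult) simp
    show "2 * exp (- (real (144 * (K0 + (L - l))) / 144)) \<le> 2 / 2 ^ (K0 + (L - l))"
      unfolding r using e[of "K0 + (L - l)"] by simp
  qed
  also have "\<dots> = 2 / 2 ^ K0 * (\<Sum>l<L. 1 / 2 ^ (L - l))" unfolding sum_distrib_left power_add by simp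
  also have "(\<Sum>l<L. 1 / 2 ^ (L - l)) = (\<Sum>l<L. 1 / 2 ^ Suc l :: real)"
    by (rule sum.reindex_bij_witness[of _ "\<lambda>l. L - Suc l" "\<lambda>l. L - Suc l"])
      (auto simp: Suc_diff_Suc simp flip: power_Suc)
  also have "\<dots> = 1 - 1 / 2 ^ L" by (induction L) (simp_all add: field_simps)
  also have "2 / 2 ^ K0 * (1 - 1 / 2 ^ L) \<le> 2 / 2 ^ K0 * (1 :: real)" by (intro mult_left_mono) auto
  finally show ?thesis by simp
qed

lemma sqrt_near:
  assumes "0 \<le> x" "0 \<le> (y::real)"
  shows "x \<le> sqrt (x\<^sup>2 + y\<^sup>2)" "sqrt (x\<^sup>2 + y\<^sup>2) \<le> x + y"
  using assms by (auto intro!: real_le_rsqrt real_le_lsqrt simp: power2_eq_square algebra_simps)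

lemma sin_half_near: "\<bar>\<bar>sin (x / 2)\<bar> - \<bar>sin (y / 2)\<bar>\<bar> \<le> \<bar>x - y\<bar> / 2" for x y :: real
proof -
  have "\<bar>sin (x / 2) - sin (y / 2)\<bar> = \<bar>2 * sin ((x / 2 - y / 2) / 2) * cos ((x / 2 + y / 2) / 2)\<bar>"
    by (simp only: sin_diff_sin)
  also have "\<dots> \<le> 2 * \<bar>sin ((x / 2 - y / 2) / 2)\<bar> * 1" unfolding abs_mult by (intro mult_mono) auto
  also have "\<dots> \<le> 2 * \<bar>(x / 2 - y / 2) / 2\<bar>" using abs_sin_x_le_abs_x[of "(x / 2 - y / 2) / 2"] by simp
  also have "2 * \<bar>(x / 2 - y / 2) / 2\<bar> = \<bar>x - y\<bar> / 2" by (simp add: abs_divide flip: diff_divide_distrib)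
  finally show ?thesis using abs_triangle_ineq3[of "sin (x / 2)" "sin (y / 2)"] by linarith
qed

lemma outk_nsq:
  assumes "finite {x. \<chi> x \<noteq> 0}"
  shows "fin (outk \<chi>)" "nsq (outk \<chi>) = (\<Sum>x | \<chi> x \<noteq> 0. (cmod (\<chi> x))\<^sup>2)"
proof -
  let ?f = "\<lambda>x. (\<lambda>_. 0)(1 := x) :: config"
  have s: "{c. outk \<chi> c \<noteq> 0} = ?f ` {x. \<chi> x \<noteq> 0}"
  proof (intro equalityI subsetI)
    fix c assume "c \<in> {c. outk \<chi> c \<noteq> 0}"
    then have "c = ?f (c 1)" "\<chi> (c 1) \<noteq> 0" by (auto simp: outk_def split: if_splits)
    then show "c \<in> ?f ` {x. \<chi> x \<noteq> 0}" by blast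
  qed (auto simp: outk_def)
  show "fin (outk \<chi>)" using assms by (simp add: fin_def s)
  have "inj_on ?f {x. \<chi> x \<noteq> 0}" by (rule inj_onI) (metis fun_upd_same)
  then show "nsq (outk \<chi>) = (\<Sum>x | \<chi> x \<noteq> 0. (cmod (\<chi> x))\<^sup>2)"
    unfolding nsq_def s by (subst sum.reindex) (simp_all add: outk_def)
qed

context walk
begin

lemma Xs_outk: "Xs (dim_vec v) (\<lambda>j. v $ j) (outk \<chi>) = product_state v \<chi>"
proof
  fix c
  have e: "c = sve_config j (c 1) \<longleftrightarrow> anc c \<and> c 0 = real j \<and> c(0 := 0) = (\<lambda>_. 0)(1 := c 1)" for j
  proof
    assume "c = sve_config j (c 1)"
    then have c: "c i = (if i = 0 then real j else if i = 1 then c 1 else 0)" for i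
      by (metis (no_types, lifting) fun_upd_other fun_upd_same sve_config_def zero_neq_one)
    have "c(0 := 0) = (\<lambda>_. 0)(1 := c 1)"
    proof
      fix i show "(c(0 := 0)) i = ((\<lambda>_. 0)(1 := c 1)) i" using c[of i] by simp
    qed
    then show "anc c \<and> c 0 = real j \<and> c(0 := 0) = (\<lambda>_. 0)(1 := c 1)"
      using c[of 0] c[of 2] c[of 3] c[of 4] c[of 5] by (simp add: anc_def)
  next
    assume a: "anc c \<and> c 0 = real j \<and> c(0 := 0) = (\<lambda>_. 0)(1 := c 1)"
    show "c = sve_config j (c 1)"
    proof
      fix i
      have "(c(0 := 0)) i = ((\<lambda>_. 0)(1 := c 1)) i" "c 0 = real j" using a by (simp_all only:)
      then show "c i = sve_config j (c 1) i" by (cases "i = 0") (simp_all add: sve_config_def)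
    qed
  qed
  have "anc c \<longleftrightarrow> True" if "c(0 := 0) = (\<lambda>_. 0)(1 := c 1)"
  proof -
    have "c i = 0" if "i \<in> {2, 3, 4, 5}" for i
      using fun_cong[OF \<open>c(0 := 0) = (\<lambda>_. 0)(1 := c 1)\<close>, of i] that by auto
    then show ?thesis by (simp add: anc_def)
  qed
  then show "Xs (dim_vec v) (\<lambda>j. v $ j) (outk \<chi>) c = product_state v \<chi> c"
    unfolding product_state_def Xs_def outk_def e by (auto simp: sum_distrib_right intro!: sum.cong)
qed

lemma gz_outk: "finite {x. \<chi> x \<noteq> 0} \<Longrightarrow> gz (outk \<chi>)"
  unfolding gz_def
proof (intro conjI allI impI)
  fix c assume "outk \<chi> c \<noteq> 0"
  then have c: "c = (\<lambda>_. 0)(1 := c 1)" by (auto simp: outk_def split: if_splits)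
  have "c i = 0" if "i \<noteq> 1" for i using that by (subst c) simp
  then show "anc c" "c 0 = 0" by (simp_all add: anc_def)
qed (rule outk_nsq)

end

context algo
begin

text \<open>Of the error 3/2^K0, one part is weight left in Y after K0 passes, each of which
  multiplies that weight by at most 1/4, and two parts come from the estimation.\<close>

lemma algo_state:
  assumes R: "R = (\<lambda>l. 144 * (K0 + (L - l)))" and th: "\<bar>th\<bar> \<le> 1" and kq: "0 < kq" and Dh: "0 < Dh" "2 * Dh \<le> 2 ^ L * kq"
    and L: "0 < sin th" "2 \<le> 2 ^ L * sin th" and sig: "0 \<le> sig" "Dh * s = sqrt (sig\<^sup>2 + kq\<^sup>2)"
  obtains a b where "aps (sveops R Wops Fops L K0 kq Dh) (X (Ket (\<lambda>_. 0))) = X a + Y b"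
    "sp a (\<lambda>c. c = (\<lambda>_. 0)(1 := c 1))" "gz b" "nsq a + nsq b = 1"
    "nsq b + nsq (restr (\<lambda>c. \<not> \<bar>c 1 - sig\<bar> \<le> 8 * kq) a) \<le> 3 / 2 ^ K0"
proof -
  let ?K = "Ket (\<lambda>_. 0)" and ?B = "\<lambda>c. 1 / 2 ^ L < \<bar>th - c 9\<bar> \<and> 1 / 2 ^ L < \<bar>th + c 9\<bar>"
  let ?far = "\<lambda>c :: config. \<not> \<bar>c 1 - sig\<bar> \<le> 8 * kq"
  define T where "T = offs L + K0 * L"
  define xs where "xs = finish (2 ^ L) kq Dh L T"
  obtain a0 b0 where 0: "aps (estops Wops L) (X ?K) = X a0 + Y b0" "sp a0 (linv L 0)" "sp b0 (linv L 0)"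
    "nsq a0 + nsq b0 = 1" "nsq (restr ?B a0) + nsq (restr ?B b0) \<le> (\<Sum>l<L. 2 * exp (- (real (R l) / 144)))"
    by (rule est_state[OF th, of L]) (rule that)
  have d0: "sp a0 (dinv L (offs L))" "sp b0 (dinv L (offs L))"
    by (rule sp_mono[OF 0(2) linv_dinv] sp_mono[OF 0(3) linv_dinv], assumption)+
  from DR_drive[of L "offs L" K0, unfolded DR_def, rule_format, OF d0]
  obtain a1 b1 where 1: "aps (drive Wops Fops L K0 (offs L)) (X a0 + Y b0) = X a1 + Y b1" "sp a1 (dinv L T)" "sp b1 (dinv L T)"
    "\<And>Q. nsq (restr (\<lambda>c. Q (c 9)) a1) + nsq (restr (\<lambda>c. Q (c 9)) b1) = nsq (restr (\<lambda>c. Q (c 9)) a0) + nsq (restr (\<lambda>c. Q (c 9)) b0)"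
    "nsq b1 = (\<Prod>l<L. (cos (2 ^ l * th))\<^sup>2) ^ K0 * nsq b0"
    unfolding T_def DP_def by blast
  have tr: "trs xs" unfolding xs_def by (rule trs_finish)
  have on: "ops_on ({1, 8, 9, 10} \<union> {40..}) xs" unfolding xs_def by (rule finish_on)
  have dj: "({1, 8, 9, 10} \<union> {40..}) \<inter> MC = {}" by (auto simp: MC_def)
  define a where "a = aps xs a1"
  define b where "b = aps xs b1"
  have f1: "fin a1" "fin b1" using 1(2,3) by (auto simp: sp_def)
  have f: "fin a" "fin b" unfolding a_def b_def using f1 fin_aps[OF trs_wfs[OF tr]] by auto
  have n: "nsq a = nsq a1" "nsq b = nsq b1" unfolding a_def b_def using f1 nsq_aps[OF trs_wfs[OF tr]] by auto
  have "aps (sveops R Wops Fops L K0 kq Dh) (X ?K) = aps xs (aps (drive Wops Fops L K0 (offs L)) (aps (estops Wops L) (X ?K)))"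
    unfolding sveops_def xs_def T_def by (simp only: aps_simps(3))
  also have "\<dots> = X a + Y b"
    unfolding 0(1) 1(1) unfolding aps_add a_def b_def Xs_commute[OF on dj] Y_commute[OF on dj] ..
  finally have A: "aps (sveops R Wops Fops L K0 kq Dh) (X ?K) = X a + Y b" .
  have B: "sp a (\<lambda>c. c = (\<lambda>_. 0)(1 := c 1))"
    unfolding a_def
  proof (rule trs_sp[OF tr 1(2)])
    fix c assume "dinv L T c"
    from pm_finish[OF this kq, of "2 ^ L" Dh] show "pm xs c = (\<lambda>_. 0)(1 := pm xs c 1)" by (simp add: xs_def)
  qed
  have C: "gz b" unfolding b_def by (rule gz_aps[OF on dj dinv_gz[OF 1(3)]])
  have n0: "nsq a1 + nsq b1 = 1" using 1(4)[of "\<lambda>_. True"] 0(4) by (simp add: restr_def)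
  have nb: "nsq b \<le> 1 / 2 ^ K0"
  proof -
    have "nsq b0 \<le> 1" using 0(4) nsq_nonneg[of a0] by linarith
    then have "nsq b \<le> 1 / 4 ^ K0 * 1"
      unfolding n 1(5) using drive_factor[OF L] by (intro mult_mono) auto
    also have "\<dots> \<le> 1 / 2 ^ K0" by (simp add: frac_le power_mono)
    finally show ?thesis .
  qed
  \<comment> \<open>Three errors add up: \<open>kq\<close> from packing, \<open>kq / 4\<close> from
    the accuracy 1/2^L of the phase, and \<open>kq\<close> from the identity block. The sum is well
    below 8 \<open>kq\<close>, the accuracy demanded.\<close>
  have near: "\<bar>outv (2 ^ L) kq Dh T c - sig\<bar> \<le> 8 * kq" if c: "dinv L T c" "\<not> ?B c" for c
  proof -
    have "Dh \<le> real (2 ^ L) * kq" using Dh by simp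
    from outv_error[OF c(1) kq less_imp_le[OF Dh(1)] this]
    have 1: "\<bar>outv (2 ^ L) kq Dh T c - \<bar>Dh * sin (c 9 / 2)\<bar>\<bar> \<le> kq" .
    have th2: "sin (th / 2) = s" using s by (simp add: th_def)
    have "\<bar>\<bar>sin (c 9 / 2)\<bar> - s\<bar> \<le> 1 / 2 ^ L / 2"
    proof -
      have m: "\<bar>c 9 - th\<bar> = \<bar>th - c 9\<bar>" "\<bar>- c 9 - th\<bar> = \<bar>th + c 9\<bar>" by arith+
      have "\<bar>\<bar>sin (c 9 / 2)\<bar> - s\<bar> \<le> \<bar>th - c 9\<bar> / 2" "\<bar>\<bar>sin (c 9 / 2)\<bar> - s\<bar> \<le> \<bar>th + c 9\<bar> / 2"
        using sin_half_near[of "c 9" th] sin_half_near[of "- c 9" th] th2 s unfolding m by simp_all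
      moreover have "\<bar>th - c 9\<bar> / 2 \<le> 1 / 2 ^ L / 2 \<or> \<bar>th + c 9\<bar> / 2 \<le> 1 / 2 ^ L / 2"
        using c(2) by (auto simp: not_less intro: divide_right_mono)
      ultimately show ?thesis using order_trans by blast
    qed
    then have "Dh * \<bar>\<bar>sin (c 9 / 2)\<bar> - s\<bar> \<le> Dh * (1 / 2 ^ L / 2)" using Dh by (intro mult_left_mono) auto
    also have "\<dots> \<le> kq / 4" using Dh by (simp add: field_simps)
    also have "Dh * \<bar>\<bar>sin (c 9 / 2)\<bar> - s\<bar> = \<bar>\<bar>Dh * sin (c 9 / 2)\<bar> - Dh * s\<bar>"
    proof -
      have "\<bar>Dh * sin (c 9 / 2)\<bar> - Dh * s = Dh * (\<bar>sin (c 9 / 2)\<bar> - s)" using Dh by (simp add: abs_mult algebra_simps)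
      then show ?thesis using Dh by (simp add: abs_mult)
    qed
    finally have 2: "\<bar>\<bar>Dh * sin (c 9 / 2)\<bar> - Dh * s\<bar> \<le> kq / 4" .
    have "sig \<le> Dh * s" "Dh * s \<le> sig + kq" unfolding sig(2) using sqrt_near[of sig kq] sig kq by auto
    then show ?thesis using 1 2 kq by linarith
  qed
  have far: "nsq (restr ?far a) \<le> 2 / 2 ^ K0"
  proof -
    have "nsq (restr ?far a) = Ex (\<lambda>c. if ?far (pm xs c) then 1 else 0) a1"
      unfolding a_def by (subst Ex_restr) (use fin_aps[OF trs_wfs[OF tr] f1(1)] pm_Ex[OF tr f1(1)] in auto)
    also have "\<dots> \<le> Ex (\<lambda>c. if ?B c then 1 else 0) a1"
    proof (rule Ex_mono)
      fix c assume "a1 c \<noteq> 0"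
      then have c: "dinv L T c" by (rule spD[OF 1(2)])
      have "pm xs c 1 = outv (2 ^ L) kq Dh T c" unfolding xs_def pm_finish[OF c kq] by simp
      then show "(if ?far (pm xs c) then 1 else 0) \<le> (if ?B c then 1 else 0 :: real)" using near[OF c] by auto
    qed
    also have "\<dots> = nsq (restr ?B a1)" by (rule Ex_restr[OF f1(1), symmetric])
    also have "\<dots> \<le> nsq (restr ?B a0) + nsq (restr ?B b0)"
      using 1(4)[of "\<lambda>x. 1 / 2 ^ L < \<bar>th - x\<bar> \<and> 1 / 2 ^ L < \<bar>th + x\<bar>"] nsq_nonneg[of "restr ?B b1"] by linarith
    also have "\<dots> \<le> 2 / 2 ^ K0" using 0(5) geometric_tail[of K0 L] unfolding R by linarith
    finally show ?thesis .
  qed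
  have "nsq b + nsq (restr ?far a) \<le> 3 / 2 ^ K0" using nb far by (simp add: field_simps)
  then show ?thesis using that A B C n n0 by simp
qed

text \<open>The ideal output is the part of the state with good estimates, rescaled from weight g =
  1 - e to 1. Rescaling costs (1 - sqrt g)^2 \<le> e in squared norm, on top of the weight e that is
  dropped; together at most 2 e.\<close>

lemma algo_out:
  assumes R: "R = (\<lambda>l. 144 * (K0 + (L - l)))" and th: "\<bar>th\<bar> \<le> 1" and kq: "0 < kq" and Dh: "0 < Dh" "2 * Dh \<le> 2 ^ L * kq"
    and L: "0 < sin th" "2 \<le> 2 ^ L * sin th" and sig: "0 \<le> sig" "Dh * s = sqrt (sig\<^sup>2 + kq\<^sup>2)" and K0: "3 / 2 ^ K0 < (1 :: real)"
  obtains \<chi> d b where "aps (sveops R Wops Fops L K0 kq Dh) (X (Ket (\<lambda>_. 0))) = X (outk \<chi>) + (X d + Y b)"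
    "unit_state_on {x. \<bar>x - sig\<bar> \<le> 8 * kq} \<chi>" "gz d" "gz b" "nsq d + nsq b \<le> 6 / 2 ^ K0"
proof -
  let ?near = "\<lambda>c :: config. \<bar>c 1 - sig\<bar> \<le> 8 * kq" and ?f = "\<lambda>x. (\<lambda>_. 0)(1 := x) :: config"
  obtain a b where 1: "aps (sveops R Wops Fops L K0 kq Dh) (X (Ket (\<lambda>_. 0))) = X a + Y b"
    "sp a (\<lambda>c. c = ?f (c 1))" "gz b" "nsq a + nsq b = 1" "nsq b + nsq (restr (\<lambda>c. \<not> ?near c) a) \<le> 3 / 2 ^ K0"
    by (rule algo_state[OF R th kq Dh L sig]) (rule that)
  have fa: "fin a" using 1(2) by (simp add: sp_def)
  define e where "e = nsq b + nsq (restr (\<lambda>c. \<not> ?near c) a)"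
  define g where "g = nsq (restr ?near a)"
  have g: "g = 1 - e" using nsq_restr_split[OF fa, of ?near] 1(4) by (simp add: g_def e_def)
  have e: "0 \<le> e" by (simp add: e_def)
  moreover have "e < 1" unfolding e_def by (rule le_less_trans[OF 1(5) K0])
  ultimately have e: "0 \<le> e" "e < 1" by auto
  then have g0: "0 < g" "g \<le> 1" using g by auto
  define \<chi> where "\<chi> x = complex_of_real (1 / sqrt g) * restr ?near a (?f x)" for x
  have ok: "outk \<chi> = complex_of_real (1 / sqrt g) *q restr ?near a"
  proof
    fix c show "outk \<chi> c = (complex_of_real (1 / sqrt g) *q restr ?near a) c"
    proof (cases "c = ?f (c 1)")
      case True
      then show ?thesis unfolding outk_def \<chi>_def using True by simp
    next
      case False
      then have "a c = 0" by (rule sp_zero[OF 1(2)])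
      then show ?thesis using False by (simp add: outk_def restr_def)
    qed
  qed
  have fr: "finite {c. restr ?near a c \<noteq> 0}" using fin_restr[OF fa] by (simp add: fin_def)
  have finx: "finite {x. \<chi> x \<noteq> 0}"
  proof (rule finite_subset)
    show "{x. \<chi> x \<noteq> 0} \<subseteq> (\<lambda>c. c 1) ` {c. restr ?near a c \<noteq> 0}"
    proof
      fix x assume "x \<in> {x. \<chi> x \<noteq> 0}"
      then have "?f x \<in> {c. restr ?near a c \<noteq> 0}" by (auto simp: \<chi>_def)
      then have "(?f x) 1 \<in> (\<lambda>c. c 1) ` {c. restr ?near a c \<noteq> 0}" by (rule imageI)
      then show "x \<in> (\<lambda>c. c 1) ` {c. restr ?near a c \<noteq> 0}" by simp
    qed
  qed (use fr in simp)
  have U: "unit_state_on {x. \<bar>x - sig\<bar> \<le> 8 * kq} \<chi>"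
    unfolding unit_state_on_def
  proof (intro conjI finx)
    show "{x. \<chi> x \<noteq> 0} \<subseteq> {x. \<bar>x - sig\<bar> \<le> 8 * kq}" by (auto simp: \<chi>_def restr_def split: if_splits)
    have "nsq (outk \<chi>) = 1"
      unfolding ok nsq_smul[OF fin_restr[OF fa]] g_def[symmetric] norm_of_real power2_abs
      using g0 by (simp add: power_divide)
    then show "(\<Sum>x | \<chi> x \<noteq> 0. (cmod (\<chi> x))\<^sup>2) = 1" using outk_nsq(2)[OF finx] by simp
  qed
  define d where "d = a - outk \<chi>"
  have ga: "gz a"
    unfolding gz_def
  proof (intro conjI allI impI fa)
    fix c assume "a c \<noteq> 0"
    then have c: "c = ?f (c 1)" by (rule spD[OF 1(2)])
    have "c i = 0" if "i \<noteq> 1" for i using that by (subst c) simp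
    then show "anc c" "c 0 = 0" by (simp_all add: anc_def)
  qed
  have gd: "gz d"
  proof -
    have "d = a + (- 1) *q outk \<chi>" by (simp add: d_def fun_eq_iff)
    then show ?thesis using ga gz_outk[OF finx] by (simp only: gz_add gz_smul)
  qed
  have "a = outk \<chi> + d" by (simp add: d_def)
  then have A: "aps (sveops R Wops Fops L K0 kq Dh) (X (Ket (\<lambda>_. 0))) = X (outk \<chi>) + (X d + Y b)"
    unfolding 1(1) by (simp only: Xs_add add.assoc)
  have dd: "d = restr (\<lambda>c. \<not> ?near c) a - complex_of_real (1 / sqrt g - 1) *q restr ?near a"
    unfolding d_def ok by (rule ext) (simp add: restr_def algebra_simps)
  have "nsq d = nsq (restr (\<lambda>c. \<not> ?near c) a) + (cmod (complex_of_real (1 / sqrt g - 1)))\<^sup>2 * g"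
    unfolding dd g_def using fa by (intro nsq_disjoint fin_restr) (auto simp: restr_def)
  also have "(cmod (complex_of_real (1 / sqrt g - 1)))\<^sup>2 * g = (1 - sqrt g)\<^sup>2"
  proof -
    have "(1 / sqrt g - 1)\<^sup>2 * (sqrt g)\<^sup>2 = (1 - sqrt g)\<^sup>2"
      using g0 unfolding power_mult_distrib[symmetric] by (simp add: algebra_simps)
    then show ?thesis using g0 by (simp only: norm_of_real power2_abs) simp
  qed
  also have "(1 - sqrt g)\<^sup>2 \<le> e"
  proof -
    have sg: "g \<le> sqrt g" "sqrt g \<le> 1" using g0 by (simp_all add: real_le_rsqrt power2_eq_square mult_le_one mult_left_le)
    then have "(1 - sqrt g)\<^sup>2 \<le> (1 - g)\<^sup>2" by (intro power_mono) auto
    also have "\<dots> \<le> e" using g e by (simp add: power2_eq_square mult_left_le)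
    finally show ?thesis .
  qed
  finally have "nsq d + nsq b \<le> 2 * e" by (simp add: e_def)
  also have "\<dots> \<le> 6 / 2 ^ K0" using 1(5) by (simp add: e_def)
  finally show ?thesis using that A U gd 1(3) by blast
qed

end

section \<open>Amplitudes of the walk on the stored matrix\<close>

context walk
begin

text \<open>The squared cosine and sine at a node are the shares of its two children, so along a
  path the product telescopes to the weight of the node divided by that of the root. Below a node of
  weight 0, where the quotient is 0/0, the amplitude is 0 already.\<close>

lemma amp_eq:
  assumes M: "\<And>d x. d < K \<Longrightarrow> x < 2 ^ d \<Longrightarrow> M0 (addr (o' * S + real x * 8 + (8 * 2 ^ d + kind))) = W (2 ^ d + x)"
    "\<And>d x. d < K \<Longrightarrow> x < 2 ^ d \<Longrightarrow> M0 (addr (o' * S + real x * 8 + (8 * 2 ^ d + kind) + 8 * 2 ^ d)) = W (2 ^ Suc d + x)"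
    and split: "\<And>d x. d < K \<Longrightarrow> x < 2 ^ d \<Longrightarrow> W (2 ^ d + x) = W (2 ^ Suc d + x) + W (2 ^ Suc d + (2 ^ d + x))"
    and nonneg: "\<And>y. 0 \<le> W y" and root: "0 < W 1"
  shows "d \<le> K \<Longrightarrow> x < 2 ^ d \<Longrightarrow> amp kind S o' d x = sqrt (W (2 ^ d + x) / W 1)"
proof (induction d arbitrary: x)
  case 0
  then show ?case using root by simp
next
  case (Suc d)
  have d: "d < K" "d \<le> K" using Suc.prems by auto
  have step: "amp kind S o' d y * cos (Ang kind S (2 ^ d) o' (real y)) = sqrt (W (2 ^ Suc d + y) / W 1)"
    "amp kind S o' d y * sin (Ang kind S (2 ^ d) o' (real y)) = sqrt (W (2 ^ Suc d + (2 ^ d + y)) / W 1)" if y: "y < 2 ^ d" for y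
  proof -
    let ?a = "W (2 ^ Suc d + y)" and ?b = "W (2 ^ Suc d + (2 ^ d + y))" and ?w = "W (2 ^ d + y)"
    have w: "?w = ?a + ?b" by (rule split[OF d(1) y])
    have ih: "amp kind S o' d y = sqrt (?w / W 1)" by (rule Suc.IH[OF d(2) y])
    have nn: "0 \<le> ?a" "0 \<le> ?b" by (rule nonneg)+
    have "amp kind S o' d y * cos (Ang kind S (2 ^ d) o' (real y)) = sqrt (?a / W 1) \<and>
      amp kind S o' d y * sin (Ang kind S (2 ^ d) o' (real y)) = sqrt (?b / W 1)"
    proof (cases "?w = 0")
      case True
      then show ?thesis using w nn by (simp add: ih)
    next
      case False
      then have wp: "0 < ?w" using w nn by linarith
      define t where "t = sqrt (?a / ?w)"
      have q: "0 \<le> ?a / ?w" "?a / ?w \<le> 1" using wp w nn by simp_all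
      then have t: "0 \<le> t" "t \<le> 1" by (simp_all add: t_def)
      have "powp (?a / ?w) (1 / 2) = t"
        using q by (cases "0 < ?a / ?w") (auto simp: powp_def t_def powr_half_sqrt)
      then have A: "Ang kind S (2 ^ d) o' (real y) = arccos t"
        unfolding Ang_def M(1)[OF d(1) y] M(2)[OF d(1) y] using t by (simp add: acs_def)
      have c: "cos (arccos t) = t" "sin (arccos t) = sqrt (1 - t\<^sup>2)" using t by (simp_all add: sin_arccos)
      have t2: "t\<^sup>2 = ?a / ?w" using q by (simp add: t_def)
      have b2: "1 - t\<^sup>2 = ?b / ?w" unfolding t2 using wp w by (simp add: field_simps)
      have m: "sqrt (?w / W 1) * sqrt (z / ?w) = sqrt (z / W 1)" for z
        unfolding real_sqrt_mult[symmetric] using wp root by simp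
      show ?thesis unfolding A c b2 ih by (simp only: t_def m)
    qed
    then show "amp kind S o' d y * cos (Ang kind S (2 ^ d) o' (real y)) = sqrt (?a / W 1)"
      "amp kind S o' d y * sin (Ang kind S (2 ^ d) o' (real y)) = sqrt (?b / W 1)" by auto
  qed
  show ?case
  proof (cases "x < 2 ^ d")
    case True
    then show ?thesis using step(1)[OF True] by simp
  next
    case False
    then have y: "x - 2 ^ d < 2 ^ d" "2 ^ d + (x - 2 ^ d) = x" using Suc.prems by auto
    show ?thesis using step(2)[OF y(1)] False unfolding y(2) by simp
  qed
qed

end

section \<open>Weights of the trees: splitting, leaves and roots\<close>

lemma on_path_node: "d \<le> D \<Longrightarrow> x < 2 ^ d \<Longrightarrow> on_path D j (2 ^ d + x) \<longleftrightarrow> j mod 2 ^ d = x"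
proof
  assume d: "d \<le> D" "x < 2 ^ d" and "on_path D j (2 ^ d + x)"
  then obtain d' where d': "2 ^ d + x = 2 ^ d' + j mod 2 ^ d'" by (auto simp: on_path_def node_def)
  have "(2::nat) ^ d \<le> 2 ^ d + x" "2 ^ d + x < 2 ^ Suc d" "(2::nat) ^ d' \<le> 2 ^ d' + j mod 2 ^ d'" "2 ^ d' + j mod 2 ^ d' < 2 ^ Suc d'"
    using d by auto
  then have "(2::nat) ^ d < 2 ^ Suc d'" "(2::nat) ^ d' < 2 ^ Suc d" unfolding d' by linarith+
  then have "d = d'" by (simp del: power_Suc)
  then show "j mod 2 ^ d = x" using d' by simp
next
  assume "d \<le> D" "j mod 2 ^ d = x"
  then show "on_path D j (2 ^ d + x)" by (auto simp: on_path_def node_def)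
qed

lemma on_path_split:
  assumes "d < D" "x < 2 ^ d"
  shows "on_path D j (2 ^ d + x) \<longleftrightarrow> on_path D j (2 ^ Suc d + x) \<or> on_path D j (2 ^ Suc d + (2 ^ d + x))"
    "\<not> (on_path D j (2 ^ Suc d + x) \<and> on_path D j (2 ^ Suc d + (2 ^ d + x)))"
proof -
  have x: "x < 2 ^ Suc d" "2 ^ d + x < 2 ^ Suc d" using assms(2) by auto
  have d: "d \<le> D" "Suc d \<le> D" using assms by auto
  note o = on_path_node[OF d(1) assms(2)] on_path_node[OF d(2) x(1)] on_path_node[OF d(2) x(2)]
  show "on_path D j (2 ^ d + x) \<longleftrightarrow> on_path D j (2 ^ Suc d + x) \<or> on_path D j (2 ^ Suc d + (2 ^ d + x))"
    unfolding o using mod_halve[of j d] assms(2) by (auto split: if_splits)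
  show "\<not> (on_path D j (2 ^ Suc d + x) \<and> on_path D j (2 ^ Suc d + (2 ^ d + x)))"
    unfolding o by auto
qed

lemma powp_mono: "x \<le> y \<Longrightarrow> 0 \<le> e \<Longrightarrow> powp x e \<le> powp y e"
  by (auto simp: powp_def intro: powr_mono2)

lemma powp_nonneg [simp]: "0 \<le> powp x e"
  by (simp add: powp_def)

lemma powp_0 [simp]: "powp 0 e = 0"
  by (simp add: powp_def)

lemma powp_root_le:
  assumes "finite I" "i \<in> I" "0 < q"
  shows "f i \<le> powp (\<Sum>i\<in>I. powp (f i) q) (1 / q)"
proof (cases "0 < f i")
  case True
  have "powp (f i) q \<le> (\<Sum>i\<in>I. powp (f i) q)" using assms by (intro member_le_sum) auto
  then have "powp (powp (f i) q) (1 / q) \<le> powp (\<Sum>i\<in>I. powp (f i) q) (1 / q)" using assms by (intro powp_mono) auto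
  moreover have "powp (powp (f i) q) (1 / q) = f i" using True assms by (simp add: powp_def powr_powr)
  ultimately show ?thesis by simp
next
  case False
  then show ?thesis using powp_nonneg[of "\<Sum>i\<in>I. powp (f i) q" "1 / q"] by linarith
qed

context params
begin

text \<open>The common scale of the amplitudes. It dominates the product of root weights for every
  row and column (\<open>Shat_bound\<close>), which keeps the argument of the arccosine in
  \<open>EAng\<close> at most 1, and for both choices of \<open>\<mu>\<close> it is at most 4
  \<open>\<mu>\<close>^2.\<close>

definition Shat :: "real mat \<Rightarrow> real" where
  "Shat A = powp (powp (S1 A) (1 / qe (dim_row A) (dim_col A))) xe * powp (S2 A) (1 / qe (dim_row A) (dim_col A))"

text \<open>The condition under which the amplitudes of the walk multiply up to the matrix entry.\<close>

definition balanced :: "real mat \<Rightarrow> bool" where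
  "balanced A \<longleftrightarrow> (\<forall>r<dim_row A. \<forall>j<dim_col A. 0 < UW A r 1 \<longrightarrow>
     VW A (tau * j) (2 ^ cost2 (dim_row A) + r) * wt q1 (A $$ (r, j)) * powp (UW A r 1) xe / UW A r 1 = (A $$ (r, j))\<^sup>2)"

lemma wt_pos: "a \<noteq> 0 \<Longrightarrow> 0 < wt q a"
proof -
  assume "a \<noteq> 0"
  then have "0 < a * a" using not_real_square_gt_zero[of a] by blast
  then show ?thesis
    by (simp only: wt_def powp_def if_True powr_gt_zero)
qed

lemma UW_split: "d < cost2 (dim_col A) \<Longrightarrow> x < 2 ^ d \<Longrightarrow> UW A r (2 ^ d + x) = UW A r (2 ^ Suc d + x) + UW A r (2 ^ Suc d + (2 ^ d + x))"
  unfolding UW_def using on_path_split[of d "cost2 (dim_col A)" x]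
  by (auto simp flip: sum.distrib intro!: sum.cong)

lemma VW_split: "d < cost2 (dim_row A) \<Longrightarrow> x < 2 ^ d \<Longrightarrow> VW A t (2 ^ d + x) = VW A t (2 ^ Suc d + x) + VW A t (2 ^ Suc d + (2 ^ d + x))"
  unfolding VW_def using on_path_split[of d "cost2 (dim_row A)" x]
  by (auto simp flip: sum.distrib intro!: sum.cong)

lemma UW_leaf: "r < dim_row A \<Longrightarrow> x < 2 ^ cost2 (dim_col A) \<Longrightarrow>
    UW A r (2 ^ cost2 (dim_col A) + x) = (if x < dim_col A then wt q1 (A $$ (r, x)) else 0)"
proof -
  assume r: "r < dim_row A" and x: "x < 2 ^ cost2 (dim_col A)"
  have "on_path (cost2 (dim_col A)) j (2 ^ cost2 (dim_col A) + x) \<longleftrightarrow> j = x" if "j < dim_col A" for j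
    using on_path_node[OF order_refl x, of j] le_cost2[of "dim_col A"] that by simp
  then have "UW A r (2 ^ cost2 (dim_col A) + x) = (\<Sum>j<dim_col A. if j = x then wt q1 (A $$ (r, x)) else 0)"
    unfolding UW_def using r by (auto intro!: sum.cong)
  then show ?thesis by simp
qed

lemma UW_root: "r < dim_row A \<Longrightarrow> UW A r 1 = (\<Sum>j<dim_col A. wt q1 (A $$ (r, j)))"
  by (simp add: UW_def del: One_nat_def)

lemma VW_leaf: "x < 2 ^ cost2 (dim_row A) \<Longrightarrow>
    VW A t (2 ^ cost2 (dim_row A) + x) = (if x < dim_row A then \<Sum>j<dim_col A. if tau * j = t then wt q2 (A $$ (x, j)) else 0 else 0)"
proof -
  assume x: "x < 2 ^ cost2 (dim_row A)"
  have o: "on_path (cost2 (dim_row A)) i (2 ^ cost2 (dim_row A) + x) \<longleftrightarrow> i = x" if "i < dim_row A" for i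
    using on_path_node[OF order_refl x, of i] le_cost2[of "dim_row A"] that by simp
  have "VW A t (2 ^ cost2 (dim_row A) + x) = (\<Sum>i<dim_row A. if i = x then (\<Sum>j<dim_col A. if tau * j = t then wt q2 (A $$ (x, j)) else 0) else 0)"
    unfolding VW_def
  proof (intro sum.cong refl)
    fix i assume i: "i \<in> {..<dim_row A}"
    show "(\<Sum>j<dim_col A. if tau * j = t \<and> on_path (cost2 (dim_row A)) i (2 ^ cost2 (dim_row A) + x) then wt q2 (A $$ (i, j)) else 0) =
        (if i = x then \<Sum>j<dim_col A. if tau * j = t then wt q2 (A $$ (x, j)) else 0 else 0)"
    proof (cases "i = x")
      case True
      then show ?thesis using o[of x] i unfolding True by simp
    next
      case False
      then show ?thesis using o[of i] i by simp
    qed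
  qed
  then show ?thesis by simp
qed

lemma VW_root: "VW A t 1 = (\<Sum>x<dim_row A. VW A t (2 ^ cost2 (dim_row A) + x))"
proof -
  have "VW A t (2 ^ cost2 (dim_row A) + x) = (\<Sum>j<dim_col A. if tau * j = t then wt q2 (A $$ (x, j)) else 0)" if "x < dim_row A" for x
    using VW_leaf[of x A t] le_cost2[of "dim_row A"] that by simp
  then show ?thesis unfolding VW_def[of A t 1] by (intro sum.cong refl) (simp del: One_nat_def)
qed

lemma qe_pos: "0 < qe m n"
  by (simp add: qe_def add_nonneg_pos)

lemma Shat_bound:
  assumes "0 \<le> xe" "r < dim_row A" "j < dim_col A"
  shows "powp (UW A r 1) xe * VW A (tau * j) 1 \<le> Shat A"
  unfolding Shat_def S1_def S2_def
proof (intro mult_mono powp_mono assms(1))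
  have "tau * j < dim_col A" using tau assms(3) by (cases "tau = 0") (auto simp: le_Suc_eq)
  then show "VW A (tau * j) 1 \<le> powp (\<Sum>t<dim_col A. powp (VW A t 1) (qe (dim_row A) (dim_col A))) (1 / qe (dim_row A) (dim_col A))"
    by (intro powp_root_le qe_pos) auto
  show "UW A r 1 \<le> powp (\<Sum>r<dim_row A. powp (UW A r 1) (qe (dim_row A) (dim_col A))) (1 / qe (dim_row A) (dim_col A))"
    using assms by (intro powp_root_le qe_pos) auto
qed (auto simp: VW_nonneg)

end

text \<open>A tree has 2 * 2^D node numbers spaced by 8, hence the stride 16 * 2^D. The factor
  \<open>tau\<close> in the stride of the columns lets all columns read tree 0 when
  \<open>tau\<close> is 0.\<close>

locale encoded = params q1 q2 xe tau + walk "params.enc q1 q2 tau A" "real (dim_col A)" "16 * 2 ^ cost2 (dim_col A)"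
    "real tau * (16 * 2 ^ cost2 (dim_row A))" "params.Shat q1 q2 xe tau A" beta xe "cost2 (dim_col A)" "cost2 (dim_row A)"
  for q1 q2 xe tau A beta +
  assumes xe: "0 \<le> xe" and bal: "balanced A" and Shat_pos: "0 < Shat A"
begin

abbreviation "D \<equiv> cost2 (dim_col A)"
abbreviation "E \<equiv> cost2 (dim_row A)"

lemma mem_U:
  assumes "y < 2 * 2 ^ D"
  shows "enc A (addr (real (8 * (r * (2 * 2 ^ D) + y) + 1))) = UW A r y"
  using enc_U[OF assms, of r] by (simp only: addr_eq)

lemma mem_V:
  assumes "y < 2 * 2 ^ E"
  shows "enc A (addr (real (8 * (t * (2 * 2 ^ E) + y) + 2))) = VW A t y"
  using enc_V[OF assms, of t] by (simp only: addr_eq)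

lemma pow_lt: "d < K \<Longrightarrow> x < 2 ^ d \<Longrightarrow> 2 ^ d + x < 2 * 2 ^ K \<and> 2 ^ Suc d + x < 2 * (2 ^ K :: nat)"
proof -
  assume "d < K" "x < 2 ^ d"
  moreover from this have "2 ^ Suc d \<le> (2::nat) ^ K" by (intro power_increasing) auto
  ultimately show ?thesis by (simp; linarith)
qed

lemma amp_U:
  assumes "r < dim_row A" "0 < UW A r 1" "x < 2 ^ D"
  shows "amp 1 (16 * 2 ^ D) (real r) D x = sqrt ((if x < dim_col A then wt q1 (A $$ (r, x)) else 0) / UW A r 1)"
proof -
  have "amp 1 (16 * 2 ^ D) (real r) D x = sqrt (UW A r (2 ^ D + x) / UW A r 1)"
  proof (rule amp_eq[where K = D])
    fix d x :: nat assume d: "d < D" "x < 2 ^ d"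
    have 1: "real r * (16 * 2 ^ D) + real x * 8 + (8 * 2 ^ d + 1) = real (8 * (r * (2 * 2 ^ D) + (2 ^ d + x)) + 1)"
      by (simp add: algebra_simps)
    show "enc A (addr (real r * (16 * 2 ^ D) + real x * 8 + (8 * 2 ^ d + 1))) = UW A r (2 ^ d + x)"
      unfolding 1 using pow_lt[OF d] by (intro mem_U) auto
    have 2: "real r * (16 * 2 ^ D) + real x * 8 + (8 * 2 ^ d + 1) + 8 * 2 ^ d = real (8 * (r * (2 * 2 ^ D) + (2 ^ Suc d + x)) + 1)"
      by (simp add: algebra_simps)
    show "enc A (addr (real r * (16 * 2 ^ D) + real x * 8 + (8 * 2 ^ d + 1) + 8 * 2 ^ d)) = UW A r (2 ^ Suc d + x)"
      unfolding 2 using pow_lt[OF d] by (intro mem_U) auto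
  qed (use assms in \<open>auto intro: UW_split UW_nonneg simp del: power_Suc\<close>)
  then show ?thesis using UW_leaf[OF assms(1,3)] by simp
qed

lemma amp_V:
  assumes "0 < VW A (tau * j) 1" "x < 2 ^ E"
  shows "amp 2 (real tau * (16 * 2 ^ E)) (real j) E x = sqrt (VW A (tau * j) (2 ^ E + x) / VW A (tau * j) 1)"
proof (rule amp_eq[where K = E])
  fix d x :: nat assume d: "d < E" "x < 2 ^ d"
  have 1: "real j * (real tau * (16 * 2 ^ E)) + real x * 8 + (8 * 2 ^ d + 2) = real (8 * ((tau * j) * (2 * 2 ^ E) + (2 ^ d + x)) + 2)"
    by (simp add: algebra_simps)
  show "enc A (addr (real j * (real tau * (16 * 2 ^ E)) + real x * 8 + (8 * 2 ^ d + 2))) = VW A (tau * j) (2 ^ d + x)"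
    unfolding 1 using pow_lt[OF d] by (intro mem_V) auto
  have 2: "real j * (real tau * (16 * 2 ^ E)) + real x * 8 + (8 * 2 ^ d + 2) + 8 * 2 ^ d = real (8 * ((tau * j) * (2 * 2 ^ E) + (2 ^ Suc d + x)) + 2)"
    by (simp add: algebra_simps)
  show "enc A (addr (real j * (real tau * (16 * 2 ^ E)) + real x * 8 + (8 * 2 ^ d + 2) + 8 * 2 ^ d)) = VW A (tau * j) (2 ^ Suc d + x)"
    unfolding 2 using pow_lt[OF d] by (intro mem_V) auto
qed (use assms in \<open>auto intro: VW_split VW_nonneg simp del: power_Suc\<close>)

lemma roots:
  "enc A (addr (real r * (16 * 2 ^ D) + 9)) = UW A r 1"
  "enc A (addr (real j * (real tau * (16 * 2 ^ E)) + 10)) = VW A (tau * j) 1"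
  "r < dim_row A \<Longrightarrow> j < dim_col A \<Longrightarrow> enc A (addr ((real r * real (dim_col A) + real j) * 8)) = A $$ (r, j)"
proof -
  have one: "(1::nat) < 2 * 2 ^ k" for k :: nat using less_le_trans[of 1 2 "2 * 2 ^ k :: nat"] by simp
  have 1: "real r * (16 * 2 ^ D) + 9 = real (8 * (r * (2 * 2 ^ D) + 1) + 1)" by (simp add: algebra_simps)
  show "enc A (addr (real r * (16 * 2 ^ D) + 9)) = UW A r 1" unfolding 1 by (rule mem_U[OF one])
  have 2: "real j * (real tau * (16 * 2 ^ E)) + 10 = real (8 * ((tau * j) * (2 * 2 ^ E) + 1) + 2)" by (simp add: algebra_simps)
  show "enc A (addr (real j * (real tau * (16 * 2 ^ E)) + 10)) = VW A (tau * j) 1" unfolding 2 by (rule mem_V[OF one])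
  assume rj: "r < dim_row A" "j < dim_col A"
  have 3: "(real r * real (dim_col A) + real j) * 8 = real (8 * (r * dim_col A + j))" by simp
  show "enc A (addr ((real r * real (dim_col A) + real j) * 8)) = A $$ (r, j)"
    unfolding 3 using enc_raw[OF rj] by (simp only: addr_eq)
qed

lemma EAng_0: "powp (UW A r 1) xe * VW A (tau * j) 1 = 0 \<Longrightarrow> cos (EAng (real j) (real r)) = 0"
  unfolding EAng_def roots by (simp only: div_0 powp_0 mult_zero_left) (simp add: acs_def)

text \<open>The three factors are sqrt(v/V), sqrt(U^xe V/S) / 4 with the sign of the entry, and
  sqrt(u/U). The column root V cancels, and \<open>balanced\<close> says that the remaining v u U^xe
  / U is the square of the entry. If a root vanishes, so does the entry.\<close>

lemma co_eq:
  assumes "j < dim_col A" "r < 2 ^ E"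
  shows "co (real j) r = (if r < dim_row A then A $$ (r, j) / (4 * sqrt (Shat A)) else 0)"
proof -
  let ?U = "UW A r 1" and ?V = "VW A (tau * j) 1" and ?S = "Shat A"
  have jD: "j < 2 ^ D" using assms le_cost2[of "dim_col A"] by linarith
  have co: "co (real j) r = amp 2 (real tau * (16 * 2 ^ E)) (real j) E r * cos (EAng (real j) (real r)) * amp 1 (16 * 2 ^ D) (real r) D j"
  proof -
    have "(\<Sum>j'<2 ^ D. if real j = real j' then amp 1 (16 * 2 ^ D) (real r) D j' else 0) = amp 1 (16 * 2 ^ D) (real r) D j"
      using jD by (simp only: of_nat_eq_iff) simp
    then show ?thesis by (simp add: co_def)
  qed
  show ?thesis
  proof (cases "powp ?U xe * ?V = 0")
    case True
    have "A $$ (r, j) = 0" if r: "r < dim_row A"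
    proof (rule ccontr)
      assume a: "A $$ (r, j) \<noteq> 0"
      have "wt q1 (A $$ (r, j)) \<le> ?U" unfolding UW_root[OF r] using assms by (intro member_le_sum) auto
      then have "0 < ?U" using wt_pos[OF a, of q1] by linarith
      moreover have "wt q2 (A $$ (r, j)) \<le> VW A (tau * j) (2 ^ E + r)"
        unfolding VW_leaf[OF assms(2)] using assms r
          member_le_sum[of j "{..<dim_col A}" "\<lambda>j'. if tau * j' = tau * j then wt q2 (A $$ (r, j')) else 0"] by simp
      moreover have "VW A (tau * j) (2 ^ E + r) \<le> ?V"
        unfolding VW_root using r by (intro member_le_sum) (auto simp: VW_nonneg)
      ultimately have "0 < powp ?U xe * ?V" using wt_pos[OF a, of q2] by (auto simp: powp_def)
      then show False using True by linarith
    qed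
    then show ?thesis unfolding co EAng_0[OF True] by simp
  next
    case False
    then have U: "0 < ?U" using UW_nonneg[of A r 1] by (cases "?U = 0") auto
    have V: "0 < ?V" using False VW_nonneg[of A "tau * j" 1] by (cases "?V = 0") auto
    have r: "r < dim_row A" using U by (auto simp: UW_def split: if_splits)
    let ?a = "A $$ (r, j)" and ?P = "powp ?U xe"
    have P: "0 < ?P" using U by (simp add: powp_def)
    define h where "h = sqrt (?P * ?V / ?S)"
    have PV: "0 < ?P * ?V / ?S" "?P * ?V / ?S \<le> 1"
      using P V Shat_pos Shat_bound[OF xe r assms(1)] by simp_all
    then have h: "0 < h" "h \<le> 1" "powp (?P * ?V / ?S) (1 / 2) = h" by (simp_all add: h_def powp_def powr_half_sqrt)
    define sg where "sg = (2 * leqr 0 ?a - 1)"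
    have sg: "\<bar>sg\<bar> = 1" "sg * \<bar>?a\<bar> = ?a" by (auto simp: sg_def leqr_def)
    have "\<bar>h * sg * (1 / 4)\<bar> \<le> 1" using h sg by (simp add: abs_mult)
    then have cE: "cos (EAng (real j) (real r)) = h * sg * (1 / 4)"
      unfolding EAng_def roots(1,2) roots(3)[OF r assms(1)] h(3) by (simp add: acs_def sg_def)
    let ?v = "VW A (tau * j) (2 ^ E + r)" and ?u = "wt q1 ?a"
    have "sqrt (?v / ?V) * h * sqrt (?u / ?U) = sqrt (?v * ?u * ?P / ?U / ?S)"
      unfolding h_def real_sqrt_mult[symmetric] using V by (simp add: field_simps)
    also have "?v * ?u * ?P / ?U = ?a\<^sup>2" using bal r assms U unfolding balanced_def by blast
    also have "sqrt (?a\<^sup>2 / ?S) = \<bar>?a\<bar> / sqrt ?S" by (simp add: real_sqrt_divide)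
    finally have k: "sqrt (?v / ?V) * h * sqrt (?u / ?U) = \<bar>?a\<bar> / sqrt ?S" .
    have "co (real j) r = sqrt (?v / ?V) * (h * sg * (1 / 4)) * sqrt (?u / ?U)"
      unfolding co cE amp_V[OF V assms(2)] amp_U[OF r U jD] using assms by simp
    also have "\<dots> = (sqrt (?v / ?V) * h * sqrt (?u / ?U)) * sg * (1 / 4)" by (simp only: mult_ac)
    also have "\<dots> = sg * \<bar>?a\<bar> / (4 * sqrt ?S)" unfolding k by (simp add: mult.commute)
    finally show ?thesis using r by (simp add: sg)
  qed
qed

text \<open>The trees are padded to a power of two; the padding leaves have weight 0 and so
  contribute no amplitude.\<close>

lemma co_0:
  assumes "\<And>j. j < dim_col A \<Longrightarrow> x \<noteq> real j" "r < 2 ^ E"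
  shows "co x r = 0"
proof -
  have "amp 2 (real tau * (16 * 2 ^ E)) x E r * cos (EAng x (real r)) * (if x = real j then amp 1 (16 * 2 ^ D) (real r) D j else 0) = 0" if j: "j < 2 ^ D" for j
  proof (cases "x = real j")
    case True
    show ?thesis
    proof (cases "UW A r 1 = 0")
      case True
      then show ?thesis using EAng_0[of r j] \<open>x = real j\<close> by simp
    next
      case False
      then have U: "0 < UW A r 1" using UW_nonneg[of A r 1] by simp
      then have "r < dim_row A" by (auto simp: UW_def split: if_splits)
      from amp_U[OF this U j] show ?thesis using assms(1)[of j] True by auto
    qed
  qed simp
  then show ?thesis unfolding co_def sum_distrib_left by (intro sum.neutral) auto
qed

text \<open>A Schur test. By \<open>balanced\<close>, the square of each term is a product P Q, so
  the inequality of the means bounds the term by (P + Q) / 2. Summing the row shares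
  \<open>p\<close> gives at most the norm of x, and summing the column weights \<open>q\<close>
  gives at most \<open>Shat A\<close> times the norm of y.\<close>

lemma Shat_ge:
  assumes x: "(\<Sum>r<dim_row A. (x r)\<^sup>2) = 1" and y: "(\<Sum>j<dim_col A. (y j)\<^sup>2) = 1"
  shows "(\<Sum>r<dim_row A. \<Sum>j<dim_col A. A $$ (r, j) * x r * y j) \<le> sqrt (Shat A)"
proof -
  let ?S = "sqrt (Shat A)"
  have S: "0 < ?S" using Shat_pos by simp
  define p where "p r j = (x r)\<^sup>2 * wt q1 (A $$ (r, j)) / UW A r 1" for r j
  define q where "q r j = (y j)\<^sup>2 * (VW A (tau * j) (2 ^ E + r) * powp (UW A r 1) xe)" for r j
  have t: "A $$ (r, j) * x r * y j \<le> (?S * p r j + q r j / ?S) / 2" if rj: "r < dim_row A" "j < dim_col A" for r j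
  proof (cases "UW A r 1 = 0")
    case True
    have "wt q1 (A $$ (r, j)) \<le> UW A r 1" unfolding UW_root[OF rj(1)] using rj by (intro member_le_sum) auto
    then have "A $$ (r, j) = 0" using True wt_pos[of "A $$ (r, j)" q1] by force
    then show ?thesis using True by (simp add: p_def q_def)
  next
    case False
    then have U: "0 < UW A r 1" using UW_nonneg[of A r 1] by simp
    define P where "P = ?S * p r j"
    define Q where "Q = q r j / ?S"
    have PQ0: "0 \<le> P" "0 \<le> Q"
      using S U by (auto simp: P_def Q_def p_def q_def VW_nonneg)
    have "P * Q = p r j * q r j" using S by (simp add: P_def Q_def)
    also have "\<dots> = (x r)\<^sup>2 * (y j)\<^sup>2 * (VW A (tau * j) (2 ^ E + r) * wt q1 (A $$ (r, j)) * powp (UW A r 1) xe / UW A r 1)"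
      by (simp add: p_def q_def)
    also have "\<dots> = (A $$ (r, j) * x r * y j)\<^sup>2"
      using bal rj U unfolding balanced_def by (simp add: power_mult_distrib)
    finally have PQ: "(A $$ (r, j) * x r * y j)\<^sup>2 = P * Q" ..
    have "P * Q \<le> ((P + Q) / 2)\<^sup>2"
      using zero_le_power2[of "P - Q"] by (simp add: power2_eq_square field_simps)
    then have "(A $$ (r, j) * x r * y j)\<^sup>2 \<le> ((P + Q) / 2)\<^sup>2" by (simp only: PQ)
    then have "A $$ (r, j) * x r * y j \<le> (P + Q) / 2"
      by (rule power2_le_imp_le) (use PQ0 in simp)
    then show ?thesis by (simp add: P_def Q_def)
  qed
  have p: "(\<Sum>r<dim_row A. \<Sum>j<dim_col A. p r j) \<le> 1"
  proof -
    have "(\<Sum>j<dim_col A. p r j) \<le> (x r)\<^sup>2" if "r < dim_row A" for r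
    proof -
      have "(\<Sum>j<dim_col A. p r j) = (x r)\<^sup>2 * (\<Sum>j<dim_col A. wt q1 (A $$ (r, j))) / UW A r 1"
        by (simp add: p_def sum_divide_distrib sum_distrib_left)
      then have "(\<Sum>j<dim_col A. p r j) = (x r)\<^sup>2 * (UW A r 1 / UW A r 1)" unfolding UW_root[OF that, symmetric] by simp
      then show ?thesis by (cases "UW A r 1 = 0") auto
    qed
    then have "(\<Sum>r<dim_row A. \<Sum>j<dim_col A. p r j) \<le> (\<Sum>r<dim_row A. (x r)\<^sup>2)" by (intro sum_mono) auto
    then show ?thesis using x by simp
  qed
  have q: "(\<Sum>r<dim_row A. \<Sum>j<dim_col A. q r j) \<le> Shat A"
  proof -
    define B where "B = powp (powp (S1 A) (1 / qe (dim_row A) (dim_col A))) xe"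
    have "(\<Sum>r<dim_row A. q r j) \<le> (y j)\<^sup>2 * Shat A" if j: "j < dim_col A" for j
    proof -
      have "powp (UW A r 1) xe \<le> B" if "r < dim_row A" for r
        unfolding B_def S1_def using xe that by (intro powp_mono powp_root_le qe_pos) auto
      then have "(\<Sum>r<dim_row A. q r j) \<le> (\<Sum>r<dim_row A. (y j)\<^sup>2 * (VW A (tau * j) (2 ^ E + r) * B))"
        unfolding q_def by (intro sum_mono mult_left_mono) (auto simp: VW_nonneg)
      also have "\<dots> = (y j)\<^sup>2 * (B * VW A (tau * j) 1)" unfolding VW_root[of A "tau * j"] sum_distrib_left by (intro sum.cong refl) (simp add: mult_ac)
      also have "\<dots> \<le> (y j)\<^sup>2 * Shat A"
      proof (intro mult_left_mono)
        have "tau * j < dim_col A" using tau j by (cases "tau = 0") (auto simp: le_Suc_eq)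
        then have "VW A (tau * j) 1 \<le> powp (S2 A) (1 / qe (dim_row A) (dim_col A))"
          unfolding S2_def by (intro powp_root_le qe_pos) auto
        then show "B * VW A (tau * j) 1 \<le> Shat A" unfolding Shat_def B_def by (intro mult_left_mono) auto
      qed simp
      finally show ?thesis .
    qed
    then have "(\<Sum>j<dim_col A. \<Sum>r<dim_row A. q r j) \<le> (\<Sum>j<dim_col A. (y j)\<^sup>2 * Shat A)" by (intro sum_mono) auto
    also have "\<dots> = Shat A" by (simp add: y flip: sum_distrib_right)
    finally show ?thesis by (subst sum.swap)
  qed
  have "(\<Sum>r<dim_row A. \<Sum>j<dim_col A. A $$ (r, j) * x r * y j) \<le>
      (\<Sum>r<dim_row A. \<Sum>j<dim_col A. (?S * p r j + q r j / ?S) / 2)"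
    using t by (intro sum_mono) auto
  also have "\<dots> = (?S * (\<Sum>r<dim_row A. \<Sum>j<dim_col A. p r j) + (\<Sum>r<dim_row A. \<Sum>j<dim_col A. q r j) / ?S) / 2"
    by (simp add: sum.distrib sum_distrib_left sum_divide_distrib add_divide_distrib)
  also have "\<dots> \<le> (?S * 1 + Shat A / ?S) / 2"
    using p q S by (intro divide_right_mono add_mono mult_left_mono) auto
  also have "Shat A / ?S = ?S" using Shat_pos by (simp add: real_div_sqrt)
  finally show ?thesis by simp
qed

end

section \<open>Singular vectors and invariant planes\<close>

context
  fixes A \<sigma> u v
  assumes svd: "is_svd A \<sigma> u v"
begin

lemma svd_sigma: "i < min (dim_row A) (dim_col A) \<Longrightarrow> 0 \<le> \<sigma> i"
  and svd_dim: "i < min (dim_row A) (dim_col A) \<Longrightarrow> dim_vec (v i) = dim_col A"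
  using svd by (auto simp: is_svd_def Let_def)

lemma svd_uu:
  assumes "i < min (dim_row A) (dim_col A)" "j < min (dim_row A) (dim_col A)"
  shows "(\<Sum>r<dim_row A. u i $ r * u j $ r) = (if i = j then 1 else 0)"
proof -
  have "u i \<bullet> u j = (if i = j then 1 else 0)" "u j \<in> carrier_vec (dim_row A)"
    using svd assms unfolding is_svd_def Let_def by blast+
  then show ?thesis by (simp add: scalar_prod_def atLeast0LessThan)
qed

lemma svd_vv:
  assumes "i < min (dim_row A) (dim_col A)" "j < min (dim_row A) (dim_col A)"
  shows "(\<Sum>r<dim_col A. v i $ r * v j $ r) = (if i = j then 1 else 0)"
proof -
  have "v i \<bullet> v j = (if i = j then 1 else 0)" "v j \<in> carrier_vec (dim_col A)"
    using svd assms unfolding is_svd_def Let_def by blast+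
  then show ?thesis by (simp add: scalar_prod_def atLeast0LessThan)
qed

lemma svd_entry: "r < dim_row A \<Longrightarrow> c < dim_col A \<Longrightarrow> A $$ (r, c) = (\<Sum>i<min (dim_row A) (dim_col A). \<sigma> i * u i $ r * v i $ c)"
  using svd by (auto simp: is_svd_def Let_def)

lemma svd_Av:
  assumes i: "i < min (dim_row A) (dim_col A)" and r: "r < dim_row A"
  shows "(\<Sum>j<dim_col A. A $$ (r, j) * v i $ j) = \<sigma> i * u i $ r"
proof -
  let ?k = "min (dim_row A) (dim_col A)"
  have "(\<Sum>j<dim_col A. A $$ (r, j) * v i $ j) = (\<Sum>j<dim_col A. \<Sum>l<?k. \<sigma> l * u l $ r * (v l $ j * v i $ j))"
    using svd_entry[OF r] by (simp add: sum_distrib_right mult.assoc)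
  also have "\<dots> = (\<Sum>l<?k. \<sigma> l * u l $ r * (\<Sum>j<dim_col A. v l $ j * v i $ j))"
    by (subst sum.swap) (simp add: sum_distrib_left)
  also have "\<dots> = (\<Sum>l<?k. if l = i then \<sigma> i * u i $ r else 0)"
    using i by (intro sum.cong refl) (simp add: svd_vv)
  finally show ?thesis using i by simp
qed

lemma svd_Atu:
  assumes i: "i < min (dim_row A) (dim_col A)" and j: "j < dim_col A"
  shows "(\<Sum>r<dim_row A. A $$ (r, j) * u i $ r) = \<sigma> i * v i $ j"
proof -
  let ?k = "min (dim_row A) (dim_col A)"
  have "(\<Sum>r<dim_row A. A $$ (r, j) * u i $ r) = (\<Sum>r<dim_row A. \<Sum>l<?k. \<sigma> l * v l $ j * (u l $ r * u i $ r))"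
    using svd_entry[OF _ j] by (simp add: sum_distrib_left sum_distrib_right mult_ac)
  also have "\<dots> = (\<Sum>l<?k. \<sigma> l * v l $ j * (\<Sum>r<dim_row A. u l $ r * u i $ r))"
    by (subst sum.swap) (simp add: sum_distrib_left)
  also have "\<dots> = (\<Sum>l<?k. if l = i then \<sigma> i * v i $ j else 0)"
    using i by (intro sum.cong refl) (simp add: svd_uu)
  finally show ?thesis using i by simp
qed

lemma svd_uAv:
  assumes i: "i < min (dim_row A) (dim_col A)"
  shows "(\<Sum>r<dim_row A. \<Sum>j<dim_col A. A $$ (r, j) * u i $ r * v i $ j) = \<sigma> i"
proof -
  have "(\<Sum>r<dim_row A. \<Sum>j<dim_col A. A $$ (r, j) * u i $ r * v i $ j) =
      (\<Sum>r<dim_row A. u i $ r * (\<Sum>j<dim_col A. A $$ (r, j) * v i $ j))"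
    by (simp add: sum_distrib_left mult_ac)
  also have "\<dots> = (\<Sum>r<dim_row A. \<sigma> i * (u i $ r * u i $ r))"
    by (intro sum.cong refl) (simp add: svd_Av[OF i])
  also have "\<dots> = \<sigma> i" by (simp add: svd_uu[OF i i] flip: sum_distrib_left)
  finally show ?thesis .
qed

end

lemma (in params) entry_pos:
  assumes a: "A $$ (r, j) \<noteq> 0" and rj: "r < dim_row A" "j < dim_col A" and xe: "0 \<le> xe"
  shows "0 < Shat A"
proof -
  have "wt q1 (A $$ (r, j)) \<le> UW A r 1" unfolding UW_root[OF rj(1)] using rj by (intro member_le_sum) auto
  then have "0 < UW A r 1" using wt_pos[OF a, of q1] by linarith
  moreover have rE: "r < 2 ^ cost2 (dim_row A)" using rj le_cost2[of "dim_row A"] by linarith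
  have "wt q2 (A $$ (r, j)) \<le> VW A (tau * j) (2 ^ cost2 (dim_row A) + r)"
    unfolding VW_leaf[OF rE] using rj
      member_le_sum[of j "{..<dim_col A}" "\<lambda>j'. if tau * j' = tau * j then wt q2 (A $$ (r, j')) else 0"] by simp
  moreover have "VW A (tau * j) (2 ^ cost2 (dim_row A) + r) \<le> VW A (tau * j) 1"
    unfolding VW_root[of A "tau * j"] using rj by (intro member_le_sum) (auto simp: VW_nonneg)
  ultimately have "0 < powp (UW A r 1) xe * VW A (tau * j) 1" using wt_pos[OF a, of q2] by (auto simp: powp_def)
  then show ?thesis using Shat_bound[OF xe rj] by linarith
qed

text \<open>It serves twice: if \<open>\<delta>\<close> is at least sqrt(Shat), the estimate 0 is
  already accurate enough, and otherwise the bound keeps the rotation angle of the walk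
  small.\<close>

lemma (in params) sigma_le:
  assumes svd: "is_svd A \<sigma> u v" and i: "i < min (dim_row A) (dim_col A)" and xe: "0 \<le> xe" and bal: "balanced A"
  shows "\<sigma> i \<le> sqrt (Shat A)"
proof (cases "0 < Shat A")
  case True
  interpret encoded q1 q2 xe tau A 0
    by unfold_locales (use xe bal True in auto)
  have "(\<Sum>r<dim_row A. \<Sum>j<dim_col A. A $$ (r, j) * u i $ r * v i $ j) \<le> sqrt (Shat A)"
    using svd_uu[OF svd i i] svd_vv[OF svd i i] by (intro Shat_ge) (simp_all add: power2_eq_square)
  then show ?thesis by (simp add: svd_uAv[OF svd i])
next
  case False
  then have "A $$ (r, j) = 0" if "r < dim_row A" "j < dim_col A" for r j using entry_pos[OF _ that xe] by auto
  then have "\<sigma> i = 0" using svd_uAv[OF svd i] by simp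
  moreover have "0 \<le> Shat A" by (simp add: Shat_def)
  ultimately show ?thesis by simp
qed

context encoded
begin

text \<open>With cos(beta) = 4 sqrt(Shat) / Dh the damping by 1/4 cancels, and \<open>Bm\<close>
  becomes the matrix (A^T A + kq^2) / Dh^2 on column indices, of which v_i is an eigenvector. As
  \<sigma>^2 \<le> Shat and kq^2 < Shat, the eigenvalue is below 2/17, hence s \<le> 2/5.\<close>

lemma walk_plane:
  assumes svd: "is_svd A \<sigma> u v" and i: "i < min (dim_row A) (dim_col A)" and kq: "0 < kq" "kq\<^sup>2 < Shat A"
    and Dh: "Dh = sqrt (16 * Shat A + kq\<^sup>2)" and beta: "beta = acs (4 * sqrt (Shat A) / Dh)"
  shows "plane (enc A) (real (dim_col A)) (16 * 2 ^ D) (real tau * (16 * 2 ^ E)) (Shat A) beta xe D E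
    (dim_col A) (\<lambda>j. v i $ j) (sqrt ((\<sigma> i)\<^sup>2 + kq\<^sup>2) / Dh)"
    "sqrt ((\<sigma> i)\<^sup>2 + kq\<^sup>2) / Dh \<le> 2 / 5"
proof -
  let ?S = "Shat A" and ?s = "sqrt ((\<sigma> i)\<^sup>2 + kq\<^sup>2) / Dh"
  have Dh2: "0 < Dh" "Dh\<^sup>2 = 16 * ?S + kq\<^sup>2" using Shat_pos kq unfolding Dh by (auto intro: add_pos_pos)
  have sig: "0 \<le> \<sigma> i" "\<sigma> i \<le> sqrt ?S"
    using svd_sigma[OF svd i] sigma_le[OF svd i xe bal] by auto
  then have sig2: "(\<sigma> i)\<^sup>2 \<le> ?S" using power_mono[OF sig(2,1), of 2] Shat_pos by simp
  have s2: "?s\<^sup>2 = ((\<sigma> i)\<^sup>2 + kq\<^sup>2) / Dh\<^sup>2" by (simp add: power_divide)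
  have sp: "0 < ?s" using Dh2 kq by (simp add: add_nonneg_pos)
  have "?s\<^sup>2 \<le> (2 / 5)\<^sup>2"
    unfolding s2 Dh2(2) using sig2 kq Shat_pos by (subst divide_le_eq) (simp add: power2_eq_square add_pos_pos)
  then show s25: "?s \<le> 2 / 5" by (rule power2_le_imp_le) simp
  define t where "t = 4 * sqrt ?S / Dh"
  have t0: "0 \<le> t" using Dh2 Shat_pos by (simp add: t_def)
  have t2: "t\<^sup>2 = 16 * ?S / Dh\<^sup>2" using Shat_pos by (simp add: t_def power_divide power_mult_distrib)
  have "t\<^sup>2 \<le> 1\<^sup>2" unfolding t2 Dh2(2) using Shat_pos by (simp add: add_pos_nonneg)
  then have t1: "t \<le> 1" by (rule power2_le_imp_le) simp
  have cb: "cos beta = t" unfolding beta t_def[symmetric] using t0 t1 by (simp add: acs_def)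
  have sb: "(sin beta)\<^sup>2 = kq\<^sup>2 / Dh\<^sup>2"
  proof -
    have "Dh\<^sup>2 \<noteq> 0" using Dh2(1) by simp
    then have "1 - 16 * ?S / Dh\<^sup>2 = (Dh\<^sup>2 - 16 * ?S) / Dh\<^sup>2" by (simp add: diff_divide_distrib)
    then show ?thesis unfolding sin_squared_eq cb t2 by (simp add: Dh2(2))
  qed
  have Sv: "(\<Sum>j<dim_col A. co (real j) r * v i $ j) = (if r < dim_row A then \<sigma> i * u i $ r / (4 * sqrt ?S) else 0)" if r: "r < 2 ^ E" for r
  proof -
    have "(\<Sum>j<dim_col A. co (real j) r * v i $ j) = (\<Sum>j<dim_col A. if r < dim_row A then A $$ (r, j) * v i $ j / (4 * sqrt ?S) else 0)"
      using co_eq r by (intro sum.cong refl) simp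
    also have "\<dots> = (if r < dim_row A then (\<Sum>j<dim_col A. A $$ (r, j) * v i $ j) / (4 * sqrt ?S) else 0)"
      by (simp add: sum_divide_distrib)
    finally show ?thesis using svd_Av[OF svd i] by simp
  qed
  have eig: "(\<Sum>j<dim_col A. Bm x (real j) * v i $ j) = ?s\<^sup>2 * (\<Sum>j<dim_col A. if x = real j then v i $ j else 0)" for x
  proof -
    let ?I = "\<Sum>j<dim_col A. if x = real j then v i $ j else 0"
    have "(\<Sum>j<dim_col A. Bm x (real j) * v i $ j) = (\<Sum>j<dim_col A. (sin beta)\<^sup>2 * (if x = real j then v i $ j else 0) +
        (cos beta)\<^sup>2 * (\<Sum>r<2 ^ E. co x r * (co (real j) r * v i $ j)))"
      by (intro sum.cong refl) (simp add: Bm_def distrib_right sum_distrib_right mult.assoc)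
    also have "\<dots> = (sin beta)\<^sup>2 * ?I + (cos beta)\<^sup>2 * (\<Sum>j<dim_col A. \<Sum>r<2 ^ E. co x r * (co (real j) r * v i $ j))"
      by (simp only: sum.distrib sum_distrib_left)
    also have "(\<Sum>j<dim_col A. \<Sum>r<2 ^ E. co x r * (co (real j) r * v i $ j)) =
        (\<Sum>r<2 ^ E. co x r * (\<Sum>j<dim_col A. co (real j) r * v i $ j))"
      by (subst sum.swap) (simp add: sum_distrib_left)
    also have "\<dots> = (\<Sum>r<2 ^ E. co x r * (if r < dim_row A then \<sigma> i * u i $ r / (4 * sqrt ?S) else 0))"
      by (intro sum.cong refl) (simp add: Sv)
    also have "\<dots> = (\<sigma> i)\<^sup>2 / (16 * ?S) * ?I"
    proof (cases "\<exists>j<dim_col A. x = real j")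
      case True
      then obtain j where j: "j < dim_col A" "x = real j" by blast
      have "(\<Sum>r<2 ^ E. co x r * (if r < dim_row A then \<sigma> i * u i $ r / (4 * sqrt ?S) else 0)) =
          (\<Sum>r<2 ^ E. if r < dim_row A then A $$ (r, j) * u i $ r * (\<sigma> i / (16 * ?S)) else 0)"
        using co_eq[OF j(1)] Shat_pos unfolding j(2) by (intro sum.cong refl) (simp add: field_simps)
      also have "\<dots> = (\<Sum>r<dim_row A. A $$ (r, j) * u i $ r * (\<sigma> i / (16 * ?S)))"
        using le_cost2[of "dim_row A"] by (intro sum.mono_neutral_cong_right) auto
      also have "\<dots> = (\<sigma> i * v i $ j) * (\<sigma> i / (16 * ?S))"
        unfolding sum_distrib_right[symmetric] svd_Atu[OF svd i j(1)] ..
      finally show ?thesis using j by (simp add: power2_eq_square)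
    next
      case False
      then have "co x r = 0" if "r < 2 ^ E" for r using co_0[of x r] that by auto
      moreover have "?I = 0" using False by (intro sum.neutral) auto
      ultimately show ?thesis by simp
    qed
    also have "(sin beta)\<^sup>2 * ?I + (cos beta)\<^sup>2 * ((\<sigma> i)\<^sup>2 / (16 * ?S) * ?I) = ?s\<^sup>2 * ?I"
      unfolding sb cb t2 s2 using Shat_pos by (simp add: field_simps add_divide_distrib)
    finally show ?thesis .
  qed
  have s1: "?s < 1" using s25 by linarith
  show "plane (enc A) (real (dim_col A)) (16 * 2 ^ D) (real tau * (16 * 2 ^ E)) (Shat A) beta xe D E
    (dim_col A) (\<lambda>j. v i $ j) ?s"
    by unfold_locales (fact sp s1 eig)+
qed

theorem encoded_sve:
  assumes svd: "is_svd A \<sigma> u v" and \<delta>: "0 < \<delta>" "\<delta> < sqrt (Shat A)"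
    and Dh: "Dh = sqrt (16 * Shat A + (\<delta> / 8)\<^sup>2)" and beta: "beta = acs (4 * sqrt (Shat A) / Dh)"
    and L: "L = lgc (16 * Dh / \<delta>)" and R: "R = (\<lambda>l. 144 * (K0 + (L - l)))" and K0: "2 \<le> K0"
    and k: "k = min (dim_row A) (dim_col A)"
  shows "\<exists>\<chi>. (\<forall>i<k. unit_state_on {x. \<bar>x - \<sigma> i\<bar> \<le> \<delta>} (\<chi> i)) \<and>
    (\<forall>\<beta>. (\<Sum>i<k. (cmod (\<beta> i))\<^sup>2) = 1 \<longrightarrow>
      within_sqdist (6 / 2 ^ K0) (aps (sveops R Wops Fops L K0 (\<delta> / 8) Dh) (sve_state k \<beta> v (\<lambda>_. ket 0))) (sve_state k \<beta> v \<chi>))"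
proof -
  define kq where "kq = \<delta> / 8"
  have kq: "0 < kq" using \<delta> by (simp add: kq_def)
  have "kq < sqrt (Shat A)" using \<delta> by (simp add: kq_def)
  then have kqS: "kq\<^sup>2 < Shat A" using power_strict_mono[of kq "sqrt (Shat A)" 2] kq Shat_pos by simp
  have Dh': "Dh = sqrt (16 * Shat A + kq\<^sup>2)" using Dh by (simp add: kq_def)
  define s where "s i = sqrt ((\<sigma> i)\<^sup>2 + kq\<^sup>2) / Dh" for i
  let ?w = "\<lambda>i j. v i $ j" and ?n = "dim_col A"
  let ?ops = "sveops R Wops Fops L K0 kq Dh"
  note P = walk_plane[OF svd _ kq kqS Dh' beta, folded k, folded s_def]
  interpret PS: planes "enc A" "real (dim_col A)" "16 * 2 ^ D" "real tau * (16 * 2 ^ E)" "Shat A" beta xe D E k ?n ?w s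
    by (intro planes.intro planes_axioms.intro walk_axioms) (use P(1) svd_vv[OF svd] in \<open>auto simp: k\<close>)
  have Dh0: "0 < Dh" using Shat_pos unfolding Dh by (intro real_sqrt_gt_zero add_pos_nonneg) auto
  \<comment> \<open>This is where 16 in the choice of \<open>L\<close> comes from:
    \<open>16 * Dh / \<delta>\<close> equals \<open>2 * Dh / kq\<close>.\<close>
  have L2: "2 * Dh \<le> 2 ^ L * kq"
    using lgc_ge[of "16 * Dh / \<delta>"] \<delta> by (simp add: L kq_def field_simps)
  have ex: "\<exists>\<chi> d b. aps ?ops (Xs ?n (?w i) (Ket (\<lambda>_. 0))) = Xs ?n (?w i) (outk \<chi>) + (Xs ?n (?w i) d + Ys ?n (?w i) (s i) b) \<and>
    unit_state_on {x. \<bar>x - \<sigma> i\<bar> \<le> \<delta>} \<chi> \<and> gz d \<and> gz b \<and> nsq d + nsq b \<le> 6 / 2 ^ K0" if i: "i < k" for i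
  proof -
    interpret PL: plane "enc A" "real (dim_col A)" "16 * 2 ^ D" "real tau * (16 * 2 ^ E)" "Shat A" beta xe D E ?n "?w i" "s i"
      by (rule P(1)[OF i])
    interpret AL: algo "enc A" "real (dim_col A)" "16 * 2 ^ D" "real tau * (16 * 2 ^ E)" "Shat A" beta xe D E ?n "?w i" "s i" R
      by unfold_locales (use K0 in \<open>simp add: R\<close>)
    have s25: "s i \<le> 2 / 5" by (rule P(2)[OF i])
    \<comment> \<open>s is at most 2/5, and 2/5 is below sin(1/2) by the cubic Taylor bound; so
      arcsin s is at most 1/2 and th at most 1.\<close>
    have th: "\<bar>PL.th\<bar> \<le> 1"
    proof -
      have "\<bar>1 / 2 - sin (1 / 2)\<bar> \<le> inverse (fact 3) * \<bar>1 / 2 :: real\<bar> ^ 3"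
        using Maclaurin_sin_bound[of "1 / 2" 3] by (simp add: numeral_3_eq_3 sin_coeff_def abs_minus_commute)
      then have "\<bar>1 / 2 - sin (1 / 2 :: real)\<bar> * 48 \<le> 1" by (simp add: fact_numeral power3_eq_cube)
      moreover have "\<bar>1 / 2 - y\<bar> * 48 \<le> 1 \<Longrightarrow> 2 / 5 \<le> y" for y :: real
        using abs_ge_self[of "1 / 2 - y"] by simp
      ultimately have "2 / 5 \<le> sin (1 / 2 :: real)" by blast
      then have "s i \<le> sin (1 / 2)" using s25 by linarith
      then have "arcsin (s i) \<le> arcsin (sin (1 / 2))" using PL.s by (intro arcsin_le_arcsin) auto
      also have "\<dots> = 1 / 2" using pi_ge_two by (intro arcsin_sin) auto
      finally have "arcsin (s i) \<le> 1 / 2" .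
      moreover have "0 \<le> arcsin (s i)" using PL.s by (intro arcsin_nonneg) auto
      ultimately show ?thesis by (simp add: PL.th_def)
    qed
    have q: "1 / 2 \<le> sqrt (1 - (s i)\<^sup>2)"
    proof (rule real_le_rsqrt)
      have "(s i)\<^sup>2 \<le> (2 / 5)\<^sup>2" using s25 PL.s by (intro power_mono) auto
      then show "(1 / 2)\<^sup>2 \<le> 1 - (s i)\<^sup>2" by (simp add: power2_eq_square)
    qed
    have sin0: "0 < sin PL.th" unfolding PL.sin_th using PL.s PL.sq_pos(1) by (intro mult_pos_pos) simp_all
    have "kq \<le> sqrt ((\<sigma> i)\<^sup>2 + kq\<^sup>2)" by (rule real_le_rsqrt) simp
    then have sk: "kq \<le> s i * Dh" using Dh0 by (simp add: s_def)
    \<comment> \<open>sin th is at least s, and s is at least kq / Dh thanks to the identity block,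
      also when the singular value is 0. The choice of \<open>L\<close> then makes 2^L s at least
      2.\<close>
    have sin1: "2 \<le> 2 ^ L * sin PL.th"
    proof -
      have "s i \<le> sin PL.th" unfolding PL.sin_th using mult_left_mono[OF q, of "2 * s i"] PL.s by simp
      then have "2 ^ L * s i \<le> 2 ^ L * sin PL.th" by simp
      moreover have "2 * Dh \<le> 2 ^ L * s i * Dh"
        using order_trans[OF L2 mult_left_mono[OF sk, of "2 ^ L"]] by (simp add: mult.assoc)
      then have "2 \<le> 2 ^ L * s i" using Dh0 by simp
      ultimately show ?thesis by linarith
    qed
    have K: "3 / 2 ^ K0 < (1 :: real)"
    proof -
      have "(2::real) ^ 2 \<le> 2 ^ K0" using K0 by (intro power_increasing) auto
      then show ?thesis by simp
    qed
    have D': "Dh * s i = sqrt ((\<sigma> i)\<^sup>2 + kq\<^sup>2)" using Dh0 by (simp add: s_def)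
    have sg: "0 \<le> \<sigma> i" using svd_sigma[OF svd] i by (simp add: k)
    have k8: "8 * kq = \<delta>" by (simp add: kq_def)
    show ?thesis
      by (rule AL.algo_out[OF R th kq Dh0 L2 sin0 sin1 sg D' K, unfolded k8]) (intro exI conjI, assumption+)
  qed
  \<comment> \<open>The ideal outputs and the errors are chosen for all singular vectors at once,
    before any amplitudes of the input appear: the outputs must not depend on them.\<close>
  obtain \<chi> where "\<forall>i. i < k \<longrightarrow> (\<exists>d b. aps ?ops (Xs ?n (?w i) (Ket (\<lambda>_. 0))) = Xs ?n (?w i) (outk (\<chi> i)) + (Xs ?n (?w i) d + Ys ?n (?w i) (s i) b) \<and>
    unit_state_on {x. \<bar>x - \<sigma> i\<bar> \<le> \<delta>} (\<chi> i) \<and> gz d \<and> gz b \<and> nsq d + nsq b \<le> 6 / 2 ^ K0)"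
    using choice[of "\<lambda>i \<chi>. i < k \<longrightarrow> (\<exists>d b. aps ?ops (Xs ?n (?w i) (Ket (\<lambda>_. 0))) = Xs ?n (?w i) (outk \<chi>) + (Xs ?n (?w i) d + Ys ?n (?w i) (s i) b) \<and>
    unit_state_on {x. \<bar>x - \<sigma> i\<bar> \<le> \<delta>} \<chi> \<and> gz d \<and> gz b \<and> nsq d + nsq b \<le> 6 / 2 ^ K0)"] ex by blast
  then obtain d where "\<forall>i. i < k \<longrightarrow> (\<exists>b. aps ?ops (Xs ?n (?w i) (Ket (\<lambda>_. 0))) = Xs ?n (?w i) (outk (\<chi> i)) + (Xs ?n (?w i) (d i) + Ys ?n (?w i) (s i) b) \<and>
    unit_state_on {x. \<bar>x - \<sigma> i\<bar> \<le> \<delta>} (\<chi> i) \<and> gz (d i) \<and> gz b \<and> nsq (d i) + nsq b \<le> 6 / 2 ^ K0)"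
    using choice[of "\<lambda>i d. i < k \<longrightarrow> (\<exists>b. aps ?ops (Xs ?n (?w i) (Ket (\<lambda>_. 0))) = Xs ?n (?w i) (outk (\<chi> i)) + (Xs ?n (?w i) d + Ys ?n (?w i) (s i) b) \<and>
    unit_state_on {x. \<bar>x - \<sigma> i\<bar> \<le> \<delta>} (\<chi> i) \<and> gz d \<and> gz b \<and> nsq d + nsq b \<le> 6 / 2 ^ K0)"] by blast
  then obtain b where *: "\<And>i. i < k \<Longrightarrow> aps ?ops (Xs ?n (?w i) (Ket (\<lambda>_. 0))) = Xs ?n (?w i) (outk (\<chi> i)) + (Xs ?n (?w i) (d i) + Ys ?n (?w i) (s i) (b i)) \<and>
    unit_state_on {x. \<bar>x - \<sigma> i\<bar> \<le> \<delta>} (\<chi> i) \<and> gz (d i) \<and> gz (b i) \<and> nsq (d i) + nsq (b i) \<le> 6 / 2 ^ K0"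
    using choice[of "\<lambda>i b. i < k \<longrightarrow> aps ?ops (Xs ?n (?w i) (Ket (\<lambda>_. 0))) = Xs ?n (?w i) (outk (\<chi> i)) + (Xs ?n (?w i) (d i) + Ys ?n (?w i) (s i) b) \<and>
    unit_state_on {x. \<bar>x - \<sigma> i\<bar> \<le> \<delta>} (\<chi> i) \<and> gz (d i) \<and> gz b \<and> nsq (d i) + nsq b \<le> 6 / 2 ^ K0"] by blast
  have st: "sve_state k \<beta> v \<xi> = (\<Sum>i<k. \<beta> i *q Xs ?n (?w i) (outk (\<xi> i)))" for \<beta> \<xi>
  proof -
    have "Xs ?n (?w i) (outk (\<xi> i)) = product_state (v i) (\<xi> i)" if "i < k" for i
      using Xs_outk[of "v i" "\<xi> i"] svd_dim[OF svd, of i] that by (simp add: k)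
    then show ?thesis by (intro ext) (simp add: sve_state_def sum_fun_apply')
  qed
  have o0: "outk (ket 0) = Ket (\<lambda>_. 0)"
  proof
    fix c :: config
    have z: "(\<lambda>_. 0)(1 := 0) = (\<lambda>_ :: nat. 0 :: real)" by (rule ext) simp
    show "outk (ket 0) c = Ket (\<lambda>_. 0) c"
    proof (cases "c = (\<lambda>_. 0)")
      case True
      show ?thesis unfolding True outk_def ket_def Ket_def z by simp
    next
      case False
      then have "c 1 \<noteq> 0" if "c = (\<lambda>_. 0)(1 := c 1)" using that z by metis
      then show ?thesis using False by (simp add: outk_def ket_def Ket_def)
    qed
  qed
  have "within_sqdist (6 / 2 ^ K0) (aps ?ops (sve_state k \<beta> v (\<lambda>_. ket 0))) (sve_state k \<beta> v \<chi>)"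
    if \<beta>: "(\<Sum>i<k. (cmod (\<beta> i))\<^sup>2) = 1" for \<beta>
  proof -
    let ?e = "\<Sum>i<k. \<beta> i *q (Xs ?n (?w i) (d i) + Ys ?n (?w i) (s i) (b i))"
    have "aps ?ops (sve_state k \<beta> v (\<lambda>_. ket 0)) = (\<Sum>i<k. \<beta> i *q aps ?ops (Xs ?n (?w i) (Ket (\<lambda>_. 0))))"
      unfolding st o0 by (simp only: aps_sum aps_smul)
    also have "\<dots> = (\<Sum>i<k. \<beta> i *q Xs ?n (?w i) (outk (\<chi> i)) + \<beta> i *q (Xs ?n (?w i) (d i) + Ys ?n (?w i) (s i) (b i)))"
      by (intro sum.cong refl) (simp only: * lessThan_iff smul_add)
    also have "\<dots> = sve_state k \<beta> v \<chi> + ?e" unfolding st sum.distrib ..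
    finally have d: "aps ?ops (sve_state k \<beta> v (\<lambda>_. ket 0)) = sve_state k \<beta> v \<chi> + ?e" .
    have fe: "fin ?e" using * by (intro fin_sum fin_smul fin_add fin_Xs plane.fin_Y[OF P(1)]) auto
    have "nsq ?e = (\<Sum>i<k. (cmod (\<beta> i))\<^sup>2 * (nsq (d i) + nsq (b i)))"
      using * by (intro PS.nsq_planes) auto
    also have "\<dots> \<le> (\<Sum>i<k. (cmod (\<beta> i))\<^sup>2 * (6 / 2 ^ K0))"
      using * by (intro sum_mono mult_left_mono) auto
    also have "\<dots> = 6 / 2 ^ K0" unfolding sum_distrib_right[symmetric] \<beta> by simp
    finally have ne: "nsq ?e \<le> 6 / 2 ^ K0" .
    have s: "{c. (sve_state k \<beta> v \<chi> + ?e) c \<noteq> sve_state k \<beta> v \<chi> c} = {c. ?e c \<noteq> 0}" by simp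
    have m: "(sve_state k \<beta> v \<chi> + ?e) c - sve_state k \<beta> v \<chi> c = ?e c" for c by simp
    show ?thesis
      unfolding within_sqdist_def d s m using fe ne unfolding fin_def nsq_def by blast
  qed
  then show ?thesis using * unfolding kq_def by blast
qed

end

section \<open>The estimation program\<close>

definition constP :: "real \<Rightarrow> com" where
  "constP x = Gs (Cj [gA (Const x) 11 19 19] [gR 6 11])"

definition mvP :: com where
  "mvP = Gs (Cj [] [QAdd Add 140 106 119, QSub Add 106 140 119])"

definition testP :: "real \<Rightarrow> com" where
  "testP xe = Seq (constP (pi / 4)) (Seq (Ar [(Add, 43, 45, 93)])
     (Seq (For 43 (Seq (cWalk xe) (Gs (Cj [gA Mul 11 6 9, gS Add 12 11 19] [gP 12]))))
     (Seq (Gs (Cj [gA (Const (pi / 2)) 11 19 19, gA Mul 12 11 6] [gP 12])) (Seq (constP (- (pi / 4))) mvP))))"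

text \<open>Register 45 holds 2^l, register 46 the number of tests at level l, and register 140 the
  current outcome cell. Going to the next level doubles the first and subtracts 144 from the second.
  The parameter allows the same code to undo the updates.\<close>

definition updP :: "real \<Rightarrow> com" where
  "updP sg = Seq (Ar [(Const 1, 82, 0, 0), (Const (2 * sg), 83, 0, 0), (Mul, 84, 45, 46), (Div, 50, 83, 84), (Sub, 51, 93, 50),
       (Const sg, 83, 0, 0), (Div, 52, 83, 45), (Sub, 53, 93, 52), (Add, 42, 46, 93)])
     (Seq (For 42 (Seq (Gs (Cj [gH 11 50, QAdd Mul 112 111 140] [gA Add 9 12 19])) (Ar [(Add, 140, 140, 82)])))
     (Seq (Gs (Cj [] [gH 9 53])) (Ar [(Add, 45, 45, 45), (Const 144, 85, 0, 0), (Sub, 46, 46, 85)])))"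

definition levelP :: "real \<Rightarrow> com" where
  "levelP xe = Seq (Ar [(Const 1, 82, 0, 0), (Add, 42, 46, 93)])
     (Seq (For 42 (Seq (testP xe) (Ar [(Add, 140, 140, 82)]))) (Seq (Ar [(Sub, 140, 140, 46)]) (updP 1)))"

definition startP :: com where
  "startP = Ar [(Const 1, 45, 0, 0), (Const 40, 140, 0, 0), (Const 144, 85, 0, 0), (Add, 46, 22, 20), (Mul, 46, 46, 85), (Add, 41, 20, 93)]"

definition estP :: "real \<Rightarrow> com" where
  "estP xe = Seq startP (For 41 (levelP xe))"

definition unwP :: com where
  "unwP = Seq startP (For 41 (updP (- 1)))"

definition passP :: "real \<Rightarrow> com" where
  "passP xe = Seq (Ar [(Const 1, 45, 0, 0), (Add, 44, 20, 93)])
     (For 44 (Seq (Seq flagZ (Seq (Ar [(Add, 43, 45, 93)]) (Seq (For 43 (cWalk xe)) mvP)))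
       (Ar [(Const 1, 82, 0, 0), (Add, 140, 140, 82), (Add, 45, 45, 45)])))"

definition driveP :: "real \<Rightarrow> com" where
  "driveP xe = Seq (Ar [(Add, 41, 22, 93)]) (Seq (For 41 (passP xe)) (Ar [(Const 40, 82, 0, 0), (Sub, 48, 140, 82)]))"

text \<open>The absolute value is obtained as the square root of the square.\<close>

definition y_gates :: "gate list" where
  "y_gates = [gA (Const (1/2)) 11 19 19, gA Mul 12 9 11, gA Sin 13 12 12, gH 14 36, gA Mul 15 14 13, gA Mul 16 15 15,
     gA (Const (1/2)) 17 19 19, gA Pow 18 16 17, gH 20 80]"

definition packAP :: com where
  "packAP = Seq (Ar [(Const 0, 80, 0, 0), (Add, 41, 21, 93)])
     (For 41 (Seq (Ar [(Add, 80, 80, 34), (Sub, 81, 93, 80)]) (Gs (Cj y_gates [gA Leq 10 20 18]))))"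

definition packCP :: com where
  "packCP = Seq (Gs (Cj [gH 11 34, gA Mul 12 11 10] [gA Add 1 12 19]))
     (Seq (Ar [(Const (1/2), 82, 0, 0), (Mul, 58, 34, 82), (Sub, 59, 93, 58), (Const 40, 140, 0, 0), (Add, 41, 48, 93)])
     (For 41 (Seq (Gs (Cj [gH 11 58, QAdd Mul 112 111 140] [gA Add 1 12 19]))
       (Ar [(Const 1, 83, 0, 0), (Add, 140, 140, 83), (Const (1/2), 82, 0, 0), (Mul, 58, 58, 82), (Sub, 59, 93, 58)]))))"

definition packDP :: com where
  "packDP = Seq (Gs (Cj [] [gA Add 8 1 19])) (Seq (Ar [(Add, 41, 48, 93)])
     (For 41 (Seq (Ar [(Add, 58, 58, 58), (Sub, 59, 93, 58), (Const 1, 83, 0, 0), (Sub, 140, 140, 83)])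
       (Seq (Gs (Cj [gH 11 58, QAdd Mul 112 111 140] [gS Add 8 12 19])) (Gs (Cj [gH 11 58, gA Sub 12 1 8] [QSub Leq 140 111 112]))))))"

definition packEP :: com where
  "packEP = Seq (Gs (Cj [gH 11 34, gA Mul 12 11 10] [gS Add 8 12 19])) (Seq (Ar [(Const 0, 80, 0, 0), (Add, 41, 21, 93)])
     (For 41 (Seq (Ar [(Add, 80, 80, 34), (Sub, 81, 93, 80)]) (Gs (Cj [gH 20 80] [gS Leq 10 20 1])))))"

definition coreP :: "real \<Rightarrow> com" where
  "coreP xe = Seq (estP xe) (Seq (driveP xe) (Seq packAP (Seq unwP (Seq packCP (Seq packDP packEP)))))"

lemma blk_const:
  assumes "cs_ok R" "\<bar>x\<bar> \<le> 2 * pi"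
  shows "blk R M [gA (Const x) 11 19 19] [gR 6 11] [Ro 6 (\<lambda>_. x)]"
  by (rule blkI, simp add: g_defs, simp add: g_defs blk_simps assms, (simp add: g_defs cs_ok_addr assms; (intro conjI all_cln)?; simp add: angle_id assms))

lemma blk_mv:
  assumes "cs_ok R" "R 140 = real (40 + t)"
  shows "blk R M [] [QAdd Add 140 106 119, QSub Add 106 140 119] (mv (40 + t))"
proof -
  have a: "addr (R 140) = 40 + t" by (rule addr_eq[OF assms(2)])
  show ?thesis
  proof (rule blkI, goal_cases)
    case 1
    show ?case by simp
  next
    case 2
    show ?case by simp
  next
    case 3
    show ?case unfolding mv_def by (simp add: cs_ok_addr a assms(1); (intro conjI all_cln)?; simp)
  qed
qed

lemma blk_mid:
  assumes "cs_ok R"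
  shows "blk R M [gA Mul 11 6 9, gS Add 12 11 19] [gP 12] [Ph (\<lambda>c. angle (- (c 6 * c 9)))]"
  by (rule blkI, simp add: g_defs, simp add: g_defs blk_simps assms, (simp add: g_defs cs_ok_addr assms; (intro conjI all_cln)?; simp))

lemma blk_half_pi:
  assumes "cs_ok R"
  shows "blk R M [gA (Const (pi / 2)) 11 19 19, gA Mul 12 11 6] [gP 12] [Ph (\<lambda>c. angle (pi / 2 * c 6))]"
  by (rule blkI, simp add: g_defs, simp add: g_defs blk_simps assms, (simp add: g_defs cs_ok_addr assms; (intro conjI all_cln)?; simp))

lemma blk_addmul:
  assumes "cs_ok R" "R 140 = real (40 + t)" "R r = x" "R (Suc r) = - x" "k \<in> {1, 8, 9}"
  shows "blk R M [gH 11 r, QAdd Mul 112 111 140] [gA Add k 12 19] [Tr k (\<lambda>c. x * c (40 + t))]"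
    "blk R M [gH 11 r, QAdd Mul 112 111 140] [gS Add k 12 19] [Tr k (\<lambda>c. - (x * c (40 + t)))]"
proof -
  have a: "addr (R 140) = 40 + t" by (rule addr_eq[OF assms(2)])
  have k: "100 + k < 140" "k < 11" "k \<noteq> 40 + t" using assms(5) by auto
  note r = a assms(1,3,4) k
  have ak: "addr (R (100 + k)) = k" using cs_ok_addr[OF assms(1), of "100 + k"] k by simp
  show "blk R M [gH 11 r, QAdd Mul 112 111 140] [gA Add k 12 19] [Tr k (\<lambda>c. x * c (40 + t))]"
  proof (rule blkI, goal_cases)
    case 1
    show ?case by (simp add: g_defs r)
  next
    case 2
    show ?case using assms(5) by (auto simp add: g_defs blk_simps r ak)
  next
    case 3
    show ?case using assms(5) by (auto simp add: g_defs cs_ok_addr r ak clnD)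
  qed
  show "blk R M [gH 11 r, QAdd Mul 112 111 140] [gS Add k 12 19] [Tr k (\<lambda>c. - (x * c (40 + t)))]"
  proof (rule blkI, goal_cases)
    case 1
    show ?case by (simp add: g_defs r)
  next
    case 2
    show ?case using assms(5) by (auto simp add: g_defs blk_simps r ak)
  next
    case 3
    show ?case using assms(5) by (auto simp add: g_defs cs_ok_addr r ak clnD)
  qed
qed

lemma blk_shift:
  assumes "cs_ok R" "R r = x"
  shows "blk R M [] [gH 9 r] [Tr 9 (\<lambda>_. x)]"
  by (rule blkI, simp, simp, simp add: g_defs cs_ok_addr assms)

lemma blk_A:
  assumes "cs_ok R" "R 36 = Dh" "R 37 = - Dh" "R 80 = x" "R 81 = - x"
  shows "blk R M y_gates [gA Leq 10 20 18] [Tr 10 (\<lambda>c. leqr x (yf Dh (c 9)))]"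
proof -
  have p: "powp (t * t) (1 / 2) = \<bar>t\<bar>" for t
    by (cases "t = 0") (auto simp: powp_def powr_half_sqrt zero_less_mult_iff)
  show ?thesis
    by (rule blkI, simp add: y_gates_def g_defs assms, simp add: y_gates_def g_defs blk_simps assms, (simp add: y_gates_def g_defs cs_ok_addr assms; (intro conjI all_cln)?; simp add: yf_def p))
qed

lemma blk_C:
  assumes "cs_ok R" "R 34 = x" "R 35 = - x"
  shows "blk R M [gH 11 34, gA Mul 12 11 10] [gA Add 1 12 19] [Tr 1 (\<lambda>c. x * c 10)]"
    "blk R M [gH 11 34, gA Mul 12 11 10] [gS Add 8 12 19] [Tr 8 (\<lambda>c. - (x * c 10))]"
proof -
  show "blk R M [gH 11 34, gA Mul 12 11 10] [gA Add 1 12 19] [Tr 1 (\<lambda>c. x * c 10)]"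
    by (rule blkI, simp add: g_defs assms, simp add: g_defs blk_simps assms, (simp add: g_defs cs_ok_addr assms; (intro conjI all_cln)?; simp))
  show "blk R M [gH 11 34, gA Mul 12 11 10] [gS Add 8 12 19] [Tr 8 (\<lambda>c. - (x * c 10))]"
    by (rule blkI, simp add: g_defs assms, simp add: g_defs blk_simps assms, (simp add: g_defs cs_ok_addr assms; (intro conjI all_cln)?; simp))
qed

lemma blk_copy:
  assumes "cs_ok R"
  shows "blk R M [] [gA Add 8 1 19] [Tr 8 (\<lambda>c. c 1)]"
  by (rule blkI, simp, simp, (simp add: g_defs cs_ok_addr assms; (intro conjI all_cln)?; simp))

lemma blk_bit:
  assumes "cs_ok R" "R 140 = real (40 + t)" "R 58 = x" "R 59 = - x"
  shows "blk R M [gH 11 58, gA Sub 12 1 8] [QSub Leq 140 111 112] [Tr (40 + t) (\<lambda>c. - leqr x (c 1 - c 8))]"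
proof -
  have a: "addr (R 140) = 40 + t" by (rule addr_eq[OF assms(2)])
  show ?thesis
    by (rule blkI, simp add: g_defs assms(1,3,4), simp add: g_defs blk_simps a assms(1,3,4), (simp add: g_defs cs_ok_addr a assms(1,3,4); (intro conjI all_cln)?; simp))
qed

lemma blk_E:
  assumes "cs_ok R" "R 80 = x" "R 81 = - x"
  shows "blk R M [gH 20 80] [gS Leq 10 20 1] [Tr 10 (\<lambda>c. - leqr x (c 1))]"
  by (rule blkI, simp add: g_defs assms, simp add: g_defs blk_simps assms, (simp add: g_defs cs_ok_addr assms; (intro conjI all_cln)?; simp))

section \<open>Correctness and running time of the estimation program\<close>

locale prog = walk +
  fixes L K0 :: nat and kq Dh :: real
  assumes K0: "0 < K0"
begin

definition Rf :: "nat \<Rightarrow> nat" where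
  "Rf l = 144 * (K0 + (L - l))"

lemma Rf_pos: "0 < Rf l"
  using K0 by (simp add: Rf_def)

sublocale sched Rf
  by unfold_locales (rule Rf_pos)

definition AG :: "regs \<Rightarrow> bool" where
  "AG R \<longleftrightarrow> R 20 = real L \<and> R 21 = 2 ^ L \<and> R 22 = real K0 \<and> R 34 = kq \<and> R 35 = - kq \<and> R 36 = Dh \<and> R 37 = - Dh"

definition ascr :: "nat set" where
  "ascr = {33, 60, 61, 62, 63, 64, 65, 66, 67, 90, 95, 41, 42, 43, 44, 45, 46, 48, 50, 51, 52, 53, 58, 59, 80, 81, 82, 83, 84, 85, 140}"

lemma WE_upd: "r \<in> ascr \<Longrightarrow> WE (R(r := v)) = WE R"
proof -
  assume r: "r \<in> ascr"
  have ne: "r \<notin> {10, 11, 12, 13, 68, 69, 70, 71, 72, 73, 74, 75, 76, 77, 78, 93, 94, 96}" "r < 100 \<or> r = 140"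
    using r unfolding ascr_def by (elim insertE emptyE; simp)+
  have "100 + k \<noteq> r" if "k < 40" for k using ne(2) that by auto
  then have "cs_ok (R(r := v)) = cs_ok R" by (simp add: cs_ok_def)
  then show ?thesis using ne(1) by (simp add: WE_def)
qed

lemma AG_upd: "r \<in> ascr \<Longrightarrow> AG (R(r := v)) = AG R"
proof -
  assume r: "r \<in> ascr"
  then have "r \<notin> {20, 21, 22, 34, 35, 36, 37}" unfolding ascr_def by (elim insertE emptyE; simp)
  then show ?thesis by (simp add: AG_def)
qed

definition S :: "(regs \<Rightarrow> bool) \<Rightarrow> regs \<Rightarrow> memory \<Rightarrow> bool" where
  "S F = (\<lambda>R M. WE R \<and> M = M0 \<and> AG R \<and> F R)"

lemma S_pre: "tr (S F') P T xs Post \<Longrightarrow> (\<And>R. F R \<Longrightarrow> F' R) \<Longrightarrow> tr (S F) P T xs Post"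
  by (erule tr_pre) (simp add: S_def)

lemma S_post: "tr Pre P T xs (S F') \<Longrightarrow> (\<And>R. F' R \<Longrightarrow> F R) \<Longrightarrow> tr Pre P T xs (S F)"
  by (erule tr_post) (simp add: S_def)

lemma S_blk:
  assumes "\<And>R. WE R \<Longrightarrow> AG R \<Longrightarrow> F R \<Longrightarrow> blk R M0 cs gs ys" "\<And>p. p \<in> set ys \<Longrightarrow> tgt p \<inter> {11..<40} = {}"
  shows "tr (S F) (Gs (Cj cs gs)) (2 * real (length cs) + real (length gs)) ys (S F)"
  by (rule tr_Cj) (use assms in \<open>auto simp: S_def intro!: pcl_ops\<close>)

lemma keep_Ar: "(\<And>f r a b. (f, r, a, b) \<in> set is \<Longrightarrow> r \<in> ascr) \<Longrightarrow> WE (fold astep is R) = WE R \<and> AG (fold astep is R) = AG R"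
proof (induction "is" arbitrary: R)
  case (Cons i "is")
  obtain f r a b where i: "i = (f, r, a, b)" by (cases i)
  then have r: "r \<in> ascr" using Cons.prems by auto
  have "WE (fold astep is (astep i R)) = WE (astep i R) \<and> AG (fold astep is (astep i R)) = AG (astep i R)"
    by (rule Cons.IH, rule Cons.prems, rule list.set_intros(2))
  then show ?case by (simp only: fold_simps i astep.simps WE_upd[OF r] AG_upd[OF r])
qed simp

lemma S_ar:
  assumes "\<And>R. R 93 = 0 \<Longrightarrow> AG R \<Longrightarrow> F R \<Longrightarrow> F' (fold astep is R)" "\<forall>i\<in>set is. fst (snd i) \<in> ascr"
  shows "tr (S F) (Ar is) (real (length is)) [] (S F')"
proof (rule tr_ArI)
  fix R M assume *: "S F R M"
  have "r \<in> ascr" if "(f, r, a, b) \<in> set is" for f r a b using assms(2) that by force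
  then have "WE (fold astep is R) = WE R \<and> AG (fold astep is R) = AG R" by (rule keep_Ar)
  moreover have "R 93 = 0" using * by (simp add: S_def WE_def)
  ultimately show "S F' (fold astep is R) M" using * assms(1)[of R] by (simp add: S_def)
qed simp

lemma S_walk: "fr wscr F \<Longrightarrow> tr (S F) (cWalk xe) (200 + 76 * (real D + real E)) Wops (S F)"
proof -
  assume F: "fr wscr F"
  have "fr wscr (\<lambda>R. AG R \<and> F R)" using F AG_upd unfolding fr_def by (simp add: wscr_def ascr_def)
  from tr_cWalk[OF this] show ?thesis unfolding S_def .
qed

lemma S_flag: "tr (S F) flagZ 13 Fops (S F)"
  using tr_flagZ[of "\<lambda>R. AG R \<and> F R"] unfolding S_def .

lemma S_for:
  assumes "\<And>k. k < j \<Longrightarrow> tr (S (\<lambda>R. I k R \<and> R r = real (j - k))) P (T k) (xs k) (S (\<lambda>R. I (Suc k) R \<and> R r = real (j - k)))"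
    "\<And>k R v w. I k (R(90 := v, r := w)) = I k R" "r \<in> {41, 42, 43, 44}"
  shows "tr (S (\<lambda>R. I 0 R \<and> R r = real j)) (For r P) ((\<Sum>k<j. T k + 3) + 1) (rep j xs) (S (\<lambda>R. I j R \<and> R r = 0))"
proof -
  have "tr (\<lambda>R M. S (I 0) R M \<and> R r = real j) (For r P) ((\<Sum>k<j. T k + 3) + 1) (concat (map xs [0..<j])) (\<lambda>R M. S (I j) R M \<and> R r = 0)"
  proof (rule tr_for)
    fix k assume "k < j"
    from assms(1)[OF this] show "tr (\<lambda>R M. S (I k) R M \<and> R r = real (j - k)) P (T k) (xs k) (\<lambda>R M. S (I (Suc k)) R M \<and> R r = real (j - k))"
      by (rule tr_conseq) (auto simp: S_def)
  next
    fix k R M v w assume "S (I k) R M"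
    then show "S (I k) (R(90 := v, r := w)) M"
      using assms(3) unfolding S_def assms(2) by (auto simp: WE_upd AG_upd ascr_def)
  qed (use assms(3) in auto)
  then show ?thesis unfolding rep_def by (rule tr_conseq) (auto simp: S_def)
qed

lemma WE_cs: "WE R \<Longrightarrow> cs_ok R"
  by (simp add: WE_def)

text \<open>Exceeds the cost of one walk step by 50. This margin, multiplied by 2^l, absorbs the
  fixed overhead of a test or of a driving step.\<close>

definition tm :: real where
  "tm = 250 + 76 * (real D + real E)"

lemma tm_ge: "250 \<le> tm"
  by (simp add: tm_def)

lemma pi_le: "\<bar>pi / 4\<bar> \<le> 2 * pi" "\<bar>- (pi / 4)\<bar> \<le> 2 * pi"
  using pi_gt_zero by simp_all

lemma mv_tgt: "p \<in> set (mv (40 + t)) \<Longrightarrow> tgt p \<inter> {11..<40} = {}"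
  by (auto simp: mv_def)

lemma tr_test:
  assumes G: "fr (insert 43 wscr) G" and lt: "\<And>R. G R \<Longrightarrow> R 45 = 2 ^ l \<and> R 140 = real (40 + t)"
  shows "tr (S G) (testP xe) (2 ^ l * tm) (testops Wops l (40 + t)) (S G)"
proof -
  have G': "fr wscr G" "G (R(43 := v)) = G R" "G (R(90 := v)) = G R" for R v
    using G by (auto simp: fr_def wscr_def)
  have a: "tr (S G) (constP (pi / 4)) (2 * real 1 + real 1) [Ro 6 (\<lambda>_. pi / 4)] (S G)"
    unfolding constP_def by (rule tr_time[OF S_blk]) (auto intro!: blk_const[OF WE_cs pi_le(1)])
  have b: "tr (S G) (Ar [(Add, 43, 45, 93)]) (real (length [(Add, 43::nat, 45::nat, 93::nat)])) [] (S (\<lambda>R. G R \<and> R 43 = real (2 ^ l)))"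
    by (rule S_ar) (use lt in \<open>auto simp: G' ascr_def\<close>)
  have c: "tr (S (\<lambda>R. G R \<and> R 43 = real (2 ^ l))) (For 43 (Seq (cWalk xe) (Gs (Cj [gA Mul 11 6 9, gS Add 12 11 19] [gP 12]))))
     ((\<Sum>k<(2::nat) ^ l. (200 + 76 * (real D + real E)) + (2 * real 2 + real 1) + 3) + 1)
     (rep (2 ^ l) (\<lambda>_. Wops @ [Ph (\<lambda>c. angle (- (c 6 * c 9)))])) (S (\<lambda>R. G R \<and> R 43 = 0))"
  proof (rule S_for, goal_cases)
    case (1 k)
    have f: "fr wscr (\<lambda>R. G R \<and> R 43 = real (2 ^ l - k))" by (intro fr_conj G' fr_eq) (simp add: wscr_def)
    have m: "tr (S F) (Gs (Cj [gA Mul 11 6 9, gS Add 12 11 19] [gP 12])) (2 * real 2 + real 1) [Ph (\<lambda>c. angle (- (c 6 * c 9)))] (S F)" for F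
      by (rule tr_time[OF S_blk]) (auto intro!: blk_mid[OF WE_cs])
    show ?case
      by (rule tr_seq[OF S_walk[OF f] m])
  qed (simp_all only: G' insertI1 insert_iff simp_thms)
  have d: "tr (S F) (Gs (Cj [gA (Const (pi / 2)) 11 19 19, gA Mul 12 11 6] [gP 12])) (2 * real 2 + real 1) [Ph (\<lambda>c. angle (pi / 2 * c 6))] (S F)" for F
    by (rule tr_time[OF S_blk], rule blk_half_pi[OF WE_cs]) auto
  have e: "tr (S F) (constP (- (pi / 4))) (2 * real 1 + real 1) [Ro 6 (\<lambda>_. - (pi / 4))] (S F)" for F
    unfolding constP_def by (rule tr_time[OF S_blk]) (auto intro!: blk_const[OF WE_cs pi_le(2)])
  have f: "tr (S (\<lambda>R. G R \<and> R 43 = 0)) mvP (2 * real 0 + real 2) (mv (40 + t)) (S (\<lambda>R. G R \<and> R 43 = 0))"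
    unfolding mvP_def by (rule tr_time[OF S_blk], rule blk_mv[OF WE_cs]) (use lt mv_tgt in simp_all)
  have T: "3 + (1 + ((2 ^ l * (208 + 76 * (real D + real E)) + 1) + (5 + (3 + 2)))) \<le> 2 ^ l * tm"
  proof -
    have "1 \<le> (2::real) ^ l" by simp
    then have "15 \<le> (2::real) ^ l * 42" by linarith
    moreover have "2 ^ l * tm = 2 ^ l * (208 + 76 * (real D + real E)) + 2 ^ l * 42" by (simp add: tm_def algebra_simps)
    ultimately show ?thesis by linarith
  qed
  show ?thesis unfolding testP_def
    by (rule tr_conseq[OF tr_seq[OF a tr_seq[OF b tr_seq[OF c tr_seq[OF d tr_seq[OF e f]]]]]])
      (use T in \<open>auto simp: S_def testops_def algebra_simps simp del: aps_simps(2)\<close>)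
qed

definition LV :: "nat \<Rightarrow> regs \<Rightarrow> bool" where
  "LV l R \<longleftrightarrow> R 45 = 2 ^ l \<and> R 46 = real (Rf l) \<and> R 140 = real (40 + offs l)"

lemma Rf_Suc: "l < L \<Longrightarrow> real (Rf l) - 144 = real (Rf (Suc l))"
proof -
  assume "l < L"
  then have "Rf l = Rf (Suc l) + 144" by (simp add: Rf_def)
  then have "real (Rf l) = real (Rf (Suc l)) + 144" by (metis of_nat_add of_nat_numeral)
  then show ?thesis by linarith
qed

lemma tr_updP:
  assumes l: "l < L" and sg: "sg = 1 \<or> sg = - 1"
  shows "tr (S (\<lambda>R. LV l R \<and> R 41 = x \<and> Pd (R 48))) (updP sg) (25 * real (Rf l)) (updops sg l) (S (\<lambda>R. LV (Suc l) R \<and> R 41 = x \<and> Pd (R 48)))"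
proof -
  let ?r = "real (Rf l)"
  define I where "I i R \<longleftrightarrow> R 45 = 2 ^ l \<and> R 46 = ?r \<and> R 140 = real (40 + (offs l + i)) \<and> R 41 = x \<and> Pd (R 48) \<and> R 82 = 1 \<and>
     R 50 = sg * wt l \<and> R 51 = - (sg * wt l) \<and> R 53 = - (sg / 2 ^ l)" for i :: nat and R :: regs
  have a: "tr (S (\<lambda>R. LV l R \<and> R 41 = x \<and> Pd (R 48))) (Ar [(Const 1, 82, 0, 0), (Const (2 * sg), 83, 0, 0), (Mul, 84, 45, 46), (Div, 50, 83, 84),
       (Sub, 51, 93, 50), (Const sg, 83, 0, 0), (Div, 52, 83, 45), (Sub, 53, 93, 52), (Add, 42, 46, 93)]) (real 9) []
     (S (\<lambda>R. I 0 R \<and> R 42 = real (Rf l)))"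
    by (rule tr_time[OF S_ar]) (auto simp: LV_def I_def wt_def ascr_def)
  have b: "tr (S (\<lambda>R. I 0 R \<and> R 42 = real (Rf l))) (For 42 (Seq (Gs (Cj [gH 11 50, QAdd Mul 112 111 140] [gA Add 9 12 19])) (Ar [(Add, 140, 140, 82)])))
     ((\<Sum>k<Rf l. ((2 * real 2 + real 1) + real 1) + 3) + 1) (rep (Rf l) (\<lambda>i. [Tr 9 (\<lambda>c. sg * wt l * c (40 + (offs l + i)))] @ []))
     (S (\<lambda>R. I (Rf l) R \<and> R 42 = 0))"
  proof (rule S_for, goal_cases)
    case (1 k)
    note k = 1
    let ?F = "\<lambda>R. I k R \<and> R 42 = real (Rf l - k)"
    have 1: "tr (S ?F) (Gs (Cj [gH 11 50, QAdd Mul 112 111 140] [gA Add 9 12 19])) (2 * real 2 + real 1) [Tr 9 (\<lambda>c. sg * wt l * c (40 + (offs l + k)))] (S ?F)"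
      by (rule tr_time[OF S_blk], rule blk_addmul(1)[OF WE_cs]) (auto simp: I_def)
    have 2: "tr (S ?F) (Ar [(Add, 140, 140, 82)]) (real 1) [] (S (\<lambda>R. I (Suc k) R \<and> R 42 = real (Rf l - k)))"
      by (rule tr_time[OF S_ar]) (auto simp: I_def ascr_def)
    show ?case
      by (rule tr_seq[OF 1 2])
  qed (simp_all add: I_def)
  let ?H = "\<lambda>R. I (Rf l) R \<and> R 42 = 0"
  have c: "tr (S ?H) (Gs (Cj [] [gH 9 53])) (2 * real 0 + real 1) [Tr 9 (\<lambda>_. - (sg / 2 ^ l))] (S ?H)"
    by (rule tr_time[OF S_blk], rule blk_shift[OF WE_cs]) (auto simp: I_def)
  have d: "tr (S ?H) (Ar [(Add, 45, 45, 45), (Const 144, 85, 0, 0), (Sub, 46, 46, 85)]) (real 3) [] (S (\<lambda>R. LV (Suc l) R \<and> R 41 = x \<and> Pd (R 48)))"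
    by (rule tr_time[OF S_ar]) (use Rf_Suc[OF l] in \<open>auto simp: I_def LV_def ascr_def\<close>)
  have T: "real 9 + (((\<Sum>k<Rf l. ((2 * real 2 + real 1) + real 1) + 3) + 1) + ((2 * real 0 + real 1) + real 3)) \<le> 25 * real (Rf l)"
    using Rf_pos[of l] by simp
  have ops: "[] @ rep (Rf l) (\<lambda>i. [Tr 9 (\<lambda>c. sg * wt l * c (40 + (offs l + i)))] @ []) @ [Tr 9 (\<lambda>_. - (sg / 2 ^ l))] @ [] = updops sg l"
    by (simp add: updops_def add.assoc)
  show ?thesis unfolding updP_def
    by (rule tr_conseq[OF tr_seq[OF a tr_seq[OF b tr_seq[OF c d]]] _ _ T]) (simp_all only: ops)
qed

lemma tr_levelP:
  assumes l: "l < L"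
  shows "tr (S (\<lambda>R. LV l R \<and> R 41 = x \<and> Pd (R 48))) (levelP xe) (real (Rf l) * 2 ^ l * (tm + 40)) (levelops Wops l) (S (\<lambda>R. LV (Suc l) R \<and> R 41 = x \<and> Pd (R 48)))"
proof -
  let ?r = "real (Rf l)"
  define I where "I i R \<longleftrightarrow> R 45 = 2 ^ l \<and> R 46 = ?r \<and> R 140 = real (40 + (offs l + i)) \<and> R 41 = x \<and> Pd (R 48) \<and> R 82 = 1" for i :: nat and R :: regs
  have a: "tr (S (\<lambda>R. LV l R \<and> R 41 = x \<and> Pd (R 48))) (Ar [(Const 1, 82, 0, 0), (Add, 42, 46, 93)]) (real 2) [] (S (\<lambda>R. I 0 R \<and> R 42 = real (Rf l)))"
    by (rule tr_time[OF S_ar]) (auto simp: LV_def I_def ascr_def)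
  have b: "tr (S (\<lambda>R. I 0 R \<and> R 42 = real (Rf l))) (For 42 (Seq (testP xe) (Ar [(Add, 140, 140, 82)])))
     ((\<Sum>k<Rf l. (2 ^ l * tm + real 1) + 3) + 1) (rep (Rf l) (\<lambda>i. testops Wops l (40 + (offs l + i)) @ []))
     (S (\<lambda>R. I (Rf l) R \<and> R 42 = 0))"
  proof (rule S_for, goal_cases)
    case (1 k)
    note k = 1
    let ?F = "\<lambda>R. I k R \<and> R 42 = real (Rf l - k)"
    have 1: "tr (S ?F) (testP xe) (2 ^ l * tm) (testops Wops l (40 + (offs l + k))) (S ?F)"
      by (rule tr_test) (auto simp: I_def wscr_def fr_def)
    have 2: "tr (S ?F) (Ar [(Add, 140, 140, 82)]) (real 1) [] (S (\<lambda>R. I (Suc k) R \<and> R 42 = real (Rf l - k)))"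
      by (rule tr_time[OF S_ar]) (auto simp: I_def ascr_def)
    show ?case
      by (rule tr_seq[OF 1 2])
  qed (simp_all add: I_def)
  have c: "tr (S (\<lambda>R. I (Rf l) R \<and> R 42 = 0)) (Ar [(Sub, 140, 140, 46)]) (real 1) [] (S (\<lambda>R. LV l R \<and> R 41 = x \<and> Pd (R 48)))"
    by (rule tr_time[OF S_ar]) (auto simp: I_def LV_def ascr_def)
  note d = tr_updP[OF l disjI1[OF refl], of x Pd]
  have T: "real 2 + (((\<Sum>k<Rf l. (2 ^ l * tm + real 1) + 3) + 1) + (real 1 + 25 * real (Rf l))) \<le> ?r * 2 ^ l * (tm + 40)"
  proof -
    have r1: "1 \<le> ?r" using Rf_pos[of l] by linarith
    then have "?r * 1 \<le> ?r * 2 ^ l" by (intro mult_left_mono) auto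
    moreover have "?r * 2 ^ l * (tm + 40) = ?r * (2 ^ l * tm) + 40 * (?r * 2 ^ l)" by (simp add: algebra_simps)
    moreover have "real 2 + (((\<Sum>k<Rf l. (2 ^ l * tm + real 1) + 3) + 1) + (real 1 + 25 * real (Rf l))) = ?r * (2 ^ l * tm) + 29 * ?r + 4"
      by (simp add: algebra_simps)
    ultimately show ?thesis using r1 by linarith
  qed
  have ops: "[] @ rep (Rf l) (\<lambda>i. testops Wops l (40 + (offs l + i)) @ []) @ [] @ updops 1 l = levelops Wops l"
    by (simp add: levelops_def add.assoc)
  show ?thesis unfolding levelP_def
    by (rule tr_conseq[OF tr_seq[OF a tr_seq[OF b tr_seq[OF c d]]] _ _ T]) (simp_all only: ops)
qed

lemma tr_startP: "(\<And>R r v. r \<in> {45, 140, 85, 46, 41} \<Longrightarrow> G (R(r := v)) = G R) \<Longrightarrow>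
    tr (S G) startP (real 6) [] (S (\<lambda>R. (LV 0 R \<and> G R) \<and> R 41 = real L))"
  unfolding startP_def by (rule tr_time[OF S_ar]) (auto simp: LV_def AG_def ascr_def Rf_def algebra_simps)

definition Bd :: real where
  "Bd = (\<Sum>l<L. real (Rf l) * 2 ^ l)"

lemma Rf_Bd: "(\<Sum>l<L. real (Rf l)) \<le> Bd"
  unfolding Bd_def
proof (rule sum_mono)
  fix l show "real (Rf l) \<le> real (Rf l) * 2 ^ l" using mult_left_mono[of 1 "2 ^ l" "real (Rf l)"] by simp
qed

lemma L_Rf: "real L \<le> (\<Sum>l<L. real (Rf l))"
proof -
  have "(\<Sum>l<L. 1) \<le> (\<Sum>l<L. real (Rf l))" using Rf_pos by (intro sum_mono) (simp add: Suc_leI)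
  then show ?thesis by simp
qed

lemma tr_estP: "tr (S (\<lambda>R. True)) (estP xe) (Bd * (tm + 43) + 7) (estops Wops L) (S (\<lambda>R. R 140 = real (40 + offs L)))"
proof -
  have a: "tr (S (\<lambda>R. True)) startP (real 6) [] (S (\<lambda>R. (LV 0 R \<and> True) \<and> R 41 = real L))" by (rule tr_startP) simp
  have b: "tr (S (\<lambda>R. LV 0 R \<and> R 41 = real L)) (For 41 (levelP xe)) ((\<Sum>l<L. real (Rf l) * 2 ^ l * (tm + 40) + 3) + 1) (rep L (levelops Wops))
     (S (\<lambda>R. LV L R \<and> R 41 = 0))"
  proof (rule S_for, goal_cases)
    case (1 k)
    from tr_levelP[OF 1, of "real (L - k)" "\<lambda>_. True"]
    show ?case by simp
  qed (auto simp: LV_def)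
  have T: "real 6 + ((\<Sum>l<L. real (Rf l) * 2 ^ l * (tm + 40) + 3) + 1) \<le> Bd * (tm + 43) + 7"
  proof -
    have "(\<Sum>l<L. real (Rf l) * 2 ^ l * (tm + 40) + 3) = Bd * (tm + 40) + 3 * real L"
      by (simp add: Bd_def sum.distrib sum_distrib_right)
    then show ?thesis using Rf_Bd L_Rf by (simp add: algebra_simps)
  qed
  show ?thesis unfolding estP_def
    by (rule tr_conseq[OF tr_seq[OF a S_pre[OF b]] _ _ T]) (simp_all add: S_def LV_def estops_def)
qed

end

section \<open>Programs for the return to X, packing and erasure\<close>

context prog
begin

lemma tr_unwP: "tr (S (\<lambda>R. R 48 = x)) unwP (28 * Bd + 7) (rep L (updops (- 1))) (S (\<lambda>R. R 48 = x))"
proof -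
  have a: "tr (S (\<lambda>R. R 48 = x)) startP (real 6) [] (S (\<lambda>R. (LV 0 R \<and> R 48 = x) \<and> R 41 = real L))" by (rule tr_startP) auto
  have b: "tr (S (\<lambda>R. (LV 0 R \<and> R 48 = x) \<and> R 41 = real L)) (For 41 (updP (- 1))) ((\<Sum>l<L. 25 * real (Rf l) + 3) + 1) (rep L (updops (- 1)))
     (S (\<lambda>R. (LV L R \<and> R 48 = x) \<and> R 41 = 0))"
  proof (rule S_for, goal_cases)
    case (1 k)
    from tr_updP[OF 1 disjI2[OF refl], of "real (L - k)" "\<lambda>y. y = x"]
    show ?case by (rule tr_conseq) (auto simp: S_def)
  qed (auto simp: LV_def)
  have T: "real 6 + ((\<Sum>l<L. 25 * real (Rf l) + 3) + 1) \<le> 28 * Bd + 7"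
  proof -
    have "(\<Sum>l<L. 25 * real (Rf l) + 3) = 25 * (\<Sum>l<L. real (Rf l)) + 3 * real L"
      by (simp add: sum.distrib sum_distrib_left)
    then show ?thesis using Rf_Bd L_Rf by simp
  qed
  show ?thesis unfolding unwP_def
    by (rule tr_conseq[OF tr_seq[OF a b] _ _ T]) (simp_all add: S_def)
qed

lemma tr_drive1:
  assumes G: "fr (insert 43 wscr) G" and lt: "\<And>R. G R \<Longrightarrow> R 45 = 2 ^ l \<and> R 140 = real (40 + t)"
  shows "tr (S G) (Seq flagZ (Seq (Ar [(Add, 43, 45, 93)]) (Seq (For 43 (cWalk xe)) mvP))) (2 ^ l * tm) (driveops Wops Fops l (40 + t)) (S G)"
proof -
  have G': "fr wscr G" "G (R(43 := v)) = G R" "G (R(90 := v)) = G R" for R v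
    using G by (auto simp: fr_def wscr_def)
  have b: "tr (S G) (Ar [(Add, 43, 45, 93)]) (real 1) [] (S (\<lambda>R. G R \<and> R 43 = real (2 ^ l)))"
    by (rule tr_time[OF S_ar]) (use lt in \<open>auto simp: G' ascr_def\<close>)
  have c: "tr (S (\<lambda>R. G R \<and> R 43 = real (2 ^ l))) (For 43 (cWalk xe))
     ((\<Sum>k<(2::nat) ^ l. (200 + 76 * (real D + real E)) + 3) + 1) (rep (2 ^ l) (\<lambda>_. Wops)) (S (\<lambda>R. G R \<and> R 43 = 0))"
  proof (rule S_for, goal_cases)
    case (1 k)
    have f: "fr wscr (\<lambda>R. G R \<and> R 43 = real (2 ^ l - k))" by (intro fr_conj G' fr_eq) (simp add: wscr_def)
    show ?case
      by (rule S_walk[OF f])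
  qed (simp_all only: G' insertI1 insert_iff simp_thms)
  have f: "tr (S (\<lambda>R. G R \<and> R 43 = 0)) mvP (2 * real 0 + real 2) (mv (40 + t)) (S (\<lambda>R. G R \<and> R 43 = 0))"
    unfolding mvP_def by (rule tr_time[OF S_blk], rule blk_mv[OF WE_cs]) (use lt mv_tgt in simp_all)
  have T: "13 + (real 1 + (((\<Sum>k<(2::nat) ^ l. (200 + 76 * (real D + real E)) + 3) + 1) + (2 * real 0 + real 2))) \<le> 2 ^ l * tm"
  proof -
    have "1 \<le> (2::real) ^ l" by simp
    then have "17 \<le> (2::real) ^ l * 47" by linarith
    moreover have "2 ^ l * tm = 2 ^ l * (203 + 76 * (real D + real E)) + 2 ^ l * 47" by (simp add: tm_def algebra_simps)
    moreover have "(\<Sum>k<(2::nat) ^ l. (200 + 76 * (real D + real E)) + 3) = 2 ^ l * (203 + 76 * (real D + real E))" by simp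
    ultimately show ?thesis by linarith
  qed
  show ?thesis
    by (rule tr_conseq[OF tr_seq[OF S_flag tr_seq[OF b tr_seq[OF c f]]] _ _ T]) (simp_all add: S_def driveops_def)
qed

lemma tr_driveP: "tr (S (\<lambda>R. R 140 = real (40 + t))) (driveP xe) (real K0 * 2 ^ L * (tm + 12) + 4) (drive Wops Fops L K0 t)
    (S (\<lambda>R. R 48 = real (t + K0 * L)))"
proof -
  have ps: "tr (S (\<lambda>R. R 140 = real (40 + (t + p * L)) \<and> R 41 = z)) (passP xe) (2 ^ L * (tm + 6) + 3)
    (rep L (\<lambda>l. driveops Wops Fops l (40 + (t + p * L + l)))) (S (\<lambda>R. R 140 = real (40 + (t + Suc p * L)) \<and> R 41 = z))" for p z
  proof -
    define I where "I l R \<longleftrightarrow> R 45 = 2 ^ l \<and> R 140 = real (40 + (t + p * L + l)) \<and> R 41 = z" for l :: nat and R :: regs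
    have a: "tr (S (\<lambda>R. R 140 = real (40 + (t + p * L)) \<and> R 41 = z)) (Ar [(Const 1, 45, 0, 0), (Add, 44, 20, 93)]) (real 2) [] (S (\<lambda>R. I 0 R \<and> R 44 = real L))"
      by (rule tr_time[OF S_ar]) (auto simp: I_def ascr_def AG_def)
    have b: "tr (S (\<lambda>R. I 0 R \<and> R 44 = real L)) (For 44 (Seq (Seq flagZ (Seq (Ar [(Add, 43, 45, 93)]) (Seq (For 43 (cWalk xe)) mvP)))
       (Ar [(Const 1, 82, 0, 0), (Add, 140, 140, 82), (Add, 45, 45, 45)]))) ((\<Sum>l<L. (2 ^ l * tm + real 3) + 3) + 1)
       (rep L (\<lambda>l. driveops Wops Fops l (40 + (t + p * L + l)) @ [])) (S (\<lambda>R. I L R \<and> R 44 = 0))"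
    proof (rule S_for, goal_cases)
      case (1 l)
      have 1: "tr (S (\<lambda>R. I l R \<and> R 44 = real (L - l))) (Seq flagZ (Seq (Ar [(Add, 43, 45, 93)]) (Seq (For 43 (cWalk xe)) mvP))) (2 ^ l * tm)
         (driveops Wops Fops l (40 + (t + p * L + l))) (S (\<lambda>R. I l R \<and> R 44 = real (L - l)))"
        by (rule tr_drive1) (auto simp: I_def fr_def wscr_def)
      have 2: "tr (S (\<lambda>R. I l R \<and> R 44 = real (L - l))) (Ar [(Const 1, 82, 0, 0), (Add, 140, 140, 82), (Add, 45, 45, 45)]) (real 3) []
         (S (\<lambda>R. I (Suc l) R \<and> R 44 = real (L - l)))"
        by (rule tr_time[OF S_ar]) (auto simp: I_def ascr_def)
      show ?case
        by (rule tr_seq[OF 1 2])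
    qed (simp_all add: I_def)
    have T: "real 2 + ((\<Sum>l<L. (2 ^ l * tm + real 3) + 3) + 1) \<le> 2 ^ L * (tm + 6) + 3"
    proof -
      have g: "(\<Sum>l<L. (2::real) ^ l) = 2 ^ L - 1" by (induction L) auto
      have s: "(\<Sum>l<L. (2 ^ l * tm + real 3) + 3) = (2 ^ L - 1) * tm + 6 * real L"
        by (simp add: sum.distrib g flip: sum_distrib_right)
      have "real L \<le> 2 ^ L" using of_nat_less_two_power[of L, where 'a = real] by linarith
      moreover have "l \<le> e \<Longrightarrow> 2 + ((e - 1) * tm + 6 * l + 1) \<le> e * (tm + 6) + 3" for l e :: real
        using tm_ge by (simp add: algebra_simps)
      ultimately show ?thesis unfolding s by simp
    qed
    show ?thesis unfolding passP_def
      by (rule tr_conseq[OF tr_seq[OF a b] _ _ T]) (simp_all add: S_def I_def algebra_simps)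
  qed
  have a: "tr (S (\<lambda>R. R 140 = real (40 + t))) (Ar [(Add, 41, 22, 93)]) (real 1) [] (S (\<lambda>R. R 140 = real (40 + (t + 0 * L)) \<and> R 41 = real K0))"
    by (rule tr_time[OF S_ar]) (auto simp: ascr_def AG_def)
  have b: "tr (S (\<lambda>R. R 140 = real (40 + (t + 0 * L)) \<and> R 41 = real K0)) (For 41 (passP xe)) ((\<Sum>p<K0. (2 ^ L * (tm + 6) + 3) + 3) + 1)
     (rep K0 (\<lambda>p. rep L (\<lambda>l. driveops Wops Fops l (40 + (t + p * L + l))))) (S (\<lambda>R. R 140 = real (40 + (t + K0 * L)) \<and> R 41 = 0))"
    by (rule S_for[where I = "\<lambda>p R. R 140 = real (40 + (t + p * L))"]) (rule ps, auto)
  have c: "tr (S (\<lambda>R. R 140 = real (40 + (t + K0 * L)) \<and> R 41 = 0)) (Ar [(Const 40, 82, 0, 0), (Sub, 48, 140, 82)]) (real 2) [] (S (\<lambda>R. R 48 = real (t + K0 * L)))"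
    by (rule tr_time[OF S_ar]) (auto simp: ascr_def)
  have T: "real 1 + (((\<Sum>p<K0. (2 ^ L * (tm + 6) + 3) + 3) + 1) + real 2) \<le> real K0 * 2 ^ L * (tm + 12) + 4"
  proof -
    have "real K0 * 1 \<le> real K0 * 2 ^ L" by (intro mult_left_mono) auto
    then show ?thesis by (simp add: algebra_simps)
  qed
  show ?thesis unfolding driveP_def
    by (rule tr_conseq[OF tr_seq[OF a tr_seq[OF b c]] _ _ T]) (simp_all add: drive_def)
qed

lemma tr_packAP: "tr (S (\<lambda>R. R 48 = x)) packAP (24 * 2 ^ L + 3) (packA (2 ^ L) kq Dh) (S (\<lambda>R. R 48 = x))"
proof -
  define I where "I k R \<longleftrightarrow> R 80 = real k * kq \<and> R 48 = x" for k :: nat and R :: regs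
  have a: "tr (S (\<lambda>R. R 48 = x)) (Ar [(Const 0, 80, 0, 0), (Add, 41, 21, 93)]) (real 2) [] (S (\<lambda>R. I 0 R \<and> R 41 = real (2 ^ L)))"
    by (rule tr_time[OF S_ar]) (auto simp: I_def ascr_def AG_def)
  have b: "tr (S (\<lambda>R. I 0 R \<and> R 41 = real (2 ^ L))) (For 41 (Seq (Ar [(Add, 80, 80, 34), (Sub, 81, 93, 80)]) (Gs (Cj y_gates [gA Leq 10 20 18]))))
    ((\<Sum>k<(2::nat) ^ L. (real 2 + (2 * real 9 + real 1)) + 3) + 1) (rep (2 ^ L) (\<lambda>k. [] @ [Tr 10 (\<lambda>c. leqr (real (Suc k) * kq) (yf Dh (c 9)))]))
    (S (\<lambda>R. I (2 ^ L) R \<and> R 41 = 0))"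
  proof (rule S_for, goal_cases)
    case (1 k)
    let ?F = "\<lambda>R. (I (Suc k) R \<and> R 41 = real (2 ^ L - k)) \<and> R 81 = - (real (Suc k) * kq)"
    have 1: "tr (S (\<lambda>R. I k R \<and> R 41 = real (2 ^ L - k))) (Ar [(Add, 80, 80, 34), (Sub, 81, 93, 80)]) (real 2) [] (S ?F)"
      by (rule tr_time[OF S_ar]) (auto simp: I_def ascr_def AG_def algebra_simps)
    have 2: "tr (S ?F) (Gs (Cj y_gates [gA Leq 10 20 18])) (2 * real 9 + real 1) [Tr 10 (\<lambda>c. leqr (real (Suc k) * kq) (yf Dh (c 9)))] (S ?F)"
      by (rule tr_time[OF S_blk], rule blk_A[OF WE_cs]) (auto simp: I_def AG_def y_gates_def)
    show ?case
      by (rule S_post[OF tr_seq[OF 1 2]]) simp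
  qed (simp_all add: I_def)
  show ?thesis unfolding packAP_def
    by (rule tr_conseq[OF tr_seq[OF a b]]) (simp_all add: S_def I_def packA_def)
qed

lemma tr_packCP: "tr (S (\<lambda>R. R 48 = real T)) packCP (13 * real T + 11) (packC kq T)
    (S (\<lambda>R. R 48 = real T \<and> R 58 = eta kq T \<and> R 140 = real (40 + T)))"
proof -
  define I where "I k R \<longleftrightarrow> R 58 = eta kq k \<and> R 59 = - eta kq k \<and> R 48 = real T \<and> R 140 = real (40 + k)" for k :: nat and R :: regs
  have a: "tr (S (\<lambda>R. R 48 = real T)) (Gs (Cj [gH 11 34, gA Mul 12 11 10] [gA Add 1 12 19])) (2 * real 2 + real 1) [Tr 1 (\<lambda>c. kq * c 10)] (S (\<lambda>R. R 48 = real T))"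
    by (rule tr_time[OF S_blk], rule blk_C(1)[OF WE_cs]) (auto simp: AG_def)
  have b: "tr (S (\<lambda>R. R 48 = real T)) (Ar [(Const (1/2), 82, 0, 0), (Mul, 58, 34, 82), (Sub, 59, 93, 58), (Const 40, 140, 0, 0), (Add, 41, 48, 93)])
     (real 5) [] (S (\<lambda>R. I 0 R \<and> R 41 = real T))"
    by (rule tr_time[OF S_ar]) (auto simp: I_def ascr_def AG_def eta_def)
  have c: "tr (S (\<lambda>R. I 0 R \<and> R 41 = real T)) (For 41 (Seq (Gs (Cj [gH 11 58, QAdd Mul 112 111 140] [gA Add 1 12 19]))
       (Ar [(Const 1, 83, 0, 0), (Add, 140, 140, 83), (Const (1/2), 82, 0, 0), (Mul, 58, 58, 82), (Sub, 59, 93, 58)])))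
     ((\<Sum>k<T. ((2 * real 2 + real 1) + real 5) + 3) + 1) (rep T (\<lambda>t. [Tr 1 (\<lambda>c. eta kq t * c (40 + t))] @ [])) (S (\<lambda>R. I T R \<and> R 41 = 0))"
  proof (rule S_for, goal_cases)
    case (1 k)
    let ?F = "\<lambda>R. I k R \<and> R 41 = real (T - k)"
    have 1: "tr (S ?F) (Gs (Cj [gH 11 58, QAdd Mul 112 111 140] [gA Add 1 12 19])) (2 * real 2 + real 1) [Tr 1 (\<lambda>c. eta kq k * c (40 + k))] (S ?F)"
      by (rule tr_time[OF S_blk], rule blk_addmul(1)[OF WE_cs]) (auto simp: I_def)
    have 2: "tr (S ?F) (Ar [(Const 1, 83, 0, 0), (Add, 140, 140, 83), (Const (1/2), 82, 0, 0), (Mul, 58, 58, 82), (Sub, 59, 93, 58)]) (real 5) []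
        (S (\<lambda>R. I (Suc k) R \<and> R 41 = real (T - k)))"
      by (rule tr_time[OF S_ar]) (auto simp: I_def ascr_def eta_def)
    show ?case
      by (rule tr_seq[OF 1 2])
  qed (simp_all add: I_def)
  show ?thesis unfolding packCP_def
    by (rule tr_conseq[OF tr_seq[OF a tr_seq[OF b c]]]) (simp_all add: S_def I_def packC_def)
qed

lemma tr_packDP: "tr (S (\<lambda>R. R 48 = real T \<and> R 58 = eta kq T \<and> R 140 = real (40 + T))) packDP (17 * real T + 4) (packD kq T) (S (\<lambda>R. True))"
proof -
  let ?P = "\<lambda>R. R 48 = real T \<and> R 58 = eta kq T \<and> R 140 = real (40 + T)"
  define I where "I k R \<longleftrightarrow> R 58 = eta kq (T - k) \<and> R 140 = real (40 + (T - k))" for k :: nat and R :: regs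
  have a: "tr (S ?P) (Gs (Cj [] [gA Add 8 1 19])) (2 * real 0 + real 1) [Tr 8 (\<lambda>c. c 1)] (S ?P)"
    by (rule tr_time[OF S_blk], rule blk_copy[OF WE_cs]) auto
  have b: "tr (S ?P) (Ar [(Add, 41, 48, 93)]) (real 1) [] (S (\<lambda>R. I 0 R \<and> R 41 = real T))"
    by (rule tr_time[OF S_ar]) (auto simp: I_def ascr_def)
  have c: "tr (S (\<lambda>R. I 0 R \<and> R 41 = real T)) (For 41 (Seq (Ar [(Add, 58, 58, 58), (Sub, 59, 93, 58), (Const 1, 83, 0, 0), (Sub, 140, 140, 83)])
       (Seq (Gs (Cj [gH 11 58, QAdd Mul 112 111 140] [gS Add 8 12 19])) (Gs (Cj [gH 11 58, gA Sub 12 1 8] [QSub Leq 140 111 112])))))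
     ((\<Sum>k<T. (real 4 + ((2 * real 2 + real 1) + (2 * real 2 + real 1))) + 3) + 1)
     (rep T (\<lambda>t. [] @ [Tr 8 (\<lambda>c. - (eta kq (T - Suc t) * c (40 + (T - Suc t))))] @ [Tr (40 + (T - Suc t)) (\<lambda>c. - leqr (eta kq (T - Suc t)) (c 1 - c 8))]))
     (S (\<lambda>R. I T R \<and> R 41 = 0))"
  proof (rule S_for, goal_cases)
    case (1 k)
    note k = 1
    define u where "u = T - Suc k"
    have u: "T - k = Suc u" using k by (simp add: u_def)
    let ?F = "\<lambda>R. (I (Suc k) R \<and> R 41 = real (T - k)) \<and> R 59 = - eta kq u"
    have 1: "tr (S (\<lambda>R. I k R \<and> R 41 = real (T - k))) (Ar [(Add, 58, 58, 58), (Sub, 59, 93, 58), (Const 1, 83, 0, 0), (Sub, 140, 140, 83)]) (real 4) [] (S ?F)"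
      by (rule tr_time[OF S_ar]) (auto simp: I_def ascr_def u eta_def simp flip: u_def)
    have 2: "tr (S ?F) (Gs (Cj [gH 11 58, QAdd Mul 112 111 140] [gS Add 8 12 19])) (2 * real 2 + real 1) [Tr 8 (\<lambda>c. - (eta kq u * c (40 + u)))] (S ?F)"
      by (rule tr_time[OF S_blk], rule blk_addmul(2)[OF WE_cs]) (auto simp: I_def simp flip: u_def)
    have 3: "tr (S ?F) (Gs (Cj [gH 11 58, gA Sub 12 1 8] [QSub Leq 140 111 112])) (2 * real 2 + real 1) [Tr (40 + u) (\<lambda>c. - leqr (eta kq u) (c 1 - c 8))] (S ?F)"
      by (rule tr_time[OF S_blk], rule blk_bit[OF WE_cs]) (auto simp: I_def simp flip: u_def)
    show ?case
      unfolding u_def[symmetric] by (rule S_post[OF tr_seq[OF 1 tr_seq[OF 2 3]]]) simp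
  qed (simp_all add: I_def)
  show ?thesis unfolding packDP_def
    by (rule tr_conseq[OF tr_seq[OF a tr_seq[OF b c]]]) (simp_all add: S_def packD_def)
qed

lemma tr_packEP: "tr (S (\<lambda>R. True)) packEP (8 * 2 ^ L + 8) (packE (2 ^ L) kq) (S (\<lambda>R. True))"
proof -
  define I where "I k R \<longleftrightarrow> R 80 = real k * kq" for k :: nat and R :: regs
  have a: "tr (S (\<lambda>R. True)) (Gs (Cj [gH 11 34, gA Mul 12 11 10] [gS Add 8 12 19])) (2 * real 2 + real 1) [Tr 8 (\<lambda>c. - (kq * c 10))] (S (\<lambda>R. True))"
    by (rule tr_time[OF S_blk], rule blk_C(2)[OF WE_cs]) (auto simp: AG_def)
  have b: "tr (S (\<lambda>R. True)) (Ar [(Const 0, 80, 0, 0), (Add, 41, 21, 93)]) (real 2) [] (S (\<lambda>R. I 0 R \<and> R 41 = real (2 ^ L)))"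
    by (rule tr_time[OF S_ar]) (auto simp: I_def ascr_def AG_def)
  have c: "tr (S (\<lambda>R. I 0 R \<and> R 41 = real (2 ^ L))) (For 41 (Seq (Ar [(Add, 80, 80, 34), (Sub, 81, 93, 80)]) (Gs (Cj [gH 20 80] [gS Leq 10 20 1]))))
    ((\<Sum>k<(2::nat) ^ L. (real 2 + (2 * real 1 + real 1)) + 3) + 1) (rep (2 ^ L) (\<lambda>k. [] @ [Tr 10 (\<lambda>c. - leqr (real (Suc k) * kq) (c 1))]))
    (S (\<lambda>R. I (2 ^ L) R \<and> R 41 = 0))"
  proof (rule S_for, goal_cases)
    case (1 k)
    let ?F = "\<lambda>R. (I (Suc k) R \<and> R 41 = real (2 ^ L - k)) \<and> R 81 = - (real (Suc k) * kq)"
    have 1: "tr (S (\<lambda>R. I k R \<and> R 41 = real (2 ^ L - k))) (Ar [(Add, 80, 80, 34), (Sub, 81, 93, 80)]) (real 2) [] (S ?F)"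
      by (rule tr_time[OF S_ar]) (auto simp: I_def ascr_def AG_def algebra_simps)
    have 2: "tr (S ?F) (Gs (Cj [gH 20 80] [gS Leq 10 20 1])) (2 * real 1 + real 1) [Tr 10 (\<lambda>c. - leqr (real (Suc k) * kq) (c 1))] (S ?F)"
      by (rule tr_time[OF S_blk], rule blk_E[OF WE_cs]) (auto simp: I_def AG_def)
    show ?case
      by (rule S_post[OF tr_seq[OF 1 2]]) simp
  qed (simp_all add: I_def)
  show ?thesis unfolding packEP_def
    by (rule tr_conseq[OF tr_seq[OF a tr_seq[OF b c]]]) (simp_all add: packE_def S_def)
qed

text \<open>The sum of (K0 + L - l) 2^l over the levels equals (K0 + 2) 2^L - L - 2 - K0. More tests
  at the early levels therefore cost only a constant factor over the last level.\<close>

lemma Bd_le: "Bd \<le> 144 * (real K0 + 2) * 2 ^ L"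
proof -
  have e: "(\<Sum>l<L. real (K0 + (L - l)) * 2 ^ l) + real L + 2 + real K0 = (real K0 + 2) * 2 ^ L"
  proof (induction L)
    case (Suc L)
    define s where "s = (\<Sum>l<L. real (K0 + (L - l)) * 2 ^ l)"
    have g: "(\<Sum>l<L. (2::real) ^ l) = 2 ^ L - 1" by (induction L) auto
    have "(\<Sum>l<Suc L. real (K0 + (Suc L - l)) * 2 ^ l) = (\<Sum>l<L. real (K0 + (L - l)) * 2 ^ l + 2 ^ l) + (real K0 + 1) * 2 ^ L"
      by (simp add: Suc_diff_le distrib_right add.commute)
    also have "\<dots> = s + (2 ^ L - 1) + (real K0 + 1) * 2 ^ L" by (simp only: sum.distrib g s_def)
    finally have e: "(\<Sum>l<Suc L. real (K0 + (Suc L - l)) * 2 ^ l) = s + (2 ^ L - 1) + (real K0 + 1) * 2 ^ L" .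
    show ?case unfolding e using Suc[folded s_def] by (simp add: algebra_simps)
  qed simp
  have B: "Bd = 144 * (\<Sum>l<L. real (K0 + (L - l)) * 2 ^ l)"
    by (simp add: Bd_def Rf_def sum_distrib_left algebra_simps)
  have "s + l + 2 + k = (k + 2) * e \<Longrightarrow> 0 \<le> l \<Longrightarrow> 0 \<le> k \<Longrightarrow> 144 * s \<le> 144 * (k + 2) * e" for s l k e :: real
    unfolding mult.assoc by simp
  from this[OF e] show ?thesis unfolding B by simp
qed

theorem tr_coreP:
  "tr (S (\<lambda>R. True)) (coreP xe) (2 ^ L * (145 * (real K0 + 2) * (tm + 200))) (sveops Rf Wops Fops L K0 kq Dh) (S (\<lambda>R. True))"
proof -
  let ?T = "offs L + K0 * L" and ?Q = "Bd + real K0 * 2 ^ L"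
  \<comment> \<open>There are no more outcome cells than \<open>?Q\<close>, a bound on the number of
    walk steps. All phases of the program, including packing and erasure, can thus be charged to
    \<open>?Q\<close>.\<close>
  have T1: "real ?T \<le> ?Q"
  proof -
    have "real (offs L) = (\<Sum>l<L. real (Rf l))" by (simp add: offs_def)
    moreover have "real L \<le> 2 ^ L" using of_nat_less_two_power[of L, where 'a = real] by linarith
    then have "real K0 * real L \<le> real K0 * 2 ^ L" by (intro mult_left_mono) auto
    ultimately show ?thesis using Rf_Bd by simp
  qed
  have B0: "0 \<le> Bd" unfolding Bd_def by (intro sum_nonneg) auto
  have "1 * 2 ^ L \<le> real K0 * 2 ^ L" using K0 by (intro mult_right_mono) auto
  then have Q1: "2 ^ L \<le> ?Q" using B0 by linarith
  have one: "1 \<le> (2::real) ^ L" by simp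
  have time: "(Bd * (tm + 43) + 7) + ((real K0 * 2 ^ L * (tm + 12) + 4) + ((24 * 2 ^ L + 3) + ((28 * Bd + 7) +
      ((13 * real ?T + 11) + ((17 * real ?T + 4) + (8 * 2 ^ L + 8)))))) \<le> 2 ^ L * (145 * (real K0 + 2) * (tm + 200))"
  proof -
    have "real K0 * 2 ^ L * (tm + 12) \<le> real K0 * 2 ^ L * (tm + 43)" by (intro mult_left_mono) auto
    then have "Bd * (tm + 43) + real K0 * 2 ^ L * (tm + 12) \<le> ?Q * (tm + 43)" by (simp add: distrib_right)
    moreover have "?Q * (tm + 200) = ?Q * (tm + 43) + 157 * ?Q" by (simp add: algebra_simps)
    moreover have "44 \<le> 44 * (2::real) ^ L" using one by simp
    moreover have "Bd \<le> ?Q" by simp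
    moreover have "b1 + b2 \<le> q1 \<Longrightarrow> q2 = q1 + 157 * q \<Longrightarrow> 44 \<le> 44 * e \<Longrightarrow> b \<le> q \<Longrightarrow> T \<le> q \<Longrightarrow> e \<le> q \<Longrightarrow>
      (b1 + 7) + ((b2 + 4) + ((24 * e + 3) + ((28 * b + 7) + ((13 * T + 11) + ((17 * T + 4) + (8 * e + 8)))))) \<le> q2"
      for b1 b2 q1 q2 q e b T :: real by linarith
    ultimately have "(Bd * (tm + 43) + 7) + ((real K0 * 2 ^ L * (tm + 12) + 4) + ((24 * 2 ^ L + 3) + ((28 * Bd + 7) +
      ((13 * real ?T + 11) + ((17 * real ?T + 4) + (8 * 2 ^ L + 8)))))) \<le> ?Q * (tm + 200)"
      using T1 Q1 by blast
    also have "b \<le> 144 * (k + 2) * e \<Longrightarrow> 0 \<le> e \<Longrightarrow> b + k * e \<le> 145 * (k + 2) * e" for b k e :: real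
      by (simp add: algebra_simps)
    from this[OF Bd_le] have "?Q \<le> 145 * (real K0 + 2) * 2 ^ L" by simp
    then have "?Q * (tm + 200) \<le> 145 * (real K0 + 2) * 2 ^ L * (tm + 200)" using tm_ge by (intro mult_right_mono) auto
    finally show ?thesis by (simp only: mult_ac)
  qed
  show ?thesis unfolding coreP_def
    by (rule tr_conseq[OF tr_seq[OF tr_estP tr_seq[OF tr_driveP tr_seq[OF tr_packAP tr_seq[OF tr_unwP tr_seq[OF tr_packCP
      tr_seq[OF tr_packDP tr_packEP]]]]]] _ _ time]) (simp_all add: sveops_def finish_def)
qed

end

section \<open>The complete program\<close>

definition cellsP :: com where
  "cellsP = Ar (map (\<lambda>k. (Const (real k), 100 + k, 0, 0)) [0..<40])"

lemma fold_cells: "fold astep (map (\<lambda>k. (Const (real k), 100 + k, 0, 0)) [0..<j]) R r =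
    (if 100 \<le> r \<and> r < 100 + j then real (r - 100) else R r)"
proof (induction j)
  case (Suc j)
  show ?case by (auto simp: Suc)
qed simp

lemma tr_cells:
  assumes "fr {100..<140} F"
  shows "tr (\<lambda>R M. F R \<and> M = M0) cellsP 40 [] (\<lambda>R M. cs_ok R \<and> F R \<and> M = M0)"
proof -
  have F: "F (fold astep (map (\<lambda>k. (Const (real k), 100 + k, 0, 0)) [0..<j]) R) = F R" if "j \<le> 40" for j R
    using that
  proof (induction j)
    case (Suc j)
    then have "100 + j \<in> {100..<140}" by simp
    then show ?case using Suc by (simp only: upt_Suc_append map_append fold_append o_apply list.map fold_simps astep.simps fr_upd[OF assms] if_True le0)
  qed simp
  show ?thesis unfolding cellsP_def
    by (rule tr_ArI) (simp_all add: F cs_ok_def fold_cells)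
qed

context params
begin

definition prepP :: com where
  "prepP = Seq cellsP (Seq (Ar [(Const 0, 93, 0, 0), (Const 8, 94, 0, 0), (Const (1/2), 96, 0, 0)]) (Seq (Pow2 10 11 1) (Seq (Pow2 12 13 0)
    (Seq (Ar [(Add, 68, 1, 93), (Sub, 69, 93, 68), (Const 16, 16, 0, 0), (Mul, 70, 16, 10), (Sub, 71, 93, 70), (Mul, 72, 16, 12),
       (Const (real tau), 16, 0, 0), (Mul, 72, 16, 72), (Sub, 73, 93, 72), (Const 1, 16, 0, 0), (Add, 14, 13, 11), (Add, 14, 14, 16),
       (Div, 15, 16, 14), (Const 3, 16, 0, 0), (Const 4, 19, 0, 0)])
    (Seq (Load 17 16) (Seq (Load 18 19)
    (Ar [(Pow, 17, 17, 15), (Const xe, 19, 0, 0), (Pow, 17, 17, 19), (Pow, 18, 18, 15), (Mul, 74, 17, 18), (Sub, 75, 93, 74),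
       (Pow, 24, 74, 96), (Leq, 27, 24, 2)])))))))"

definition mainP :: "nat \<Rightarrow> com" where
  "mainP c = Seq (Ar [(Const (1/8), 28, 0, 0), (Mul, 34, 28, 2), (Sub, 35, 93, 34), (Const 16, 28, 0, 0), (Mul, 29, 28, 74), (Mul, 30, 34, 34),
       (Add, 29, 29, 30), (Pow, 36, 29, 96), (Sub, 37, 93, 36), (Const 4, 30, 0, 0), (Mul, 30, 30, 24), (Div, 30, 30, 36),
       (Arccos, 76, 30, 30), (Sub, 77, 93, 76), (Add, 78, 76, 93), (Mul, 29, 28, 36), (Div, 29, 29, 2),
       (Const (real c + 3), 30, 0, 0), (Const 1, 28, 0, 0), (Add, 28, 28, 11), (Mul, 22, 30, 28)])
     (Seq (Pow2 21 20 29) (coreP xe))"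

text \<open>Register 27 is 1 if sqrt(Shat) \<le> \<open>\<delta>\<close>. Then doing nothing is
  right, because the estimate 0 is within \<open>\<delta>\<close> of every singular value; this
  includes the zero matrix, for which the scale of the walk vanishes.\<close>

definition sveP :: "nat \<Rightarrow> com" where
  "sveP c = Seq prepP (If_nz 27 Skip (mainP c))"

definition PE :: "real mat \<Rightarrow> real \<Rightarrow> regs \<Rightarrow> bool" where
  "PE A \<delta> = (\<lambda>R. R 2 = \<delta> \<and> R 93 = 0 \<and> R 94 = 8 \<and> R 96 = 1 / 2 \<and> R 68 = real (dim_col A) \<and> R 69 = - real (dim_col A) \<and>
     R 70 = 16 * 2 ^ cost2 (dim_col A) \<and> R 71 = - (16 * 2 ^ cost2 (dim_col A)) \<and>
     R 72 = real tau * (16 * 2 ^ cost2 (dim_row A)) \<and> R 73 = - (real tau * (16 * 2 ^ cost2 (dim_row A))) \<and>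
     R 74 = Shat A \<and> R 75 = - Shat A \<and> R 10 = 2 ^ cost2 (dim_col A) \<and> R 11 = real (cost2 (dim_col A)) \<and>
     R 12 = 2 ^ cost2 (dim_row A) \<and> R 13 = real (cost2 (dim_row A)) \<and> R 24 = sqrt (Shat A) \<and> cs_ok R)"

lemma powp_half: "0 \<le> x \<Longrightarrow> powp x (1 / 2) = sqrt x"
  by (cases "x = 0") (auto simp: powp_def powr_half_sqrt)

lemma Shat_nonneg: "0 \<le> Shat A"
  by (simp add: Shat_def)

lemma tr_prepP:
  "tr (\<lambda>R M. R = init_regs [real (dim_row A), real (dim_col A), \<delta>] \<and> M = enc A) prepP
    (80 + 5 * (real (cost2 (dim_col A)) + real (cost2 (dim_row A)))) []
    (\<lambda>R M. (PE A \<delta> R \<and> R 27 = leqr (sqrt (Shat A)) \<delta>) \<and> M = enc A)"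
proof -
  let ?m = "dim_row A" and ?n = "dim_col A"
  let ?D = "cost2 ?n" and ?E = "cost2 ?m"
  define F0 where "F0 = (\<lambda>R :: regs. R 0 = real ?m \<and> R 1 = real ?n \<and> R 2 = \<delta>)"
  define F1 where "F1 = (\<lambda>R :: regs. R 0 = real ?m \<and> R 1 = real ?n \<and> R 2 = \<delta> \<and> R 93 = 0 \<and> R 94 = 8 \<and> R 96 = 1 / 2 \<and> cs_ok R)"
  define F2 where "F2 = (\<lambda>R. F1 R \<and> R 10 = 2 ^ ?D \<and> R 11 = real ?D)"
  define F3 where "F3 = (\<lambda>R. F2 R \<and> R 12 = 2 ^ ?E \<and> R 13 = real ?E)"
  define F4 where "F4 = (\<lambda>R. F3 R \<and> R 68 = real ?n \<and> R 69 = - real ?n \<and> R 70 = 16 * 2 ^ ?D \<and> R 71 = - (16 * 2 ^ ?D) \<and>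
     R 72 = real tau * (16 * 2 ^ ?E) \<and> R 73 = - (real tau * (16 * 2 ^ ?E)) \<and> R 15 = 1 / qe ?m ?n \<and> R 19 = 4)"
  have cs: "r < 100 \<Longrightarrow> cs_ok (R(r := v)) = cs_ok R" for R r v
    using fr_upd[OF fr_cs_ok[of "{r}"]] by simp
  have f0: "fr {100..<140} F0" unfolding F0_def by (intro fr_conj fr_eq) auto
  have f1: "fr {10, 11, 91, 92} F1" unfolding F1_def by (intro fr_conj fr_eq fr_cs_ok) auto
  have f2: "fr {12, 13, 91, 92} F2" unfolding F2_def F1_def by (intro fr_conj fr_eq fr_cs_ok) auto
  have 1: "tr (\<lambda>R M. R = init_regs [real ?m, real ?n, \<delta>] \<and> M = enc A) cellsP 40 [] (\<lambda>R M. cs_ok R \<and> F0 R \<and> M = enc A)"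
    by (rule tr_pre[OF tr_cells[OF f0]]) (simp add: F0_def init_regs_def)
  have 2: "tr (\<lambda>R M. cs_ok R \<and> F0 R \<and> M = enc A) (Ar [(Const 0, 93, 0, 0), (Const 8, 94, 0, 0), (Const (1/2), 96, 0, 0)]) 3 []
    (\<lambda>R M. R 1 = real ?n \<and> M = enc A \<and> F1 R)"
    by (rule tr_ArI) (simp_all add: F0_def F1_def cs)
  have 3: "tr (\<lambda>R M. R 1 = real ?n \<and> M = enc A \<and> F1 R) (Pow2 10 11 1) (6 + 5 * real ?D) []
    (\<lambda>R M. R 0 = real ?m \<and> M = enc A \<and> F2 R)"
    by (rule tr_conseq[OF tr_Pow2[OF f1, of 1 "real ?n" "enc A"]]) (auto simp: F2_def F1_def cost2_def)
  have 4: "tr (\<lambda>R M. R 0 = real ?m \<and> M = enc A \<and> F2 R) (Pow2 12 13 0) (6 + 5 * real ?E) []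
    (\<lambda>R M. F3 R \<and> M = enc A)"
    by (rule tr_conseq[OF tr_Pow2[OF f2, of 0 "real ?m" "enc A"]]) (auto simp: F3_def cost2_def)
  have 5: "tr (\<lambda>R M. F3 R \<and> M = enc A) (Ar [(Add, 68, 1, 93), (Sub, 69, 93, 68), (Const 16, 16, 0, 0), (Mul, 70, 16, 10), (Sub, 71, 93, 70),
       (Mul, 72, 16, 12), (Const (real tau), 16, 0, 0), (Mul, 72, 16, 72), (Sub, 73, 93, 72), (Const 1, 16, 0, 0), (Add, 14, 13, 11), (Add, 14, 14, 16),
       (Div, 15, 16, 14), (Const 3, 16, 0, 0), (Const 4, 19, 0, 0)]) 15 [] (\<lambda>R M. (F4 R \<and> R 16 = 3) \<and> M = enc A)"
    by (rule tr_ArI) (simp_all add: F4_def F3_def F2_def F1_def cs qe_def)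
  have ad: "addr 3 = 3" "addr 4 = 4" using addr_eq[of 3 3] addr_eq[of 4 4] by simp_all
  have 6: "tr (\<lambda>R M. (F4 R \<and> R 16 = 3) \<and> M = enc A) (Load 17 16) 1 [] (\<lambda>R M. (F4 R \<and> R 17 = S1 A) \<and> M = enc A)"
    by (rule tr_conseq[OF tr_Load]) (auto simp: F4_def F3_def F2_def F1_def cs ad enc_3)
  have 7: "tr (\<lambda>R M. (F4 R \<and> R 17 = S1 A) \<and> M = enc A) (Load 18 19) 1 [] (\<lambda>R M. (F4 R \<and> R 17 = S1 A \<and> R 18 = S2 A) \<and> M = enc A)"
    by (rule tr_conseq[OF tr_Load]) (auto simp: F4_def F3_def F2_def F1_def cs ad enc_4)
  have 8: "tr (\<lambda>R M. (F4 R \<and> R 17 = S1 A \<and> R 18 = S2 A) \<and> M = enc A) (Ar [(Pow, 17, 17, 15), (Const xe, 19, 0, 0), (Pow, 17, 17, 19),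
       (Pow, 18, 18, 15), (Mul, 74, 17, 18), (Sub, 75, 93, 74), (Pow, 24, 74, 96), (Leq, 27, 24, 2)]) 8 []
       (\<lambda>R M. (PE A \<delta> R \<and> R 27 = leqr (sqrt (Shat A)) \<delta>) \<and> M = enc A)"
  proof (rule tr_ArI, goal_cases)
    case (1 R M)
    note r = 1[unfolded F4_def F3_def F2_def F1_def]
    show ?case by (simp add: PE_def cs r powp_half[OF Shat_nonneg, of A, unfolded Shat_def] Shat_def)
  qed simp
  show ?thesis unfolding prepP_def
    by (rule tr_conseq[OF tr_seq[OF 1 tr_seq[OF 2 tr_seq[OF 3 tr_seq[OF 4 tr_seq[OF 5 tr_seq[OF 6 tr_seq[OF 7 8]]]]]]]]) simp_all
qed

end

lemma (in encoded) tr_mainP: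
  assumes \<delta>: "0 < \<delta>" and Dh: "Dh = sqrt (16 * Shat A + (\<delta> / 8)\<^sup>2)" and beta': "beta = acs (4 * sqrt (Shat A) / Dh)"
    and L: "L = lgc (16 * Dh / \<delta>)" and K0: "K0 = (c + 3) * (D + 1)"
  shows "tr (\<lambda>R M. PE A \<delta> R \<and> M = enc A) (mainP c)
    (27 + 5 * real L + 2 ^ L * (145 * (real K0 + 2) * (450 + 76 * (real D + real E))))
    (sveops (\<lambda>l. 144 * (K0 + (L - l))) Wops Fops L K0 (\<delta> / 8) Dh) (\<lambda>R M. M = enc A)"
proof -
  interpret P: prog "enc A" "real (dim_col A)" "16 * 2 ^ D" "real tau * (16 * 2 ^ E)" "Shat A" beta xe D E L K0 "\<delta> / 8" Dh
    by unfold_locales (simp add: K0)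
  define F where "F = (\<lambda>R. WE R \<and> R 22 = real K0 \<and> R 34 = \<delta> / 8 \<and> R 35 = - (\<delta> / 8) \<and> R 36 = Dh \<and> R 37 = - Dh)"
  have cs: "r < 100 \<Longrightarrow> cs_ok (R(r := v)) = cs_ok R" for R r v
    using fr_upd[OF fr_cs_ok[of "{r}"]] by simp
  have fF: "fr {21, 20, 91, 92} F"
    unfolding F_def WE_def by (intro fr_conj fr_eq fr_cs_ok) auto
  have ph: "powp (16 * Shat A + \<delta> / 8 * (\<delta> / 8)) (1 / 2) = Dh"
    using Shat_nonneg[of A] by (subst powp_half) (auto simp: Dh power2_eq_square)
  have ph': "powp (16 * Shat A + (\<delta> * \<delta>) / 64) (1 / 2) = Dh" using ph by simp
  have ph'': "powp (\<delta> * \<delta> / 64 + 16 * Shat A) (1 / 2) = Dh" using ph' by (simp add: add.commute)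
  have 1: "tr (\<lambda>R M. PE A \<delta> R \<and> M = enc A) (Ar [(Const (1/8), 28, 0, 0), (Mul, 34, 28, 2), (Sub, 35, 93, 34), (Const 16, 28, 0, 0),
       (Mul, 29, 28, 74), (Mul, 30, 34, 34),
       (Add, 29, 29, 30), (Pow, 36, 29, 96), (Sub, 37, 93, 36), (Const 4, 30, 0, 0), (Mul, 30, 30, 24), (Div, 30, 30, 36),
       (Arccos, 76, 30, 30), (Sub, 77, 93, 76), (Add, 78, 76, 93), (Mul, 29, 28, 36), (Div, 29, 29, 2),
       (Const (real c + 3), 30, 0, 0), (Const 1, 28, 0, 0), (Add, 28, 28, 11), (Mul, 22, 30, 28)]) 21 []
     (\<lambda>R M. R 29 = 16 * Dh / \<delta> \<and> M = enc A \<and> F R)"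
  proof (rule tr_ArI, goal_cases)
    case (1 R M)
    note r = 1[unfolded PE_def]
    show ?case using \<delta> by (simp add: F_def WE_def cs r ph ph' ph'' beta'[symmetric] K0 algebra_simps)
  qed simp
  have 2: "tr (\<lambda>R M. R 29 = 16 * Dh / \<delta> \<and> M = enc A \<and> F R) (Pow2 21 20 29) (6 + 5 * real L) [] (P.S (\<lambda>R. True))"
    by (rule tr_conseq[OF tr_Pow2[OF fF, of 29 "16 * Dh / \<delta>" "enc A"]]) (simp_all add: P.S_def P.AG_def F_def L[symmetric])
  have R: "P.Rf = (\<lambda>l. 144 * (K0 + (L - l)))" by (rule ext) (simp add: P.Rf_def)
  show ?thesis unfolding mainP_def
    by (rule tr_conseq[OF tr_seq[OF 1 tr_seq[OF 2 P.tr_coreP]]]) (simp_all add: R P.tm_def P.S_def)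
qed

section \<open>From the program to singular value estimation\<close>

definition has_sve :: "(real mat \<Rightarrow> real) \<Rightarrow> bool" where
  "has_sve \<mu> \<longleftrightarrow> (\<exists>upd. efficient_qram_structure upd \<and>
      (\<forall>c::nat. \<exists>sve. \<exists>C::real. \<exists>k::nat.
        \<forall>m>0. \<forall>n>0. \<forall>A\<in>carrier_mat m n. \<forall>M. stores upd m n A M \<longrightarrow>
          (\<forall>\<delta>>0. performs_sve sve A M \<delta> (1 / real (n + 1) ^ c)
                   (C * lg m n ^ k * max 1 (\<mu> A / \<delta>)))))"

lemma clean_input: "clean (sve_state k \<beta> v (\<lambda>_. ket 0))"
proof -
  have "cln c" if "c = sve_config j (c 1)" for c j
    by (subst that) (simp add: cln_def sve_config_def)
  then show ?thesis
    unfolding clean_def sve_state_def product_state_def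
    by (auto elim!: sum.not_neutral_contains_not_neutral split: if_splits)
qed

lemma within_sqdist_mono: "within_sqdist \<epsilon> \<psi> \<phi> \<Longrightarrow> \<epsilon> \<le> \<epsilon>' \<Longrightarrow> within_sqdist \<epsilon>' \<psi> \<phi>"
  by (auto simp: within_sqdist_def)

lemma fold_acs: "\<bar>acs x\<bar> \<le> 2 * pi"
  using arccos_lbound[of x] arccos_ubound[of x] pi_gt_zero by (auto simp: acs_def abs_le_iff)

text \<open>The power 2^(cost2 n + 1) is at least n + 1 and at least 2. In the chosen K, c copies of
  it pay for (n + 1)^c, and three copies for 8, which exceeds 6.\<close>

lemma error_bound:
  assumes "K = (c + 3) * (cost2 n + 1)"
  shows "6 / 2 ^ K \<le> 1 / real (n + 1) ^ c"
proof -
  let ?w = "2 ^ (cost2 n + 1) :: nat"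
  have "1 \<le> (2::nat) ^ cost2 n" "?w = 2 * 2 ^ cost2 n" by simp_all
  then have w: "n + 1 \<le> ?w" "2 \<le> ?w" using le_cost2[of n] by linarith+
  have "(n + 1) ^ c * 2 ^ 3 \<le> ?w ^ c * ?w ^ 3" using w by (intro mult_mono power_mono) auto
  also have "\<dots> = 2 ^ K" by (simp only: assms flip: power_add power_mult) (simp add: algebra_simps)
  finally have "real ((n + 1) ^ c * 2 ^ 3) \<le> real (2 ^ K)" by (simp only: of_nat_le_iff)
  then have "8 * real (n + 1) ^ c \<le> 2 ^ K" by (simp add: mult.commute)
  moreover have "0 \<le> real (n + 1) ^ c" by simp
  ultimately have "6 * real (n + 1) ^ c \<le> 2 ^ K" by linarith
  then show ?thesis by (simp add: field_simps)
qed

text \<open>2^L is at most 32 Dh / \<delta>, and Dh \<le> 4 sqrt S + \<delta>/8 \<le> 8 \<mu> +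
  \<delta>/8. This gives 256 \<mu>/\<delta> + 4, hence the constant 260.\<close>

lemma pow_bound:
  assumes \<delta>: "0 < \<delta>" "\<delta> < sqrt S" and S: "sqrt S \<le> 2 * \<mu>" and L: "L = lgc (16 * sqrt (16 * S + (\<delta> / 8)\<^sup>2) / \<delta>)"
  shows "2 ^ L \<le> 260 * max 1 (\<mu> / \<delta>)"
proof -
  let ?Dh = "sqrt (16 * S + (\<delta> / 8)\<^sup>2)"
  have S0: "0 < S" using \<delta> by (metis less_trans real_sqrt_gt_0_iff)
  have "?Dh \<le> sqrt (16 * S) + sqrt ((\<delta> / 8)\<^sup>2)" using S0 by (intro sqrt_add_le_add_sqrt) auto
  then have u: "?Dh \<le> 4 * sqrt S + \<delta> / 8" using \<delta> by (simp add: real_sqrt_mult)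
  have "sqrt (16 * S) \<le> ?Dh" by (intro real_sqrt_le_mono) simp
  then have "4 * sqrt S \<le> ?Dh" by (simp add: real_sqrt_mult)
  then have "1 \<le> 16 * ?Dh / \<delta>" using \<delta> by (simp add: field_simps)
  then have "2 ^ L \<le> 2 * (16 * ?Dh / \<delta>)" unfolding L by (rule lgc_le)
  also have "\<dots> \<le> 32 * (8 * \<mu> + \<delta> / 8) / \<delta>" using u S \<delta> by (simp add: divide_right_mono)
  also have "\<dots> = 256 * (\<mu> / \<delta>) + 4" using \<delta> by (simp add: field_simps)
  also have "\<dots> \<le> 260 * max 1 (\<mu> / \<delta>)" by simp
  finally show ?thesis .
qed

context params
begin

text \<open>The main product consists of 260 from the bound on 2^L, 145 from the count of steps, 754
  lg for one walk step (450 + 76 * 4) and (3 c + 11) lg for K0 + 2; these are the two factors lg.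
  The 1428 is 100 for the preparation, 28 for fixed steps and 1300 for computing 2^L by
  doubling.\<close>

lemma performs_sveP:
  assumes xe: "0 \<le> xe" and bal: "balanced A" and S: "sqrt (Shat A) \<le> 2 * \<mu>" and dim: "0 < dim_row A" "0 < dim_col A" and \<delta>: "0 < \<delta>"
  shows "performs_sve (sveP c) A (enc A) \<delta> (1 / real (dim_col A + 1) ^ c)
    ((1428 + 260 * 145 * 754 * (3 * real c + 11)) * lg (dim_row A) (dim_col A) ^ 2 * max 1 (\<mu> / \<delta>))"
  unfolding performs_sve_def Let_def
proof (intro allI impI)
  fix \<sigma> u v assume svd: "is_svd A \<sigma> u v"
  let ?l = "lg (dim_row A) (dim_col A)" and ?k = "min (dim_row A) (dim_col A)" and ?D = "cost2 (dim_col A)" and ?E = "cost2 (dim_row A)"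
  let ?X = "max 1 (\<mu> / \<delta>)" and ?C = "260 * 145 * 754 * (3 * real c + 11)"
  let ?T = "(1428 + ?C) * ?l ^ 2 * ?X"
  let ?I = "\<lambda>R M. R = init_regs [real (dim_row A), real (dim_col A), \<delta>] \<and> M = enc A"
  have l1: "1 \<le> ?l" and DE: "real ?E \<le> 2 * ?l" "real ?D \<le> 2 * ?l"
    using lg_ge_1[OF dim] cost2_lg[OF dim] by auto
  have ll: "?l \<le> ?l ^ 2" using l1 by (simp add: power2_eq_square)
  have lX: "?l \<le> ?l ^ 2 * ?X" "?X \<le> ?l ^ 2 * ?X"
    using mult_mono[OF ll max.cobounded1[of 1 "\<mu> / \<delta>"]] mult_right_mono[of 1 "?l ^ 2" ?X] l1 ll by auto
  have T: "(1428 + ?C) * ?l ^ 2 * ?X = 1428 * (?l ^ 2 * ?X) + ?C * (?l ^ 2 * ?X)"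
    by (simp only: distrib_right mult.assoc)
  have CX: "0 \<le> ?C * (?l ^ 2 * ?X)" by simp
  have p: "80 + 5 * (real ?D + real ?E) \<le> 100 * ?l" using DE l1 by simp
  have concl: "\<exists>t R' \<psi>'. exec (sveP c) (init_regs [real (dim_row A), real (dim_col A), \<delta>], enc A, sve_state ?k \<beta> v (\<lambda>_. ket 0)) t (R', enc A, \<psi>') \<and>
      real t \<le> ?T \<and> within_sqdist (1 / real (dim_col A + 1) ^ c) \<psi>' (sve_state ?k \<beta> v \<chi>)"
    if "tr ?I (sveP c) ?T xs (\<lambda>R M. M = enc A)" "within_sqdist (1 / real (dim_col A + 1) ^ c) (aps xs (sve_state ?k \<beta> v (\<lambda>_. ket 0))) (sve_state ?k \<beta> v \<chi>)"
    for xs \<beta> \<chi>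
    using trD[OF that(1), of "init_regs [real (dim_row A), real (dim_col A), \<delta>]" "enc A"] that(2) clean_input by blast
  show "\<exists>\<chi>. (\<forall>i<?k. unit_state_on {s. \<bar>s - \<sigma> i\<bar> \<le> \<delta>} (\<chi> i)) \<and> (\<forall>\<beta>. (\<Sum>i<?k. (cmod (\<beta> i))\<^sup>2) = 1 \<longrightarrow>
      (\<exists>t R' \<psi>'. exec (sveP c) (init_regs [real (dim_row A), real (dim_col A), \<delta>], enc A, sve_state ?k \<beta> v (\<lambda>_. ket 0)) t (R', enc A, \<psi>') \<and>
        real t \<le> ?T \<and> within_sqdist (1 / real (dim_col A + 1) ^ c) \<psi>' (sve_state ?k \<beta> v \<chi>)))"
  proof (cases "sqrt (Shat A) \<le> \<delta>")
    case True
    have "tr ?I (sveP c) (80 + 5 * (real ?D + real ?E) + (0 + 1)) ([] @ []) (\<lambda>R M. M = enc A)"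
      unfolding sveP_def
      by (rule tr_seq[OF tr_prepP tr_post[OF tr_if_true[OF tr_skip]]]) (simp_all add: leqr_def True)
    moreover have "80 + 5 * (real ?D + real ?E) + (0 + 1) \<le> ?T" unfolding T using p lX(1) l1 CX by linarith
    ultimately have t: "tr ?I (sveP c) ?T [] (\<lambda>R M. M = enc A)"
      unfolding append_Nil by (rule tr_time)
    have u: "unit_state_on {s. \<bar>s - \<sigma> i\<bar> \<le> \<delta>} (ket 0)" if "i < ?k" for i
      using svd_sigma[OF svd that] sigma_le[OF svd that xe bal] True by (auto simp: unit_state_on_def ket_def)
    have w: "within_sqdist (1 / real (dim_col A + 1) ^ c) (aps [] \<psi>) \<psi>" for \<psi> by (simp add: within_sqdist_def)
    show ?thesis by (intro exI[of _ "\<lambda>_. ket 0"] conjI allI impI concl[OF t] u w)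
  next
    case False
    then have lt: "\<delta> < sqrt (Shat A)" by simp
    then have pos: "0 < Shat A" using \<delta> by (metis less_trans real_sqrt_gt_0_iff)
    define Dh where "Dh = sqrt (16 * Shat A + (\<delta> / 8)\<^sup>2)"
    define b where "b = acs (4 * sqrt (Shat A) / Dh)"
    define L where "L = lgc (16 * Dh / \<delta>)"
    define K0 where "K0 = (c + 3) * (?D + 1)"
    interpret W: encoded q1 q2 xe tau A b
      by unfold_locales (simp_all add: b_def fold_acs xe bal pos)
    let ?ops = "sveops (\<lambda>l. 144 * (K0 + (L - l))) W.Wops W.Fops L K0 (\<delta> / 8) Dh"
    let ?Tm = "27 + 5 * real L + 2 ^ L * (145 * (real K0 + 2) * (450 + 76 * (real ?D + real ?E)))"
    have "tr ?I (sveP c) (80 + 5 * (real ?D + real ?E) + (?Tm + 1)) ([] @ ?ops) (\<lambda>R M. M = enc A)"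
      unfolding sveP_def
      by (rule tr_seq[OF tr_prepP tr_if_false[OF tr_pre[OF W.tr_mainP[OF \<delta> Dh_def b_def L_def K0_def]]]])
        (simp_all add: leqr_def False)
    moreover have "80 + 5 * (real ?D + real ?E) + (?Tm + 1) \<le> ?T"
    proof -
      have "real K0 + 2 = (real c + 3) * (real ?D + 1) + 2" by (simp add: K0_def algebra_simps)
      also have "\<dots> \<le> (real c + 3) * (3 * ?l) + 2 * ?l" using DE l1 by (intro add_mono mult_left_mono) auto
      finally have k: "real K0 + 2 \<le> (3 * real c + 11) * ?l" by (simp add: algebra_simps)
      have L2: "2 ^ L \<le> 260 * ?X" by (rule pow_bound[OF \<delta> lt S L_def[unfolded Dh_def]])
      have "2 ^ L * (145 * (real K0 + 2) * (450 + 76 * (real ?D + real ?E))) \<le> 260 * ?X * (145 * ((3 * real c + 11) * ?l) * (754 * ?l))"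
        using L2 k DE l1 by (intro mult_mono) auto
      also have "\<dots> = ?C * (?l ^ 2 * ?X)" by (simp add: power2_eq_square)
      finally have m: "2 ^ L * (145 * (real K0 + 2) * (450 + 76 * (real ?D + real ?E))) \<le> ?C * (?l ^ 2 * ?X)" .
      have "real L \<le> 2 ^ L" using of_nat_less_two_power[of L, where 'a = real] by linarith
      then have "5 * real L \<le> 1300 * (?l ^ 2 * ?X)" using L2 lX(2) by linarith
      then show ?thesis unfolding T using m p lX(1) l1 by linarith
    qed
    ultimately have t: "tr ?I (sveP c) ?T ?ops (\<lambda>R M. M = enc A)"
      unfolding append_Nil by (rule tr_time)
    have "3 * 1 \<le> K0" unfolding K0_def by (rule mult_le_mono) auto
    then have "2 \<le> K0" by simp
    from W.encoded_sve[OF svd \<delta> lt Dh_def b_def L_def refl this refl]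
    obtain \<chi> where \<chi>: "\<forall>i<?k. unit_state_on {s. \<bar>s - \<sigma> i\<bar> \<le> \<delta>} (\<chi> i)" "\<forall>\<beta>. (\<Sum>i<?k. (cmod (\<beta> i))\<^sup>2) = 1 \<longrightarrow>
        within_sqdist (6 / 2 ^ K0) (aps ?ops (sve_state ?k \<beta> v (\<lambda>_. ket 0))) (sve_state ?k \<beta> v \<chi>)" by (elim exE conjE)
    show ?thesis
    proof (intro exI[of _ \<chi>] conjI \<chi>(1) allI impI)
      fix \<beta> :: "nat \<Rightarrow> complex" assume "(\<Sum>i<?k. (cmod (\<beta> i))\<^sup>2) = 1"
      then show "\<exists>t R' \<psi>'. exec (sveP c) (init_regs [real (dim_row A), real (dim_col A), \<delta>], enc A, sve_state ?k \<beta> v (\<lambda>_. ket 0)) t (R', enc A, \<psi>') \<and>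
          real t \<le> ?T \<and> within_sqdist (1 / real (dim_col A + 1) ^ c) \<psi>' (sve_state ?k \<beta> v \<chi>)"
        using \<chi>(2) by (intro concl[OF t] within_sqdist_mono[OF _ error_bound[OF K0_def]]) simp
    qed
  qed
qed

lemma sve_structure:
  assumes "0 \<le> xe" "\<And>A. balanced A" "\<And>A. 0 < dim_row A \<Longrightarrow> 0 < dim_col A \<Longrightarrow> sqrt (Shat A) \<le> 2 * \<mu> A"
  shows "has_sve \<mu>"
  unfolding has_sve_def
proof (rule exI[of _ upd], rule conjI[OF efficient_upd], intro allI)
  fix c :: nat
  have "performs_sve (sveP c) A M \<delta> (1 / real (n + 1) ^ c) ((1428 + 260 * 145 * 754 * (3 * real c + 11)) * lg m n ^ 2 * max 1 (\<mu> A / \<delta>))"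
    if "0 < m" "0 < n" "stores upd m n A M" "0 < \<delta>" for m n A M \<delta>
    using performs_sveP[OF assms(1,2,3), of A \<delta> c] stores_enc[OF that(3)] that by auto
  then show "\<exists>sve C k. \<forall>m>0. \<forall>n>0. \<forall>A\<in>carrier_mat m n. \<forall>M. stores upd m n A M \<longrightarrow>
      (\<forall>\<delta>>0. performs_sve sve A M \<delta> (1 / real (n + 1) ^ c) (C * lg m n ^ k * max 1 (\<mu> A / \<delta>)))" by blast
qed

text \<open>At most 2^q summands, each at most B^q, have the total (2 B)^q: for such a large q, the
  q-norm costs only the factor 2 over the maximum.\<close>

lemma powp_root_ge:
  assumes "0 < q" "\<And>i. i \<in> I \<Longrightarrow> f i \<le> B" "real (card I) \<le> 2 powr q" "0 \<le> B"
  shows "powp (\<Sum>i\<in>I. powp (f i) q) (1 / q) \<le> 2 * B"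
proof -
  have "(\<Sum>i\<in>I. powp (f i) q) \<le> (\<Sum>i\<in>I. powp B q)" using assms by (intro sum_mono powp_mono) auto
  also have "\<dots> \<le> 2 powr q * powp B q" using assms by (simp add: mult_right_mono)
  also have "\<dots> = powp (2 * B) q" using assms(4) by (simp add: powp_def powr_mult)
  finally have "powp (\<Sum>i\<in>I. powp (f i) q) (1 / q) \<le> powp (powp (2 * B) q) (1 / q)" using assms(1) by (intro powp_mono) auto
  also have "\<dots> = 2 * B" using assms by (auto simp: powp_def powr_powr)
  finally show ?thesis .
qed

lemma card_qe: "real (dim_row A) \<le> 2 powr qe (dim_row A) (dim_col A)" "real (dim_col A) \<le> 2 powr qe (dim_row A) (dim_col A)"
proof -
  have *: "real n \<le> 2 powr q" if "real (cost2 n) \<le> q" for n q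
  proof -
    have "real n \<le> real (2 ^ cost2 n)" using le_cost2 by (simp only: of_nat_le_iff)
    also have "\<dots> = 2 powr real (cost2 n)" by (simp add: powr_realpow)
    also have "\<dots> \<le> 2 powr q" using that by (intro powr_mono) auto
    finally show ?thesis .
  qed
  show "real (dim_row A) \<le> 2 powr qe (dim_row A) (dim_col A)" "real (dim_col A) \<le> 2 powr qe (dim_row A) (dim_col A)"
    by (intro *; simp add: qe_def)+
qed

lemma S1_root: "(\<And>i. i < dim_row A \<Longrightarrow> UW A i 1 \<le> B) \<Longrightarrow> 0 \<le> B \<Longrightarrow> powp (S1 A) (1 / qe (dim_row A) (dim_col A)) \<le> 2 * B"
  unfolding S1_def by (rule powp_root_ge[OF qe_pos]) (use card_qe in auto)

lemma S2_root: "(\<And>t. t < dim_col A \<Longrightarrow> VW A t 1 \<le> B) \<Longrightarrow> 0 \<le> B \<Longrightarrow> powp (S2 A) (1 / qe (dim_row A) (dim_col A)) \<le> 2 * B"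
  unfolding S2_def by (rule powp_root_ge[OF qe_pos]) (use card_qe in auto)

lemma VW_root_sum: "VW A t 1 = (\<Sum>i<dim_row A. \<Sum>j<dim_col A. if tau * j = t then wt q2 (A $$ (i, j)) else 0)"
  by (simp add: VW_def del: One_nat_def)

lemma VW_leaf_row: "r < dim_row A \<Longrightarrow> VW A t (2 ^ cost2 (dim_row A) + r) = (\<Sum>j<dim_col A. if tau * j = t then wt q2 (A $$ (r, j)) else 0)"
  using VW_leaf[of r A t] le_cost2[of "dim_row A"] by simp

end

section \<open>The two choices of the norm\<close>

lemma powp_square: "powp (a * a) (q / 2) = \<bar>a\<bar> powr q"
proof (cases "a = 0")
  case False
  then have a: "a * a = \<bar>a\<bar> powr 2" by (simp add: power2_eq_square)
  show ?thesis unfolding a powp_def powr_powr using False by simp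
qed (simp add: powp_def)

text \<open>Each column has its own tree, so its leaf is |a|^(2 - 2p). With \<open>xe\<close> = 1
  the row root cancels, and \<open>balanced\<close> holds because the two exponents add up to
  2.\<close>

lemma sve_mu_p:
  assumes p: "p \<in> {0..1}"
  shows "has_sve (mu_p p)"
proof -
  interpret params "2 * p" "2 * (1 - p)" 1 1 by unfold_locales (use p in auto)
  have w: "wt q a = \<bar>a\<bar> powr q" for q a by (simp add: wt_def powp_square)
  show ?thesis
  proof (rule sve_structure)
    fix A
    show "balanced A"
      unfolding balanced_def
    proof (intro allI impI)
      fix r j assume r: "r < dim_row A" and j: "j < dim_col A" and "0 < UW A r 1"
      then have "VW A (1 * j) (2 ^ cost2 (dim_row A) + r) * wt (2 * p) (A $$ (r, j)) * powp (UW A r 1) 1 / UW A r 1 =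
          \<bar>A $$ (r, j)\<bar> powr (2 * (1 - p)) * \<bar>A $$ (r, j)\<bar> powr (2 * p)"
        by (subst VW_leaf_row) (simp_all add: w powp_def)
      also have "\<dots> = \<bar>A $$ (r, j)\<bar> powr 2" by (simp flip: powr_add)
      also have "\<dots> = (A $$ (r, j))\<^sup>2" by simp
      finally show "VW A (1 * j) (2 ^ cost2 (dim_row A) + r) * wt (2 * p) (A $$ (r, j)) * powp (UW A r 1) 1 / UW A r 1 = (A $$ (r, j))\<^sup>2" .
    qed
    assume dim: "0 < dim_row A" "0 < dim_col A"
    let ?a = "s_norm (2 * p) A" and ?b = "s_norm (2 * (1 - p)) (transpose_mat A)"
    have U: "UW A r 1 \<le> ?a" if "r < dim_row A" for r
      unfolding s_norm_def UW_root[OF that] w using that by (intro Max_ge) auto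
    have V: "VW A t 1 \<le> ?b" if "t < dim_col A" for t
    proof -
      have "VW A t 1 = (\<Sum>i<dim_row A. \<bar>A $$ (i, t)\<bar> powr (2 * (1 - p)))"
        unfolding VW_root_sum w using that by simp
      also have "\<dots> = (\<Sum>i<dim_col (transpose_mat A). \<bar>transpose_mat A $$ (t, i)\<bar> powr (2 * (1 - p)))"
        using that by (intro sum.cong) auto
      also have "\<dots> \<le> ?b" unfolding s_norm_def using that by (intro Max_ge) auto
      finally show ?thesis .
    qed
    have a: "0 \<le> ?a" using order_trans[OF UW_nonneg U[OF dim(1)]] .
    have b: "0 \<le> ?b" using order_trans[OF VW_nonneg V[OF dim(2)]] .
    have "Shat A \<le> 2 * ?a * (2 * ?b)"
      unfolding Shat_def using S1_root[OF U a] S2_root[OF V b] a b by (intro mult_mono) (auto simp: powp_def)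
    then have "sqrt (Shat A) \<le> sqrt (4 * (?a * ?b))" by (intro real_sqrt_le_mono) simp
    then show "sqrt (Shat A) \<le> 2 * mu_p p A" by (simp add: mu_p_def real_sqrt_mult)
  qed simp
qed

text \<open>The single shared column tree has the squared row norms as leaves, which cancel against
  the row roots and leave the square of the entry. Its root is the squared Frobenius norm, and with
  \<open>xe\<close> = 0 the row factor of \<open>Shat\<close> is at most 1.\<close>

lemma sve_frobenius:
  "has_sve frobenius"
proof -
  interpret params 2 2 0 0 by unfold_locales auto
  have w: "wt 2 a = a\<^sup>2" for a using powp_square[of a 2] by (simp add: wt_def)
  show ?thesis
  proof (rule sve_structure)
    fix A
    show "balanced A"
      unfolding balanced_def
    proof (intro allI impI)
      fix r j assume r: "r < dim_row A" and j: "j < dim_col A" and U: "0 < UW A r 1"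
      then show "VW A (0 * j) (2 ^ cost2 (dim_row A) + r) * wt 2 (A $$ (r, j)) * powp (UW A r 1) 0 / UW A r 1 = (A $$ (r, j))\<^sup>2"
        by (subst VW_leaf_row) (simp_all add: w powp_def UW_root del: One_nat_def)
    qed
    assume dim: "0 < dim_row A" "0 < dim_col A"
    let ?f = "\<Sum>i<dim_row A. \<Sum>j<dim_col A. (A $$ (i, j))\<^sup>2"
    have f: "0 \<le> ?f" by (intro sum_nonneg) auto
    have V: "VW A t 1 \<le> ?f" for t
      unfolding VW_root_sum w by (intro sum_mono) auto
    have "Shat A \<le> 1 * (2 * ?f)"
      unfolding Shat_def using S2_root[OF V f] f by (intro mult_mono) (auto simp: powp_def)
    then have "sqrt (Shat A) \<le> sqrt (4 * ?f)" using f by (intro real_sqrt_le_mono) linarith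
    then show "sqrt (Shat A) \<le> 2 * frobenius A" by (simp add: frobenius_def real_sqrt_mult)
  qed simp
qed

theorem mainTheorem2:
  fixes \<mu> :: "real mat \<Rightarrow> real"
  assumes "(\<exists>p\<in>{0..1}. \<mu> = mu_p p) \<or> \<mu> = frobenius"
  shows "\<exists>upd. efficient_qram_structure upd \<and>
    (\<forall>c::nat. \<exists>sve. \<exists>C::real. \<exists>k::nat.
      \<forall>m>0. \<forall>n>0. \<forall>A\<in>carrier_mat m n. \<forall>M. stores upd m n A M \<longrightarrow>
        (\<forall>\<delta>>0. performs_sve sve A M \<delta> (1 / real (n + 1) ^ c)
                 (C * lg m n ^ k * max 1 (\<mu> A / \<delta>))))"
proof -
  have "has_sve \<mu>" using assms sve_mu_p sve_frobenius by blast
  then show ?thesis unfolding has_sve_def .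
qed

end
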